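(* Let $n\ge1$. Every total decoration $\theta\in\mathcal D_n$ satisfies $0\le\operatorname{fd}_n(\theta)\le\ell_n-1$. The differential preserves total decoration and gives a canonical decomposition into bigraded $\mathfrak S_n$-subcomplexes $$C_\bullet^{t,q}(\delta_n)=\bigoplus_{d=0}^{\ell_n-1}C_\bullet^{t,q}(\delta_n;d).$$ If $\theta=(\sigma,\tau)$ contributes to $H_k^{i,j}(n)$, then $\operatorname{fd}_n(\theta)=\ell_n-k-j$. Consequently, $$H_k^{i,j}(n)=0\quad\text{unless}\quad k+j\le\ell_n\le i+j.$$ For every $d\ge0$, $$\mathcal H_{n,d}(t,u)=\sum_k\operatorname{ch}_{t,u}H_k(C_\bullet^{t,q}(\delta_n;d))=\sum_{\substack{k\ge1,\ j\ge0\\ k+j=\ell_n-d}}u^j[q^j]\operatorname{ch}_{t,q}H_k(C_\bullet^{t,q}(\delta_n)),$$ $$\sum_k(-1)^{\ell_n-k}\operatorname{ch}_{t,-u}H_k(C_\bullet^{t,q}(\delta_n;d))=(-1)^d\mathcal H_{n,d}(t,u).$$ Summing over $d$ gives $$\sum_{k=1}^{\ell_n}(-1)^{\ell_n-k}\operatorname{ch}_{t,-u}H_k(C_\bullet^{t,q}(\delta_n))=\sum_{d=0}^{\ell_n-1}(-1)^d\mathcal H_{n,d}(t,u).$$ If $\dim_n(f):=n!\,[p_1^n]f$ denotes the dimension of the virtual $\mathfrak S_n$-module with Frobenius characteristic $f$, then $$n!\,Z_{\delta_n}(t,-u)=\dim_n\Bigl(\sum_{d=0}^{\ell_n-1}(-1)^d\mathcal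 H_{n,d}(t,u)\Bigr).$$ Thus the assertion $n!Z_{\delta_n}(t,-u)\in\mathbb N[t,u]$ states that the scalar dimension of this alternating sum of classes with nonnegative ribbon Schur expansions is coefficientwise nonnegative.
   Context: Conventions. $\mathbb N$ includes $0$; $[m]=\{1,\dots,m\}$, $[0]=\varnothing$; $\mathbb K$ is a field of characteristic zero and all vector spaces are over $\mathbb K$. For $m\ge0$, $m^+=\lceil m/2\rceil$ and $m^-=\lfloor m/2\rfloor$. A composition $\alpha=(\alpha_1,\dots,\alpha_r)\models n$ is a sequence of positive integers with sum $n$; $\ell(\alpha)=r$; its cut set is $D(\alpha)=\{\alpha_1,\alpha_1+\alpha_2,\dots,\alpha_1+\cdots+\alpha_{r-1}\}\subseteq[n-1]$. For $\beta,\alpha\models n$, $\beta\succeq\alpha$ ($\beta$ is a coarsening of $\alpha$) means $D(\beta)\subseteq D(\alpha)$. For $S\subseteq[n-1]$, $\gamma_S$ is the composition of $n$ with $D(\gamma_S)=S$. The ribbon Schur function is $r_\alpha=\sum_{\beta\succeq\alpha}(-1)^{\ell(\alpha)-\ell(\beta)}h_\beta$, with $h_\beta=h_{\beta_1}h_{\beta_2}\cdots$ complete homogeneous; $p_1$ is the first power sum and $[p_1^n]f$ is the coefficient of $p_1^n$ in the power-sum expansion. Zigzag compositions: $\delta_{2N}=(2,\dots,2)$ ($N$ parts) and $\delta_{2N+1}=(2,\dots,2,1)$ ($N$ twos); $\ell_n=\ell(\delta_n)=\lceil n/2\rceil$. The polynomial $Z_\alpha$. $Z_\alpha(t,q)=\sum_{\beta\succeq\alpha}(-1)^{\ell(\alpha)-\ell(\beta)}\prod_j\mathsf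 h_{\beta_j}(t,q)$, where $\mathsf h_m(t,q)=\frac1{m!}\prod_{i=1}^{m^-}(t+i)\prod_{j=0}^{m^+-1}(t+jq)$. Decorations. $c(\cdot)$ is the number of cycles of a permutation, fixed points included. For $\sigma\in\mathfrak S_a$, $\sigma'\in\mathfrak S_b$, $\sigma\oplus\sigma'\in\mathfrak S_{a+b}$ acts as $\sigma$ on $[a]$ and by $a+j\mapsto a+\sigma'(j)$ on the rest. $\mathfrak R_s$ is the set of permutations of $\{\ast,1,\dots,s\}$ (rooted permutations); the cycle containing $\ast$ is the root cycle, written starting at $\ast$. For $\tau\in\mathfrak R_a$, $\upsilon\in\mathfrak R_b$ with root cycles $(\ast,a_1,\dots,a_u)$ and $(\ast,b_1,\dots,b_v)$, $\tau\star\upsilon\in\mathfrak R_{a+b}$ has root cycle $(\ast,a_1,\dots,a_u,a+b_1,\dots,a+b_v)$, and its nonroot cycles are those of $\tau$ together with those of $\upsilon$ with every letter shifted by $a$. For $m\ge1$, $\mathcal D_m=\mathfrak S_{m^+}\times\mathfrak R_{m^-}$; for $\xi=(\sigma,\tau)\in\mathcal D_m$, $\deg_q\xi=m^+-c(\sigma)$ and $\deg_t\xi=c(\sigma)+c(\tau)-1$. If $a,b$ are not both odd, $(\sigma,\tau)\diamond(\sigma',\tau')=(\sigma\oplus\sigma',\tau\star\tau')$ defines $\diamond:\mathcal D_a\times\mathcal D_b\to\mathcal D_{a+b}$ (associative, bidegree-additive). Decorated complex. For $\beta=(\beta_1,\dots,\beta_k)\models n$, $\operatorname{OSP}_\beta[n]$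 is the set of ordered set partitions $(B_1,\dots,B_k)$ of $[n]$ with $|B_i|=\beta_i$. $C_k^{t,q}(\alpha)$ has basis the elements $(B_1,\dots,B_k;\xi_1,\dots,\xi_k)$ with $\beta\succeq\alpha$, $\ell(\beta)=k$, $(B_1,\dots,B_k)\in\operatorname{OSP}_\beta[n]$, $\xi_i\in\mathcal D_{\beta_i}$; it is bigraded by the sums of the $\deg_t\xi_i$ and of the $\deg_q\xi_i$; $\mathfrak S_n$ acts on block labels and fixes decorations. The differential is $\sum_{i=1}^{k-1}(-1)^{i-1}d_i^{t,q}$, where $d_i^{t,q}$ merges $B_i,B_{i+1}$ into $B_i\sqcup B_{i+1}$ and replaces $\xi_i,\xi_{i+1}$ by $\xi_i\diamond\xi_{i+1}$ if $\beta_i,\beta_{i+1}$ are not both odd, and is $0$ if both are odd. For $\alpha=\delta_n$ the total decoration of a basis element is $\xi_1\diamond\cdots\diamond\xi_k\in\mathcal D_n$. $H_k^{i,j}(n)$ is the part of $H_k(C_\bullet^{t,q}(\delta_n))$ of bidegree ($t$-degree, $q$-degree) $=(i,j)$. A total decoration $\theta$ contributes to $H_k^{i,j}(n)$ if the subcomplex spanned by basis elements with total decoration $\theta$ has nonzero homology in homological degree $k$ and bidegree $(i,j)$. Factorization cuts. Let $\theta=(\sigma,\tau)\in\mathcal D_n$. A cut $c\in D(\delta_n)$ is a factorization cut of $\theta$ if (a) $\sigma([c^+])=[c^+]$; and (b) every nonroot cycle of $\tau$ lies entirely in $[c^-]$ or entirely in $\{c^-+1,\dots,n^-\}$, and in the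 root cycle $(\ast,a_1,\dots,a_u)$ all letters $\le c^-$ come before all letters $>c^-$. $F_{\delta_n}(\theta)$ is the set of factorization cuts of $\theta$ and $\gamma_{\delta_n}(\theta)=\gamma_{F_{\delta_n}(\theta)}$. Defect. $\operatorname{fd}_n(\theta)=c(\sigma)-|F_{\delta_n}(\theta)|-1$. $C_\bullet^{t,q}(\delta_n;d)$ is the span of the basis elements of $C_\bullet^{t,q}(\delta_n)$ whose total decoration has factorization defect $d$. For $d\ge0$, $$\mathcal H_{n,d}(t,u)=\sum_{\theta\in\mathcal D_n,\ \operatorname{fd}_n(\theta)=d}t^{\deg_t\theta}u^{\deg_q\theta}r_{\gamma_{\delta_n}(\theta)}.$$ For a finite-dimensional bigraded $\mathfrak S_n$-module $V=\bigoplus V_{d,e}$, $\operatorname{ch}_{t,q}V=\sum_{d,e}\operatorname{ch}(V_{d,e})t^dq^e$, with $\operatorname{ch}$ the Frobenius characteristic; $\operatorname{ch}_{t,u}$ and $\operatorname{ch}_{t,-u}$ mean substitution of $q=u$ and $q=-u$. *)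

theory Defs
  imports
    Complex_Main
    "HOL-Library.Multiset"
    "HOL-Library.Poly_Mapping"
    "HOL-Combinatorics.Combinatorics"
    "HOL-Computational_Algebra.Polynomial"
begin

section \<open>Formal power series in countably many variables\<close>

text \<open>
  A monomial in \<open>x\<^sub>0, x\<^sub>1, \<dots>\<close> is the multiset of its variable indices, and a series is its
  coefficient function.  Symmetric functions over \<open>'a\<close> are particular such series, with
  the multiplication of series; the zigzag classes have coefficients in \<open>'k poly poly\<close>.
\<close>

typedef 'a mseries = "UNIV :: (nat multiset \<Rightarrow> 'a) set"
  morphisms mcoeff Mseries by simp

lemma mcoeff_Mseries [simp]: "mcoeff (Mseries f) M = f M"
  by (simp add: Mseries_inverse)

lemma mseries_eqI: "(\<And>M. mcoeff F M = mcoeff G M) \<Longrightarrow> F = G"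
  by (metis ext mcoeff_inject)

lemma finite_submultisets [simp]: "finite {A. A \<subseteq># M}" for M :: "nat multiset"
proof (induction M)
  case (add x M)
  have "{A. A \<subseteq># add_mset x M} \<subseteq> {A. A \<subseteq># M} \<union> add_mset x ` {A. A \<subseteq># M}"
  proof
    fix A assume A: "A \<in> {A. A \<subseteq># add_mset x M}"
    show "A \<in> {A. A \<subseteq># M} \<union> add_mset x ` {A. A \<subseteq># M}"
    proof (cases "x \<in># A")
      case True
      then obtain B where B: "A = add_mset x B" by (metis multi_member_split)
      with A show ?thesis by auto
    next
      case False
      from A obtain D where D: "add_mset x M = A + D" by (auto simp: subset_mset.le_iff_add)
      with False have "x \<in># D" by (metis union_iff union_single_eq_member)
      then obtain E where "D = add_mset x E" by (metis multi_member_split)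
      with D have "M = A + E" by simp
      then show ?thesis by simp
    qed
  qed
  then show ?case using add finite_subset by fastforce
qed simp

lemma submultiset_chain:
  assumes "A \<subseteq># M" "B \<subseteq># A"
  shows "B \<subseteq># M \<and> A - B \<subseteq># M - B \<and> M - B - (A - B) = M - A \<and> B + (A - B) = (A :: nat multiset)"
proof -
  obtain C where C: "A = B + C" using assms(2) by (auto simp: subset_mset.le_iff_add)
  obtain D where D: "M = A + D" using assms(1) by (auto simp: subset_mset.le_iff_add)
  show ?thesis unfolding D C by (simp add: add.assoc)
qed

lemma submultiset_add:
  assumes "B \<subseteq># M" "C \<subseteq># M - B"
  shows "B + C \<subseteq># (M :: nat multiset)"
proof -
  obtain D where D: "M = B + D" using assms(1) by (auto simp: subset_mset.le_iff_add)
  show ?thesis using assms(2) unfolding D by simp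
qed

lemma submultiset_diff_diff:
  assumes "A \<subseteq># M"
  shows "M - (M - A) = (A :: nat multiset)"
proof -
  obtain D where D: "M = A + D" using assms by (auto simp: subset_mset.le_iff_add)
  show ?thesis unfolding D by simp
qed

instantiation mseries :: (comm_ring_1) comm_ring_1
begin

definition "0 = Mseries (\<lambda>_. 0)"
definition "1 = Mseries (\<lambda>M. if M = {#} then 1 else 0)"
definition "F + G = Mseries (\<lambda>M. mcoeff F M + mcoeff G M)"
definition "F - G = Mseries (\<lambda>M. mcoeff F M - mcoeff G M)"
definition "- F = Mseries (\<lambda>M. - mcoeff F M)"
definition "F * G = Mseries (\<lambda>M. \<Sum>A | A \<subseteq># M. mcoeff F A * mcoeff G (M - A))"

instance
proof
  fix F G H :: "'a mseries"
  show "F * G * H = F * (G * H)"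
  proof (rule mseries_eqI)
    fix M :: "nat multiset"
    have "mcoeff (F * G * H) M =
        (\<Sum>A | A \<subseteq># M. \<Sum>B | B \<subseteq># A. mcoeff F B * mcoeff G (A - B) * mcoeff H (M - A))"
      by (simp add: times_mseries_def sum_distrib_right)
    also have "\<dots> = (\<Sum>(A, B)\<in>Sigma {A. A \<subseteq># M} (\<lambda>A. {B. B \<subseteq># A}).
        mcoeff F B * mcoeff G (A - B) * mcoeff H (M - A))"
      by (simp add: sum.Sigma)
    also have "\<dots> = (\<Sum>(B, C)\<in>Sigma {B. B \<subseteq># M} (\<lambda>B. {C. C \<subseteq># M - B}).
        mcoeff F B * mcoeff G C * mcoeff H (M - B - C))"
      by (rule sum.reindex_bij_witness[where i = "\<lambda>(B, C). (B + C, B)" and j = "\<lambda>(A, B). (B, A - B)"])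
        (auto simp: submultiset_add dest: submultiset_chain)
    also have "\<dots> = mcoeff (F * (G * H)) M"
      by (simp add: times_mseries_def sum_distrib_left sum.Sigma mult.assoc)
    finally show "mcoeff (F * G * H) M = mcoeff (F * (G * H)) M" .
  qed
  show "F * G = G * F"
  proof (rule mseries_eqI)
    fix M :: "nat multiset"
    show "mcoeff (F * G) M = mcoeff (G * F) M"
      unfolding times_mseries_def mcoeff_Mseries
      by (rule sum.reindex_bij_witness[where i = "\<lambda>A. M - A" and j = "\<lambda>A. M - A"])
        (auto simp: mult.commute submultiset_diff_diff)
  qed
  show "1 * F = F"
  proof (rule mseries_eqI)
    fix M :: "nat multiset"
    have "mcoeff (1 * F) M = (\<Sum>A | A \<subseteq># M. if A = {#} then mcoeff F (M - A) else 0)"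
      unfolding times_mseries_def one_mseries_def mcoeff_Mseries
      by (rule sum.cong) auto
    then show "mcoeff (1 * F) M = mcoeff F M" by simp
  qed
  show "(F + G) * H = F * H + G * H"
    by (rule mseries_eqI)
      (simp add: times_mseries_def plus_mseries_def distrib_right sum.distrib)
  show "(0::'a mseries) \<noteq> 1"
  proof
    assume "(0::'a mseries) = 1"
    then have "mcoeff (0::'a mseries) {#} = mcoeff 1 {#}" by (rule arg_cong)
    then show False by (simp add: zero_mseries_def one_mseries_def)
  qed
qed (rule mseries_eqI;
  simp add: plus_mseries_def minus_mseries_def uminus_mseries_def zero_mseries_def algebra_simps)+

end

definition smult_ms :: "'a::comm_ring_1 \<Rightarrow> 'a mseries \<Rightarrow> 'a mseries" where
  "smult_ms c F = Mseries (\<lambda>M. c * mcoeff F M)"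

definition map_ms :: "('a \<Rightarrow> 'b) \<Rightarrow> 'a mseries \<Rightarrow> 'b mseries" where
  "map_ms f F = Mseries (\<lambda>M. f (mcoeff F M))"


section \<open>Compositions\<close>

definition compositions :: "nat \<Rightarrow> nat list set" where
  "compositions n = {\<alpha>. 0 \<notin> set \<alpha> \<and> sum_list \<alpha> = n}"

definition cuts :: "nat list \<Rightarrow> nat set" where
  "cuts \<alpha> = {sum_list (take i \<alpha>) | i. 1 \<le> i \<and> i < length \<alpha>}"

definition coarsenings :: "nat list \<Rightarrow> nat list set" where
  "coarsenings \<alpha> = {\<beta> \<in> compositions (sum_list \<alpha>). cuts \<beta> \<subseteq> cuts \<alpha>}"

definition comp_of_cuts :: "nat \<Rightarrow> nat set \<Rightarrow> nat list" where
  "comp_of_cuts n S = (THE \<gamma>. \<gamma> \<in> compositions n \<and> cuts \<gamma> = S)"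

definition zigzag :: "nat \<Rightarrow> nat list" where
  "zigzag n = replicate (n div 2) 2 @ (if odd n then [1] else [])"

definition ell :: "nat \<Rightarrow> nat" where
  "ell n = length (zigzag n)"


section \<open>Symmetric functions\<close>

definition psum :: "nat \<Rightarrow> 'a::comm_ring_1 mseries" where
  "psum m = Mseries (\<lambda>M. if \<exists>i. M = replicate_mset m i then 1 else 0)"

definition hsym :: "nat \<Rightarrow> 'a::comm_ring_1 mseries" where
  "hsym m = Mseries (\<lambda>M. if size M = m then 1 else 0)"

definition ribbon :: "nat list \<Rightarrow> 'a::comm_ring_1 mseries" where
  "ribbon \<alpha> = (\<Sum>\<beta>\<in>coarsenings \<alpha>. (-1) ^ (length \<alpha> - length \<beta>) * prod_list (map hsym \<beta>))"

text \<open>Partitions are multisets of positive integers; \<open>[p\<^sub>1\<^sup>n] f\<close> is the entry of the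
  power-sum expansion of \<open>f\<close> at the partition with \<open>n\<close> parts equal to \<open>1\<close>.\<close>

definition p1_coeff :: "nat \<Rightarrow> 'a::comm_ring_1 mseries \<Rightarrow> 'a" where
  "p1_coeff n f = (THE c. \<exists>a :: nat multiset \<Rightarrow>\<^sub>0 'a.
      (\<forall>\<mu>\<in>Poly_Mapping.keys a. 0 \<notin># \<mu>) \<and>
      f = (\<Sum>\<mu>\<in>Poly_Mapping.keys a. smult_ms (Poly_Mapping.lookup a \<mu>) (\<Prod>m\<in>#\<mu>. psum m)) \<and>
      c = Poly_Mapping.lookup a (replicate_mset n 1))"

definition dim_sf :: "nat \<Rightarrow> 'a::comm_ring_1 mseries \<Rightarrow> 'a" where
  "dim_sf n f = of_nat (fact n) * p1_coeff n f"


section \<open>The polynomial Z\<close>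

text \<open>A polynomial in \<open>t\<close> and \<open>q\<close> is an element of \<open>'k poly poly\<close>: the outer variable is
  \<open>q\<close> (also called \<open>u\<close>), the inner one is \<open>t\<close>.\<close>

definition var_t :: "'k::field poly poly" where "var_t = [:[:0, 1:]:]"
definition var_q :: "'k::field poly poly" where "var_q = [:0, 1:]"

definition bimonom :: "'k::field \<Rightarrow> nat \<Rightarrow> nat \<Rightarrow> 'k poly poly" where
  "bimonom c i j = monom (monom c i) j"

definition negate_q :: "'k::field poly poly \<Rightarrow> 'k poly poly" where
  "negate_q P = pcompose P (- var_q)"

definition nat_coeffs :: "'k::field poly poly \<Rightarrow> bool" where
  "nat_coeffs P \<longleftrightarrow> (\<forall>i j. coeff (coeff P j) i \<in> \<nat>)"

definition up_half :: "nat \<Rightarrow> nat" where "up_half m = (m + 1) div 2"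
definition dn_half :: "nat \<Rightarrow> nat" where "dn_half m = m div 2"

definition h_tq :: "nat \<Rightarrow> 'k::field_char_0 poly poly" where
  "h_tq m = [:[:1 / of_nat (fact m):]:] * (\<Prod>i=1..dn_half m. var_t + of_nat i)
     * (\<Prod>j<up_half m. var_t + of_nat j * var_q)"

definition Z_poly :: "nat list \<Rightarrow> 'k::field_char_0 poly poly" where
  "Z_poly \<alpha> = (\<Sum>\<beta>\<in>coarsenings \<alpha>. (-1) ^ (length \<alpha> - length \<beta>) * prod_list (map h_tq \<beta>))"


section \<open>Decorations\<close>

text \<open>An element of \<open>\<SS>\<^sub>a\<close> is a function permuting \<open>{1..a}\<close>; a rooted permutation in
  \<open>\<RR>\<^sub>s\<close> is a function permuting \<open>{0..s}\<close>, where \<open>0\<close> plays the role of the root \<open>*\<close>.\<close>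

type_synonym decoration = "(nat \<Rightarrow> nat) \<times> (nat \<Rightarrow> nat)"

definition cycle_count :: "nat set \<Rightarrow> (nat \<Rightarrow> nat) \<Rightarrow> nat" where
  "cycle_count A \<sigma> = card (orbit \<sigma> ` A)"

definition perm_oplus :: "nat \<Rightarrow> nat \<Rightarrow> (nat \<Rightarrow> nat) \<Rightarrow> (nat \<Rightarrow> nat) \<Rightarrow> nat \<Rightarrow> nat" where
  "perm_oplus a b \<sigma> \<sigma>' x =
     (if x \<le> a then \<sigma> x else if x \<le> a + b then a + \<sigma>' (x - a) else x)"

text \<open>The letters \<open>a\<^sub>1, \<dots>, a\<^sub>u\<close> of the root cycle \<open>(*, a\<^sub>1, \<dots>, a\<^sub>u)\<close>.\<close>

definition root_word :: "(nat \<Rightarrow> nat) \<Rightarrow> nat list" where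
  "root_word \<tau> = map (\<lambda>i. (\<tau> ^^ i) 0) [1..<card (orbit \<tau> 0)]"

definition rooted_star :: "nat \<Rightarrow> nat \<Rightarrow> (nat \<Rightarrow> nat) \<Rightarrow> (nat \<Rightarrow> nat) \<Rightarrow> nat \<Rightarrow> nat" where
  "rooted_star a b \<tau> \<upsilon> x =
     (let r = 0 # root_word \<tau> @ map ((+) a) (root_word \<upsilon>) in
      if x \<in> set r then cycle_of_list r x
      else if x \<le> a then \<tau> x
      else if x \<le> a + b then a + \<upsilon> (x - a)
      else x)"

definition decorations :: "nat \<Rightarrow> decoration set" where
  "decorations m = {\<sigma>. \<sigma> permutes {1..up_half m}} \<times> {\<tau>. \<tau> permutes {0..dn_half m}}"

definition deg_q :: "nat \<Rightarrow> decoration \<Rightarrow> nat" where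
  "deg_q m \<xi> = up_half m - cycle_count {1..up_half m} (fst \<xi>)"

definition deg_t :: "nat \<Rightarrow> decoration \<Rightarrow> nat" where
  "deg_t m \<xi> = cycle_count {1..up_half m} (fst \<xi>) + cycle_count {0..dn_half m} (snd \<xi>) - 1"

text \<open>Only meaningful when \<open>a\<close> and \<open>b\<close> are not both odd.\<close>

definition diamond :: "nat \<Rightarrow> nat \<Rightarrow> decoration \<Rightarrow> decoration \<Rightarrow> decoration" where
  "diamond a b \<xi> \<eta> =
     (perm_oplus (up_half a) (up_half b) (fst \<xi>) (fst \<eta>),
      rooted_star (dn_half a) (dn_half b) (snd \<xi>) (snd \<eta>))"


section \<open>Vector spaces with a given basis\<close>

text \<open>The space with basis indexed by a set \<open>B\<close> of elements of \<open>'b\<close> is the set of finitely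
  supported functions \<open>'b \<Rightarrow>\<^sub>0 'k\<close> whose support is contained in \<open>B\<close>.\<close>

definition scale_fs :: "'k::field \<Rightarrow> ('b \<Rightarrow>\<^sub>0 'k) \<Rightarrow> 'b \<Rightarrow>\<^sub>0 'k" where
  "scale_fs c x = Poly_Mapping.map ((*) c) x"

lemma lookup_scale_fs [simp]:
  "Poly_Mapping.lookup (scale_fs c x) b = c * Poly_Mapping.lookup x b"
  by (simp add: scale_fs_def Poly_Mapping.map.rep_eq when_def)

global_interpretation fs: vector_space "scale_fs :: 'k::field \<Rightarrow> ('b \<Rightarrow>\<^sub>0 'k) \<Rightarrow> 'b \<Rightarrow>\<^sub>0 'k"
  by unfold_locales (auto intro!: poly_mapping_eqI simp: lookup_add algebra_simps)

definition lin_ext :: "('b \<Rightarrow> ('c \<Rightarrow>\<^sub>0 'k)) \<Rightarrow> ('b \<Rightarrow>\<^sub>0 'k::field) \<Rightarrow> 'c \<Rightarrow>\<^sub>0 'k" where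
  "lin_ext f x = (\<Sum>b\<in>Poly_Mapping.keys x. scale_fs (Poly_Mapping.lookup x b) (f b))"

text \<open>The trace on \<open>Z / W\<close> of a linear map preserving \<open>Z\<close> and \<open>W \<subseteq> Z\<close>: if \<open>T\<close> is a basis of
  \<open>Z\<close> extending a basis \<open>S\<close> of \<open>W\<close>, the classes of \<open>T - S\<close> are a basis of the quotient, and
  the coordinates of a class are those of any representative with respect to \<open>T\<close>.\<close>

definition quotient_trace ::
    "(('b \<Rightarrow>\<^sub>0 'k::field) \<Rightarrow> ('b \<Rightarrow>\<^sub>0 'k)) \<Rightarrow> ('b \<Rightarrow>\<^sub>0 'k) set \<Rightarrow> ('b \<Rightarrow>\<^sub>0 'k) set \<Rightarrow> 'k" where
  "quotient_trace f Z W =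
     (let (S, T) = (SOME (S, T). fs.independent T \<and> S \<subseteq> T \<and> fs.span S = W \<and> fs.span T = Z)
      in \<Sum>b\<in>T - S. fs.representation T (f b) b)"

text \<open>Frobenius characteristic of the \<open>\<SS>\<^sub>n\<close>-module \<open>Z / W\<close>.\<close>

definition frobenius ::
    "nat \<Rightarrow> ((nat \<Rightarrow> nat) \<Rightarrow> ('b \<Rightarrow>\<^sub>0 'k::field_char_0) \<Rightarrow> ('b \<Rightarrow>\<^sub>0 'k)) \<Rightarrow>
     ('b \<Rightarrow>\<^sub>0 'k) set \<Rightarrow> ('b \<Rightarrow>\<^sub>0 'k) set \<Rightarrow> 'k mseries" where
  "frobenius n act Z W = smult_ms (1 / of_nat (fact n))
     (\<Sum>w | w permutes {1..n}.
        smult_ms (quotient_trace (act w) Z W) (\<Prod>C\<in>orbit w ` {1..n}. psum (card C)))"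


section \<open>The decorated complex\<close>

type_synonym basis_elt = "nat set list \<times> decoration list"
type_synonym 'k chain = "basis_elt \<Rightarrow>\<^sub>0 'k"

definition osp :: "nat \<Rightarrow> nat list \<Rightarrow> nat set list set" where
  "osp n \<beta> = {Bs. map card Bs = \<beta> \<and> \<Union>(set Bs) = {1..n} \<and>
     (\<forall>i < length Bs. \<forall>j < length Bs. i \<noteq> j \<longrightarrow> Bs ! i \<inter> Bs ! j = {})}"

definition basis :: "nat list \<Rightarrow> nat \<Rightarrow> basis_elt set" where
  "basis \<alpha> k = {(Bs, \<xi>s). \<exists>\<beta>\<in>coarsenings \<alpha>. length \<beta> = k \<and> Bs \<in> osp (sum_list \<alpha>) \<beta> \<and>
     length \<xi>s = k \<and> (\<forall>i<k. \<xi>s ! i \<in> decorations (\<beta> ! i))}"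

definition bideg :: "basis_elt \<Rightarrow> nat \<times> nat" where
  "bideg b = (sum_list (map2 deg_t (map card (fst b)) (snd b)),
              sum_list (map2 deg_q (map card (fst b)) (snd b)))"

definition merge_at :: "('a \<Rightarrow> 'a \<Rightarrow> 'a) \<Rightarrow> nat \<Rightarrow> 'a list \<Rightarrow> 'a list" where
  "merge_at f i xs = take i xs @ f (xs ! i) (xs ! Suc i) # drop (i + 2) xs"

text \<open>List positions start at \<open>0\<close>, so \<open>face i\<close> merges the blocks with the one-based numbers
  \<open>i + 1\<close> and \<open>i + 2\<close>, and its sign is \<open>(-1)\<^sup>i\<close>.\<close>

definition face :: "nat \<Rightarrow> basis_elt \<Rightarrow> 'k::field chain" where
  "face i b = (let Bs = fst b; \<xi>s = snd b; p = card (Bs ! i); q = card (Bs ! Suc i) in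
     if odd p \<and> odd q then 0
     else Poly_Mapping.single (merge_at (\<union>) i Bs, merge_at (diamond p q) i \<xi>s) 1)"

definition boundary_basis :: "basis_elt \<Rightarrow> 'k::field chain" where
  "boundary_basis b = (\<Sum>i < length (fst b) - 1. scale_fs ((-1) ^ i) (face i b))"

definition boundary :: "'k::field chain \<Rightarrow> 'k chain" where
  "boundary = lin_ext boundary_basis"

definition act :: "(nat \<Rightarrow> nat) \<Rightarrow> 'k::field chain \<Rightarrow> 'k chain" where
  "act w = lin_ext (\<lambda>b. Poly_Mapping.single (map ((`) w) (fst b), snd b) 1)"

definition component :: "nat \<Rightarrow> nat \<Rightarrow> 'k::field chain \<Rightarrow> 'k chain" where
  "component i j = lin_ext (\<lambda>b. if bideg b = (i, j) then Poly_Mapping.single b 1 else 0)"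

text \<open>For a predicate \<open>P\<close> on basis elements, the subspace of the \<open>k\<close>-th chain group spanned
  by the basis elements satisfying \<open>P\<close>, and the cycles and boundaries of bidegree \<open>(i, j)\<close>.\<close>

definition chain_group :: "nat list \<Rightarrow> (basis_elt \<Rightarrow> bool) \<Rightarrow> nat \<Rightarrow> 'k::field chain set" where
  "chain_group \<alpha> P k = {x. Poly_Mapping.keys x \<subseteq> {b \<in> basis \<alpha> k. P b}}"

definition cycles :: "nat list \<Rightarrow> (basis_elt \<Rightarrow> bool) \<Rightarrow> nat \<Rightarrow> nat \<Rightarrow> nat \<Rightarrow> 'k::field chain set" where
  "cycles \<alpha> P k i j = {x \<in> chain_group \<alpha> P k. boundary x = 0 \<and> component i j x = x}"

definition boundaries :: "nat list \<Rightarrow> (basis_elt \<Rightarrow> bool) \<Rightarrow> nat \<Rightarrow> nat \<Rightarrow> nat \<Rightarrow> 'k::field chain set" where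
  "boundaries \<alpha> P k i j = {x \<in> boundary ` chain_group \<alpha> P (Suc k). component i j x = x}"

definition homology_zero ::
    "'k::field itself \<Rightarrow> nat list \<Rightarrow> (basis_elt \<Rightarrow> bool) \<Rightarrow> nat \<Rightarrow> nat \<Rightarrow> nat \<Rightarrow> bool" where
  "homology_zero K \<alpha> P k i j \<longleftrightarrow> cycles \<alpha> P k i j = (boundaries \<alpha> P k i j :: 'k chain set)"

text \<open>\<open>ch\<^sub>t\<^sub>,\<^sub>q\<close> of the \<open>k\<close>-th homology of the complex \<open>chain_group \<alpha> P\<close>; bidegrees without basis
  element do not contribute.\<close>

definition ch_homology ::
    "nat list \<Rightarrow> (basis_elt \<Rightarrow> bool) \<Rightarrow> nat \<Rightarrow> 'k::field_char_0 poly poly mseries" where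
  "ch_homology \<alpha> P k = (\<Sum>(i, j)\<in>bideg ` basis \<alpha> k.
     map_ms (\<lambda>c. bimonom c i j)
       (frobenius (sum_list \<alpha>) act (cycles \<alpha> P k i j) (boundaries \<alpha> P k i j)))"

definition bigraded_Sn_complex :: "nat \<Rightarrow> (nat \<Rightarrow> 'k::field chain set) \<Rightarrow> bool" where
  "bigraded_Sn_complex n D \<longleftrightarrow> (\<forall>k. fs.subspace (D k) \<and>
     (\<forall>x\<in>D k.
        boundary x \<in> D (k - 1) \<and> boundary (boundary x) = 0 \<and>
        (\<forall>i j. component i j x \<in> D k \<and> boundary (component i j x) = component i j (boundary x)) \<and>
        (\<forall>w. w permutes {1..n} \<longrightarrow> act w x \<in> D k \<and> boundary (act w x) = act w (boundary x) \<and>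
           (\<forall>i j. component i j (act w x) = act w (component i j x)))))"


section \<open>Total decorations and factorization defect\<close>

text \<open>\<open>diamond\<close> is associative where it is defined, so the bracketing is immaterial.\<close>

fun total_decoration_of :: "nat list \<Rightarrow> decoration list \<Rightarrow> decoration" where
  "total_decoration_of [b] [\<xi>] = \<xi>"
| "total_decoration_of (b # c # bs) (\<xi> # \<xi>s) =
     diamond b (sum_list (c # bs)) \<xi> (total_decoration_of (c # bs) \<xi>s)"
| "total_decoration_of _ _ = (id, id)"

definition total_decoration :: "basis_elt \<Rightarrow> decoration" where
  "total_decoration b = total_decoration_of (map card (fst b)) (snd b)"

definition factorization_cuts :: "nat \<Rightarrow> decoration \<Rightarrow> nat set" where
  "factorization_cuts n \<theta> = {c \<in> cuts (zigzag n).
     fst \<theta> ` {1..up_half c} = {1..up_half c} \<and>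
     (\<forall>C \<in> orbit (snd \<theta>) ` {0..dn_half n}. 0 \<notin> C \<longrightarrow>
        C \<subseteq> {1..dn_half c} \<or> C \<subseteq> {dn_half c + 1..dn_half n}) \<and>
     (let r = root_word (snd \<theta>) in
        \<forall>i < length r. \<forall>j < length r. r ! i \<le> dn_half c \<and> r ! j > dn_half c \<longrightarrow> i < j)}"

definition factorization_composition :: "nat \<Rightarrow> decoration \<Rightarrow> nat list" where
  "factorization_composition n \<theta> = comp_of_cuts n (factorization_cuts n \<theta>)"

definition fd :: "nat \<Rightarrow> decoration \<Rightarrow> int" where
  "fd n \<theta> = int (cycle_count {1..up_half n} (fst \<theta>)) - int (card (factorization_cuts n \<theta>)) - 1"

definition contributes ::
    "'k::field itself \<Rightarrow> nat \<Rightarrow> decoration \<Rightarrow> nat \<Rightarrow> nat \<Rightarrow> nat \<Rightarrow> bool" where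
  "contributes K n \<theta> k i j \<longleftrightarrow>
     \<not> homology_zero K (zigzag n) (\<lambda>b. total_decoration b = \<theta>) k i j"

abbreviation full :: "basis_elt \<Rightarrow> bool" where
  "full b \<equiv> True"

definition has_defect :: "nat \<Rightarrow> nat \<Rightarrow> basis_elt \<Rightarrow> bool" where
  "has_defect n d b \<longleftrightarrow> fd n (total_decoration b) = int d"

definition defect_class :: "nat \<Rightarrow> nat \<Rightarrow> 'k::field_char_0 poly poly mseries" where
  "defect_class n d = (\<Sum>\<theta> | \<theta> \<in> decorations n \<and> fd n \<theta> = int d.
     smult_ms (bimonom 1 (deg_t n \<theta>) (deg_q n \<theta>)) (ribbon (factorization_composition n \<theta>)))"

end

theory Submission
  imports Defs
begin

section \<open>Traces on finite-dimensional subspaces\<close>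

locale traces = vector_space scale for scale :: "'a::field \<Rightarrow> 'b::ab_group_add \<Rightarrow> 'b" (infixr \<open>*s\<close> 75)
begin

definition fin_dim :: "'b set \<Rightarrow> bool" where
  "fin_dim V \<longleftrightarrow> (\<exists>B. finite B \<and> span B = V)"

definition trace_on :: "('b \<Rightarrow> 'b) \<Rightarrow> 'b set \<Rightarrow> 'a" where
  "trace_on f V = (\<Sum>b\<in>(SOME B. independent B \<and> span B = V).
     representation (SOME B. independent B \<and> span B = V) (f b) b)"

lemma fin_dim_span: "finite B \<Longrightarrow> fin_dim (span B)"
  unfolding fin_dim_def by blast

lemma fin_dim_subspace: "fin_dim V \<Longrightarrow> subspace V"
  unfolding fin_dim_def by auto

lemma fin_dim_subset:
  assumes "fin_dim V" "subspace W" "W \<subseteq> V"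
  shows "fin_dim W"
proof -
  obtain C where C: "finite C" "span C = V" using assms(1) unfolding fin_dim_def by blast
  obtain B where B: "B \<subseteq> W" "independent B" "W \<subseteq> span B"
    by (rule maximal_independent_subset_extend[OF empty_subsetI independent_empty])
  have "B \<subseteq> span C" using B(1) assms(3) C(2) by blast
  then have "finite B" using independent_span_bound[OF C(1) B(2)] by blast
  moreover have "span B = W" using B assms(2) span_minimal by blast
  ultimately show ?thesis using fin_dim_span by blast
qed

lemma finite_independent:
  assumes "fin_dim V" "independent B" "B \<subseteq> V"
  shows "finite B"
  using assms independent_span_bound unfolding fin_dim_def by blast

lemma extend_to_basis:
  assumes "independent S" "S \<subseteq> V" "fin_dim V"
  obtains T where "S \<subseteq> T" "independent T" "span T = V" "finite T"
proof -
  obtain T where T: "S \<subseteq> T" "T \<subseteq> V" "independent T" "V \<subseteq> span T"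
    by (rule maximal_independent_subset_extend[OF assms(2,1)])
  have "span T = V" using T fin_dim_subspace[OF assms(3)] span_minimal by blast
  with T show ?thesis using that finite_independent[OF assms(3)] by blast
qed

text \<open>This is tr(AB) = tr(BA) for the two matrices of change of basis: expanding the vectors
  of each basis in the other one turns both sums into the same double sum.\<close>

lemma trace_basis_independent:
  assumes T: "finite T" "independent T" and T': "finite T'" "independent T'"
    and sp: "span T = span T'" and f: "Vector_Spaces.linear scale scale f" "f ` span T \<subseteq> span T"
  shows "(\<Sum>b\<in>T. representation T (f b) b) = (\<Sum>b\<in>T'. representation T' (f b) b)"
proof -
  interpret f: Vector_Spaces.linear scale scale f by fact
  have "representation T (f b) b = (\<Sum>c\<in>T'. representation T' b c * representation T (f c) b)"
    if b: "b \<in> T" for b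
  proof -
    have bs: "b \<in> span T'" using b sp span_base by blast
    have "f b = f (\<Sum>c\<in>T'. representation T' b c *s c)"
      using sum_representation_eq[OF T'(2) bs T'(1)] by simp
    also have "\<dots> = (\<Sum>c\<in>T'. representation T' b c *s f c)"
      by (simp add: f.sum f.scale)
    finally have eq: "f b = \<dots>" .
    have mem: "f c \<in> span T" if "c \<in> T'" for c using f(2) that sp span_base by blast
    show ?thesis unfolding eq
      using mem by (simp add: representation_sum[OF T(2)] span_scale representation_scale[OF T(2)])
  qed
  then have "(\<Sum>b\<in>T. representation T (f b) b)
      = (\<Sum>b\<in>T. \<Sum>c\<in>T'. representation T' b c * representation T (f c) b)" by simp
  also have "\<dots> = (\<Sum>c\<in>T'. \<Sum>b\<in>T. representation T' b c * representation T (f c) b)"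
    by (rule sum.swap)
  also have "\<dots> = (\<Sum>c\<in>T'. representation T' (f c) c)"
  proof (rule sum.cong[OF refl])
    fix c assume c: "c \<in> T'"
    have fc: "f c \<in> span T" using f(2) c sp span_base by blast
    have mem: "b \<in> span T'" if "b \<in> T" for b using that sp span_base by blast
    have "representation T' (f c) c = representation T' (\<Sum>b\<in>T. representation T (f c) b *s b) c"
      using sum_representation_eq[OF T(2) fc T(1)] by simp
    also have "\<dots> = (\<Sum>b\<in>T. representation T' b c * representation T (f c) b)"
      using mem by (simp add: representation_sum[OF T'(2)] span_scale representation_scale[OF T'(2)] mult.commute)
    finally show "(\<Sum>b\<in>T. representation T' b c * representation T (f c) b) = representation T' (f c) c" ..
  qed
  finally show ?thesis .
qed

lemma trace_on_basis:
  assumes "finite T" "independent T" "span T = V" "Vector_Spaces.linear scale scale f" "f ` V \<subseteq> V"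
  shows "trace_on f V = (\<Sum>b\<in>T. representation T (f b) b)"
proof -
  define B where "B = (SOME B. independent B \<and> span B = V)"
  have B: "independent B \<and> span B = V" unfolding B_def by (rule someI[of _ T]) (use assms in auto)
  have "B \<subseteq> span T" using B assms(3) span_superset[of B] by simp
  then have "finite B" using independent_span_bound[OF assms(1)] B by blast
  then show ?thesis unfolding trace_on_def B_def[symmetric]
    using trace_basis_independent[of B T f] B assms by simp
qed

lemma trace_on_diff:
  assumes T: "independent T" "S \<subseteq> T" "span S = W" "span T = Z" and fin: "fin_dim Z"
    and f: "Vector_Spaces.linear scale scale f" "f ` Z \<subseteq> Z" "f ` W \<subseteq> W"
  shows "(\<Sum>b\<in>T - S. representation T (f b) b) = trace_on f Z - trace_on f W"
proof -
  have finT: "finite T" using finite_independent[OF fin T(1)] T(4) span_superset[of T] by simp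
  then have finS: "finite S" using T(2) finite_subset by blast
  have iS: "independent S" using T(1,2) independent_mono by blast
  have "representation T (f b) b = representation S (f b) b" if "b \<in> S" for b
  proof -
    have "f b \<in> span S" using that f(3) T(3) span_base by blast
    then show ?thesis using representation_extend[OF T(1) _ T(2)] by simp
  qed
  then have "trace_on f W = (\<Sum>b\<in>S. representation T (f b) b)"
    using trace_on_basis[OF finS iS T(3) f(1,3)] by simp
  moreover have "trace_on f Z = (\<Sum>b\<in>T. representation T (f b) b)"
    using trace_on_basis[OF finT T(1,4) f(1,2)] .
  ultimately show ?thesis using sum_diff[OF finT T(2)] by metis
qed

text \<open>Rank-nullity for traces: a complement of the kernel of \<open>D\<close> in \<open>C\<close> is mapped
  isomorphically onto the image, and this isomorphism is compatible with \<open>f\<close> modulo the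
  kernel.\<close>

lemma trace_kernel_image:
  assumes C: "fin_dim C" and f: "Vector_Spaces.linear scale scale f" "f ` C \<subseteq> C"
    and D: "Vector_Spaces.linear scale scale D" and comm: "\<And>x. x \<in> C \<Longrightarrow> D (f x) = f (D x)"
  shows "trace_on f C = trace_on f {x \<in> C. D x = 0} + trace_on f (D ` C)"
proof -
  interpret f: Vector_Spaces.linear scale scale f by fact
  interpret D: Vector_Spaces.linear scale scale D by fact
  let ?Z = "{x \<in> C. D x = 0}"
  have sC: "subspace C" using fin_dim_subspace[OF C] .
  have sZ: "subspace ?Z"
    using subspace_inter[OF sC D.subspace_kernel] by (simp add: Int_def)
  have fZ: "fin_dim ?Z" using fin_dim_subset[OF C sZ] by auto
  obtain S where S: "independent S" "span S = ?Z" "finite S"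
    by (rule extend_to_basis[OF independent_empty empty_subsetI fZ])
  have "S \<subseteq> C" using S(2) span_superset by blast
  then obtain T where T: "S \<subseteq> T" "independent T" "span T = C" "finite T"
    by (rule extend_to_basis[OF S(1) _ C])
  have fZZ: "f ` ?Z \<subseteq> ?Z"
  proof (rule image_subsetI)
    fix x assume x: "x \<in> ?Z"
    then have "D (f x) = f 0" using comm by simp
    then show "f x \<in> ?Z" using x f(2) by (auto simp: f.zero)
  qed
  let ?U = "T - S"
  have indU: "independent ?U" using T(2) independent_mono by blast
  have spU: "span ?U \<subseteq> C" using T(3) span_mono[of ?U T] by auto
  have inj: "inj_on D (span ?U)"
    unfolding D.inj_on_iff_eq_0[OF subspace_span]
  proof (intro ballI impI)
    fix x assume x: "x \<in> span ?U" "D x = 0"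
    then have xS: "x \<in> span S" using spU S(2) by auto
    have "representation T x b = 0" for b
    proof (rule ccontr)
      assume "representation T x b \<noteq> 0"
      moreover have "representation T x = representation S x" "representation T x = representation ?U x"
        by (rule representation_extend[OF T(2) xS T(1)], rule representation_extend[OF T(2) x(1) Diff_subset])
      ultimately show False using representation_ne_zero[of S x b] representation_ne_zero[of ?U x b] by auto
    qed
    moreover have "x \<in> span T" using x(1) span_mono[of ?U T] by auto
    ultimately show "x = 0" using sum_representation_eq[OF T(2) _ T(4)] by fastforce
  qed
  have injU: "inj_on D ?U" using inj inj_on_subset span_superset by blast
  have indDU: "independent (D ` ?U)" using D.independent_injective_image[OF indU inj] .
  have coord: "D x = (\<Sum>c\<in>?U. representation T x c *s D c)" if "x \<in> C" for x
  proof -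
    have "D x = D (\<Sum>c\<in>T. representation T x c *s c)"
      using sum_representation_eq[OF T(2) _ T(4)] that T(3) by simp
    also have "\<dots> = (\<Sum>c\<in>T. representation T x c *s D c)" by (simp add: D.sum D.scale)
    also have "\<dots> = (\<Sum>c\<in>?U. representation T x c *s D c)"
    proof (rule sum.mono_neutral_right[OF T(4)])
      show "\<forall>c\<in>T - ?U. representation T x c *s D c = 0"
        using S(2) span_superset[of S] by auto
    qed auto
    finally show ?thesis .
  qed
  have spDU: "span (D ` ?U) = D ` C"
  proof
    show "span (D ` ?U) \<subseteq> D ` C" unfolding D.span_image using spU by auto
    show "D ` C \<subseteq> span (D ` ?U)"
    proof
      fix y assume "y \<in> D ` C"
      then obtain x where x: "x \<in> C" "y = D x" by blast
      show "y \<in> span (D ` ?U)" unfolding x(2) coord[OF x(1)]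
        by (intro span_sum span_scale span_base) auto
    qed
  qed
  have fDC: "f ` (D ` C) \<subseteq> D ` C"
  proof clarify
    fix x assume x: "x \<in> C"
    then show "f (D x) \<in> D ` C" using comm[OF x, symmetric] f(2) by auto
  qed
  have rep: "representation (D ` ?U) (D x) (D b) = representation T x b"
    if "x \<in> C" "b \<in> ?U" for x b
  proof -
    have "representation (D ` ?U) (D x) (D b)
        = (\<Sum>c\<in>?U. representation T x c * representation (D ` ?U) (D c) (D b))"
    proof -
      have mem: "D c \<in> span (D ` ?U)" if "c \<in> ?U" for c using that by (blast intro: span_base)
      have "representation (D ` ?U) (D x) (D b)
          = (\<Sum>c\<in>?U. representation (D ` ?U) (representation T x c *s D c) (D b))"
        unfolding coord[OF that(1)] by (subst representation_sum[OF indDU]) (use mem span_scale in blast)+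
      then show ?thesis using representation_scale[OF indDU mem] by simp
    qed
    also have "\<dots> = (\<Sum>c\<in>?U. if c = b then representation T x c else 0)"
    proof (rule sum.cong[OF refl])
      fix c assume c: "c \<in> ?U"
      have "representation (D ` ?U) (D c) (D b) = (if D b = D c then 1 else 0)"
        by (subst representation_basis[OF indDU]) (use c in auto)
      also have "D b = D c \<longleftrightarrow> c = b" using injU c that(2) by (auto dest: inj_onD)
      finally show "representation T x c * representation (D ` ?U) (D c) (D b)
          = (if c = b then representation T x c else 0)" by simp
    qed
    also have "\<dots> = representation T x b" using that(2) T(4) by simp
    finally show ?thesis .
  qed
  have "trace_on f (D ` C) = (\<Sum>e\<in>D ` ?U. representation (D ` ?U) (f e) e)"
    by (rule trace_on_basis) (use T(4) indDU spDU f fDC in auto)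
  also have "\<dots> = (\<Sum>b\<in>?U. representation (D ` ?U) (f (D b)) (D b))"
    by (simp add: sum.reindex[OF injU])
  also have "\<dots> = (\<Sum>b\<in>?U. representation T (f b) b)"
  proof (rule sum.cong[OF refl])
    fix b assume b: "b \<in> ?U"
    then have "b \<in> C" "f b \<in> C" using T(3) span_superset[of T] f(2) by auto
    then show "representation (D ` ?U) (f (D b)) (D b) = representation T (f b) b"
      using rep[of "f b" b] b comm by simp
  qed
  also have "\<dots> = trace_on f C - trace_on f ?Z"
    by (rule trace_on_diff) (use T S C f fZZ in auto)
  finally show ?thesis by simp
qed

lemma trace_direct_sum:
  assumes A: "fin_dim A" and B: "fin_dim B" and int: "A \<inter> B = {0}"
    and f: "Vector_Spaces.linear scale scale f" "f ` A \<subseteq> A" "f ` B \<subseteq> B"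
  shows "trace_on f {a + b | a b. a \<in> A \<and> b \<in> B} = trace_on f A + trace_on f B"
proof -
  interpret f: Vector_Spaces.linear scale scale f by fact
  obtain S where S: "independent S" "span S = A" "finite S"
    by (rule extend_to_basis[OF independent_empty empty_subsetI A])
  obtain U where U: "independent U" "span U = B" "finite U"
    by (rule extend_to_basis[OF independent_empty empty_subsetI B])
  have disj: "S \<inter> U = {}"
  proof -
    have "S \<inter> U \<subseteq> {0}" using int S(2) U(2) span_superset[of S] span_superset[of U] by auto
    moreover have "0 \<notin> S" using S(1) dependent_zero by blast
    ultimately show ?thesis by auto
  qed
  have sp: "span (S \<union> U) = {a + b | a b. a \<in> A \<and> b \<in> B}" unfolding span_Un S(2) U(2) by auto
  have ind: "independent (S \<union> U)"
    unfolding independent_explicit_module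
  proof (intro allI impI)
    fix t u v assume t: "finite t" "t \<subseteq> S \<union> U" "(\<Sum>v\<in>t. u v *s v) = 0" "v \<in> t"
    have split: "t = (t \<inter> S) \<union> (t \<inter> U)" using t(2) by auto
    have eq0: "(\<Sum>v\<in>t \<inter> S. u v *s v) + (\<Sum>v\<in>t \<inter> U. u v *s v) = 0"
      using t(3) disj t(1) by (subst (asm) split, subst (asm) sum.union_disjoint) auto
    have a: "(\<Sum>v\<in>t \<inter> S. u v *s v) \<in> A" unfolding S(2)[symmetric]
      by (intro span_sum span_scale span_base) auto
    have b: "(\<Sum>v\<in>t \<inter> U. u v *s v) \<in> B" unfolding U(2)[symmetric]
      by (intro span_sum span_scale span_base) auto
    from eq0 have eqn: "(\<Sum>v\<in>t \<inter> S. u v *s v) = - (\<Sum>v\<in>t \<inter> U. u v *s v)"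
      by (simp add: eq_neg_iff_add_eq_0)
    then have "(\<Sum>v\<in>t \<inter> S. u v *s v) \<in> B" using b fin_dim_subspace[OF B] subspace_neg by simp
    with a int have "(\<Sum>v\<in>t \<inter> S. u v *s v) = 0" by auto
    moreover from this eqn have "(\<Sum>v\<in>t \<inter> U. u v *s v) = 0" by simp
    ultimately show "u v = 0"
      using t(1,2,4) independentD[OF S(1), of "t \<inter> S" u v] independentD[OF U(1), of "t \<inter> U" u v] by blast
  qed
  have fsp: "f ` span (S \<union> U) \<subseteq> span (S \<union> U)"
  proof (rule image_subsetI)
    fix x assume "x \<in> span (S \<union> U)"
    then obtain a b where x: "x = a + b" "a \<in> A" "b \<in> B" unfolding sp by blast
    then have "f x = f a + f b" "f a \<in> A" "f b \<in> B" using f(2,3) by (auto simp: f.add)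
    then show "f x \<in> span (S \<union> U)" unfolding sp by blast
  qed
  have "(\<Sum>b\<in>(S \<union> U) - S. representation (S \<union> U) (f b) b) = trace_on f (span (S \<union> U)) - trace_on f A"
    by (rule trace_on_diff) (use ind S U f fsp fin_dim_span in auto)
  moreover have "(\<Sum>b\<in>(S \<union> U) - S. representation (S \<union> U) (f b) b) = (\<Sum>b\<in>U. representation U (f b) b)"
  proof (rule sum.cong)
    show "S \<union> U - S = U" using disj by auto
    fix b assume b: "b \<in> U"
    then have "f b \<in> span U" using f(3) U(2) span_superset[of U] by auto
    then show "representation (S \<union> U) (f b) b = representation U (f b) b"
      using representation_extend[OF ind, of "f b" U] by auto
  qed
  moreover have "\<dots> = trace_on f B" using trace_on_basis[of U B f] U f by simp
  ultimately show ?thesis using sp by (simp add: algebra_simps)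
qed

text \<open>The Hopf trace formula; both sides telescope because a chain group is made of its cycles
  and of the boundaries one degree below.\<close>

lemma hopf_trace:
  fixes C :: "nat \<Rightarrow> 'b set"
  assumes C: "\<And>k. fin_dim (C k)" and f: "Vector_Spaces.linear scale scale f" "\<And>k. f ` C k \<subseteq> C k"
    and D: "Vector_Spaces.linear scale scale D" "\<And>k. D ` C (Suc k) \<subseteq> C k" and comm: "\<And>k x. x \<in> C k \<Longrightarrow> D (f x) = f (D x)"
    and bot: "C 0 = {0}" and top: "C (Suc m) = {0}"
  shows "(\<Sum>k\<le>m. (-1) ^ k * (trace_on f {x \<in> C k. D x = 0} - trace_on f (D ` C (Suc k))))
    = (\<Sum>k\<le>m. (-1) ^ k * trace_on f (C k))"
proof -
  interpret D: Vector_Spaces.linear scale scale D by fact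
  have t0: "trace_on f {0} = 0"
    using trace_on_basis[of "{}" "{0}" f] f(2)[of 0] bot f(1) independent_empty by auto
  have tr: "trace_on f (C k) = trace_on f {x \<in> C k. D x = 0} + trace_on f (D ` C k)" for k
    by (rule trace_kernel_image) (use C f D comm in auto)
  have "(\<Sum>k\<le>p. (-1) ^ k * (trace_on f {x \<in> C k. D x = 0} - trace_on f (D ` C (Suc k))))
      = (\<Sum>k\<le>p. (-1) ^ k * trace_on f (C k)) - (-1) ^ p * trace_on f (D ` C (Suc p))" for p
  proof (induction p)
    case 0
    have "D ` C 0 = {0}" using bot by (auto simp: D.zero)
    then show ?case using tr[of 0] t0 by simp
  next
    case (Suc p)
    then show ?case using tr[of "Suc p"] by (simp add: algebra_simps)
  qed
  moreover have "D ` C (Suc m) = {0}" using top by (auto simp: D.zero)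
  ultimately show ?thesis using t0 by simp
qed

end

global_interpretation fs: traces "scale_fs :: 'k::field \<Rightarrow> ('b \<Rightarrow>\<^sub>0 'k) \<Rightarrow> 'b \<Rightarrow>\<^sub>0 'k"
  by unfold_locales

lemma quotient_trace_eq:
  fixes f :: "('b \<Rightarrow>\<^sub>0 'k::field) \<Rightarrow> ('b \<Rightarrow>\<^sub>0 'k)"
  assumes Z: "fs.fin_dim Z" and W: "fs.subspace W" "W \<subseteq> Z"
    and f: "Vector_Spaces.linear scale_fs scale_fs f" "f ` Z \<subseteq> Z" "f ` W \<subseteq> W"
  shows "quotient_trace f Z W = fs.trace_on f Z - fs.trace_on f W"
proof -
  let ?P = "\<lambda>(S, T). fs.independent T \<and> S \<subseteq> T \<and> fs.span S = W \<and> fs.span T = Z"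
  define p where "p = (SOME p. ?P p)"
  have fW: "fs.fin_dim W" using fs.fin_dim_subset Z W by blast
  obtain S where S: "fs.independent S" "fs.span S = W"
    by (rule fs.extend_to_basis[OF fs.independent_empty empty_subsetI fW])
  have "S \<subseteq> Z" using S(2) W(2) fs.span_superset by blast
  then obtain T where T: "S \<subseteq> T" "fs.independent T" "fs.span T = Z"
    by (rule fs.extend_to_basis[OF S(1) _ Z])
  have "?P p" unfolding p_def by (rule someI[of _ "(S, T)"]) (use S T in auto)
  then obtain S' T' where p: "p = (S', T')" "fs.independent T'" "S' \<subseteq> T'" "fs.span S' = W" "fs.span T' = Z"
    by (cases p) auto
  have "quotient_trace f Z W = (\<Sum>b\<in>T' - S'. fs.representation T' (f b) b)"
    unfolding quotient_trace_def p_def[symmetric] p(1) by simp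
  also have "\<dots> = fs.trace_on f Z - fs.trace_on f W"
    by (rule fs.trace_on_diff) (use p Z f in auto)
  finally show ?thesis .
qed

section \<open>Compositions and their cuts\<close>

lemma Nil_compositions [simp]: "[] \<in> compositions n \<longleftrightarrow> n = 0"
  by (auto simp: compositions_def)

lemma Cons_compositions: "b # \<beta> \<in> compositions n \<longleftrightarrow> 0 < b \<and> b \<le> n \<and> \<beta> \<in> compositions (n - b)"
  by (auto simp: compositions_def)

lemma compositions_sum: "\<beta> \<in> compositions n \<Longrightarrow> sum_list \<beta> = n"
  by (simp add: compositions_def)

lemma compositions_0 [simp]: "\<beta> \<in> compositions 0 \<longleftrightarrow> \<beta> = []"
  by (cases \<beta>) (auto simp: compositions_def)

lemma cuts_Nil [simp]: "cuts [] = {}" and cuts_single [simp]: "cuts [b] = {}"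
  by (auto simp: cuts_def)

lemma cuts_Cons:
  assumes "\<beta> \<noteq> []"
  shows "cuts (b # \<beta>) = insert b ((+) b ` cuts \<beta>)"
proof (intro subset_antisym subsetI)
  fix c assume "c \<in> cuts (b # \<beta>)"
  then obtain i where i: "c = sum_list (take i (b # \<beta>))" "1 \<le> i" "i < length (b # \<beta>)"
    by (auto simp: cuts_def)
  then obtain j where j: "i = Suc j" by (cases i) auto
  show "c \<in> insert b ((+) b ` cuts \<beta>)"
  proof (cases "j = 0")
    case False
    then have "sum_list (take j \<beta>) \<in> cuts \<beta>" using i j by (auto simp: cuts_def)
    then show ?thesis using i j by simp
  qed (use i j in simp)
next
  fix c assume "c \<in> insert b ((+) b ` cuts \<beta>)"
  then show "c \<in> cuts (b # \<beta>)"
  proof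
    assume "c = b"
    moreover have "b = sum_list (take 1 (b # \<beta>)) \<and> 1 < length (b # \<beta>)" using assms by simp
    ultimately show ?thesis unfolding cuts_def by blast
  next
    assume "c \<in> (+) b ` cuts \<beta>"
    then obtain i where i: "c = b + sum_list (take i \<beta>)" "1 \<le> i" "i < length \<beta>"
      by (auto simp: cuts_def)
    then have "c = sum_list (take (Suc i) (b # \<beta>)) \<and> 1 \<le> Suc i \<and> Suc i < length (b # \<beta>)" by simp
    then show ?thesis unfolding cuts_def by blast
  qed
qed

lemma cuts_bounds: "\<beta> \<in> compositions n \<Longrightarrow> cuts \<beta> \<subseteq> {0<..<n}"
proof (induction \<beta> arbitrary: n)
  case (Cons b \<beta>)
  show ?case
  proof (cases "\<beta> = []")
    case False
    have "\<beta> \<in> compositions (n - b)" "0 < b" using Cons.prems by (auto simp: Cons_compositions)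
    moreover from this have "0 < n - b" using False by (cases "n - b = 0") (simp_all del: diff_is_0_eq)
    moreover have "cuts \<beta> \<subseteq> {0<..<n - b}" using Cons.IH calculation(1) .
    ultimately show ?thesis using False by (fastforce simp: cuts_Cons)
  qed simp
qed simp

lemma finite_cuts [simp]: "finite (cuts \<beta>)"
proof -
  have "cuts \<beta> = (\<lambda>i. sum_list (take i \<beta>)) ` {1..<length \<beta>}" by (auto simp: cuts_def)
  then show ?thesis by simp
qed

lemma card_cuts: "\<beta> \<in> compositions n \<Longrightarrow> \<beta> \<noteq> [] \<Longrightarrow> length \<beta> = Suc (card (cuts \<beta>))"
proof (induction \<beta> arbitrary: n)
  case (Cons b \<beta>)
  show ?case
  proof (cases "\<beta> = []")
    case False
    have \<beta>: "\<beta> \<in> compositions (n - b)" "0 < b" using Cons.prems by (auto simp: Cons_compositions)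
    then have "b \<notin> (+) b ` cuts \<beta>" using cuts_bounds by fastforce
    moreover have "card ((+) b ` cuts \<beta>) = card (cuts \<beta>)" by (rule card_image) simp
    ultimately show ?thesis using Cons.IH[OF \<beta>(1) False] False by (simp add: cuts_Cons)
  qed simp
qed simp

lemma cuts_inject:
  "\<beta> \<in> compositions n \<Longrightarrow> \<gamma> \<in> compositions n \<Longrightarrow> cuts \<beta> = cuts \<gamma> \<Longrightarrow> \<beta> = \<gamma>"
proof (induction \<beta> arbitrary: n \<gamma>)
  case Nil
  then show ?case by (auto simp: compositions_def) (metis list.set_intros(1) neq_Nil_conv)
next
  case (Cons b \<beta>)
  then obtain c \<delta> where \<gamma>: "\<gamma> = c # \<delta>" by (cases \<gamma>) (auto simp: Cons_compositions)
  have bc: "0 < b" "\<beta> \<in> compositions (n - b)" "0 < c" "\<delta> \<in> compositions (n - c)" "b \<le> n" "c \<le> n"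
    using Cons.prems \<gamma> by (auto simp: Cons_compositions)
  have len: "length \<beta> = length \<delta>" using card_cuts[OF Cons.prems(1)] card_cuts[OF Cons.prems(2)] Cons.prems(3) \<gamma> by simp
  show ?case
  proof (cases "\<beta> = []")
    case True
    then show ?thesis using len \<gamma> Cons.prems by (auto simp: Cons_compositions)
  next
    case False
    then have D: "\<delta> \<noteq> []" using len by auto
    have "insert b ((+) b ` cuts \<beta>) = insert c ((+) c ` cuts \<delta>)"
      using Cons.prems(3) \<gamma> False D by (simp add: cuts_Cons)
    moreover have "b < x" if "x \<in> (+) b ` cuts \<beta>" for x using that cuts_bounds[OF bc(2)] by auto
    moreover have "c < x" if "x \<in> (+) c ` cuts \<delta>" for x using that cuts_bounds[OF bc(4)] by auto
    ultimately have eq: "b = c" "(+) b ` cuts \<beta> = (+) c ` cuts \<delta>"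
      using insert_ident[of b "(+) b ` cuts \<beta>" "(+) c ` cuts \<delta>"] by (metis insertE insertI1 less_asym less_irrefl)+
    then have "cuts \<beta> = cuts \<delta>" by (simp add: inj_image_eq_iff)
    then show ?thesis using Cons.IH[OF bc(2), of \<delta>] bc eq \<gamma> by simp
  qed
qed

lemma composition_with_cuts:
  assumes "S \<subseteq> {0<..<n}" "0 < n"
  shows "\<exists>\<gamma>\<in>compositions n. cuts \<gamma> = S"
  using assms
proof (induction "card S" arbitrary: S n)
  case 0
  then have "S = {}" by (metis card_0_eq finite_greaterThanLessThan finite_subset)
  moreover have "[n] \<in> compositions n" using 0 by (simp add: Cons_compositions)
  ultimately show ?case by (intro bexI[of _ "[n]"]) auto
next
  case (Suc k)
  have fin: "finite S" using Suc.prems finite_subset by blast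
  then have ne: "S \<noteq> {}" using Suc.hyps(2) by auto
  define c where "c = Min S"
  have c: "c \<in> S" "\<And>x. x \<in> S \<Longrightarrow> c \<le> x" using fin ne by (auto simp: c_def)
  define T where "T = (\<lambda>x. x - c) ` (S - {c})"
  have cT: "(+) c ` T = S - {c}" unfolding T_def image_image using c(2)
    by (force intro: image_eqI)
  have "T \<subseteq> {0<..<n - c}"
  proof
    fix x assume "x \<in> T"
    then obtain y where "y \<in> S" "y \<noteq> c" "x = y - c" by (auto simp: T_def)
    then show "x \<in> {0<..<n - c}" using c(2)[of y] Suc.prems(1) by auto
  qed
  moreover have "card T = k"
  proof -
    have "card ((+) c ` T) = card T" by (rule card_image) simp
    then show ?thesis using cT Suc.hyps(2) fin c(1) by simp
  qed
  moreover have "0 < n - c" "0 < c" using Suc.prems(1) c(1) by auto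
  ultimately obtain \<gamma> where \<gamma>: "\<gamma> \<in> compositions (n - c)" "cuts \<gamma> = T" using Suc.hyps(1)[of T "n - c"] by blast
  then have ne: "\<gamma> \<noteq> []" using \<open>0 < n - c\<close> by auto
  then have "cuts (c # \<gamma>) = S" using \<gamma>(2) cT c(1) by (auto simp: cuts_Cons)
  moreover have "c # \<gamma> \<in> compositions n" using \<gamma>(1) \<open>0 < c\<close> \<open>0 < n - c\<close> by (simp add: Cons_compositions)
  ultimately show ?case by blast
qed

lemma comp_of_cuts:
  assumes "S \<subseteq> {0<..<n}" "0 < n"
  shows "comp_of_cuts n S \<in> compositions n" "cuts (comp_of_cuts n S) = S"
proof -
  have "\<exists>!\<gamma>. \<gamma> \<in> compositions n \<and> cuts \<gamma> = S"
    using composition_with_cuts[OF assms] cuts_inject by blast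
  from theI'[OF this] show "comp_of_cuts n S \<in> compositions n" "cuts (comp_of_cuts n S) = S"
    by (auto simp: comp_of_cuts_def)
qed

lemma finite_compositions [simp]: "finite (compositions n)"
proof -
  have "compositions n \<subseteq> {xs. set xs \<subseteq> {..n} \<and> length xs \<le> n}"
  proof
    fix \<beta> assume \<beta>: "\<beta> \<in> compositions n"
    have "length \<beta> \<le> sum_list \<beta>" if "0 \<notin> set \<beta>" using that by (induction \<beta>) auto
    then show "\<beta> \<in> {xs. set xs \<subseteq> {..n} \<and> length xs \<le> n}"
      using \<beta> member_le_sum_list by (auto simp: compositions_def)
  qed
  then show ?thesis using finite_lists_length_le[of "{..n}" n] finite_subset by auto
qed

lemma finite_coarsenings [simp]: "finite (coarsenings \<alpha>)"
  by (rule finite_subset[of _ "compositions (sum_list \<alpha>)"]) (auto simp: coarsenings_def)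

lemma zigzag_add2: "zigzag (Suc (Suc n)) = 2 # zigzag n"
  by (simp add: zigzag_def)

lemma zigzag_compositions: "zigzag n \<in> compositions n"
proof (induction n rule: induct_nat_012)
  case (ge2 n)
  then show ?case by (simp add: zigzag_add2 Cons_compositions)
qed (simp_all add: zigzag_def Cons_compositions)

lemma sum_zigzag [simp]: "sum_list (zigzag n) = n"
  using zigzag_compositions compositions_sum by blast

lemma ell_up_half: "ell n = up_half n"
  by (auto simp: ell_def zigzag_def up_half_def elim!: evenE oddE)

lemma cuts_zigzag: "cuts (zigzag n) = {c. even c \<and> 0 < c \<and> c < n}"
proof (induction n rule: induct_nat_012)
  case (ge2 n)
  show ?case
  proof (cases "n = 0")
    case True
    then show ?thesis by (auto simp: zigzag_def elim!: evenE)
  next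
    case False
    then have "zigzag n \<noteq> []" using zigzag_compositions[of n] by (metis Nil_compositions)
    then have "cuts (zigzag (Suc (Suc n))) = insert 2 ((+) 2 ` {c. even c \<and> 0 < c \<and> c < n})"
      using ge2 by (simp add: zigzag_add2 cuts_Cons)
    also have "\<dots> = {c. even c \<and> 0 < c \<and> c < Suc (Suc n)}"
    proof (intro subset_antisym subsetI)
      fix c assume c: "c \<in> {c. even c \<and> 0 < c \<and> c < Suc (Suc n)}"
      show "c \<in> insert 2 ((+) 2 ` {c. even c \<and> 0 < c \<and> c < n})"
      proof (cases "c = 2")
        case False
        then have "c = 2 + (c - 2)" "even (c - 2)" "0 < c - 2" "c - 2 < n" using c by (auto elim!: evenE)
        then show ?thesis by blast
      qed simp
    qed (use False in auto)
    finally show ?thesis .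
  qed
qed (auto simp: zigzag_def)

lemma coarsenings_zigzag: "coarsenings (zigzag n) = {\<beta> \<in> compositions n. \<forall>c\<in>cuts \<beta>. even c}"
  using cuts_bounds[of _ n] by (fastforce simp: coarsenings_def cuts_zigzag)

lemma coarsenings_zigzag_Cons:
  assumes "\<beta> \<noteq> []"
  shows "b # \<beta> \<in> coarsenings (zigzag n) \<longleftrightarrow>
    0 < b \<and> even b \<and> b \<le> n \<and> \<beta> \<in> coarsenings (zigzag (n - b))"
  using assms by (auto simp: coarsenings_zigzag Cons_compositions cuts_Cons)

lemma coarsenings_comp_of_cuts:
  assumes "S \<subseteq> {0<..<n}" "0 < n"
  shows "coarsenings (comp_of_cuts n S) = {\<beta> \<in> compositions n. cuts \<beta> \<subseteq> S}"
    "length (comp_of_cuts n S) = Suc (card S)"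
proof -
  note c = comp_of_cuts[OF assms]
  show "coarsenings (comp_of_cuts n S) = {\<beta> \<in> compositions n. cuts \<beta> \<subseteq> S}"
    using c compositions_sum[OF c(1)] by (simp add: coarsenings_def)
  have "comp_of_cuts n S \<noteq> []" using c(1) assms(2) by auto
  then show "length (comp_of_cuts n S) = Suc (card S)" using card_cuts[OF c(1)] c(2) by simp
qed

section \<open>Gluing permutations\<close>

definition lift :: "nat \<Rightarrow> nat \<Rightarrow> nat" where
  "lift a x = (if x = 0 then 0 else a + x)"

text \<open>Conjugation by \<open>lift a\<close>: \<open>g\<close> acts on the root \<open>0\<close> and on the letters above \<open>a\<close>.\<close>

definition shift :: "nat \<Rightarrow> (nat \<Rightarrow> nat) \<Rightarrow> nat \<Rightarrow> nat" where
  "shift a g y = (if 0 < y \<and> y \<le> a then y else lift a (g (y - a)))"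

text \<open>Both gluing operations on decorations are this product of two permutations that only share
  the point \<open>0\<close>: multiplying two cycles through a common point concatenates them there, which
  is the rule for root cycles, and a permutation of \<open>{1..a}\<close> is one of \<open>{0..a}\<close> that fixes \<open>0\<close>.
  Hence all that follows is proved once for \<open>star\<close>.\<close>

definition star :: "nat \<Rightarrow> (nat \<Rightarrow> nat) \<Rightarrow> (nat \<Rightarrow> nat) \<Rightarrow> nat \<Rightarrow> nat" where
  "star a f g = shift a g \<circ> f"

text \<open>No letter above \<open>a\<close> is followed by a nonroot letter up to \<open>a\<close>.\<close>

definition splits :: "nat \<Rightarrow> (nat \<Rightarrow> nat) \<Rightarrow> bool" where
  "splits a f \<longleftrightarrow> (\<forall>x>a. f x = 0 \<or> a < f x)"

lemma lift_simps [simp]: "lift a 0 = 0" "lift a x = 0 \<longleftrightarrow> x = 0" "lift a x - a = x"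
    "x \<noteq> 0 \<Longrightarrow> lift a x = a + x" "lift a x = lift a y \<longleftrightarrow> x = y"
  by (auto simp: lift_def)

lemma lift_lift [simp]: "lift a (lift b x) = lift (a + b) x"
  by (simp add: lift_def)

lemma lift_not_small: "\<not> (0 < lift a x \<and> lift a x \<le> a)"
  by (auto simp: lift_def)

lemma lift_unlift: "\<not> (0 < y \<and> y \<le> a) \<Longrightarrow> lift a (y - a) = y"
  by (auto simp: lift_def)

lemma shift_large: "\<not> (0 < y \<and> y \<le> a) \<Longrightarrow> shift a g y = lift a (g (y - a))"
  by (simp only: shift_def if_False)

lemma shift_lift [simp]: "shift a g (lift a x) = lift a (g x)"
  by (subst shift_large[OF lift_not_small]) simp

lemma shift_small: "0 < y \<Longrightarrow> y \<le> a \<Longrightarrow> shift a g y = y"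
  by (simp add: shift_def)

lemma shift_comp: "shift a (u \<circ> v) = shift a u \<circ> shift a v"
proof
  fix y show "shift a (u \<circ> v) y = (shift a u \<circ> shift a v) y"
    unfolding comp_apply by (cases "0 < y \<and> y \<le> a") (metis shift_small, metis shift_large shift_lift comp_apply)
qed

lemma shift_shift: "shift a (shift b g) = shift (a + b) g"
proof
  fix y
  consider "0 < y" "y \<le> a" | "\<not> (0 < y \<and> y \<le> a)" "0 < y - a" "y - a \<le> b"
    | "\<not> (0 < y \<and> y \<le> a)" "\<not> (0 < y - a \<and> y - a \<le> b)" by argo
  then show "shift a (shift b g) y = shift (a + b) g y"
  proof cases
    case 3
    then have "\<not> (0 < y \<and> y \<le> a + b)" by auto
    then show ?thesis
      unfolding shift_large[OF 3(1)] shift_large[OF 3(2)] by (subst shift_large) (simp_all add: add.commute)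
  qed (auto simp: shift_def lift_def)
qed

lemma star_assoc: "star a f (star b g h) = star (a + b) (star a f g) h"
  by (simp add: star_def shift_comp shift_shift comp_assoc)

lemma permutes_fixes_above: "f permutes {0..a::nat} \<Longrightarrow> a < x \<Longrightarrow> f x = x"
  by (rule permutes_not_in) auto

lemma permutes_le: "f permutes {0..a::nat} \<Longrightarrow> f x \<le> a \<longleftrightarrow> x \<le> a"
  using permutes_in_image[of f "{0..a}" x] by simp

lemma permutes_from_0: "f permutes {1..a::nat} \<Longrightarrow> f permutes {0..a}"
  by (rule permutes_subset) auto

lemma permutes_from_0_iff: "f permutes {1..a} \<longleftrightarrow> f permutes {0..a::nat} \<and> f 0 = 0"
proof (intro iffI conjI)
  assume f: "f permutes {0..a} \<and> f 0 = 0"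
  show "f permutes {1..a}"
  proof (rule permutes_superset[OF conjunct1[OF f]])
    fix x assume "x \<in> {0..a} - {1..a}"
    then show "f x = x" using f by (cases x) auto
  qed
next
  assume "f permutes {1..a}"
  then show "f permutes {0..a}" by (rule permutes_from_0)
  show "f 0 = 0" using \<open>f permutes {1..a}\<close> by (rule permutes_not_in) simp
qed

lemma lift_le: "lift a x \<le> a + b \<longleftrightarrow> x \<le> b"
  by (auto simp: lift_def)

lemma shift_permutes:
  assumes "g permutes {0..b}"
  shows "shift a g permutes {0..a + b}"
proof (rule inj_imp_permutes)
  have inj: "inj g" using assms by (rule permutes_inj)
  show "inj_on (shift a g) {0..a + b}"
  proof (rule inj_onI)
    fix x y assume eq: "shift a g x = shift a g y"
    show "x = y"
    proof (cases "0 < x \<and> x \<le> a"; cases "0 < y \<and> y \<le> a")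
      assume large: "\<not> (0 < x \<and> x \<le> a)" "\<not> (0 < y \<and> y \<le> a)"
      then have "lift a (g (x - a)) = lift a (g (y - a))" using eq by (metis shift_large)
      then have "g (x - a) = g (y - a)" by (simp only: lift_simps)
      then have "x - a = y - a" by (rule injD[OF inj])
      then show ?thesis using lift_unlift[OF large(1)] lift_unlift[OF large(2)] by metis
    next
      assume *: "0 < x \<and> x \<le> a" "\<not> (0 < y \<and> y \<le> a)"
      then have "x = lift a (g (y - a))" using eq by (metis shift_small shift_large)
      then show ?thesis using * lift_not_small by metis
    next
      assume *: "\<not> (0 < x \<and> x \<le> a)" "0 < y \<and> y \<le> a"
      then have "y = lift a (g (x - a))" using eq by (metis shift_small shift_large)
      then show ?thesis using * lift_not_small by metis
    qed (use eq in \<open>simp add: shift_def\<close>)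
  qed
  show "finite {0..a + b}" by simp
  fix x assume x: "x \<in> {0..a + b}"
  then have "g (x - a) \<le> b" using permutes_le[OF assms, of "x - a"] by auto
  then have "lift a (g (x - a)) \<in> {0..a + b}" using lift_le by simp
  then show "shift a g x \<in> {0..a + b}" using x by (cases "0 < x \<and> x \<le> a") (auto simp: shift_def)
next
  fix x assume "x \<notin> {0..a + b}"
  then have "g (x - a) = x - a" "a < x" using permutes_fixes_above[OF assms, of "x - a"] by auto
  then show "shift a g x = x" by (simp add: shift_large)
qed

lemma star_permutes:
  assumes "f permutes {0..a}" "g permutes {0..b}"
  shows "star a f g permutes {0..a + b}"
  unfolding star_def
  by (rule permutes_compose[OF permutes_subset[OF assms(1)] shift_permutes[OF assms(2)]]) auto

lemma star_large:
  assumes "f permutes {0..a}" "a < x"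
  shows "star a f g x = lift a (g (x - a))"
  using permutes_fixes_above[OF assms] assms(2) by (simp add: star_def shift_def)

lemma star_splits:
  assumes "f permutes {0..a}"
  shows "splits a (star a f g)"
  using lift_not_small by (auto simp: splits_def star_large[OF assms] lift_def)

lemma star_splits_beyond:
  assumes "f permutes {0..a}"
  shows "splits (a + c) (star a f g) \<longleftrightarrow> splits c g"
proof
  assume L: "splits (a + c) (star a f g)"
  show "splits c g" unfolding splits_def
  proof (intro allI impI)
    fix x assume "c < x"
    then have "star a f g (a + x) = 0 \<or> a + c < star a f g (a + x)"
      using L by (auto simp: splits_def)
    then show "g x = 0 \<or> c < g x" using \<open>c < x\<close> star_large[OF assms, of "a + x" g] by (auto simp: lift_def split: if_splits)
  qed
next
  assume R: "splits c g"
  show "splits (a + c) (star a f g)" unfolding splits_def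
  proof (intro allI impI)
    fix x assume x: "a + c < x"
    then have "g (x - a) = 0 \<or> c < g (x - a)" using R by (auto simp: splits_def)
    then show "star a f g x = 0 \<or> a + c < star a f g x" using x star_large[OF assms, of x g] by (auto simp: lift_def)
  qed
qed

lemma star_injective:
  assumes f: "f permutes {0..a}" "f' permutes {0..a}" and eq: "star a f g = star a f' g'"
  shows "f = f'" "g = g'"
proof -
  \<comment> \<open>a nonroot value up to \<open>a\<close> of the product is a value of the first factor\<close>
  have val: "f x = (if 0 < star a f g x \<and> star a f g x \<le> a then star a f g x else 0)"
    if "f permutes {0..a}" "x \<le> a" for f g x
  proof (cases "f x = 0")
    case True
    then show ?thesis using lift_not_small[of a "g 0"] by (auto simp: star_def shift_def)
  next
    case False
    then show ?thesis using permutes_le[OF that(1), of x] that(2) by (auto simp: star_def shift_small)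
  qed
  show ff: "f = f'"
  proof
    fix x show "f x = f' x"
      using val[OF f(1), of x g] val[OF f(2), of x g'] eq permutes_fixes_above[OF f(1)] permutes_fixes_above[OF f(2)]
      by (cases "x \<le> a") auto
  qed
  have "shift a g = shift a g'"
  proof
    fix y obtain x where "f x = y" using permutes_surj[OF f(1)] by (metis surjD)
    then show "shift a g y = shift a g' y" using fun_cong[OF eq, of x] ff unfolding star_def by auto
  qed
  then have "lift a (g x) = lift a (g' x)" for x by (metis shift_lift)
  then show "g = g'" by auto
qed

text \<open>The first factor is forced to agree with \<open>p\<close> where \<open>p\<close> takes a nonroot value up to \<open>a\<close>;
  on the one remaining point of \<open>{0..a}\<close> its value is the root.\<close>

lemma star_surjective:
  assumes p: "p permutes {0..a + b}" and spl: "splits a p"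
  obtains f g where "f permutes {0..a}" "g permutes {0..b}" "p = star a f g"
proof -
  define f where "f x = (if x \<le> a then (if 0 < p x \<and> p x \<le> a then p x else 0) else x)" for x
  have hit: "\<exists>x\<le>a. f x = y" if y: "0 < y" "y \<le> a" for y
  proof -
    obtain x where x: "p x = y" using permutes_surj[OF p] by (metis surjD)
    have "x \<le> a" using spl y x unfolding splits_def by (metis leI not_gr0 not_le)
    then show ?thesis using x y by (auto simp: f_def)
  qed
  have zero: "\<exists>x\<le>a. f x = 0"
  proof (rule ccontr)
    assume no: "\<not> (\<exists>x\<le>a. f x = 0)"
    have "p ` {0..a} \<subseteq> {1..a}"
    proof (rule image_subsetI)
      fix x assume x: "x \<in> {0..a}"
      then have "f x \<noteq> 0" using no by simp
      then show "p x \<in> {1..a}" using x unfolding f_def by (cases "0 < p x \<and> p x \<le> a") auto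
    qed
    then have "card (p ` {0..a}) \<le> card {1..a}" by (rule card_mono[rotated]) simp
    then show False using permutes_inj_on[OF p, of "{0..a}"] by (simp add: card_image)
  qed
  have fle: "f ` {0..a} \<subseteq> {0..a}" by (auto simp: f_def)
  have "{0..a} \<subseteq> f ` {0..a}"
  proof
    fix y assume "y \<in> {0..a}"
    then have "\<exists>x\<le>a. f x = y" using hit[of y] zero by (cases "y = 0") auto
    then show "y \<in> f ` {0..a}" by auto
  qed
  then have im: "f ` {0..a} = {0..a}" using fle by blast
  then have "inj_on f {0..a}" using finite_surj_inj[of "{0..a}" f] by simp
  then have f: "f permutes {0..a}"
    using im by (intro bij_imp_permutes) (auto simp: bij_betw_def f_def)
  define h where "h = p \<circ> inv f"
  have finv: "inv f permutes {0..a}" using f by (rule permutes_inv)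
  have h: "h permutes {0..a + b}" unfolding h_def
    by (rule permutes_compose[OF permutes_subset[OF finv] p]) auto
  have hsmall: "h y = y" if y: "0 < y" "y \<le> a" for y
  proof -
    obtain x where x: "x \<le> a" "f x = y" using hit[OF y] by blast
    then have "p x = y" using y by (auto simp: f_def split: if_splits)
    moreover have "inv f y = x" using x f by (metis permutes_inverses(2))
    ultimately show ?thesis by (simp add: h_def)
  qed
  have hlarge: "\<not> (0 < h y \<and> h y \<le> a)" if "\<not> (0 < y \<and> y \<le> a)" for y
    using that hsmall[of "h y"] permutes_inj[OF h] by (metis injD)
  define g where "g u = h (lift a u) - a" for u
  have sg: "shift a g = h"
  proof
    fix y show "shift a g y = h y"
    proof (cases "0 < y \<and> y \<le> a")
      case False
      have "g (y - a) = h y - a" by (simp only: g_def lift_unlift[OF False])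
      then have "shift a g y = lift a (h y - a)" using shift_large[OF False, of g] by metis
      then show ?thesis using lift_unlift[OF hlarge[OF False]] by simp
    qed (simp add: shift_small hsmall)
  qed
  have "g permutes {0..b}"
  proof (rule inj_imp_permutes)
    show "inj_on g {0..b}"
    proof (rule inj_onI)
      fix u v assume "g u = g v"
      then have "lift a (g u) = lift a (g v)" by simp
      then have "h (lift a u) = h (lift a v)"
        unfolding g_def using lift_unlift[OF hlarge[OF lift_not_small]] by metis
      then have "lift a u = lift a v" by (rule injD[OF permutes_inj[OF h]])
      then show "u = v" by simp
    qed
    fix u assume "u \<in> {0..b}"
    then have "h (lift a u) \<le> a + b" using permutes_le[OF h] lift_le by simp
    then show "g u \<in> {0..b}" by (auto simp: g_def)
  next
    fix u assume "u \<notin> {0..b}"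
    then have "lift a u = a + u" "h (a + u) = a + u" using permutes_fixes_above[OF h] by auto
    then show "g u = u" by (simp add: g_def)
  qed simp
  moreover have "p = star a f g" unfolding star_def sg h_def
    using permutes_inv_o(2)[OF f] by (simp add: comp_assoc)
  ultimately show ?thesis using that f by blast
qed

section \<open>The gluing operations on decorations\<close>

lemma perm_oplus_eq_star:
  assumes "f permutes {1..a}" "g permutes {1..b}"
  shows "perm_oplus a b f g = star a f g"
proof
  fix x
  have f0: "f permutes {0..a}" "f 0 = 0" and g0: "g permutes {0..b}" "g 0 = 0"
    using assms permutes_from_0_iff by auto
  show "perm_oplus a b f g x = star a f g x"
  proof (cases "x \<le> a")
    case True
    then have "f x \<le> a" using permutes_le[OF f0(1)] by blast
    then show ?thesis using True g0(2) by (auto simp: perm_oplus_def star_def shift_def)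
  next
    case False
    have "g (x - a) \<noteq> 0" using False permutes_inj[OF g0(1)] g0(2) by (metis diff_is_0_eq injD)
    moreover have "x - a > b \<Longrightarrow> g (x - a) = x - a" using permutes_fixes_above[OF g0(1)] by blast
    ultimately show ?thesis using False star_large[OF f0(1), of x g] by (auto simp: perm_oplus_def)
  qed
qed

lemma cycle_of_list_append:
  assumes "distinct (x # as @ bs)"
  shows "cycle_of_list (x # as @ bs) = cycle_of_list (x # bs) \<circ> cycle_of_list (x # as)"
  using assms
proof (induction as arbitrary: x)
  case (Cons j as)
  have "transpose x j \<circ> cycle_of_list (j # bs) \<circ> inv (transpose x j) = cycle_of_list (map (transpose x j) (j # bs))"
    by (rule conjugation_of_cycle) (use Cons.prems in auto)
  moreover have "map (transpose x j) bs = bs"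
    using Cons.prems by (intro map_idI) (auto simp: transpose_eq_iff)
  ultimately have conj: "transpose x j \<circ> cycle_of_list (j # bs) = cycle_of_list (x # bs) \<circ> transpose x j"
    by (simp add: fun_eq_iff) (metis comp_apply inv_swap_id transpose_involutory)
  have "cycle_of_list (x # (j # as) @ bs) = transpose x j \<circ> cycle_of_list (j # as @ bs)" by simp
  also have "\<dots> = transpose x j \<circ> (cycle_of_list (j # bs) \<circ> cycle_of_list (j # as))"
    using Cons.prems by (subst Cons.IH) auto
  also have "\<dots> = cycle_of_list (x # bs) \<circ> transpose x j \<circ> cycle_of_list (j # as)"
    by (simp only: comp_assoc[symmetric] conj)
  finally show ?case by (simp add: comp_assoc)
qed simp

lemma cycle_of_list_map:
  assumes "distinct cs" "inj f" "c \<in> set cs"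
  shows "cycle_of_list (map f cs) (f c) = f (cycle_of_list cs c)"
proof -
  have "map (cycle_of_list (map f cs)) (map f cs) = rotate 1 (map f cs)"
    using cyclic_rotation[of "map f cs" 1] assms by (simp add: distinct_map inj_on_def inj_def)
  also have "\<dots> = map f (map (cycle_of_list cs) cs)"
    using cyclic_rotation[OF assms(1), of 1] by (simp add: rotate1_map)
  finally show ?thesis using assms(3) by (simp add: map_eq_conv)
qed

lemma card_orbit_0:
  assumes "permutation p"
  shows "card (orbit p x) = least_power p x" "set (support p x) = orbit p x"
proof -
  show s: "set (support p x) = orbit p x"
    unfolding support_set[OF assms] orbit_altdef_permutation[OF assms] by auto
  have "card (set (support p x)) = least_power p x"
    using distinct_card[OF cycle_of_permutation[OF assms]] by simp
  then show "card (orbit p x) = least_power p x" using s by simp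
qed

lemma root_word_support:
  assumes "permutation p"
  shows "support p 0 = 0 # root_word p"
  using least_power_of_permutation(2)[OF assms, of 0]
  by (simp add: root_word_def card_orbit_0(1)[OF assms] upt_conv_Cons)

lemma orbit_closed:
  assumes "permutation p"
  shows "p y \<in> orbit p x \<longleftrightarrow> y \<in> orbit p x"
  using assms by (metis orbit.step orbit_trans permutation_orbit_step permutation_self_in_orbit)

lemma rooted_star_eq_star:
  assumes f: "f permutes {0..a}" and g: "g permutes {0..b}"
  shows "rooted_star a b f g = star a f g"
proof
  fix x
  have pf: "permutation f" and pg: "permutation g"
    using f g permutes_imp_permutation by blast+
  define as where "as = root_word f"
  define bs where "bs = map ((+) a) (root_word g)"
  have sf: "0 # as = support f 0" and sg: "0 # root_word g = support g 0"
    using root_word_support pf pg by (auto simp: as_def)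
  have mlift: "0 # bs = map (lift a) (0 # root_word g)"
  proof -
    have "0 \<notin> set (root_word g)" using cycle_of_permutation[OF pg, of 0] sg by (metis distinct.simps(2))
    then show ?thesis by (auto simp: bs_def lift_def)
  qed
  have da: "distinct (0 # as)" unfolding sf by (rule cycle_of_permutation[OF pf])
  have dg: "distinct (0 # root_word g)" unfolding sg by (rule cycle_of_permutation[OF pg])
  have db: "distinct (0 # bs)" unfolding mlift using dg by (subst distinct_map) (auto simp: inj_on_def)
  have seta: "set (0 # as) = orbit f 0" unfolding sf using card_orbit_0(2)[OF pf] .
  have setg: "set (0 # root_word g) = orbit g 0" unfolding sg using card_orbit_0(2)[OF pg] .
  have setb: "set (0 # bs) = lift a ` orbit g 0" unfolding mlift set_map setg ..
  have ale: "y \<le> a" if "y \<in> orbit f 0" for y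
    using that permutes_orbit_subset[OF f, of 0] by auto
  have bgt: "a < y" if y: "y \<in> set bs" for y
  proof -
    obtain u where u: "u \<in> set (root_word g)" "y = a + u" using y by (auto simp: bs_def)
    then show ?thesis using dg by (cases "u = 0") auto
  qed
  have "set as \<inter> set bs = {}"
  proof (rule ccontr)
    assume "set as \<inter> set bs \<noteq> {}"
    then obtain y where y: "y \<in> set as" "y \<in> set bs" by blast
    then have "y \<in> orbit f 0" unfolding seta[symmetric] by simp
    then show False using ale bgt[OF y(2)] by fastforce
  qed
  then have disj: "distinct (0 # as @ bs)" using da db by simp
  have cf: "cycle_of_list (0 # as) y = (if y \<in> orbit f 0 then f y else y)" for y
    using cycle_restrict[OF pf, of y 0] id_outside_supp[of y "0 # as"] seta unfolding sf by auto
  have cg: "cycle_of_list (0 # bs) (lift a y) = (if y \<in> orbit g 0 then lift a (g y) else lift a y)" for y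
  proof (cases "y \<in> orbit g 0")
    case True
    have "cycle_of_list (0 # bs) (lift a y) = lift a (cycle_of_list (0 # root_word g) y)"
      unfolding mlift by (rule cycle_of_list_map) (use dg setg True in \<open>auto simp: inj_def\<close>)
    then show ?thesis using cycle_restrict[OF pg, of y 0] True setg unfolding sg by auto
  next
    case False
    then have "lift a y \<notin> set (0 # bs)" unfolding setb by auto
    then show ?thesis using id_outside_supp False by metis
  qed
  have rdef: "rooted_star a b f g x = (if x \<in> set (0 # as @ bs) then cycle_of_list (0 # as @ bs) x
      else if x \<le> a then f x else if x \<le> a + b then a + g (x - a) else x)"
    by (simp add: rooted_star_def as_def bs_def Let_def)
  show "rooted_star a b f g x = star a f g x"
  proof (cases "x \<in> set (0 # as @ bs)")
    case True
    then have r: "rooted_star a b f g x = cycle_of_list (0 # bs) (cycle_of_list (0 # as) x)"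
      unfolding rdef cycle_of_list_append[OF disj] by simp
    show ?thesis
    proof (cases "x \<in> orbit f 0")
      case x: True
      then have fx: "f x \<in> orbit f 0" using orbit_closed[OF pf] by blast
      show ?thesis
      proof (cases "f x = 0")
        case True
        have "cycle_of_list (0 # bs) 0 = lift a (g 0)"
          using cg[of 0] permutation_self_in_orbit[OF pg, of 0] by simp
        then show ?thesis using x True r by (simp add: cf star_def shift_def)
      next
        case False
        then have "f x \<notin> set (0 # bs)" using ale[OF fx] bgt by fastforce
        then have "cycle_of_list (0 # bs) (f x) = f x" by (rule id_outside_supp)
        then show ?thesis using x False r ale[OF fx] by (simp add: cf star_def shift_small)
      qed
    next
      case x: False
      then have "x \<in> set bs" using True seta by auto
      then obtain y where y: "y \<in> orbit g 0" "x = lift a y" using setb by (metis imageE list.set_intros(2))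
      have "a < x" using bgt \<open>x \<in> set bs\<close> by blast
      have "rooted_star a b f g x = lift a (g y)" using r x y cg by (simp add: cf)
      then show ?thesis using star_large[OF f \<open>a < x\<close>, of g] y(2) by simp
    qed
  next
    case False
    then have xf: "x \<notin> orbit f 0" and xb: "x \<notin> set (0 # bs)" unfolding seta[symmetric] by auto
    show ?thesis
    proof (cases "x \<le> a")
      case True
      have "f x \<notin> orbit f 0" using xf orbit_closed[OF pf] by blast
      then have "f x \<noteq> 0" using permutation_self_in_orbit[OF pf, of 0] by metis
      then show ?thesis using False True permutes_le[OF f, of x] unfolding rdef
        by (simp add: star_def shift_small)
    next
      case large: False
      then have "x - a \<notin> orbit g 0" using xb setb by (metis image_eqI le_eq_less_or_eq lift_unlift)
      then have "g (x - a) \<notin> orbit g 0" using orbit_closed[OF pg] by blast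
      then have "g (x - a) \<noteq> 0" using permutation_self_in_orbit[OF pg, of 0] by metis
      then show ?thesis using False large star_large[OF f, of x g] permutes_fixes_above[OF g, of "x - a"]
        unfolding rdef by auto
    qed
  qed
qed

section \<open>Counting cycles\<close>

definition invariant :: "('a \<Rightarrow> 'a) \<Rightarrow> 'a set \<Rightarrow> bool" where
  "invariant f Y \<longleftrightarrow> (\<forall>x. f x \<in> Y \<longleftrightarrow> x \<in> Y)"

text \<open>Invariant sets are the unions of cycles, so they count the cycles; they are easier to
  follow through a product of permutations than the cycles themselves.\<close>

lemma card_invariant_sets:
  assumes A: "finite A" and f: "f permutes A"
  shows "card {Y. Y \<subseteq> A \<and> invariant f Y} = 2 ^ cycle_count A f"
proof -
  have pf: "permutation f" using assms permutes_imp_permutation by blast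
  have same: "orbit f x = orbit f y" if "x \<in> orbit f y" for x y
    using that orbit_cyclic_eq3[OF cyclic_on_orbit[OF f A]] by blast
  have "bij_betw Union (Pow (orbit f ` A)) {Y. Y \<subseteq> A \<and> invariant f Y}"
  proof (rule bij_betw_imageI)
    have sub: "U \<subseteq> V" if U: "U \<subseteq> orbit f ` A" "V \<subseteq> orbit f ` A" and eq: "\<Union>U = \<Union>V" for U V
    proof
      fix C assume C: "C \<in> U"
      then obtain x where x: "C = orbit f x" using U by blast
      have "x \<in> \<Union>V" using C x permutation_self_in_orbit[OF pf] eq by blast
      then obtain y where y: "x \<in> orbit f y" "orbit f y \<in> V" using U(2) by blast
      then show "C \<in> V" using same x by metis
    qed
    show "inj_on Union (Pow (orbit f ` A))"
      by (rule inj_onI) (use sub in \<open>metis PowD subset_antisym\<close>)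
    show "Union ` Pow (orbit f ` A) = {Y. Y \<subseteq> A \<and> invariant f Y}"
    proof (intro subset_antisym subsetI)
      fix Y assume "Y \<in> Union ` Pow (orbit f ` A)"
      then obtain U where U: "U \<subseteq> orbit f ` A" "Y = \<Union>U" by blast
      have "Y \<subseteq> A" using U permutes_orbit_subset[OF f] by blast
      moreover have "invariant f Y" unfolding invariant_def U(2) using U(1) orbit_closed[OF pf] by blast
      ultimately show "Y \<in> {Y. Y \<subseteq> A \<and> invariant f Y}" by blast
    next
      fix Y assume Y: "Y \<in> {Y. Y \<subseteq> A \<and> invariant f Y}"
      have "orbit f x \<subseteq> Y" if "x \<in> Y" for x
      proof
        fix y assume "y \<in> orbit f x"
        then show "y \<in> Y" using that Y by induct (auto simp: invariant_def)
      qed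
      then have "Y = \<Union>(orbit f ` Y)" using permutation_self_in_orbit[OF pf] by blast
      then show "Y \<in> Union ` Pow (orbit f ` A)" using Y by blast
    qed
  qed
  from bij_betw_same_card[OF this] show ?thesis
    using A by (simp add: card_Pow cycle_count_def)
qed

lemma cycle_count_le: "finite A \<Longrightarrow> cycle_count A f \<le> card A"
  unfolding cycle_count_def by (rule card_image_le)

lemma cycle_count_insert:
  assumes A: "finite A" "a \<notin> A" and w: "w permutes A" and b: "b \<in> insert a A"
  shows "cycle_count (insert a A) (transpose a b \<circ> w) = (if b = a then Suc (cycle_count A w) else cycle_count A w)"
proof -
  have wa: "w x = a \<longleftrightarrow> x = a" for x
    using permutes_not_in[OF w A(2)] inj_eq[OF permutes_inj[OF w], of x a] by simp
  have p: "transpose a b \<circ> w permutes insert a A"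
    by (rule permutes_compose[OF permutes_subset[OF w] permutes_swap_id]) (use b in auto)
  have ins: "invariant w (insert a Z) \<longleftrightarrow> invariant w Z" "invariant w (Z - {a}) \<longleftrightarrow> invariant w Z"
    for Z
  proof -
    have "w x \<in> insert a Z \<longleftrightarrow> x \<in> insert a Z" if "w x \<in> Z \<longleftrightarrow> x \<in> Z" for x using that wa[of x] by simp
    moreover have "w x \<in> Z \<longleftrightarrow> x \<in> Z" if "w x \<in> insert a Z \<longleftrightarrow> x \<in> insert a Z" for x
      using that wa[of x] wa[of a] by (cases "x = a") simp_all
    moreover have "(w x \<in> Z - {a} \<longleftrightarrow> x \<in> Z - {a}) \<longleftrightarrow> (w x \<in> Z \<longleftrightarrow> x \<in> Z)" for x
      using wa[of x] wa[of a] by (cases "x = a") simp_all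
    ultimately show "invariant w (insert a Z) \<longleftrightarrow> invariant w Z" "invariant w (Z - {a}) \<longleftrightarrow> invariant w Z"
      unfolding invariant_def by metis+
  qed
  have "(2::nat) ^ cycle_count (insert a A) (transpose a b \<circ> w)
      = 2 ^ (if b = a then Suc (cycle_count A w) else cycle_count A w)"
  proof (cases "b = a")
    case True
    let ?I = "{Y. Y \<subseteq> A \<and> invariant w Y}"
    have "{Y. Y \<subseteq> insert a A \<and> invariant w Y} = ?I \<union> insert a ` ?I"
    proof (intro subset_antisym subsetI)
      fix Y assume Y: "Y \<in> {Y. Y \<subseteq> insert a A \<and> invariant w Y}"
      show "Y \<in> ?I \<union> insert a ` ?I"
      proof (cases "a \<in> Y")
        case True
        then have "Y = insert a (Y - {a})" by blast
        moreover have "Y - {a} \<in> ?I" using Y ins(2) by blast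
        ultimately show ?thesis by blast
      qed (use Y in blast)
    qed (use ins in auto)
    moreover have "card (insert a ` ?I) = card ?I"
      by (rule card_image) (use A(2) in \<open>auto intro!: inj_onI\<close>)
    moreover have "?I \<inter> insert a ` ?I = {}" using A(2) by auto
    moreover have "finite ?I" using A(1) by simp
    ultimately have "card {Y. Y \<subseteq> insert a A \<and> invariant w Y} = 2 * card ?I"
      by (simp add: card_Un_disjoint)
    then show ?thesis using card_invariant_sets[of "insert a A", OF _ p] card_invariant_sets[OF A(1) w] A(1) True
      by simp
  next
    case False
    then have bA: "b \<in> A" using b by blast
    have inv: "invariant (transpose a b \<circ> w) Y \<longleftrightarrow> invariant w Y \<and> (a \<in> Y \<longleftrightarrow> b \<in> Y)" for Y
    proof
      assume L: "invariant (transpose a b \<circ> w) Y"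
      have ab: "a \<in> Y \<longleftrightarrow> b \<in> Y" using L[unfolded invariant_def, rule_format, of a] wa[of a] by simp
      then have "transpose a b z \<in> Y \<longleftrightarrow> z \<in> Y" for z by (simp add: transpose_def)
      then show "invariant w Y \<and> (a \<in> Y \<longleftrightarrow> b \<in> Y)" using L ab by (simp add: invariant_def)
    next
      assume R: "invariant w Y \<and> (a \<in> Y \<longleftrightarrow> b \<in> Y)"
      then have "transpose a b z \<in> Y \<longleftrightarrow> z \<in> Y" for z by (simp add: transpose_def)
      then show "invariant (transpose a b \<circ> w) Y" using R by (simp add: invariant_def)
    qed
    have "bij_betw (\<lambda>Z. if b \<in> Z then insert a Z else Z) {Y. Y \<subseteq> A \<and> invariant w Y}
        {Y. Y \<subseteq> insert a A \<and> invariant (transpose a b \<circ> w) Y}"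
    proof (rule bij_betw_byWitness[where f' = "\<lambda>Y. Y - {a}"])
      show "\<forall>Y\<in>{Y. Y \<subseteq> A \<and> invariant w Y}. (if b \<in> Y then insert a Y else Y) - {a} = Y"
        using A(2) by auto
      show "\<forall>Y\<in>{Y. Y \<subseteq> insert a A \<and> invariant (transpose a b \<circ> w) Y}.
          (if b \<in> Y - {a} then insert a (Y - {a}) else Y - {a}) = Y"
        using False by (auto simp: inv)
      show "(\<lambda>Z. if b \<in> Z then insert a Z else Z) ` {Y. Y \<subseteq> A \<and> invariant w Y}
          \<subseteq> {Y. Y \<subseteq> insert a A \<and> invariant (transpose a b \<circ> w) Y}"
        using A(2) by (auto simp: inv ins)
      show "(\<lambda>Y. Y - {a}) ` {Y. Y \<subseteq> insert a A \<and> invariant (transpose a b \<circ> w) Y}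
          \<subseteq> {Y. Y \<subseteq> A \<and> invariant w Y}" by (auto simp: inv ins)
    qed
    from bij_betw_same_card[OF this] show ?thesis
      using card_invariant_sets[of "insert a A", OF _ p] card_invariant_sets[OF A(1) w] A(1) False by simp
  qed
  then show ?thesis by (rule power_inject_exp[THEN iffD1, rotated]) simp
qed

text \<open>The generating function of permutations by number of cycles: a new letter \<open>a\<close> is either
  a fixed point or is inserted after one of the others.\<close>

lemma sum_permutations_cycle_count:
  fixes x y :: "'r::comm_semiring_1"
  assumes "finite A"
  shows "(\<Sum>w | w permutes A. x ^ cycle_count A w * y ^ (card A - cycle_count A w))
    = (\<Prod>j<card A. x + of_nat j * y)"
  using assms
proof (induction A)
  case empty
  then show ?case by (simp add: cycle_count_def)
next
  case (insert a A)
  let ?g = "\<lambda>w. x ^ cycle_count A w * y ^ (card A - cycle_count A w)"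
  let ?h = "\<lambda>w. x ^ cycle_count (insert a A) w * y ^ (card (insert a A) - cycle_count (insert a A) w)"
  have "(\<Sum>w | w permutes insert a A. ?h w)
      = (\<Sum>b\<in>insert a A. \<Sum>w | w permutes A. ?h (transpose a b \<circ> w))"
    by (rule sum_over_permutations_insert[OF insert.hyps])
  also have "\<dots> = (\<Sum>w | w permutes A. ?h (transpose a a \<circ> w)) + (\<Sum>b\<in>A. \<Sum>w | w permutes A. ?h (transpose a b \<circ> w))"
    by (rule sum.insert[OF insert.hyps])
  also have "(\<Sum>w | w permutes A. ?h (transpose a a \<circ> w)) = (\<Sum>w | w permutes A. x * ?g w)"
  proof (rule sum.cong[OF refl])
    fix w assume "w \<in> {w. w permutes A}"
    then have "cycle_count (insert a A) (transpose a a \<circ> w) = Suc (cycle_count A w)"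
      using cycle_count_insert[OF insert.hyps, of w a] by simp
    then show "?h (transpose a a \<circ> w) = x * ?g w"
      using insert.hyps by (simp add: mult.assoc)
  qed
  also have "(\<Sum>b\<in>A. \<Sum>w | w permutes A. ?h (transpose a b \<circ> w)) = (\<Sum>b\<in>A. \<Sum>w | w permutes A. y * ?g w)"
  proof (intro sum.cong[OF refl])
    fix b w assume b: "b \<in> A" and "w \<in> {w. w permutes A}"
    then have "cycle_count (insert a A) (transpose a b \<circ> w) = cycle_count A w"
      using cycle_count_insert[OF insert.hyps, of w b] insert.hyps(2) by auto
    then show "?h (transpose a b \<circ> w) = y * ?g w"
      using insert.hyps cycle_count_le[OF insert.hyps(1), of w] by (simp add: Suc_diff_le mult.left_commute)
  qed
  also have "(\<Sum>w | w permutes A. x * ?g w) + (\<Sum>b\<in>A. \<Sum>w | w permutes A. y * ?g w)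
      = (x + of_nat (card A) * y) * (\<Prod>j<card A. x + of_nat j * y)"
    unfolding insert.IH[symmetric] by (simp add: sum_distrib_left distrib_right mult.assoc sum.distrib)
  finally show ?case using insert.hyps by (simp add: mult.commute)
qed

lemma cycle_count_pos:
  assumes "finite A" "A \<noteq> {}"
  shows "0 < cycle_count A f"
  using assms by (auto simp: cycle_count_def card_gt_0_iff)

lemma cycle_count_from_0:
  assumes "f permutes {1..a::nat}"
  shows "cycle_count {0..a} f = Suc (cycle_count {1..a} f)"
proof -
  have f0: "f 0 = 0" using assms permutes_from_0_iff by blast
  have "orbit f ` {0..a} = insert {0} (orbit f ` {1..a})"
  proof -
    have "{0..a} = insert 0 {1..a}" by auto
    moreover have "orbit f 0 = {0}" using orbit_eq_singleton_iff f0 by metis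
    ultimately show ?thesis by auto
  qed
  moreover have "{0} \<notin> orbit f ` {1..a}"
  proof
    assume "{0} \<in> orbit f ` {1..a}"
    then obtain x where "x \<in> {1..a}" "orbit f x = {0}" by force
    then show False using permutes_orbit_subset[OF assms, of x] by simp
  qed
  ultimately show ?thesis by (simp add: cycle_count_def)
qed

lemma invariant_last_point:
  assumes A: "finite A" and f: "f permutes A" and z: "z \<in> A"
    and rest: "\<And>x. x \<in> A \<Longrightarrow> x \<noteq> z \<Longrightarrow> f x \<in> Y \<longleftrightarrow> x \<in> Y"
  shows "f z \<in> Y \<longleftrightarrow> z \<in> Y"
proof -
  let ?c = "\<lambda>x. if x \<in> Y then 1 else (0::nat)"
  have "(\<Sum>x\<in>A. ?c (f x)) = (\<Sum>x\<in>A. ?c x)"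
    using sum.permute[OF f, of ?c] by (simp add: comp_def)
  moreover have "(\<Sum>x\<in>A. ?c (f x)) = ?c (f z) + (\<Sum>x\<in>A - {z}. ?c (f x))"
    "(\<Sum>x\<in>A. ?c x) = ?c z + (\<Sum>x\<in>A - {z}. ?c x)"
    using A z by (simp_all add: sum.remove)
  moreover have "(\<Sum>x\<in>A - {z}. ?c (f x)) = (\<Sum>x\<in>A - {z}. ?c x)"
    using rest by (intro sum.cong) auto
  ultimately have "?c (f z) = ?c z" by linarith
  then show ?thesis by (simp split: if_splits)
qed

lemma invariant_star:
  assumes f: "f permutes {0..a}"
  shows "invariant (star a f g) Y \<longleftrightarrow> invariant f Y \<and> invariant (shift a g) Y"
proof
  assume L: "invariant (star a f g) Y"
  have rest: "f x \<in> Y \<longleftrightarrow> x \<in> Y" if "f x \<noteq> 0" "x \<le> a" for x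
    using L[unfolded invariant_def, rule_format, of x] that permutes_le[OF f, of x]
    by (simp add: star_def shift_small)
  obtain z where z: "f z = 0" using permutes_surj[OF f] by (metis surjD)
  have za: "z \<le> a" using permutes_le[OF f, of z] z by simp
  have "f z \<in> Y \<longleftrightarrow> z \<in> Y"
  proof (rule invariant_last_point[OF _ f])
    fix x assume "x \<in> {0..a}" "x \<noteq> z"
    then show "f x \<in> Y \<longleftrightarrow> x \<in> Y" using rest[of x] z inj_eq[OF permutes_inj[OF f], of x z] by simp
  qed (use za in auto)
  then have inv: "f x \<in> Y \<longleftrightarrow> x \<in> Y" for x
    using rest[of x] z inj_eq[OF permutes_inj[OF f], of x z] permutes_fixes_above[OF f, of x]
      \<open>f z \<in> Y \<longleftrightarrow> z \<in> Y\<close> by (cases "x \<le> a"; cases "x = z") simp_all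
  have "shift a g y \<in> Y \<longleftrightarrow> y \<in> Y" for y
  proof -
    obtain x where "f x = y" using permutes_surj[OF f] by (metis surjD)
    then show ?thesis using inv[of x] L[unfolded invariant_def, rule_format, of x] by (simp add: star_def)
  qed
  then show "invariant f Y \<and> invariant (shift a g) Y" using inv by (simp add: invariant_def)
qed (simp add: invariant_def star_def)

lemma invariant_shift: "invariant (shift a g) Y \<longleftrightarrow> invariant g {u. lift a u \<in> Y}"
proof
  assume L: "invariant (shift a g) Y"
  have "lift a (g u) \<in> Y \<longleftrightarrow> lift a u \<in> Y" for u
    using L[unfolded invariant_def, rule_format, of "lift a u"] unfolding shift_lift .
  then show "invariant g {u. lift a u \<in> Y}" unfolding invariant_def mem_Collect_eq by blast
next
  assume R: "invariant g {u. lift a u \<in> Y}"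
  show "invariant (shift a g) Y" unfolding invariant_def
  proof
    fix y show "shift a g y \<in> Y \<longleftrightarrow> y \<in> Y"
    proof (cases "0 < y \<and> y \<le> a")
      case False
      show ?thesis using R[unfolded invariant_def, rule_format, of "y - a"] lift_unlift[OF False]
          shift_large[OF False, of g] by simp
    qed (simp add: shift_small)
  qed
qed

text \<open>Half of the invariant sets contain the root, since complementation exchanges them with
  the others.\<close>

lemma card_invariant_sets_root:
  assumes f: "f permutes {0..a::nat}"
  shows "2 * card {Y. Y \<subseteq> {0..a} \<and> invariant f Y \<and> (0 \<in> Y \<longleftrightarrow> r)} = 2 ^ cycle_count {0..a} f"
proof -
  let ?I = "\<lambda>r. {Y. Y \<subseteq> {0..a} \<and> invariant f Y \<and> (0 \<in> Y \<longleftrightarrow> r)}"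
  have "bij_betw (\<lambda>Y. {0..a} - Y) (?I r) (?I (\<not> r))"
    by (rule bij_betw_byWitness[where f' = "\<lambda>Y. {0..a} - Y"])
      (use permutes_in_image[OF f] in \<open>auto simp: invariant_def\<close>)
  then have "card (?I r) = card (?I (\<not> r))" by (rule bij_betw_same_card)
  moreover have "{Y. Y \<subseteq> {0..a} \<and> invariant f Y} = ?I r \<union> ?I (\<not> r)" by blast
  moreover have "?I r \<inter> ?I (\<not> r) = {}" by blast
  moreover have fin: "finite (?I s)" for s by (rule finite_subset[of _ "Pow {0..a}"]) auto
  ultimately have "card {Y. Y \<subseteq> {0..a} \<and> invariant f Y} = 2 * card (?I r)"
    by (simp add: card_Un_disjoint[OF fin fin])
  then show ?thesis using card_invariant_sets[OF _ f] by simp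
qed

lemma cycle_count_star:
  assumes f: "f permutes {0..a}" and g: "g permutes {0..b}"
  shows "Suc (cycle_count {0..a + b} (star a f g)) = cycle_count {0..a} f + cycle_count {0..b} g"
proof -
  let ?I = "\<lambda>r. {Y. Y \<subseteq> {0..a} \<and> invariant f Y \<and> (0 \<in> Y \<longleftrightarrow> r)}"
  let ?J = "\<lambda>r. {Y. Y \<subseteq> {0..b} \<and> invariant g Y \<and> (0 \<in> Y \<longleftrightarrow> r)}"
  let ?S = "{Y. Y \<subseteq> {0..a + b} \<and> invariant (star a f g) Y}"
  let ?join = "\<lambda>(Y, Z). Y \<union> lift a ` Z"
  have unl: "{u. lift a u \<in> Y \<union> lift a ` Z} = Z" if "0 \<in> Y \<longleftrightarrow> 0 \<in> Z" "Y \<subseteq> {0..a}" for Y Z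
  proof (rule set_eqI)
    fix u show "u \<in> {u. lift a u \<in> Y \<union> lift a ` Z} \<longleftrightarrow> u \<in> Z"
    proof (cases "u = 0")
      case False
      have "lift a u \<in> lift a ` Z \<longleftrightarrow> u \<in> Z" by (simp only: image_iff lift_simps) blast
      moreover have "lift a u \<notin> Y" using that(2) False by (auto simp: lift_def)
      ultimately show ?thesis by blast
    qed (use that in \<open>auto intro: image_eqI[of _ _ 0]\<close>)
  qed
  have low: "(Y \<union> lift a ` Z) \<inter> {0..a} = Y" if "0 \<in> Y \<longleftrightarrow> 0 \<in> Z" "Y \<subseteq> {0..a}" for Y Z
    using that by (auto simp: lift_def split: if_splits)
  have cap: "invariant f (Y \<inter> {0..a}) \<longleftrightarrow> invariant f Y" for Y
    using permutes_le[OF f] permutes_fixes_above[OF f] unfolding invariant_def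
    by (metis IntD1 IntI atLeastAtMost_iff le0 not_le_imp_less)
  have "bij_betw ?join (?I True \<times> ?J True \<union> ?I False \<times> ?J False) ?S"
  proof (rule bij_betw_byWitness[where f' = "\<lambda>Y. (Y \<inter> {0..a}, {u. lift a u \<in> Y})"])
    show "\<forall>p\<in>?I True \<times> ?J True \<union> ?I False \<times> ?J False. (?join p \<inter> {0..a}, {u. lift a u \<in> ?join p}) = p"
    proof
      fix p assume "p \<in> ?I True \<times> ?J True \<union> ?I False \<times> ?J False"
      then obtain Y Z where p: "p = (Y, Z)" "Y \<subseteq> {0..a}" "0 \<in> Y \<longleftrightarrow> 0 \<in> Z" by auto
      show "(?join p \<inter> {0..a}, {u. lift a u \<in> ?join p}) = p"
        unfolding p(1) prod.case low[OF p(3,2)] unl[OF p(3,2)] ..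
    qed
    show "\<forall>Y\<in>?S. ?join (Y \<inter> {0..a}, {u. lift a u \<in> Y}) = Y"
    proof
      fix Y assume Y: "Y \<in> ?S"
      have "y \<in> lift a ` {u. lift a u \<in> Y}" if "y \<in> Y" "\<not> y \<le> a" for y
        using that by (intro image_eqI[of _ _ "y - a"]) (auto simp: lift_def)
      then show "?join (Y \<inter> {0..a}, {u. lift a u \<in> Y}) = Y" by fastforce
    qed
    show "?join ` (?I True \<times> ?J True \<union> ?I False \<times> ?J False) \<subseteq> ?S"
    proof (rule image_subsetI)
      fix p assume "p \<in> ?I True \<times> ?J True \<union> ?I False \<times> ?J False"
      then obtain Y Z where p: "p = (Y, Z)" "Y \<subseteq> {0..a}" "invariant f Y" "Z \<subseteq> {0..b}" "invariant g Z"
        "0 \<in> Y \<longleftrightarrow> 0 \<in> Z" by auto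
      have "invariant f (Y \<union> lift a ` Z)" using cap[of "Y \<union> lift a ` Z"] low p by simp
      moreover have "invariant (shift a g) (Y \<union> lift a ` Z)" unfolding invariant_shift using unl p by simp
      moreover have "Y \<union> lift a ` Z \<subseteq> {0..a + b}"
        using p(2,4) lift_le by (auto simp: subset_iff intro: le_trans)
      ultimately show "?join p \<in> ?S" using invariant_star[OF f] p(1) by simp
    qed
    show "(\<lambda>Y. (Y \<inter> {0..a}, {u. lift a u \<in> Y})) ` ?S \<subseteq> ?I True \<times> ?J True \<union> ?I False \<times> ?J False"
    proof (rule image_subsetI)
      fix Y assume Y: "Y \<in> ?S"
      then have inv: "invariant f Y" "invariant (shift a g) Y" using invariant_star[OF f] by auto
      moreover have "{u. lift a u \<in> Y} \<subseteq> {0..b}" using Y lift_le by auto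
      ultimately show "(Y \<inter> {0..a}, {u. lift a u \<in> Y}) \<in> ?I True \<times> ?J True \<union> ?I False \<times> ?J False"
        using cap invariant_shift by auto
    qed
  qed
  then have "card ?S = card (?I True \<times> ?J True \<union> ?I False \<times> ?J False)"
    by (simp add: bij_betw_same_card)
  also have "\<dots> = card (?I True) * card (?J True) + card (?I False) * card (?J False)"
  proof -
    have fin: "finite (?I s)" "finite (?J s)" for s
      by (simp_all add: finite_subset[of _ "Pow {0..a}"] finite_subset[of _ "Pow {0..b}"])
    have "card (?I True \<times> ?J True \<union> ?I False \<times> ?J False) = card (?I True \<times> ?J True) + card (?I False \<times> ?J False)"
      by (rule card_Un_disjoint) (use fin in auto)
    then show ?thesis by (simp only: card_cartesian_product)
  qed
  finally have "2 * card ?S * 2 = (2 * card (?I True)) * (2 * card (?J True)) + (2 * card (?I False)) * (2 * card (?J False))"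
    by simp
  then have "2 * card ?S * 2 = 2 * (2 ^ cycle_count {0..a} f * 2 ^ cycle_count {0..b} g)"
    unfolding card_invariant_sets_root[OF f] card_invariant_sets_root[OF g] by simp
  moreover have "card ?S = 2 ^ cycle_count {0..a + b} (star a f g)"
    using card_invariant_sets[OF _ star_permutes[OF f g]] by simp
  ultimately have "(2::nat) ^ Suc (cycle_count {0..a + b} (star a f g)) = 2 ^ (cycle_count {0..a} f + cycle_count {0..b} g)"
    by (simp add: power_add)
  then show ?thesis by (rule power_inject_exp[THEN iffD1, rotated]) simp
qed

section \<open>Factorization of decorations\<close>

lemma half_add:
  assumes "even a"
  shows "up_half (a + b) = up_half a + up_half b" "dn_half (a + b) = dn_half a + dn_half b"
  using assms by (auto simp: up_half_def dn_half_def elim!: evenE)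

lemma half_even: "even a \<Longrightarrow> up_half a = dn_half a"
  by (auto simp: up_half_def dn_half_def elim!: evenE)

lemma mem_decorations:
  "\<xi> \<in> decorations m \<longleftrightarrow> fst \<xi> permutes {1..up_half m} \<and> snd \<xi> permutes {0..dn_half m}"
  by (auto simp: decorations_def mem_Times_iff)

lemma finite_decorations [simp]: "finite (decorations m)"
  by (simp add: decorations_def finite_permutations)

lemma diamond_star:
  assumes "\<xi> \<in> decorations a" "\<eta> \<in> decorations b"
  shows "diamond a b \<xi> \<eta> = (star (up_half a) (fst \<xi>) (fst \<eta>), star (dn_half a) (snd \<xi>) (snd \<eta>))"
  using assms by (simp add: diamond_def mem_decorations perm_oplus_eq_star rooted_star_eq_star)

lemma star_permutes_from_1:
  assumes "f permutes {1..a}" "g permutes {1..b}"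
  shows "star a f g permutes {1..a + b}"
proof -
  have f: "f permutes {0..a}" "f 0 = 0" and g: "g permutes {0..b}" "g 0 = 0"
    using assms permutes_from_0_iff by blast+
  then have "star a f g 0 = 0" by (simp add: star_def shift_def)
  then show ?thesis using star_permutes[OF f(1) g(1)] permutes_from_0_iff by blast
qed

lemma diamond_decorations:
  assumes "even a" "\<xi> \<in> decorations a" "\<eta> \<in> decorations b"
  shows "diamond a b \<xi> \<eta> \<in> decorations (a + b)"
  using assms star_permutes_from_1 star_permutes
  by (simp add: diamond_star mem_decorations half_add)

lemma diamond_assoc:
  assumes "even a" "even b" "\<xi> \<in> decorations a" "\<eta> \<in> decorations b" "\<zeta> \<in> decorations c"
  shows "diamond a (b + c) \<xi> (diamond b c \<eta> \<zeta>) = diamond (a + b) c (diamond a b \<xi> \<eta>) \<zeta>"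
proof -
  note 1 = diamond_decorations[OF assms(2,4,5)] and 2 = diamond_decorations[OF assms(1,3,4)]
  show ?thesis
    unfolding diamond_star[OF assms(3) 1] diamond_star[OF 2 assms(5)]
    unfolding diamond_star[OF assms(4,5)] diamond_star[OF assms(3,4)] half_add[OF assms(1)]
    by (simp add: star_assoc)
qed

lemma deg_q_diamond:
  assumes "even a" "\<xi> \<in> decorations a" "\<eta> \<in> decorations b"
  shows "deg_q (a + b) (diamond a b \<xi> \<eta>) = deg_q a \<xi> + deg_q b \<eta>"
    and "deg_t (a + b) (diamond a b \<xi> \<eta>) = deg_t a \<xi> + deg_t b \<eta>"
proof -
  have \<xi>: "fst \<xi> permutes {1..up_half a}" "snd \<xi> permutes {0..dn_half a}"
    and \<eta>: "fst \<eta> permutes {1..up_half b}" "snd \<eta> permutes {0..dn_half b}"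
    using assms by (auto simp: mem_decorations)
  have "cycle_count {1..up_half a + up_half b} (star (up_half a) (fst \<xi>) (fst \<eta>))
      = cycle_count {1..up_half a} (fst \<xi>) + cycle_count {1..up_half b} (fst \<eta>)"
    using cycle_count_star[OF permutes_from_0[OF \<xi>(1)] permutes_from_0[OF \<eta>(1)]]
      cycle_count_from_0[OF \<xi>(1)] cycle_count_from_0[OF \<eta>(1)]
      cycle_count_from_0[OF star_permutes_from_1[OF \<xi>(1) \<eta>(1)]] by simp
  moreover have "Suc (cycle_count {0..dn_half a + dn_half b} (star (dn_half a) (snd \<xi>) (snd \<eta>)))
      = cycle_count {0..dn_half a} (snd \<xi>) + cycle_count {0..dn_half b} (snd \<eta>)"
    by (rule cycle_count_star[OF \<xi>(2) \<eta>(2)])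
  moreover have "cycle_count {1..up_half a} (fst \<xi>) \<le> up_half a" "cycle_count {1..up_half b} (fst \<eta>) \<le> up_half b"
    using cycle_count_le[of "{1..up_half a}" "fst \<xi>"] cycle_count_le[of "{1..up_half b}" "fst \<eta>"] by auto
  moreover have "0 < cycle_count {0..dn_half a} (snd \<xi>)" "0 < cycle_count {0..dn_half b} (snd \<eta>)"
    using cycle_count_pos[of "{0..dn_half a}" "snd \<xi>"] cycle_count_pos[of "{0..dn_half b}" "snd \<eta>"] by auto
  ultimately show "deg_q (a + b) (diamond a b \<xi> \<eta>) = deg_q a \<xi> + deg_q b \<eta>"
    "deg_t (a + b) (diamond a b \<xi> \<eta>) = deg_t a \<xi> + deg_t b \<eta>"
    using assms unfolding diamond_star[OF assms(2,3)]
    by (simp_all add: deg_q_def deg_t_def half_add)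
qed

lemma splits_image_iff:
  assumes f: "f permutes {1..p::nat}" and a: "a \<le> p"
  shows "f ` {1..a} = {1..a} \<longleftrightarrow> splits a f"
proof
  assume L: "f ` {1..a} = {1..a}"
  show "splits a f" unfolding splits_def
  proof (intro allI impI)
    fix x assume x: "a < x"
    show "f x = 0 \<or> a < f x"
    proof (rule ccontr)
      assume "\<not> (f x = 0 \<or> a < f x)"
      then have "f x \<in> f ` {1..a}" unfolding L by auto
      then have "x \<in> {1..a}" using inj_image_mem_iff[OF permutes_inj[OF f]] by blast
      then show False using x by simp
    qed
  qed
next
  assume R: "splits a f"
  have f0: "f x = 0 \<longleftrightarrow> x = 0" for x
    using permutes_not_in[OF f, of 0] inj_eq[OF permutes_inj[OF f], of x 0] by auto
  have "{1..a} \<subseteq> f ` {1..a}"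
  proof
    fix y assume y: "y \<in> {1..a}"
    obtain x where x: "f x = y" using permutes_surj[OF f] by (metis surjD)
    have "x \<le> a" using R[unfolded splits_def, rule_format, of x] x y by (cases "x \<le> a") auto
    moreover have "x \<noteq> 0" using f0[of x] x y by auto
    ultimately show "y \<in> f ` {1..a}" using x by auto
  qed
  then show "f ` {1..a} = {1..a}"
    by (metis card_image card_seteq finite_atLeastAtMost finite_imageI le_refl permutes_inj_on[OF f])
qed

lemma splits_cycles_iff:
  assumes f: "f permutes {0..p::nat}" and a: "a \<le> p"
  shows "(\<forall>C \<in> orbit f ` {0..p}. 0 \<notin> C \<longrightarrow> C \<subseteq> {1..a} \<or> C \<subseteq> {a + 1..p}) \<and>
     (let r = root_word f in
        \<forall>i < length r. \<forall>j < length r. r ! i \<le> a \<and> r ! j > a \<longrightarrow> i < j) \<longleftrightarrow> splits a f"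
proof -
  have pf: "permutation f" using f permutes_imp_permutation by blast
  define L where "L = card (orbit f 0)"
  have L: "L = least_power f 0" using card_orbit_0(1)[OF pf] by (simp add: L_def)
  have fL: "(f ^^ L) 0 = 0" and Lpos: "0 < L" unfolding L using least_power_of_permutation[OF pf] by auto
  have dist: "distinct (support f 0)" by (rule cycle_of_permutation[OF pf])
  have nz: "(f ^^ i) 0 \<noteq> 0" if "0 < i" "i < L" for i
  proof
    assume "(f ^^ i) 0 = 0"
    then have "support f 0 ! i = support f 0 ! 0" using that by (simp add: L)
    then show False using nth_eq_iff_index_eq[OF dist, of i 0] that by (simp add: L)
  qed
  have r: "length (root_word f) = L - 1" "\<And>i. i < L - 1 \<Longrightarrow> root_word f ! i = (f ^^ Suc i) 0"
    by (simp_all add: root_word_def L_def)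
  show ?thesis unfolding Let_def r(1)
  proof
    assume R: "splits a f"
    have large: "f x = 0 \<or> a < f x" if "a < x" for x using R that by (simp add: splits_def)
    show "(\<forall>C \<in> orbit f ` {0..p}. 0 \<notin> C \<longrightarrow> C \<subseteq> {1..a} \<or> C \<subseteq> {a + 1..p}) \<and>
      (\<forall>i<L - 1. \<forall>j<L - 1. root_word f ! i \<le> a \<and> root_word f ! j > a \<longrightarrow> i < j)"
    proof (intro conjI ballI impI allI)
      fix C assume C: "C \<in> orbit f ` {0..p}" "0 \<notin> C"
      then obtain x where x: "C = orbit f x" by blast
      have Cp: "C \<subseteq> {0..p}" using C permutes_orbit_subset[OF f] by blast
      have Cpos: "y \<noteq> 0" if "y \<in> C" for y using that C(2) by metis
      show "C \<subseteq> {1..a} \<or> C \<subseteq> {a + 1..p}"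
      proof (cases "\<exists>y\<in>C. a < y")
        case True
        then obtain y where y: "y \<in> C" "a < y" by blast
        have "C = orbit f y"
          using y(1) orbit_cyclic_eq3[OF cyclic_on_orbit[OF f]] unfolding x by blast
        have "a < z" if "z \<in> orbit f y" for z using that
        proof induct
          case base
          have "f y \<in> C" using y(1) orbit_closed[OF pf] x by blast
          then show ?case using large[OF y(2)] Cpos by blast
        next
          case (step z)
          have "f z \<in> C" using step(1) orbit_closed[OF pf] \<open>C = orbit f y\<close> by blast
          then show ?case using large[OF step(2)] Cpos by blast
        qed
        then show ?thesis using \<open>C = orbit f y\<close> Cp by fastforce
      next
        case False
        then show ?thesis using Cpos by (force simp: not_less)
      qed
    next
      fix i j assume ij: "i < L - 1" "j < L - 1" "root_word f ! i \<le> a \<and> root_word f ! j > a"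
      show "i < j"
      proof (rule ccontr)
        assume "\<not> i < j"
        then have "j \<le> i" by simp
        then have "a < (f ^^ Suc i) 0" using ij(1)
        proof (induction i rule: dec_induct)
          case base
          then show ?case using ij(2,3) r(2) by simp
        next
          case (step m)
          have "Suc (Suc m) < L" using step.prems by linarith
          then show ?case using step large[of "(f ^^ Suc m) 0"] nz[of "Suc (Suc m)"] by simp
        qed
        then show False using ij r(2) by simp
      qed
    qed
  next
    assume A: "(\<forall>C \<in> orbit f ` {0..p}. 0 \<notin> C \<longrightarrow> C \<subseteq> {1..a} \<or> C \<subseteq> {a + 1..p}) \<and>
      (\<forall>i<L - 1. \<forall>j<L - 1. root_word f ! i \<le> a \<and> root_word f ! j > a \<longrightarrow> i < j)"
    show "splits a f" unfolding splits_def
    proof (intro allI impI)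
      fix x assume x: "a < x"
      show "f x = 0 \<or> a < f x"
      proof (rule ccontr)
        assume bad: "\<not> (f x = 0 \<or> a < f x)"
        then have xp: "x \<le> p" using permutes_fixes_above[OF f, of x] x by (cases "x \<le> p") auto
        have mem: "x \<in> orbit f x" "f x \<in> orbit f x"
          using permutation_self_in_orbit[OF pf] orbit.base by auto
        show False
        proof (cases "0 \<in> orbit f x")
          case False
          then have "orbit f x \<subseteq> {1..a} \<or> orbit f x \<subseteq> {a + 1..p}" using A xp by auto
          then show False using mem x bad by auto
        next
          case True
          then have "orbit f x = orbit f 0"
            using orbit_cyclic_eq3[OF cyclic_on_orbit[OF f finite_atLeastAtMost], of 0 x] by simp
          then have "x \<in> set (support f 0)" using mem(1) card_orbit_0(2)[OF pf] by simp
          then obtain i where i: "i < L" "x = (f ^^ i) 0" by (auto simp: L)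
          have "i \<noteq> 0" using i x by (cases i) auto
          moreover have "Suc i < L"
          proof (rule ccontr)
            assume "\<not> Suc i < L"
            then have "Suc i = L" using i by simp
            then have "f x = 0" using fL i(2) by auto
            then show False using bad by simp
          qed
          moreover obtain m where m: "i = Suc m" using \<open>i \<noteq> 0\<close> by (cases i) auto
          ultimately have "root_word f ! Suc m = f x" "root_word f ! m = x" "Suc m < L - 1"
            using r(2)[of m] r(2)[of "Suc m"] i(2) by simp_all
          then have "Suc m < m" using A bad x by (metis Suc_lessD not_le_imp_less)
          then show False by simp
        qed
      qed
    qed
  qed
qed

lemma factorization_cuts_splits:
  assumes "\<theta> \<in> decorations n"
  shows "factorization_cuts n \<theta> = {c. even c \<and> 0 < c \<and> c < n \<and>
    splits (up_half c) (fst \<theta>) \<and> splits (dn_half c) (snd \<theta>)}"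
proof -
  have le: "up_half c \<le> up_half n" "dn_half c \<le> dn_half n" if "c < n" for c
    using that by (auto simp: up_half_def dn_half_def intro: div_le_mono)
  have \<theta>: "fst \<theta> permutes {1..up_half n}" "snd \<theta> permutes {0..dn_half n}"
    using assms by (auto simp: mem_decorations)
  show ?thesis unfolding factorization_cuts_def cuts_zigzag mem_Collect_eq
  proof (rule Collect_cong)
    fix c
    show "(even c \<and> 0 < c \<and> c < n) \<and> fst \<theta> ` {1..up_half c} = {1..up_half c} \<and>
      (\<forall>C\<in>orbit (snd \<theta>) ` {0..dn_half n}. 0 \<notin> C \<longrightarrow> C \<subseteq> {1..dn_half c} \<or> C \<subseteq> {dn_half c + 1..dn_half n}) \<and>
      (let r = root_word (snd \<theta>) in \<forall>i<length r. \<forall>j<length r. r ! i \<le> dn_half c \<and> dn_half c < r ! j \<longrightarrow> i < j)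
      \<longleftrightarrow> even c \<and> 0 < c \<and> c < n \<and> splits (up_half c) (fst \<theta>) \<and> splits (dn_half c) (snd \<theta>)"
    proof (cases "c < n")
      case True
      then show ?thesis
        using splits_image_iff[OF \<theta>(1) le(1)[OF True]] splits_cycles_iff[OF \<theta>(2) le(2)[OF True]] by argo
    qed simp
  qed
qed

lemma factorization_cuts_bounds: "factorization_cuts n \<theta> \<subseteq> {0<..<n}"
  by (auto simp: factorization_cuts_def cuts_zigzag)

lemma finite_factorization_cuts [simp]: "finite (factorization_cuts n \<theta>)"
  using factorization_cuts_bounds finite_subset by blast

lemma factorization_cuts_diamond:
  assumes a: "even a" "0 < a" and m: "0 < m" and \<xi>: "\<xi> \<in> decorations a" "\<eta> \<in> decorations m"
  shows "a \<in> factorization_cuts (a + m) (diamond a m \<xi> \<eta>)"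
    and "a + c \<in> factorization_cuts (a + m) (diamond a m \<xi> \<eta>) \<longleftrightarrow> c = 0 \<or> c \<in> factorization_cuts m \<eta>"
proof -
  have p: "fst \<xi> permutes {0..up_half a}" "snd \<xi> permutes {0..dn_half a}"
    using \<xi>(1) permutes_from_0 by (auto simp: mem_decorations)
  note F = factorization_cuts_splits[OF diamond_decorations[OF a(1) \<xi>]]
  show a: "a \<in> factorization_cuts (a + m) (diamond a m \<xi> \<eta>)"
    unfolding F using a m star_splits[OF p(1)] star_splits[OF p(2)] by (simp add: diamond_star[OF \<xi>])
  show "a + c \<in> factorization_cuts (a + m) (diamond a m \<xi> \<eta>) \<longleftrightarrow> c = 0 \<or> c \<in> factorization_cuts m \<eta>"
  proof (cases "c = 0")
    case False
    then show ?thesis unfolding F factorization_cuts_splits[OF \<xi>(2)]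
      using assms(1) star_splits_beyond[OF p(1)] star_splits_beyond[OF p(2)]
      by (simp add: diamond_star[OF \<xi>] half_add)
  qed (use a in simp)
qed

text \<open>Cutting a total decoration at a factorization cut is possible in exactly one way; this
  is what makes the cut set of a basis element, together with the total decoration, determine
  all its decorations.\<close>

lemma diamond_bij:
  assumes a: "even a" "0 < a" and m: "0 < m"
  shows "bij_betw (\<lambda>(\<xi>, \<eta>). diamond a m \<xi> \<eta>) (decorations a \<times> decorations m)
    {\<theta> \<in> decorations (a + m). a \<in> factorization_cuts (a + m) \<theta>}"
proof (rule bij_betw_imageI)
  show "inj_on (\<lambda>(\<xi>, \<eta>). diamond a m \<xi> \<eta>) (decorations a \<times> decorations m)"
  proof (rule inj_onI)
    fix p p' assume mem: "p \<in> decorations a \<times> decorations m" "p' \<in> decorations a \<times> decorations m"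
      and eq: "(\<lambda>(\<xi>, \<eta>). diamond a m \<xi> \<eta>) p = (\<lambda>(\<xi>, \<eta>). diamond a m \<xi> \<eta>) p'"
    obtain s t u v s' t' u' v' where p: "p = ((s, t), (u, v))" "p' = ((s', t'), (u', v'))"
      by (metis prod.collapse)
    have d: "(s, t) \<in> decorations a" "(u, v) \<in> decorations m" "(s', t') \<in> decorations a" "(u', v') \<in> decorations m"
      using mem p by auto
    have "star (up_half a) s u = star (up_half a) s' u'" "star (dn_half a) t v = star (dn_half a) t' v'"
      using eq unfolding p prod.case diamond_star[OF d(1,2)] diamond_star[OF d(3,4)] by auto
    moreover have "s permutes {0..up_half a}" "s' permutes {0..up_half a}" "t permutes {0..dn_half a}" "t' permutes {0..dn_half a}"
      using d permutes_from_0 by (auto simp: mem_decorations)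
    ultimately show "p = p'" unfolding p using star_injective by blast
  qed
  show "(\<lambda>(\<xi>, \<eta>). diamond a m \<xi> \<eta>) ` (decorations a \<times> decorations m)
      = {\<theta> \<in> decorations (a + m). a \<in> factorization_cuts (a + m) \<theta>}"
  proof (intro subset_antisym subsetI)
    fix \<theta> assume "\<theta> \<in> (\<lambda>(\<xi>, \<eta>). diamond a m \<xi> \<eta>) ` (decorations a \<times> decorations m)"
    then show "\<theta> \<in> {\<theta> \<in> decorations (a + m). a \<in> factorization_cuts (a + m) \<theta>}"
      using diamond_decorations[OF a(1)] factorization_cuts_diamond(1)[OF a m] by auto
  next
    fix \<theta> assume \<theta>: "\<theta> \<in> {\<theta> \<in> decorations (a + m). a \<in> factorization_cuts (a + m) \<theta>}"
    then have d: "fst \<theta> permutes {1..up_half a + up_half m}" "snd \<theta> permutes {0..dn_half a + dn_half m}"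
      and spl: "splits (up_half a) (fst \<theta>)" "splits (dn_half a) (snd \<theta>)"
      using factorization_cuts_splits[of \<theta> "a + m"] by (auto simp: mem_decorations half_add[OF a(1)])
    obtain s u where s: "s permutes {0..up_half a}" "u permutes {0..up_half m}" "fst \<theta> = star (up_half a) s u"
      using star_surjective[OF permutes_from_0[OF d(1)] spl(1)] by blast
    obtain t v where t: "t permutes {0..dn_half a}" "v permutes {0..dn_half m}" "snd \<theta> = star (dn_half a) t v"
      using star_surjective[OF d(2) spl(2)] by blast
    have f0: "star (up_half a) s u 0 = 0" using d(1) permutes_from_0_iff s(3) by metis
    have "s 0 = 0"
    proof (rule ccontr)
      assume "s 0 \<noteq> 0"
      then have "star (up_half a) s u 0 = s 0"
        using permutes_le[OF s(1), of 0] by (simp add: star_def shift_small)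
      then show False using f0 \<open>s 0 \<noteq> 0\<close> by simp
    qed
    then have "u 0 = 0" using f0 by (simp add: star_def shift_def)
    then have st: "(s, t) \<in> decorations a" "(u, v) \<in> decorations m"
      using s t \<open>s 0 = 0\<close> permutes_from_0_iff[of s] permutes_from_0_iff[of u] by (simp_all add: mem_decorations)
    moreover have "\<theta> = diamond a m (s, t) (u, v)" unfolding diamond_star[OF st] using s(3) t(3) by (metis fst_conv prod.collapse snd_conv)
    ultimately show "\<theta> \<in> (\<lambda>(\<xi>, \<eta>). diamond a m \<xi> \<eta>) ` (decorations a \<times> decorations m)"
      using st by (intro image_eqI[of _ _ "((s, t), (u, v))"]) auto
  qed
qed

lemma diamond_bij_cuts:
  assumes b: "0 < b" "even b" and m: "0 < m" and \<beta>: "\<beta> \<in> coarsenings (zigzag m)" and ne: "\<beta> \<noteq> []"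
  shows "bij_betw (\<lambda>(\<xi>, \<eta>). diamond b m \<xi> \<eta>) (decorations b \<times> {\<theta> \<in> decorations m. cuts \<beta> \<subseteq> factorization_cuts m \<theta>})
    {\<theta> \<in> decorations (b + m). cuts (b # \<beta>) \<subseteq> factorization_cuts (b + m) \<theta>}"
proof -
  note D = diamond_bij[OF b(2,1) m]
  let ?d = "\<lambda>(\<xi>, \<eta>). diamond b m \<xi> \<eta>"
  have iff: "cuts (b # \<beta>) \<subseteq> factorization_cuts (b + m) (diamond b m \<xi> \<eta>) \<longleftrightarrow> cuts \<beta> \<subseteq> factorization_cuts m \<eta>"
    if "\<xi> \<in> decorations b" "\<eta> \<in> decorations m" for \<xi> \<eta>
  proof -
    have "0 \<notin> cuts \<beta>" using cuts_bounds[of \<beta> m] \<beta> by (auto simp: coarsenings_zigzag)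
    then show ?thesis
      using factorization_cuts_diamond[OF b(2,1) m that] unfolding cuts_Cons[OF ne]
      by (auto simp: image_subset_iff subset_iff)
  qed
  have "?d ` (decorations b \<times> {\<theta> \<in> decorations m. cuts \<beta> \<subseteq> factorization_cuts m \<theta>})
      = {\<theta> \<in> decorations (b + m). cuts (b # \<beta>) \<subseteq> factorization_cuts (b + m) \<theta>}"
  proof (intro subset_antisym subsetI)
    fix \<theta> assume "\<theta> \<in> ?d ` (decorations b \<times> {\<theta> \<in> decorations m. cuts \<beta> \<subseteq> factorization_cuts m \<theta>})"
    then obtain \<xi> \<eta> where "\<xi> \<in> decorations b" "\<eta> \<in> decorations m" "\<theta> = diamond b m \<xi> \<eta>"
      "cuts \<beta> \<subseteq> factorization_cuts m \<eta>" by fast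
    then show "\<theta> \<in> {\<theta> \<in> decorations (b + m). cuts (b # \<beta>) \<subseteq> factorization_cuts (b + m) \<theta>}"
      using iff[of \<xi> \<eta>] diamond_decorations[OF b(2), of \<xi> \<eta> m] by blast
  next
    fix \<theta> assume \<theta>: "\<theta> \<in> {\<theta> \<in> decorations (b + m). cuts (b # \<beta>) \<subseteq> factorization_cuts (b + m) \<theta>}"
    then have "\<theta> \<in> {\<theta> \<in> decorations (b + m). b \<in> factorization_cuts (b + m) \<theta>}"
      unfolding cuts_Cons[OF ne] by auto
    then obtain \<xi> \<eta> where d: "\<xi> \<in> decorations b" "\<eta> \<in> decorations m" "\<theta> = diamond b m \<xi> \<eta>"
      unfolding bij_betw_imp_surj_on[OF D, symmetric] by fast
    then show "\<theta> \<in> ?d ` (decorations b \<times> {\<theta> \<in> decorations m. cuts \<beta> \<subseteq> factorization_cuts m \<theta>})"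
      using \<theta> iff[OF d(1,2)] by (intro image_eqI[of _ _ "(\<xi>, \<eta>)"]) auto
  qed
  moreover have "inj_on ?d (decorations b \<times> {\<theta> \<in> decorations m. cuts \<beta> \<subseteq> factorization_cuts m \<theta>})"
    by (rule inj_on_subset[OF bij_betw_imp_inj_on[OF D]]) auto
  ultimately show ?thesis by (rule bij_betw_imageI[rotated])
qed

lemma total_decoration_of_Cons:
  assumes "\<beta> \<noteq> []" "length \<xi>s = length \<beta>"
  shows "total_decoration_of (b # \<beta>) (\<xi> # \<xi>s) = diamond b (sum_list \<beta>) \<xi> (total_decoration_of \<beta> \<xi>s)"
  using assms by (cases \<beta>) auto

lemma total_decoration_bij:
  assumes "\<beta> \<in> coarsenings (zigzag n)" "0 < n"
  shows "bij_betw (total_decoration_of \<beta>) {\<xi>s. list_all2 (\<lambda>\<xi> b. \<xi> \<in> decorations b) \<xi>s \<beta>}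
    {\<theta> \<in> decorations n. cuts \<beta> \<subseteq> factorization_cuts n \<theta>}"
  using assms
proof (induction \<beta> arbitrary: n)
  case Nil
  then show ?case by (simp add: coarsenings_zigzag)
next
  case (Cons b \<beta>)
  show ?case
  proof (cases "\<beta> = []")
    case True
    then have bn: "b = n" using Cons.prems by (auto simp: coarsenings_zigzag compositions_def)
    have D: "{\<xi>s. list_all2 (\<lambda>\<xi> b. \<xi> \<in> decorations b) \<xi>s (b # \<beta>)} = (\<lambda>\<xi>. [\<xi>]) ` decorations n"
      using True bn by (auto simp: list_all2_Cons2)
    show ?thesis unfolding D unfolding True bn
    proof (rule bij_betw_imageI)
      show "inj_on (total_decoration_of [n]) ((\<lambda>\<xi>. [\<xi>]) ` decorations n)" by (rule inj_onI) auto
      show "total_decoration_of [n] ` (\<lambda>\<xi>. [\<xi>]) ` decorations n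
          = {\<theta> \<in> decorations n. cuts [n] \<subseteq> factorization_cuts n \<theta>}" by (simp add: image_image)
    qed
  next
    case False
    define m where "m = n - b"
    have b: "0 < b" "even b" "n = b + m" and \<beta>: "\<beta> \<in> coarsenings (zigzag m)"
      using Cons.prems coarsenings_zigzag_Cons[OF False] by (auto simp: m_def)
    have sum\<beta>: "sum_list \<beta> = m" using \<beta> compositions_sum by (auto simp: coarsenings_zigzag)
    have m: "0 < m" using \<beta> False by (cases "m = 0") (auto simp: coarsenings_zigzag)
    let ?D = "\<lambda>\<beta>. {\<xi>s. list_all2 (\<lambda>\<xi> b. \<xi> \<in> decorations b) \<xi>s \<beta>}"
    let ?T = "total_decoration_of"
    have len: "length \<xi>s = length \<beta>" if "\<xi>s \<in> ?D \<beta>" for \<xi>s using that list_all2_lengthD by blast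
    note IH = Cons.IH[OF \<beta> m]
    have 1: "bij_betw (\<lambda>\<xi>s. (hd \<xi>s, tl \<xi>s)) (?D (b # \<beta>)) (decorations b \<times> ?D \<beta>)"
      by (rule bij_betw_byWitness[where f' = "\<lambda>(\<xi>, \<xi>s). \<xi> # \<xi>s"]) (auto simp: list_all2_Cons2)
    have 2: "bij_betw (map_prod id (?T \<beta>)) (decorations b \<times> ?D \<beta>)
        (decorations b \<times> {\<theta> \<in> decorations m. cuts \<beta> \<subseteq> factorization_cuts m \<theta>})"
      using IH by (intro bij_betw_map_prod) auto
    have 3: "bij_betw (\<lambda>(\<xi>, \<eta>). diamond b m \<xi> \<eta>) (decorations b \<times> {\<theta> \<in> decorations m. cuts \<beta> \<subseteq> factorization_cuts m \<theta>})
        {\<theta> \<in> decorations n. cuts (b # \<beta>) \<subseteq> factorization_cuts n \<theta>}"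
      using diamond_bij_cuts[OF b(1,2) m \<beta> False] unfolding b(3) .
    have "bij_betw ((\<lambda>(\<xi>, \<eta>). diamond b m \<xi> \<eta>) \<circ> (map_prod id (?T \<beta>) \<circ> (\<lambda>\<xi>s. (hd \<xi>s, tl \<xi>s)))) (?D (b # \<beta>))
        {\<theta> \<in> decorations n. cuts (b # \<beta>) \<subseteq> factorization_cuts n \<theta>}"
      by (rule bij_betw_trans[OF bij_betw_trans[OF 1 2] 3])
    then show ?thesis
    proof (rule bij_betw_cong[THEN iffD1, rotated])
      fix \<xi>s assume "\<xi>s \<in> ?D (b # \<beta>)"
      then obtain \<xi> \<xi>s' where "\<xi>s = \<xi> # \<xi>s'" "\<xi>s' \<in> ?D \<beta>" by (auto simp: list_all2_Cons2)
      then show "((\<lambda>(\<xi>, \<eta>). diamond b m \<xi> \<eta>) \<circ> (map_prod id (?T \<beta>) \<circ> (\<lambda>\<xi>s. (hd \<xi>s, tl \<xi>s)))) \<xi>s = ?T (b # \<beta>) \<xi>s"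
        using total_decoration_of_Cons[OF False len] sum\<beta> by simp
    qed
  qed
qed

section \<open>Coefficients of series\<close>

lemma mcoeff_simps [simp]:
  "mcoeff 0 M = 0" "mcoeff 1 M = (if M = {#} then 1 else 0)"
  "mcoeff (F + G) M = mcoeff F M + mcoeff G M" "mcoeff (F - G) M = mcoeff F M - mcoeff G M"
  "mcoeff (- F) M = - mcoeff F M" "mcoeff (smult_ms c F) M = c * mcoeff F M"
  "mcoeff (map_ms f H) M = f (mcoeff H M)"
  for F G :: "'a::comm_ring_1 mseries"
  by (simp_all add: zero_mseries_def one_mseries_def plus_mseries_def minus_mseries_def
      uminus_mseries_def smult_ms_def map_ms_def)

lemma mcoeff_times: "mcoeff (F * G) M = (\<Sum>A | A \<subseteq># M. mcoeff F A * mcoeff G (M - A))"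
  by (simp add: times_mseries_def)

lemma mcoeff_sum: "mcoeff (sum f I) M = (\<Sum>i\<in>I. mcoeff (f i) M)"
  by (induction I rule: infinite_finite_induct) auto

lemma smult_ms_times: "smult_ms c F * G = smult_ms c (F * G)"
  by (rule mseries_eqI) (simp add: mcoeff_times sum_distrib_left mult.assoc)

lemma times_smult_ms: "F * smult_ms c G = smult_ms c (F * G)"
  using smult_ms_times[of c G F] by (simp add: mult.commute)

lemma smult_smult_ms [simp]: "smult_ms c (smult_ms d F) = smult_ms (c * d) F"
  by (rule mseries_eqI) (simp add: mult.assoc)

lemma smult_ms_0 [simp]: "smult_ms c 0 = 0" "smult_ms 0 F = 0" "smult_ms 1 F = F"
  by (rule mseries_eqI, simp)+

lemma smult_ms_sum: "smult_ms c (sum f I) = (\<Sum>i\<in>I. smult_ms c (f i))"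
  by (rule mseries_eqI) (simp add: mcoeff_sum sum_distrib_left)

lemma smult_ms_sum_left: "smult_ms (sum f I) F = (\<Sum>i\<in>I. smult_ms (f i) F)"
  by (rule mseries_eqI) (simp add: mcoeff_sum sum_distrib_right)

lemma of_nat_mult_ms: "of_nat c * F = smult_ms (of_nat c) F"
proof (induction c)
  case (Suc c)
  then show ?case by (intro mseries_eqI) (simp add: distrib_right)
qed simp

lemma power_neg_one_ms: "(- 1) ^ k * F = smult_ms ((- 1) ^ k) F"
proof (induction k)
  case (Suc k)
  have "(- 1) ^ Suc k * F = - ((- 1) ^ k * F)" by simp
  then show ?case unfolding Suc.IH by (intro mseries_eqI) simp
qed simp

section \<open>Coefficients at squarefree monomials\<close>

lemma finite_submsets [simp]: "finite {A. A \<subseteq># (M :: nat multiset) \<and> P A}"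
  by (rule finite_subset[OF _ finite_submultisets[of M]]) auto

lemma mcoeff_times_squarefree:
  assumes "finite V"
  shows "mcoeff (F * G) (mset_set V) = (\<Sum>U\<in>Pow V. mcoeff F (mset_set U) * mcoeff G (mset_set (V - U)))"
  unfolding mcoeff_times
proof (rule sum.reindex_bij_witness[where i = mset_set and j = set_mset])
  fix A assume A: "A \<in> {A. A \<subseteq># mset_set V}"
  have "count A x \<le> count (mset_set V) x" for x using A mset_subset_eq_count by auto
  moreover have "count (mset_set V) x \<le> 1" for x by (cases "x \<in> V"; cases "finite V") auto
  ultimately have le: "count A x \<le> 1" for x using le_trans by blast
  show eq: "mset_set (set_mset A) = A"
  proof (rule multiset_eqI)
    fix x show "count (mset_set (set_mset A)) x = count A x"
    proof (cases "x \<in># A")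
      case True
      then have "count A x = 1" using le[of x] count_greater_zero_iff[of A x] by linarith
      then show ?thesis using True by simp
    qed (simp add: count_eq_zero_iff)
  qed
  show "set_mset A \<in> Pow V" using A assms set_mset_mono by fastforce
  then have "mset_set (V - set_mset A) = mset_set V - mset_set (set_mset A)"
    using assms by (intro mset_set_Diff) auto
  then show "mcoeff F (mset_set (set_mset A)) * mcoeff G (mset_set (V - set_mset A)) = mcoeff F A * mcoeff G (mset_set V - A)"
    using eq by simp
next
  fix U assume U: "U \<in> Pow V"
  then have "finite U" using assms finite_subset by blast
  then show "set_mset (mset_set U) = U" by simp
  show "mset_set U \<in> {A. A \<subseteq># mset_set V}" using U assms by (auto intro: subset_imp_msubset_mset_set)
qed

lemma mcoeff_psum_squarefree:
  assumes "finite V" "0 < m"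
  shows "mcoeff (psum m) (mset_set V) = (if m = 1 \<and> card V = 1 then 1 else 0)"
proof -
  have "(\<exists>i. mset_set V = replicate_mset m i) \<longleftrightarrow> m = 1 \<and> card V = 1"
  proof
    assume "\<exists>i. mset_set V = replicate_mset m i"
    then obtain i where i: "mset_set V = replicate_mset m i" by blast
    then have "card V = m" by (metis size_mset_set size_replicate_mset)
    moreover have "count (mset_set V) i = m" using i by simp
    then have "m \<le> 1" using assms(1) by (cases "i \<in> V") auto
    ultimately show "m = 1 \<and> card V = 1" using assms(2) by auto
  qed (auto simp: card_1_singleton_iff)
  then show ?thesis by (simp add: psum_def)
qed

text \<open>Among the products of power sums only the powers of \<open>p\<^sub>1\<close> have squarefree monomials, and
  \<open>p\<^sub>1\<^sup>n\<close> has the coefficient \<open>n!\<close> at each one of degree \<open>n\<close>.\<close>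

lemma mcoeff_psum_prod_squarefree:
  assumes "finite V" "0 \<notin># \<mu>"
  shows "mcoeff (\<Prod>m\<in>#\<mu>. psum m :: 'a::comm_ring_1 mseries) (mset_set V)
    = (if \<mu> = replicate_mset (card V) 1 then of_nat (fact (card V)) else 0)"
  using assms
proof (induction \<mu> arbitrary: V)
  case empty
  then show ?case by (auto simp: mset_set_empty_iff)
next
  case (add m \<mu>)
  have m: "0 < m" "0 \<notin># \<mu>" using add.prems by (auto intro: gr0I)
  let ?F = "\<Prod>m\<in>#\<mu>. psum m :: 'a mseries"
  have "mcoeff (\<Prod>m\<in>#add_mset m \<mu>. psum m) (mset_set V)
      = (\<Sum>U\<in>Pow V. mcoeff (psum m) (mset_set U) * mcoeff ?F (mset_set (V - U)))"
    by (simp add: mcoeff_times_squarefree[OF add.prems(1)])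
  also have "\<dots> = (\<Sum>U\<in>{U\<in>Pow V. m = 1 \<and> card U = 1}. if \<mu> = replicate_mset (card V - 1) 1 then of_nat (fact (card V - 1)) else 0)"
  proof (rule sum.mono_neutral_cong_right)
    show "finite (Pow V)" using add.prems by simp
    show "\<forall>U\<in>Pow V - {U \<in> Pow V. m = 1 \<and> card U = 1}. mcoeff (psum m) (mset_set U) * mcoeff ?F (mset_set (V - U)) = 0"
    proof
      fix U assume U: "U \<in> Pow V - {U \<in> Pow V. m = 1 \<and> card U = 1}"
      then have "finite U" using add.prems(1) finite_subset by auto
      moreover have "\<not> (m = 1 \<and> card U = 1)" using U by blast
      ultimately show "mcoeff (psum m) (mset_set U) * mcoeff ?F (mset_set (V - U)) = 0"
        by (simp only: mcoeff_psum_squarefree[OF _ m(1)] if_False mult_zero_left)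
    qed
    fix U assume U: "U \<in> {U\<in>Pow V. m = 1 \<and> card U = 1}"
    then have fin: "finite U" "finite (V - U)" using add.prems(1) finite_subset by auto
    have "card (V - U) = card V - 1" using U fin by (simp add: card_Diff_subset)
    then show "mcoeff (psum m) (mset_set U) * mcoeff ?F (mset_set (V - U))
        = (if \<mu> = replicate_mset (card V - 1) 1 then of_nat (fact (card V - 1)) else 0)"
      using U add.IH[OF fin(2) m(2)] by (simp add: mcoeff_psum_squarefree[OF fin(1)])
  qed auto
  also have "\<dots> = (if add_mset m \<mu> = replicate_mset (card V) 1 then of_nat (fact (card V)) else 0)"
  proof (cases "m = 1")
    case True
    have "card {U \<in> Pow V. m = 1 \<and> card U = 1} = card V"
      using n_subsets[OF add.prems(1), of 1] True by (simp add: Pow_def)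
    then show ?thesis using True by (cases "card V") (auto simp: distrib_right)
  next
    case False
    then have "add_mset m \<mu> \<noteq> replicate_mset (card V) 1"
      by (metis in_replicate_mset union_single_eq_member)
    then show ?thesis using False by auto
  qed
  finally show ?case .
qed

section \<open>Series with a power sum expansion\<close>

definition psum_span :: "'a::comm_ring_1 mseries set" where
  "psum_span = {f. \<exists>a :: nat multiset \<Rightarrow>\<^sub>0 'a. (\<forall>\<mu>\<in>Poly_Mapping.keys a. 0 \<notin># \<mu>) \<and>
      f = (\<Sum>\<mu>\<in>Poly_Mapping.keys a. smult_ms (Poly_Mapping.lookup a \<mu>) (\<Prod>m\<in>#\<mu>. psum m))}"

lemma psum_span_expansion:
  fixes a :: "nat multiset \<Rightarrow>\<^sub>0 'a::comm_ring_1"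
  assumes "finite S" "Poly_Mapping.keys a \<subseteq> S"
  shows "(\<Sum>\<mu>\<in>Poly_Mapping.keys a. smult_ms (Poly_Mapping.lookup a \<mu>) (\<Prod>m\<in>#\<mu>. psum m))
    = (\<Sum>\<mu>\<in>S. smult_ms (Poly_Mapping.lookup a \<mu>) (\<Prod>m\<in>#\<mu>. psum m))"
  by (rule sum.mono_neutral_left) (use assms in \<open>auto simp: in_keys_iff\<close>)

lemma psum_span_monomial:
  assumes "0 \<notin># \<mu>"
  shows "smult_ms c (\<Prod>m\<in>#\<mu>. psum m) \<in> psum_span"
proof -
  have "smult_ms c (\<Prod>m\<in>#\<mu>. psum m) = (\<Sum>\<nu>\<in>Poly_Mapping.keys (Poly_Mapping.single \<mu> c).
      smult_ms (Poly_Mapping.lookup (Poly_Mapping.single \<mu> c) \<nu>) (\<Prod>m\<in>#\<nu>. psum m))"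
    by (subst psum_span_expansion[of "{\<mu>}"]) auto
  then show ?thesis using assms unfolding psum_span_def
    by (intro CollectI exI[of _ "Poly_Mapping.single \<mu> c"]) auto
qed

lemma psum_span_add:
  assumes "f \<in> psum_span" "g \<in> psum_span"
  shows "f + g \<in> psum_span"
proof -
  obtain a b where a: "\<forall>\<mu>\<in>Poly_Mapping.keys a. 0 \<notin># \<mu>"
      "f = (\<Sum>\<mu>\<in>Poly_Mapping.keys a. smult_ms (Poly_Mapping.lookup a \<mu>) (\<Prod>m\<in>#\<mu>. psum m))"
    and b: "\<forall>\<mu>\<in>Poly_Mapping.keys b. 0 \<notin># \<mu>"
      "g = (\<Sum>\<mu>\<in>Poly_Mapping.keys b. smult_ms (Poly_Mapping.lookup b \<mu>) (\<Prod>m\<in>#\<mu>. psum m))"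
    using assms by (auto simp: psum_span_def)
  let ?S = "Poly_Mapping.keys a \<union> Poly_Mapping.keys b"
  have "f + g = (\<Sum>\<mu>\<in>?S. smult_ms (Poly_Mapping.lookup (a + b) \<mu>) (\<Prod>m\<in>#\<mu>. psum m))"
    unfolding a(2) b(2) by (subst (1 2) psum_span_expansion[of ?S])
      (auto intro!: mseries_eqI simp: mcoeff_sum lookup_add distrib_right sum.distrib)
  also have "\<dots> = (\<Sum>\<mu>\<in>Poly_Mapping.keys (a + b). smult_ms (Poly_Mapping.lookup (a + b) \<mu>) (\<Prod>m\<in>#\<mu>. psum m))"
    using Poly_Mapping.keys_add[of a b] by (subst psum_span_expansion[of ?S]) auto
  finally show ?thesis unfolding psum_span_def using a(1) b(1) Poly_Mapping.keys_add[of a b]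
    by (intro CollectI exI[of _ "a + b"]) auto
qed

lemma psum_span_0: "0 \<in> psum_span"
  using psum_span_monomial[of "{#}" 0] by simp

lemma psum_span_sum: "(\<And>i. i \<in> I \<Longrightarrow> f i \<in> psum_span) \<Longrightarrow> sum f I \<in> psum_span"
  by (induction I rule: infinite_finite_induct) (auto intro: psum_span_0 psum_span_add)

lemma psum_span_mult:
  assumes "f \<in> psum_span" "g \<in> psum_span"
  shows "f * g \<in> psum_span"
proof -
  obtain a b where a: "\<forall>\<mu>\<in>Poly_Mapping.keys a. 0 \<notin># \<mu>"
      "f = (\<Sum>\<mu>\<in>Poly_Mapping.keys a. smult_ms (Poly_Mapping.lookup a \<mu>) (\<Prod>m\<in>#\<mu>. psum m))"
    and b: "\<forall>\<mu>\<in>Poly_Mapping.keys b. 0 \<notin># \<mu>"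
      "g = (\<Sum>\<mu>\<in>Poly_Mapping.keys b. smult_ms (Poly_Mapping.lookup b \<mu>) (\<Prod>m\<in>#\<mu>. psum m))"
    using assms by (auto simp: psum_span_def)
  have "f * g = (\<Sum>\<mu>\<in>Poly_Mapping.keys a. \<Sum>\<nu>\<in>Poly_Mapping.keys b.
      smult_ms (Poly_Mapping.lookup a \<mu> * Poly_Mapping.lookup b \<nu>) (\<Prod>m\<in>#\<mu> + \<nu>. psum m))"
    unfolding a(2) b(2) sum_product
    by (intro sum.cong[OF refl]) (simp add: smult_ms_times times_smult_ms mult.commute)
  also have "\<dots> \<in> psum_span"
    using a(1) b(1) by (intro psum_span_sum psum_span_monomial) auto
  finally show ?thesis .
qed

lemma psum_span_smult: "f \<in> psum_span \<Longrightarrow> smult_ms c f \<in> psum_span"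
  using psum_span_mult[OF psum_span_monomial[of "{#}" c], of f] by (simp add: smult_ms_times)

lemma psum_span_1: "1 \<in> psum_span"
  using psum_span_monomial[of "{#}" 1] by simp

lemma psum_span_prod: "(\<And>i. i \<in> I \<Longrightarrow> f i \<in> psum_span) \<Longrightarrow> prod f I \<in> psum_span"
  by (induction I rule: infinite_finite_induct) (auto intro: psum_span_1 psum_span_mult)

lemma psum_span_psum: "0 < m \<Longrightarrow> psum m \<in> psum_span"
  using psum_span_monomial[of "{#m#}" 1] by simp

text \<open>The coefficient of \<open>p\<^sub>1\<^sup>n\<close> is well defined, because it can be read off from the
  coefficient at the product of \<open>n\<close> distinct variables.\<close>

lemma dim_sf_squarefree:
  fixes f :: "'a::{idom,ring_char_0} mseries"
  assumes "f \<in> psum_span"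
  shows "dim_sf n f = mcoeff f (mset_set {..<n})"
proof -
  let ?P = "\<lambda>c. \<exists>a :: nat multiset \<Rightarrow>\<^sub>0 'a.
      (\<forall>\<mu>\<in>Poly_Mapping.keys a. 0 \<notin># \<mu>) \<and>
      f = (\<Sum>\<mu>\<in>Poly_Mapping.keys a. smult_ms (Poly_Mapping.lookup a \<mu>) (\<Prod>m\<in>#\<mu>. psum m)) \<and>
      c = Poly_Mapping.lookup a (replicate_mset n 1)"
  have val: "of_nat (fact n) * c = mcoeff f (mset_set {..<n})" if c: "?P c" for c
  proof -
    obtain a where a: "\<forall>\<mu>\<in>Poly_Mapping.keys a. 0 \<notin># \<mu>"
      "f = (\<Sum>\<mu>\<in>Poly_Mapping.keys a. smult_ms (Poly_Mapping.lookup a \<mu>) (\<Prod>m\<in>#\<mu>. psum m))"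
      "c = Poly_Mapping.lookup a (replicate_mset n 1)" using c by blast
    have "mcoeff f (mset_set {..<n}) = (\<Sum>\<mu>\<in>Poly_Mapping.keys a. Poly_Mapping.lookup a \<mu> *
        (if \<mu> = replicate_mset n 1 then of_nat (fact n) else 0))"
      unfolding a(2) mcoeff_sum using a(1)
      by (intro sum.cong[OF refl]) (simp add: mcoeff_psum_prod_squarefree)
    also have "\<dots> = (\<Sum>\<mu>\<in>Poly_Mapping.keys a. if \<mu> = replicate_mset n 1 then c * of_nat (fact n) else 0)"
      by (rule sum.cong) (auto simp: a(3))
    also have "\<dots> = of_nat (fact n) * c"
      using a(3) by (auto simp: in_keys_iff mult.commute)
    finally show ?thesis ..
  qed
  obtain c where c: "?P c" using assms by (auto simp: psum_span_def)
  have "p1_coeff n f = c" unfolding p1_coeff_def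
  proof (rule the_equality[of ?P])
    fix d assume d: "?P d"
    have "of_nat (fact n) * d = of_nat (fact n) * c" unfolding val[OF d] val[OF c] ..
    then show "d = c" by (simp only: mult_cancel_left of_nat_eq_0_iff fact_nonzero) simp
  qed (rule c)
  then show ?thesis using val[OF c] by (simp add: dim_sf_def)
qed

section \<open>Complete homogeneous functions\<close>

text \<open>The multinomial coefficient of \<open>\<beta>\<close>.\<close>

fun multinomial :: "nat list \<Rightarrow> nat" where
  "multinomial [] = 1"
| "multinomial (b # \<beta>) = (sum_list (b # \<beta>) choose b) * multinomial \<beta>"

lemma multinomial_fact: "multinomial \<beta> * prod_list (map fact \<beta>) = fact (sum_list \<beta>)"
proof (induction \<beta>)
  case (Cons b \<beta>)
  have "fact b * fact (sum_list \<beta>) * ((b + sum_list \<beta>) choose b) = (fact (b + sum_list \<beta>) :: nat)"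
    using binomial_fact_lemma[of b "b + sum_list \<beta>"] by simp
  then show ?case using Cons by (simp add: mult_ac) (metis mult.assoc mult.left_commute)
qed simp

lemma mcoeff_hsym_prod_squarefree:
  assumes "finite V"
  shows "mcoeff (prod_list (map hsym \<beta>) :: 'a::comm_ring_1 mseries) (mset_set V)
    = (if card V = sum_list \<beta> then of_nat (multinomial \<beta>) else 0)"
  using assms
proof (induction \<beta> arbitrary: V)
  case Nil
  then show ?case by (auto simp: mset_set_empty_iff)
next
  case (Cons b \<beta>)
  let ?F = "prod_list (map hsym \<beta>) :: 'a mseries"
  have "mcoeff (prod_list (map hsym (b # \<beta>))) (mset_set V)
      = (\<Sum>U\<in>Pow V. mcoeff (hsym b) (mset_set U) * mcoeff ?F (mset_set (V - U)))"
    by (simp add: mcoeff_times_squarefree[OF Cons.prems])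
  also have "\<dots> = (\<Sum>U\<in>{U. U \<subseteq> V \<and> card U = b}. if card V = b + sum_list \<beta> then of_nat (multinomial \<beta>) else 0)"
  proof (rule sum.mono_neutral_cong_right)
    show "finite (Pow V)" using Cons.prems by simp
    show "\<forall>U\<in>Pow V - {U. U \<subseteq> V \<and> card U = b}. mcoeff (hsym b) (mset_set U) * mcoeff ?F (mset_set (V - U)) = 0"
      by (auto simp: hsym_def)
    fix U assume U: "U \<in> {U. U \<subseteq> V \<and> card U = b}"
    then have fin: "finite U" "finite (V - U)" "card U \<le> card V"
      using Cons.prems finite_subset by (auto intro: card_mono)
    have "card (V - U) = card V - b" using U fin by (simp add: card_Diff_subset)
    moreover have "card V - b = sum_list \<beta> \<longleftrightarrow> card V = b + sum_list \<beta>" using U fin(3) by auto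
    ultimately show "mcoeff (hsym b) (mset_set U) * mcoeff ?F (mset_set (V - U))
        = (if card V = b + sum_list \<beta> then of_nat (multinomial \<beta>) else 0)"
      using U unfolding Cons.IH[OF fin(2)] by (simp add: hsym_def)
  qed auto
  also have "\<dots> = (if card V = sum_list (b # \<beta>) then of_nat (multinomial (b # \<beta>)) else 0)"
    using n_subsets[OF Cons.prems, of b] by simp
  finally show ?case .
qed

section \<open>Extension of scalars\<close>

lemma map_ms_times:
  assumes "\<And>x y. f (x + y) = f x + f y" "\<And>x y. f (x * y) = f x * f y"
  shows "map_ms f (F * G) = map_ms f F * map_ms f G"
proof (rule mseries_eqI)
  fix M
  have f0: "f 0 = 0" using assms(1)[of 0 0] by simp
  have "f (sum g I) = (\<Sum>i\<in>I. f (g i))" for g and I :: "nat multiset set"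
    using assms(1) f0 by (induction I rule: infinite_finite_induct) auto
  then show "mcoeff (map_ms f (F * G)) M = mcoeff (map_ms f F * map_ms f G) M"
    by (simp add: mcoeff_times assms(2))
qed

lemma map_ms_sum:
  assumes "\<And>x y. f (x + y) = f x + f y"
  shows "map_ms f (\<Sum>i\<in>I. F i) = (\<Sum>i\<in>I. map_ms f (F i))"
proof (rule mseries_eqI)
  fix M
  have f0: "f 0 = 0" using assms[of 0 0] by simp
  have "f (sum g I) = (\<Sum>i\<in>I. f (g i))" for g
    using assms f0 by (induction I rule: infinite_finite_induct) auto
  then show "mcoeff (map_ms f (\<Sum>i\<in>I. F i)) M = mcoeff (\<Sum>i\<in>I. map_ms f (F i)) M"
    by (simp add: mcoeff_sum)
qed

lemma map_ms_ribbon: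
  assumes "\<And>x y. f (x + y) = f x + f y" "\<And>x y. f (x * y) = f x * f y" "f 1 = 1"
  shows "map_ms f (ribbon \<alpha>) = ribbon \<alpha>"
proof -
  have f0: "f 0 = 0" using assms(1)[of 0 0] by simp
  have neg: "f (- x) = - f x" for x using assms(1)[of x "- x"] f0 by (simp add: eq_neg_iff_add_eq_0 add.commute)
  have one: "map_ms f 1 = 1" by (rule mseries_eqI) (simp add: f0 assms(3))
  have h: "map_ms f (hsym m) = hsym m" for m
    by (rule mseries_eqI) (simp add: hsym_def f0 assms(3))
  have "map_ms f (prod_list (map hsym \<beta>)) = prod_list (map hsym \<beta>)" for \<beta>
    by (induction \<beta>) (simp_all add: one map_ms_times[OF assms(1,2)] h)
  moreover have "f ((- 1) ^ k) = (- 1) ^ k" for k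
    by (induction k) (simp_all add: assms(3) neg)
  then have "map_ms f (smult_ms ((- 1) ^ k) F) = smult_ms ((- 1) ^ k) (map_ms f F)" for k F
    by (intro mseries_eqI) (simp add: assms(2))
  ultimately show ?thesis
    by (simp add: ribbon_def map_ms_sum[OF assms(1)] power_neg_one_ms)
qed

section \<open>Power sums of permutations\<close>

text \<open>The product of power sums given by the cycle type of \<open>w\<close>.\<close>

definition cycle_psum :: "'b set \<Rightarrow> ('b \<Rightarrow> 'b) \<Rightarrow> 'a::comm_ring_1 mseries" where
  "cycle_psum A w = (\<Prod>C\<in>orbit w ` A. psum (card C))"

text \<open>Invariant colourings of \<open>A\<close> by variables, with the multiset of colours prescribed.\<close>

definition colourings :: "'b set \<Rightarrow> ('b \<Rightarrow> 'b) \<Rightarrow> nat multiset \<Rightarrow> ('b \<Rightarrow> nat) set" where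
  "colourings A w M = {f \<in> A \<rightarrow>\<^sub>E UNIV. (\<forall>x\<in>A. f (w x) = f x) \<and> image_mset f (mset_set A) = M}"

lemma finite_colour_set:
  assumes "finite A"
  shows "finite {f \<in> A \<rightarrow>\<^sub>E UNIV. P f \<and> image_mset f (mset_set A) = (M :: nat multiset)}"
proof (rule finite_subset)
  show "{f \<in> A \<rightarrow>\<^sub>E UNIV. P f \<and> image_mset f (mset_set A) = M} \<subseteq> A \<rightarrow>\<^sub>E set_mset M"
    using assms by (auto simp: PiE_iff extensional_def)
  show "finite (A \<rightarrow>\<^sub>E set_mset M)" using assms by (rule finite_PiE) simp
qed

lemma finite_colourings: "finite A \<Longrightarrow> finite (colourings A w M)"
  unfolding colourings_def by (rule finite_colour_set)

text \<open>A monomial of a product of power sums arises by choosing one variable for each factor.\<close>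

lemma mcoeff_psum_prod_partition:
  assumes "finite \<C>" "\<And>C. C \<in> \<C> \<Longrightarrow> finite C \<and> C \<noteq> {}" "disjoint \<C>"
  shows "mcoeff (\<Prod>C\<in>\<C>. psum (card C) :: 'a::comm_ring_1 mseries) M =
    of_nat (card {f \<in> \<Union>\<C> \<rightarrow>\<^sub>E UNIV. (\<forall>C\<in>\<C>. \<forall>x\<in>C. \<forall>y\<in>C. f x = f y) \<and> image_mset f (mset_set (\<Union>\<C>)) = M})"
  using assms
proof (induction \<C> arbitrary: M)
  case empty
  then show ?case by (auto simp: eq_commute[of "{#}"])
next
  case (insert C \<C>)
  let ?K = "\<lambda>\<C> M. {f \<in> \<Union>\<C> \<rightarrow>\<^sub>E UNIV. (\<forall>C\<in>\<C>. \<forall>x\<in>C. \<forall>y\<in>C. f x = f y) \<and> image_mset f (mset_set (\<Union>\<C>)) = (M :: nat multiset)}"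
  let ?D = "\<Union>\<C>"
  let ?F = "\<Prod>C\<in>\<C>. psum (card C) :: 'a mseries"
  have C: "finite C" "C \<noteq> {}" using insert.prems by auto
  have disj: "C \<inter> ?D = {}" using insert.prems(2) insert.hyps(2) by (fastforce simp: disjoint_def)
  have finD: "finite ?D" using insert.hyps(1) insert.prems(1) by auto
  have c0: "0 < card C" using C by (simp add: card_gt_0_iff)
  obtain z where z: "z \<in> C" using C by blast
  define I where "I = {i. replicate_mset (card C) i \<subseteq># M}"
  have I: "finite I"
  proof (rule finite_subset)
    show "I \<subseteq> set_mset M" using c0 by (auto simp: I_def dest!: set_mset_mono)
  qed simp
  have "mcoeff (\<Prod>C\<in>insert C \<C>. psum (card C) :: 'a mseries) M
      = (\<Sum>A | A \<subseteq># M. mcoeff (psum (card C)) A * mcoeff ?F (M - A))"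
    using insert.hyps by (simp add: mcoeff_times)
  also have "\<dots> = (\<Sum>A\<in>replicate_mset (card C) ` I. mcoeff ?F (M - A))"
  proof (rule sum.mono_neutral_cong_right)
    show "finite {A. A \<subseteq># M}" by simp
    show "replicate_mset (card C) ` I \<subseteq> {A. A \<subseteq># M}" by (auto simp: I_def)
    show "\<forall>A\<in>{A. A \<subseteq># M} - replicate_mset (card C) ` I. mcoeff (psum (card C)) A * mcoeff ?F (M - A) = 0"
      by (auto simp: I_def psum_def)
    fix A assume "A \<in> replicate_mset (card C) ` I"
    then have "mcoeff (psum (card C) :: 'a mseries) A = 1" by (auto simp: psum_def)
    then show "mcoeff (psum (card C)) A * mcoeff ?F (M - A) = mcoeff ?F (M - A)" by simp
  qed
  also have "\<dots> = (\<Sum>i\<in>I. mcoeff ?F (M - replicate_mset (card C) i))"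
    using c0 by (subst sum.reindex) (auto intro!: inj_onI dest: arg_cong[where f = set_mset])
  also have "\<dots> = (\<Sum>i\<in>I. of_nat (card (?K \<C> (M - replicate_mset (card C) i))))"
  proof (rule sum.cong[OF refl])
    fix i show "mcoeff ?F (M - replicate_mset (card C) i) = of_nat (card (?K \<C> (M - replicate_mset (card C) i)))"
      by (rule insert.IH) (use insert.prems in \<open>auto simp: disjoint_def\<close>)
  qed
  also have "\<dots> = of_nat (card (Sigma I (\<lambda>i. ?K \<C> (M - replicate_mset (card C) i))))"
    using I finite_colour_set[OF finD] by (subst card_SigmaI) auto
  also have "card (Sigma I (\<lambda>i. ?K \<C> (M - replicate_mset (card C) i))) = card (?K (insert C \<C>) M)"
  proof (rule bij_betw_same_card)
    let ?join = "\<lambda>(i, f) x. if x \<in> C then i else f x"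
    have mset: "image_mset f (mset_set (C \<union> ?D)) = replicate_mset (card C) i + image_mset f (mset_set ?D)"
      if "\<And>x. x \<in> C \<Longrightarrow> f x = i" for f i
    proof -
      have "image_mset f (mset_set C) = image_mset (\<lambda>_. i) (mset_set C)"
        using that C(1) by (intro image_mset_cong) auto
      then show ?thesis using disj C(1) finD by (simp add: mset_set_Union image_mset_const_eq)
    qed
    show "bij_betw ?join (Sigma I (\<lambda>i. ?K \<C> (M - replicate_mset (card C) i))) (?K (insert C \<C>) M)"
    proof (rule bij_betw_byWitness[where f' = "\<lambda>f. (f z, restrict f ?D)"])
      show "\<forall>p\<in>Sigma I (\<lambda>i. ?K \<C> (M - replicate_mset (card C) i)). (?join p z, restrict (?join p) ?D) = p"
      proof
        fix p assume "p \<in> Sigma I (\<lambda>i. ?K \<C> (M - replicate_mset (card C) i))"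
        then obtain i f where p: "p = (i, f)" "f \<in> ?D \<rightarrow>\<^sub>E UNIV" by blast
        have "restrict (?join (i, f)) ?D = f"
        proof
          fix x show "restrict (?join (i, f)) ?D x = f x"
            using disj p(2) by (cases "x \<in> ?D") (auto simp: PiE_iff extensional_def)
        qed
        then show "(?join p z, restrict (?join p) ?D) = p" using z p(1) by simp
      qed
      show "\<forall>f\<in>?K (insert C \<C>) M. ?join (f z, restrict f ?D) = f"
      proof
        fix f assume f: "f \<in> ?K (insert C \<C>) M"
        have "?join (f z, restrict f ?D) x = f x" for x
        proof (cases "x \<in> C")
          case True
          have "\<forall>x\<in>C. \<forall>y\<in>C. f x = f y" using f by fast
          then have "f z = f x" using z True by blast
          then show ?thesis using True by simp
        next
          case False
          have "f x = undefined" if "x \<notin> \<Union>(insert C \<C>)" using f that by (blast intro: PiE_arb)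
          then show ?thesis using False by (cases "x \<in> ?D") auto
        qed
        then show "?join (f z, restrict f ?D) = f" by blast
      qed
      show "?join ` Sigma I (\<lambda>i. ?K \<C> (M - replicate_mset (card C) i)) \<subseteq> ?K (insert C \<C>) M"
      proof (rule image_subsetI)
        fix p assume "p \<in> Sigma I (\<lambda>i. ?K \<C> (M - replicate_mset (card C) i))"
        then obtain i f where p: "p = (i, f)" "i \<in> I" "f \<in> ?K \<C> (M - replicate_mset (card C) i)" by blast
        have agree: "?join p x = f x" if "x \<in> ?D" for x using that disj p(1) by auto
        have "image_mset (?join p) (mset_set ?D) = image_mset f (mset_set ?D)"
          using agree finD by (intro image_mset_cong) auto
        then have "image_mset (?join p) (mset_set (C \<union> ?D)) = replicate_mset (card C) i + (M - replicate_mset (card C) i)"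
          using mset[of "?join p" i] p by simp
        then have "image_mset (?join p) (mset_set (C \<union> ?D)) = M"
          using p(2) by (simp add: I_def subset_mset.add_diff_inverse)
        moreover have "\<forall>B\<in>insert C \<C>. \<forall>x\<in>B. \<forall>y\<in>B. ?join p x = ?join p y"
        proof (intro ballI)
          fix B x y assume "B \<in> insert C \<C>" "x \<in> B" "y \<in> B"
          then show "?join p x = ?join p y"
          proof (cases "B = C")
            case False
            then have B: "B \<in> \<C>" using \<open>B \<in> insert C \<C>\<close> by blast
            then have "f x = f y" using \<open>x \<in> B\<close> \<open>y \<in> B\<close> p(3) by fast
            moreover have "x \<in> ?D" "y \<in> ?D" using B \<open>x \<in> B\<close> \<open>y \<in> B\<close> by blast+
            ultimately show ?thesis by (simp only: agree)
          next
            case True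
            then show ?thesis using p(1) \<open>x \<in> B\<close> \<open>y \<in> B\<close> by simp
          qed
        qed
        moreover have "?join p \<in> \<Union>(insert C \<C>) \<rightarrow>\<^sub>E UNIV"
        proof -
          have ext: "f \<in> extensional ?D" using p(3) by (simp add: PiE_iff)
          have "?join p x = undefined" if "x \<notin> \<Union>(insert C \<C>)" for x
            using extensional_arb[OF ext, of x] that p(1) by simp
          then show ?thesis by (simp add: PiE_iff extensional_def)
        qed
        ultimately show "?join p \<in> ?K (insert C \<C>) M" unfolding mem_Collect_eq Union_insert by blast
      qed
      show "(\<lambda>f. (f z, restrict f ?D)) ` ?K (insert C \<C>) M \<subseteq> Sigma I (\<lambda>i. ?K \<C> (M - replicate_mset (card C) i))"
      proof (rule image_subsetI)
        fix f assume f: "f \<in> ?K (insert C \<C>) M"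
        have "image_mset f (mset_set (C \<union> ?D)) = replicate_mset (card C) (f z) + image_mset f (mset_set ?D)"
        proof (rule mset)
          fix x assume "x \<in> C"
          have "\<forall>x\<in>C. \<forall>y\<in>C. f x = f y" using f by fast
          then show "f x = f z" using \<open>x \<in> C\<close> z by blast
        qed
        moreover have "image_mset f (mset_set (\<Union>(insert C \<C>))) = M" using f by fast
        ultimately have M: "M = replicate_mset (card C) (f z) + image_mset f (mset_set ?D)" by simp
        have "image_mset (restrict f ?D) (mset_set ?D) = image_mset f (mset_set ?D)"
          using finD by (intro image_mset_cong) auto
        then have "image_mset (restrict f ?D) (mset_set ?D) = M - replicate_mset (card C) (f z)" using M by simp
        moreover have "\<forall>B\<in>\<C>. \<forall>x\<in>B. \<forall>y\<in>B. restrict f ?D x = restrict f ?D y"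
        proof (intro ballI)
          fix B x y assume "B \<in> \<C>" "x \<in> B" "y \<in> B"
          moreover have "\<forall>x\<in>B. \<forall>y\<in>B. f x = f y" using f \<open>B \<in> \<C>\<close> by fast
          ultimately show "restrict f ?D x = restrict f ?D y" by (metis UnionI restrict_apply)
        qed
        moreover have "restrict f ?D \<in> ?D \<rightarrow>\<^sub>E UNIV" by auto
        moreover have "f z \<in> I" using M by (simp add: I_def)
        ultimately show "(f z, restrict f ?D) \<in> Sigma I (\<lambda>i. ?K \<C> (M - replicate_mset (card C) i))"
          by blast
      qed
    qed
  qed
  finally show ?case .
qed

lemma mcoeff_cycle_psum:
  assumes A: "finite A" and w: "w permutes A"
  shows "mcoeff (cycle_psum A w :: 'a::comm_ring_1 mseries) M = of_nat (card (colourings A w M))"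
proof -
  have pw: "permutation w" using assms permutes_imp_permutation by blast
  have self: "x \<in> orbit w x" for x by (rule permutation_self_in_orbit[OF pw])
  have un: "\<Union>(orbit w ` A) = A" using self permutes_orbit_subset[OF w] by blast
  have "mcoeff (cycle_psum A w :: 'a mseries) M = of_nat (card {f \<in> \<Union>(orbit w ` A) \<rightarrow>\<^sub>E UNIV.
      (\<forall>C\<in>orbit w ` A. \<forall>x\<in>C. \<forall>y\<in>C. f x = f y) \<and> image_mset f (mset_set (\<Union>(orbit w ` A))) = M})"
    unfolding cycle_psum_def
  proof (rule mcoeff_psum_prod_partition)
    show "finite (orbit w ` A)" using A by simp
    fix C assume "C \<in> orbit w ` A"
    then show "finite C \<and> C \<noteq> {}" using un A self by (metis Union_upper finite_subset empty_iff imageE)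
  next
    show "disjoint (orbit w ` A)"
    proof (rule disjointI)
      fix C D assume CD: "C \<in> orbit w ` A" "D \<in> orbit w ` A" "C \<noteq> D"
      then obtain x y where xy: "C = orbit w x" "D = orbit w y" by blast
      show "C \<inter> D = {}"
      proof (rule ccontr)
        assume "C \<inter> D \<noteq> {}"
        then obtain z where "z \<in> orbit w x" "z \<in> orbit w y" using xy by blast
        then have "orbit w z = orbit w x" "orbit w z = orbit w y"
          using orbit_cyclic_eq3[OF cyclic_on_orbit[OF w A]] by blast+
        then show False using CD(3) xy by simp
      qed
    qed
  qed
  also have "{f \<in> \<Union>(orbit w ` A) \<rightarrow>\<^sub>E UNIV. (\<forall>C\<in>orbit w ` A. \<forall>x\<in>C. \<forall>y\<in>C. f x = f y)
      \<and> image_mset f (mset_set (\<Union>(orbit w ` A))) = M} = colourings A w M"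
  proof -
    have "(\<forall>C\<in>orbit w ` A. \<forall>x\<in>C. \<forall>y\<in>C. f x = f y) \<longleftrightarrow> (\<forall>x\<in>A. f (w x) = f x)" for f :: "'b \<Rightarrow> nat"
    proof
      assume R: "\<forall>C\<in>orbit w ` A. \<forall>x\<in>C. \<forall>y\<in>C. f x = f y"
      show "\<forall>x\<in>A. f (w x) = f x"
      proof
        fix x assume "x \<in> A"
        then have "\<forall>y\<in>orbit w x. \<forall>z\<in>orbit w x. f y = f z" using R by blast
        then show "f (w x) = f x" using self[of x] orbit.base[of w x] by blast
      qed
    next
      assume L: "\<forall>x\<in>A. f (w x) = f x"
      have "f y = f x" if "y \<in> orbit w x" "x \<in> A" for x y
        using that
      proof induct
        case (step y)
        then have "y \<in> A" using permutes_orbit_subset[OF w] by blast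
        then show ?case using step L by simp
      qed (use L in blast)
      then show "\<forall>C\<in>orbit w ` A. \<forall>x\<in>C. \<forall>y\<in>C. f x = f y" by (metis imageE)
    qed
    then show ?thesis unfolding un colourings_def by simp
  qed
  finally show ?thesis .
qed

lemma colourings_insert:
  assumes A: "finite A" "a \<notin> A" and w: "w permutes A" and b: "b \<in> insert a A"
  shows "card (colourings (insert a A) (transpose a b \<circ> w) M)
    = (\<Sum>i\<in>set_mset M. card {f \<in> colourings A w (M - {#i#}). b = a \<or> f b = i})"
proof -
  have wa: "w a = a" using w A(2) permutes_not_in by metis
  have wA: "w x \<in> A \<longleftrightarrow> x \<in> A" for x using permutes_in_image[OF w] .
  have inv: "(\<forall>x\<in>insert a A. f ((transpose a b \<circ> w) x) = f x) \<longleftrightarrow> f b = f a \<and> (\<forall>x\<in>A. f (w x) = f x)"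
    for f :: "'a \<Rightarrow> nat"
  proof -
    have "f (transpose a b z) = f z" if "f b = f a" for z using that by (auto simp: transpose_def)
    then show ?thesis using wa by auto
  qed
  have K: "colourings (insert a A) (transpose a b \<circ> w) M = {f \<in> insert a A \<rightarrow>\<^sub>E UNIV. f b = f a \<and>
      (\<forall>x\<in>A. f (w x) = f x) \<and> add_mset (f a) (image_mset f (mset_set A)) = M}"
    unfolding colourings_def inv using A by auto
  let ?S = "Sigma (set_mset M) (\<lambda>i. {f \<in> colourings A w (M - {#i#}). b = a \<or> f b = i})"
  have "bij_betw (\<lambda>(i, f). f(a := i)) ?S (colourings (insert a A) (transpose a b \<circ> w) M)"
  proof (rule bij_betw_byWitness[where f' = "\<lambda>f. (f a, restrict f A)"])
    show "\<forall>p\<in>?S. ((case p of (i, f) \<Rightarrow> f(a := i)) a, restrict (case p of (i, f) \<Rightarrow> f(a := i)) A) = p"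
    proof
      fix p assume "p \<in> ?S"
      then obtain i f where p: "p = (i, f)" "f \<in> A \<rightarrow>\<^sub>E UNIV" by (auto simp: colourings_def)
      have "restrict (f(a := i)) A = f"
      proof
        fix x show "restrict (f(a := i)) A x = f x"
          using p(2) A(2) by (cases "x \<in> A") (auto simp: PiE_iff extensional_def)
      qed
      then show "((case p of (i, f) \<Rightarrow> f(a := i)) a, restrict (case p of (i, f) \<Rightarrow> f(a := i)) A) = p"
        using p(1) by simp
    qed
    show "\<forall>f\<in>colourings (insert a A) (transpose a b \<circ> w) M. (case (f a, restrict f A) of (i, f) \<Rightarrow> f(a := i)) = f"
      unfolding K by (auto simp: PiE_iff extensional_def fun_eq_iff)
    show "(\<lambda>(i, f). f(a := i)) ` ?S \<subseteq> colourings (insert a A) (transpose a b \<circ> w) M"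
    proof (rule image_subsetI)
      fix p assume "p \<in> ?S"
      then obtain i f where p: "p = (i, f)" "i \<in># M" "f \<in> A \<rightarrow>\<^sub>E UNIV" "\<forall>x\<in>A. f (w x) = f x"
        "image_mset f (mset_set A) = M - {#i#}" "b = a \<or> f b = i" by (auto simp: colourings_def)
      let ?g = "f(a := i)"
      have "image_mset ?g (mset_set A) = image_mset f (mset_set A)"
        using A by (intro image_mset_cong) auto
      moreover have "\<forall>x\<in>A. ?g (w x) = ?g x" using p(4) A(2) wA by auto
      moreover have "?g \<in> insert a A \<rightarrow>\<^sub>E UNIV" using p(3) by (auto simp: PiE_iff extensional_def)
      ultimately show "(\<lambda>(i, f). f(a := i)) p \<in> colourings (insert a A) (transpose a b \<circ> w) M"
        unfolding K using p by auto
    qed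
    show "(\<lambda>f. (f a, restrict f A)) ` colourings (insert a A) (transpose a b \<circ> w) M \<subseteq> ?S"
    proof (rule image_subsetI)
      fix f assume f: "f \<in> colourings (insert a A) (transpose a b \<circ> w) M"
      have "image_mset (restrict f A) (mset_set A) = image_mset f (mset_set A)"
        using A by (intro image_mset_cong) auto
      moreover have "b = a \<or> restrict f A b = f a" using f b unfolding K by auto
      moreover have "\<forall>x\<in>A. restrict f A (w x) = restrict f A x" using f wA unfolding K by auto
      ultimately show "(f a, restrict f A) \<in> ?S" using f unfolding K by (auto simp: colourings_def)
    qed
  qed
  then have "card (colourings (insert a A) (transpose a b \<circ> w) M) = card ?S" by (simp add: bij_betw_same_card)
  also have "\<dots> = (\<Sum>i\<in>set_mset M. card {f \<in> colourings A w (M - {#i#}). b = a \<or> f b = i})"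
    using finite_colourings[OF A(1)] by (subst card_SigmaI) auto
  finally show ?thesis .
qed

text \<open>Double counting over all permutations. In the step, a colour \<open>i\<close> of the new letter can
  be inherited from any letter of the same colour, or be independent if the letter is a fixed
  point, which amounts to the multiplicity of \<open>i\<close> in \<open>M\<close>.\<close>

lemma sum_card_colourings:
  assumes "finite A"
  shows "(\<Sum>w | w permutes A. card (colourings A w M)) = (if size M = card A then fact (card A) else 0)"
proof (cases "size M = card A")
  case False
  have "colourings A w M = {}" for w
    using False by (auto simp: colourings_def)
  then show ?thesis using False by simp
next
  case True
  with assms show ?thesis
  proof (induction A arbitrary: M)
    case empty
    then show ?case by (simp add: colourings_def)
  next
    case (insert a A)
    have inner: "(\<Sum>b\<in>insert a A. card {f \<in> colourings A w (M - {#i#}). b = a \<or> f b = i})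
        = count M i * card (colourings A w (M - {#i#}))" if i: "i \<in># M" for w i
    proof -
      let ?K = "colourings A w (M - {#i#})"
      have fin: "finite ?K" by (rule finite_colourings[OF insert.hyps(1)])
      have "(\<Sum>b\<in>insert a A. card {f \<in> ?K. b = a \<or> f b = i}) = card ?K + (\<Sum>b\<in>A. card {f \<in> ?K. f b = i})"
        using insert.hyps by (subst sum.insert) (auto intro!: sum.cong arg_cong[where f = card])
      also have "(\<Sum>b\<in>A. card {f \<in> ?K. f b = i}) = (\<Sum>b\<in>A. \<Sum>f\<in>?K. if f b = i then 1 else 0)"
        by (intro sum.cong[OF refl]) (simp add: sum.If_cases[OF fin] Int_def)
      also have "\<dots> = (\<Sum>f\<in>?K. \<Sum>b\<in>A. if f b = i then 1 else 0)" by (rule sum.swap)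
      also have "\<dots> = (\<Sum>f\<in>?K. count M i - 1)"
      proof (rule sum.cong[OF refl])
        fix f assume "f \<in> ?K"
        then have "count (image_mset f (mset_set A)) i = count M i - 1" by (simp add: colourings_def)
        then have "card {b \<in> A. f b = i} = count M i - 1"
          using insert.hyps(1) by (simp add: count_image_mset vimage_def Int_def conj_commute)
        then show "(\<Sum>b\<in>A. if f b = i then 1 else 0) = count M i - 1"
          by (simp add: sum.If_cases[OF insert.hyps(1)] Int_def)
      qed
      finally have "(\<Sum>b\<in>insert a A. card {f \<in> ?K. b = a \<or> f b = i}) = card ?K + card ?K * (count M i - 1)" by simp
      moreover have "0 < count M i" using i by simp
      ultimately show ?thesis by (cases "count M i") simp_all
    qed
    have "(\<Sum>w | w permutes insert a A. card (colourings (insert a A) w M))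
        = (\<Sum>b\<in>insert a A. \<Sum>w | w permutes A. card (colourings (insert a A) (transpose a b \<circ> w) M))"
      by (rule sum_over_permutations_insert[OF insert.hyps])
    also have "\<dots> = (\<Sum>b\<in>insert a A. \<Sum>w | w permutes A. \<Sum>i\<in>set_mset M. card {f \<in> colourings A w (M - {#i#}). b = a \<or> f b = i})"
      by (intro sum.cong[OF refl] colourings_insert[OF insert.hyps]) auto
    also have "\<dots> = (\<Sum>w | w permutes A. \<Sum>i\<in>set_mset M. \<Sum>b\<in>insert a A. card {f \<in> colourings A w (M - {#i#}). b = a \<or> f b = i})"
      by (subst sum.swap) (intro sum.cong[OF refl] sum.swap)
    also have "\<dots> = (\<Sum>w | w permutes A. \<Sum>i\<in>set_mset M. count M i * card (colourings A w (M - {#i#})))"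
      by (intro sum.cong[OF refl] inner) auto
    also have "\<dots> = (\<Sum>i\<in>set_mset M. count M i * (\<Sum>w | w permutes A. card (colourings A w (M - {#i#}))))"
      by (subst sum.swap) (simp add: sum_distrib_left)
    also have "\<dots> = (\<Sum>i\<in>set_mset M. count M i * fact (card A))"
    proof (rule sum.cong[OF refl])
      fix i assume "i \<in># M"
      then have s: "size (M - {#i#}) = card A" using insert.prems insert.hyps by (simp add: size_Diff_singleton)
      show "count M i * (\<Sum>w | w permutes A. card (colourings A w (M - {#i#}))) = count M i * fact (card A)"
        unfolding insert.IH[OF s] using s by simp
    qed
    also have "\<dots> = size M * fact (card A)" by (simp add: size_multiset_overloaded_eq sum_distrib_right)
    finally show ?case using insert.prems insert.hyps by simp
  qed
qed

lemma sum_cycle_psum: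
  assumes "finite A"
  shows "(\<Sum>w | w permutes A. cycle_psum A w) = smult_ms (of_nat (fact (card A))) (hsym (card A) :: 'a::comm_ring_1 mseries)"
proof (rule mseries_eqI)
  fix M
  have "mcoeff (\<Sum>w | w permutes A. cycle_psum A w :: 'a mseries) M = (\<Sum>w | w permutes A. of_nat (card (colourings A w M)))"
    unfolding mcoeff_sum by (rule sum.cong[OF refl]) (simp add: mcoeff_cycle_psum[OF assms])
  also have "\<dots> = of_nat (\<Sum>w | w permutes A. card (colourings A w M))" by simp
  finally show "mcoeff (\<Sum>w | w permutes A. cycle_psum A w :: 'a mseries) M
      = mcoeff (smult_ms (of_nat (fact (card A))) (hsym (card A))) M"
    by (simp add: sum_card_colourings[OF assms] hsym_def)
qed

section \<open>Permutation modules on ordered set partitions\<close>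

definition ordered_partitions :: "'b set \<Rightarrow> nat list \<Rightarrow> 'b set list set" where
  "ordered_partitions A \<beta> = {Bs. map card Bs = \<beta> \<and> \<Union>(set Bs) = A \<and>
     (\<forall>i < length Bs. \<forall>j < length Bs. i \<noteq> j \<longrightarrow> Bs ! i \<inter> Bs ! j = {})}"

lemma osp_eq: "osp n \<beta> = ordered_partitions {1..n} \<beta>"
  by (simp add: osp_def ordered_partitions_def)

lemma ordered_partitions_Nil: "ordered_partitions A [] = (if A = {} then {[]} else {})"
  by (auto simp: ordered_partitions_def)

lemma ordered_partitions_Cons:
  "B # Bs \<in> ordered_partitions A (b # \<beta>) \<longleftrightarrow> B \<subseteq> A \<and> card B = b \<and> Bs \<in> ordered_partitions (A - B) \<beta>"
proof -
  let ?P = "\<lambda>Bs. \<forall>i < length Bs. \<forall>j < length Bs. i \<noteq> j \<longrightarrow> Bs ! i \<inter> Bs ! j = {}"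
  have P: "?P (B # Bs) \<longleftrightarrow> B \<inter> \<Union>(set Bs) = {} \<and> ?P Bs"
  proof
    assume L: "?P (B # Bs)"
    have "B \<inter> Bs ! j = {}" if "j < length Bs" for j
      using L[rule_format, of 0 "Suc j"] that by simp
    then have "B \<inter> \<Union>(set Bs) = {}" by (fastforce simp: in_set_conv_nth)
    moreover have "Bs ! i \<inter> Bs ! j = {}" if "i < length Bs" "j < length Bs" "i \<noteq> j" for i j
      using L[rule_format, of "Suc i" "Suc j"] that by simp
    ultimately show "B \<inter> \<Union>(set Bs) = {} \<and> ?P Bs" by blast
  next
    assume R: "B \<inter> \<Union>(set Bs) = {} \<and> ?P Bs"
    show "?P (B # Bs)"
    proof (intro allI impI)
      fix i j assume ij: "i < length (B # Bs)" "j < length (B # Bs)" "i \<noteq> j"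
      have mem: "Bs ! k \<subseteq> \<Union>(set Bs)" if "k < length Bs" for k using that nth_mem by blast
      show "(B # Bs) ! i \<inter> (B # Bs) ! j = {}"
      proof (cases i; cases j)
        fix k assume "i = 0" "j = Suc k"
        then show ?thesis using ij R mem[of k] by auto
      next
        fix k assume "i = Suc k" "j = 0"
        then show ?thesis using ij R mem[of k] by auto
      next
        fix k l assume "i = Suc k" "j = Suc l"
        then show ?thesis using ij R by simp
      qed (use ij in simp)
    qed
  qed
  show ?thesis unfolding ordered_partitions_def mem_Collect_eq P by auto
qed

lemma ordered_partitions_ConsE:
  assumes "Cs \<in> ordered_partitions A (b # \<beta>)"
  obtains B Bs where "Cs = B # Bs" "B \<subseteq> A" "card B = b" "Bs \<in> ordered_partitions (A - B) \<beta>"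
proof (cases Cs)
  case Nil
  then show ?thesis using assms by (simp add: ordered_partitions_def)
next
  case (Cons B Bs)
  then show ?thesis using assms that by (simp add: ordered_partitions_Cons)
qed

lemma finite_ordered_partitions: "finite A \<Longrightarrow> finite (ordered_partitions A \<beta>)"
proof (induction \<beta> arbitrary: A)
  case Nil
  then show ?case by (simp add: ordered_partitions_Nil)
next
  case (Cons b \<beta>)
  have "ordered_partitions A (b # \<beta>) \<subseteq> (\<Union>B\<in>Pow A. (#) B ` ordered_partitions (A - B) \<beta>)"
  proof
    fix Cs assume "Cs \<in> ordered_partitions A (b # \<beta>)"
    then obtain B Bs where "Cs = B # Bs" "B \<subseteq> A" "Bs \<in> ordered_partitions (A - B) \<beta>"
      by (rule ordered_partitions_ConsE)
    then show "Cs \<in> (\<Union>B\<in>Pow A. (#) B ` ordered_partitions (A - B) \<beta>)" by blast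
  qed
  then show ?case using Cons by (meson finite_Diff finite_Pow_iff finite_UN_I finite_imageI finite_subset)
qed

lemma perm_restrict_permutes:
  assumes "w permutes A" "B \<subseteq> A" "w ` B = B"
  shows "perm_restrict w B permutes B"
  using permutes_inj_on[OF assms(1), of B] assms(3)
  by (intro bij_imp_permutes) (auto simp: bij_betw_def inj_on_def perm_restrict_def image_def)

lemma cycle_psum_split:
  assumes A: "finite A" and w: "w permutes A" and B: "B \<subseteq> A" "w ` B = B"
  shows "cycle_psum A w = cycle_psum B (perm_restrict w B) * cycle_psum (A - B) (perm_restrict w (A - B))"
proof -
  have wD: "w ` (A - B) = A - B"
    using permutes_image[OF w] B(2) image_set_diff[OF permutes_inj[OF w], of A B] by simp
  have orb: "orbit w x = orbit (perm_restrict w S) x" if "x \<in> S" "w ` S = S" for x S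
    using that by (intro orbit_cong0[of x S]) (auto simp: perm_restrict_def)
  have eq: "orbit w ` S = orbit (perm_restrict w S) ` S" if "w ` S = S" for S
    using orb that by (intro image_cong) auto
  have sub: "C \<subseteq> S" if C: "C \<in> orbit w ` S" and S: "w ` S = S" for C S
  proof
    fix y assume "y \<in> C"
    then obtain x where "x \<in> S" "y \<in> orbit w x" using C by blast
    from this(2,1) show "y \<in> S" by induct (use S in auto)
  qed
  have "orbit w ` A = orbit w ` B \<union> orbit w ` (A - B)" using B(1) by blast
  moreover have "orbit w ` B \<inter> orbit w ` (A - B) = {}"
  proof (rule equals0I)
    fix C assume C: "C \<in> orbit w ` B \<inter> orbit w ` (A - B)"
    then have "C \<subseteq> B" "C \<subseteq> A - B" using sub B(2) wD by blast+
    then have "C = {}" by blast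
    moreover obtain x where "C = orbit w x" using C by blast
    ultimately show False using orbit_nonempty[of w x] by simp
  qed
  moreover have "finite (orbit w ` B)" "finite (orbit w ` (A - B))" using A finite_subset[OF B(1) A] by auto
  ultimately show ?thesis unfolding cycle_psum_def eq[OF B(2), symmetric] eq[OF wD, symmetric]
    by (simp add: prod.union_disjoint)
qed

text \<open>A permutation that stabilizes each block is a tuple of permutations of the blocks, and
  the cycle types combine; so the Frobenius characteristic of the module of ordered set
  partitions of type \<open>\<beta>\<close> is \<open>h\<^sub>\<beta>\<close>, one factor for each block.\<close>

lemma sum_fixed_ordered_partitions:
  assumes "finite A" "sum_list \<beta> = card A"
  shows "(\<Sum>w | w permutes A. smult_ms (of_nat (card {Bs \<in> ordered_partitions A \<beta>. map ((`) w) Bs = Bs})) (cycle_psum A w))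
    = smult_ms (of_nat (fact (card A))) (prod_list (map hsym \<beta>) :: 'a::comm_ring_1 mseries)"
  using assms
proof (induction \<beta> arbitrary: A)
  case Nil
  then have "A = {}" by simp
  moreover have "{Bs \<in> ordered_partitions {} []. map ((`) w) Bs = Bs} = {[]}" for w :: "'b \<Rightarrow> 'b"
    by (auto simp: ordered_partitions_Nil)
  ultimately show ?case by (simp add: cycle_psum_def ordered_partitions_Nil)
next
  case (Cons b \<beta>)
  let ?p = "cycle_psum :: 'b set \<Rightarrow> _ \<Rightarrow> 'a mseries"
  define fixd where "fixd A \<beta> w = {Bs \<in> ordered_partitions A \<beta>. map ((`) w) Bs = Bs}" for A :: "'b set" and \<beta> and w :: "'b \<Rightarrow> 'b"
  define perms where "perms A = {w. w permutes A}" for A :: "'b set"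
  have finfix: "finite (fixd A \<beta> w)" if "finite A" for A \<beta> w
    unfolding fixd_def using finite_ordered_partitions[OF that] by simp
  have finperms: "finite (perms A)" if "finite A" for A
    unfolding perms_def using finite_permutations[OF that] .
  have sumfix: "smult_ms (of_nat (card (fixd A \<beta> w))) F = (\<Sum>Bs\<in>fixd A \<beta> w. F)" for A \<beta> w and F :: "'a mseries"
    by (simp add: of_nat_mult_ms)
  define \<B> where "\<B> = {B. B \<subseteq> A \<and> card B = b}"
  have \<B>: "finite \<B>" unfolding \<B>_def using Cons.prems(1) by simp
  let ?S = "Sigma (perms A) (\<lambda>w. fixd A (b # \<beta>) w)"
  let ?T = "Sigma \<B> (\<lambda>B. perms B \<times> Sigma (perms (A - B)) (\<lambda>w. fixd (A - B) \<beta> w))"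
  have fixed_rest: "map ((`) v) Bs = map ((`) w) Bs" if "\<And>x. x \<in> \<Union>(set Bs) \<Longrightarrow> v x = w x"
    for v w :: "'b \<Rightarrow> 'b" and Bs
    using that by (intro map_cong refl image_cong) auto
  have "(\<Sum>w\<in>perms A. smult_ms (of_nat (card (fixd A (b # \<beta>) w))) (?p A w))
      = (\<Sum>w\<in>perms A. \<Sum>Bs\<in>fixd A (b # \<beta>) w. ?p A w)" by (simp add: sumfix)
  also have "\<dots> = (\<Sum>(w, Bs)\<in>?S. ?p A w)"
    by (rule sum.Sigma) (use finperms finfix Cons.prems in auto)
  also have "\<dots> = (\<Sum>(B, u, v, Bs)\<in>?T. ?p B u * ?p (A - B) v)"
  proof (rule sum.reindex_bij_witness[where i = "\<lambda>(B, u, v, Bs). (u \<circ> v, B # Bs)"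
        and j = "\<lambda>(w, Cs). (hd Cs, perm_restrict w (hd Cs), perm_restrict w (A - hd Cs), tl Cs)"])
    fix p assume "p \<in> ?S"
    then obtain w Cs where p: "p = (w, Cs)" "w permutes A" "Cs \<in> ordered_partitions A (b # \<beta>)" "map ((`) w) Cs = Cs"
      by (auto simp: perms_def fixd_def)
    then obtain B Bs where B: "Cs = B # Bs" "B \<subseteq> A" "card B = b" "Bs \<in> ordered_partitions (A - B) \<beta>"
      by (auto elim: ordered_partitions_ConsE)
    have wB: "w ` B = B" and wBs: "map ((`) w) Bs = Bs" using p(4) B(1) by auto
    have wD: "w ` (A - B) = A - B"
      using permutes_image[OF p(2)] wB image_set_diff[OF permutes_inj[OF p(2)], of A B] by simp
    show "(\<lambda>(B, u, v, Bs). (u \<circ> v, B # Bs)) ((\<lambda>(w, Cs). (hd Cs, perm_restrict w (hd Cs), perm_restrict w (A - hd Cs), tl Cs)) p) = p"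
    proof -
      have "(perm_restrict w B \<circ> perm_restrict w (A - B)) x = w x" for x
      proof (cases "x \<in> A - B")
        case True
        then have "w x \<in> A - B" using wD by blast
        then show ?thesis using True by (simp add: perm_restrict_def)
      next
        case False
        then show ?thesis using permutes_not_in[OF p(2), of x] by (auto simp: perm_restrict_def)
      qed
      then show ?thesis using p(1) B(1) by (simp add: fun_eq_iff)
    qed
    show "(\<lambda>(w, Cs). (hd Cs, perm_restrict w (hd Cs), perm_restrict w (A - hd Cs), tl Cs)) p \<in> ?T"
    proof -
      have "\<Union>(set Bs) = A - B" using B(4) by (simp add: ordered_partitions_def)
      then have "map ((`) (perm_restrict w (A - B))) Bs = map ((`) w) Bs"
        by (intro fixed_rest) (simp add: perm_restrict_def)
      then have "Bs \<in> fixd (A - B) \<beta> (perm_restrict w (A - B))" using wBs B(4) by (simp add: fixd_def)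
      moreover have "perm_restrict w B permutes B" "perm_restrict w (A - B) permutes A - B"
        using perm_restrict_permutes[OF p(2)] B(2) wB wD by auto
      ultimately show ?thesis using p(1) B by (simp add: \<B>_def perms_def)
    qed
    show "(\<lambda>(B, u, v, Bs). ?p B u * ?p (A - B) v) ((\<lambda>(w, Cs). (hd Cs, perm_restrict w (hd Cs), perm_restrict w (A - hd Cs), tl Cs)) p)
        = (case p of (w, Bs) \<Rightarrow> ?p A w)"
      using p(1) B(1) by (simp add: cycle_psum_split[OF Cons.prems(1) p(2) B(2) wB])
  next
    fix q assume "q \<in> ?T"
    then obtain B u v Bs where q: "q = (B, u, v, Bs)" "B \<subseteq> A" "card B = b" "u permutes B" "v permutes A - B"
      "Bs \<in> ordered_partitions (A - B) \<beta>" "map ((`) v) Bs = Bs" by (auto simp: \<B>_def perms_def fixd_def)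
    have uv: "(u \<circ> v) x = (if x \<in> B then u x else v x)" for x
    proof (cases "x \<in> B")
      case True
      then show ?thesis using permutes_not_in[OF q(5), of x] by simp
    next
      case False
      have "v x \<notin> B"
        using permutes_in_image[OF q(5), of x] permutes_not_in[OF q(5), of x] False by (cases "x \<in> A") auto
      then show ?thesis using permutes_not_in[OF q(4)] False by simp
    qed
    show "(\<lambda>(w, Cs). (hd Cs, perm_restrict w (hd Cs), perm_restrict w (A - hd Cs), tl Cs)) ((\<lambda>(B, u, v, Bs). (u \<circ> v, B # Bs)) q) = q"
    proof -
      have "perm_restrict (u \<circ> v) B = u" "perm_restrict (u \<circ> v) (A - B) = v"
        using uv permutes_not_in[OF q(4)] permutes_not_in[OF q(5)] by (auto simp: perm_restrict_def fun_eq_iff)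
      then show ?thesis using q(1) by simp
    qed
    show "(\<lambda>(B, u, v, Bs). (u \<circ> v, B # Bs)) q \<in> ?S"
    proof -
      have "u \<circ> v permutes A"
        by (rule permutes_compose[OF permutes_subset[OF q(5)] permutes_subset[OF q(4)]]) (use q(2) in auto)
      moreover have "(u \<circ> v) ` B = B" using uv permutes_image[OF q(4)] by (simp add: image_def)
      moreover have "\<Union>(set Bs) = A - B" using q(6) by (simp add: ordered_partitions_def)
      then have "map ((`) (u \<circ> v)) Bs = map ((`) v) Bs" by (intro fixed_rest) (simp only: uv, simp)
      moreover have "B # Bs \<in> ordered_partitions A (b # \<beta>)" using q by (simp add: ordered_partitions_Cons)
      ultimately show ?thesis using q(1,7) by (simp add: perms_def fixd_def)
    qed
  qed
  also have "\<dots> = (\<Sum>B\<in>\<B>. \<Sum>u\<in>perms B. \<Sum>v\<in>perms (A - B). \<Sum>Bs\<in>fixd (A - B) \<beta> v. ?p B u * ?p (A - B) v)"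
  proof -
    have finB: "finite B" "finite (A - B)" if "B \<in> \<B>" for B using that Cons.prems(1) finite_subset[of B A] by (auto simp: \<B>_def)
    have "(\<Sum>B\<in>\<B>. \<Sum>u\<in>perms B. \<Sum>v\<in>perms (A - B). \<Sum>Bs\<in>fixd (A - B) \<beta> v. ?p B u * ?p (A - B) v)
        = (\<Sum>B\<in>\<B>. \<Sum>u\<in>perms B. \<Sum>(v, Bs)\<in>Sigma (perms (A - B)) (\<lambda>w. fixd (A - B) \<beta> w). ?p B u * ?p (A - B) v)"
      by (intro sum.cong[OF refl] sum.Sigma) (use finB finperms finfix in auto)
    also have "\<dots> = (\<Sum>B\<in>\<B>. \<Sum>(u, v, Bs)\<in>perms B \<times> Sigma (perms (A - B)) (\<lambda>w. fixd (A - B) \<beta> w). ?p B u * ?p (A - B) v)"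
      by (intro sum.cong[OF refl], subst sum.Sigma) (use finB finperms finfix in \<open>auto simp: case_prod_unfold\<close>)
    also have "\<dots> = (\<Sum>(B, u, v, Bs)\<in>?T. ?p B u * ?p (A - B) v)"
      by (subst sum.Sigma) (use \<B> finB finperms finfix in \<open>auto simp: case_prod_unfold\<close>)
    finally show ?thesis ..
  qed
  also have "\<dots> = (\<Sum>B\<in>\<B>. (\<Sum>u\<in>perms B. ?p B u) * (\<Sum>v\<in>perms (A - B). smult_ms (of_nat (card (fixd (A - B) \<beta> v))) (?p (A - B) v)))"
    unfolding sum_product by (intro sum.cong[OF refl]) (simp only: sumfix sum_distrib_left)
  also have "\<dots> = (\<Sum>B\<in>\<B>. smult_ms (of_nat (fact b * fact (card A - b))) (hsym b * prod_list (map hsym \<beta>)))"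
  proof (rule sum.cong[OF refl])
    fix B assume B: "B \<in> \<B>"
    then have B': "B \<subseteq> A" "card B = b" by (auto simp: \<B>_def)
    then have finB: "finite B" using Cons.prems(1) finite_subset by blast
    then have fin: "finite B" "finite (A - B)" "card B = b" "card (A - B) = card A - b"
      using Cons.prems(1) B' by (simp_all add: card_Diff_subset)
    have "sum_list \<beta> = card (A - B)" using Cons.prems(2) fin(4) by simp
    note IH = Cons.IH[OF fin(2) this, folded fixd_def perms_def]
    show "(\<Sum>u\<in>perms B. ?p B u) * (\<Sum>v\<in>perms (A - B). smult_ms (of_nat (card (fixd (A - B) \<beta> v))) (?p (A - B) v))
        = smult_ms (of_nat (fact b * fact (card A - b))) (hsym b * prod_list (map hsym \<beta>))"
      unfolding IH using sum_cycle_psum[OF fin(1), where 'a = 'a] fin(3,4)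
      by (simp add: perms_def smult_ms_times times_smult_ms mult.commute)
  qed
  also have "\<dots> = smult_ms (of_nat (fact (card A))) (prod_list (map hsym (b # \<beta>)))"
  proof -
    have "card \<B> = card A choose b" unfolding \<B>_def using n_subsets[OF Cons.prems(1)] .
    moreover have "fact b * fact (card A - b) * (card A choose b) = (fact (card A) :: nat)"
      using Cons.prems(2) by (intro binomial_fact_lemma) simp
    ultimately have "card \<B> * (fact b * fact (card A - b)) = fact (card A)" by (simp add: mult.commute)
    then have "(of_nat (card \<B>) :: 'a) * of_nat (fact b * fact (card A - b)) = of_nat (fact (card A))"
      by (metis of_nat_mult)
    then show ?thesis by (simp add: of_nat_mult_ms del: of_nat_mult of_nat_fact)
  qed
  finally show ?case unfolding fixd_def perms_def .
qed

lemma cycle_psum_in_psum_span: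
  assumes A: "finite A" and w: "w permutes A"
  shows "cycle_psum A w \<in> psum_span"
  unfolding cycle_psum_def
proof (intro psum_span_prod psum_span_psum)
  fix C assume "C \<in> orbit w ` A"
  then obtain x where x: "x \<in> A" "C = orbit w x" by blast
  then have "C \<subseteq> A" "C \<noteq> {}" using permutes_orbit_subset[OF w x(1)] orbit_nonempty[of w x] by simp_all
  then show "0 < card C" using A finite_subset by (simp add: card_gt_0_iff)
qed

lemma hsym_in_psum_span:
  assumes "c * of_nat (fact m) = (1 :: 'a::comm_ring_1)"
  shows "(hsym m :: 'a mseries) \<in> psum_span"
proof -
  have "smult_ms c (\<Sum>w | w permutes {..<m}. cycle_psum {..<m} w) = smult_ms (c * of_nat (fact m)) (hsym m :: 'a mseries)"
    using sum_cycle_psum[of "{..<m}", where 'a = 'a] by simp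
  then have "hsym m = smult_ms c (\<Sum>w | w permutes {..<m}. cycle_psum {..<m} w :: 'a mseries)"
    unfolding assms smult_ms_0 by (rule sym)
  then show ?thesis by (auto intro!: psum_span_smult psum_span_sum cycle_psum_in_psum_span)
qed

section \<open>Flags of subsets\<close>

definition flag :: "'b set \<Rightarrow> 'b set set \<Rightarrow> bool" where
  "flag A X \<longleftrightarrow> (\<forall>S\<in>X. S \<noteq> {} \<and> S \<subset> A) \<and> (\<forall>S\<in>X. \<forall>T\<in>X. S \<subseteq> T \<or> T \<subseteq> S)"

lemma flag_subset: "flag A X \<Longrightarrow> Y \<subseteq> X \<Longrightarrow> flag A Y"
  unfolding flag_def by blast

lemma flag_finite: "finite A \<Longrightarrow> flag A X \<Longrightarrow> finite X"
  by (rule finite_subset[of X "Pow A"]) (auto simp: flag_def)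

lemma flag_chain: "flag A X \<Longrightarrow> S \<in> X \<Longrightarrow> T \<in> X \<Longrightarrow> S \<subseteq> T \<or> T \<subseteq> S"
  unfolding flag_def by blast

lemma flag_mem: "flag A X \<Longrightarrow> S \<in> X \<Longrightarrow> S \<noteq> {} \<and> S \<subset> A"
  unfolding flag_def by blast

definition flag_sign :: "'b set set \<Rightarrow> 'b set \<Rightarrow> 'k::comm_ring_1" where
  "flag_sign X S = (- 1) ^ card {T \<in> X. T \<subset> S}"

lemma flag_sign_square [simp]: "flag_sign X S * flag_sign X S = (1 :: 'k::comm_ring_1)"
  by (simp add: flag_sign_def power_mult_distrib[symmetric])

lemma flag_sign_remove:
  assumes "finite X" "S \<in> X" "T \<in> X"
  shows "flag_sign (X - {T}) S = (if T \<subset> S then - flag_sign X S else flag_sign X S :: 'k::comm_ring_1)"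
proof (cases "T \<subset> S")
  case True
  have "{U \<in> X. U \<subset> S} = insert T {U \<in> X - {T}. U \<subset> S}" using True assms by blast
  then have "card {U \<in> X. U \<subset> S} = Suc (card {U \<in> X - {T}. U \<subset> S})" using assms by simp
  then show ?thesis using True by (simp add: flag_sign_def)
next
  case False
  then have "{U \<in> X. U \<subset> S} = {U \<in> X - {T}. U \<subset> S}" by blast
  then show ?thesis using False by (simp add: flag_sign_def)
qed

text \<open>The usual sign rule of a simplicial complex: deleting two members of a flag in either
  order gives opposite signs.\<close>

lemma flag_sign_swap:
  assumes "finite X" "S \<in> X" "T \<in> X" "S \<noteq> T" "S \<subseteq> T \<or> T \<subseteq> S"
  shows "flag_sign X S * flag_sign (X - {S}) T = - (flag_sign X T * flag_sign (X - {T}) S :: 'k::comm_ring_1)"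
proof (cases "S \<subset> T")
  case True
  then have "\<not> T \<subset> S" by blast
  then show ?thesis using True by (simp add: mult.commute flag_sign_remove[OF assms(1,2,3)] flag_sign_remove[OF assms(1,3,2)])
next
  case False
  then have "T \<subset> S" using assms(4,5) by blast
  then show ?thesis using False by (simp add: mult.commute flag_sign_remove[OF assms(1,2,3)] flag_sign_remove[OF assms(1,3,2)])
qed

section \<open>Inversions of a flag\<close>

text \<open>A flag of subsets of \<open>{1..n}\<close> is a permutation, obtained by writing each block in
  increasing order, together with a set of cuts that contains its descents. The inversions of
  the permutation are the pairs \<open>x < y\<close> such that some member of the flag separates \<open>y\<close> from
  \<open>x\<close>; they determine the order \<open>precedes\<close> of the letters. Dropping a cut preserves the
  permutation exactly if the cut is not a descent, and otherwise destroys inversions.\<close>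

definition inversions :: "nat \<Rightarrow> nat set set \<Rightarrow> (nat \<times> nat) set" where
  "inversions n X = {(x, y). x \<in> {1..n} \<and> y \<in> {1..n} \<and> x < y \<and> (\<exists>S\<in>X. y \<in> S \<and> x \<notin> S)}"

definition precedes :: "(nat \<times> nat) set \<Rightarrow> nat \<Rightarrow> nat \<Rightarrow> bool" where
  "precedes R x y \<longleftrightarrow> x < y \<and> (x, y) \<notin> R \<or> y < x \<and> (y, x) \<in> R"

definition initial :: "nat \<Rightarrow> (nat \<times> nat) set \<Rightarrow> nat set \<Rightarrow> bool" where
  "initial n R I \<longleftrightarrow> I \<subseteq> {1..n} \<and> (\<forall>x\<in>I. \<forall>y\<in>{1..n} - I. precedes R x y)"

lemma finite_inversions [simp]: "finite (inversions n X)"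
  by (rule finite_subset[of _ "{1..n} \<times> {1..n}"]) (auto simp: inversions_def)

lemma inversions_mono: "Y \<subseteq> X \<Longrightarrow> inversions n Y \<subseteq> inversions n X"
  by (auto simp: inversions_def)

lemma precedes_asym: "precedes R x y \<Longrightarrow> \<not> precedes R y x"
  by (auto simp: precedes_def)

lemma initial_chain:
  assumes "initial n R I" "initial n R J"
  shows "I \<subseteq> J \<or> J \<subseteq> I"
proof (rule ccontr)
  assume "\<not> (I \<subseteq> J \<or> J \<subseteq> I)"
  then obtain x y where "x \<in> I" "x \<notin> J" "y \<in> J" "y \<notin> I" by blast
  then have "precedes R x y" "precedes R y x" using assms unfolding initial_def by blast+
  then show False using precedes_asym by blast
qed

lemma flag_member_initial:
  assumes X: "flag {1..n} X" and T: "T \<in> X"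
  shows "initial n (inversions n X) T"
  unfolding initial_def
proof (intro conjI ballI)
  show sub: "T \<subseteq> {1..n}" using flag_mem[OF X T] by blast
  fix x y assume x: "x \<in> T" and y: "y \<in> {1..n} - T"
  show "precedes (inversions n X) x y"
  proof (cases "x < y")
    case True
    have "(x, y) \<notin> inversions n X"
    proof
      assume "(x, y) \<in> inversions n X"
      then obtain S where "S \<in> X" "y \<in> S" "x \<notin> S" by (auto simp: inversions_def)
      then show False using flag_chain[OF X T, of S] x y by blast
    qed
    then show ?thesis using True by (simp add: precedes_def)
  next
    case False
    then have "y < x" using x y by (metis DiffD2 linorder_neqE_nat)
    moreover have "(y, x) \<in> inversions n X" using \<open>y < x\<close> x y sub T by (auto simp: inversions_def)
    ultimately show ?thesis by (simp add: precedes_def)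
  qed
qed

lemma inversions_insert_initial:
  assumes "initial n (inversions n X) I"
  shows "inversions n (insert I X) = inversions n X"
proof -
  have "(y, x) \<in> inversions n X" if "x \<in> I" "y \<notin> I" "y \<in> {1..n}" "y < x" for x y
  proof -
    have "precedes (inversions n X) x y" using assms that unfolding initial_def by blast
    then show ?thesis using that(4) by (simp add: precedes_def)
  qed
  then have "inversions n (insert I X) \<subseteq> inversions n X" unfolding inversions_def by blast
  then show ?thesis using inversions_mono[of X "insert I X" n] by blast
qed

lemma flag_insert_initial:
  assumes X: "flag {1..n} X" and I: "initial n (inversions n X) I" "I \<noteq> {}" "I \<noteq> {1..n}"
  shows "flag {1..n} (insert I X)"
proof -
  have "S \<subseteq> I \<or> I \<subseteq> S" if "S \<in> X" for S
    using initial_chain[OF flag_member_initial[OF X that] I(1)] .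
  moreover have "I \<subseteq> {1..n}" using I(1) by (simp add: initial_def)
  ultimately show ?thesis using X I(2,3) unfolding flag_def by blast
qed

text \<open>Initial segments of every size exist: the letters are ordered by the number of members of
  the flag that avoid them, and within a block by size.\<close>

lemma initial_exists:
  assumes X: "flag {1..n} X" and c: "c \<le> n"
  shows "\<exists>I. initial n (inversions n X) I \<and> card I = c"
proof -
  have finX: "finite X" using flag_finite[OF _ X] by simp
  define rk where "rk x = card {S \<in> X. x \<notin> S}" for x
  have sep: "(\<exists>S\<in>X. x \<in> S \<and> y \<notin> S) \<longleftrightarrow> rk x < rk y" for x y
  proof
    assume "\<exists>S\<in>X. x \<in> S \<and> y \<notin> S"
    then obtain S where S: "S \<in> X" "x \<in> S" "y \<notin> S" by blast
    have "{S \<in> X. x \<notin> S} \<subset> {S \<in> X. y \<notin> S}" using S flag_chain[OF X S(1)] by blast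
    then show "rk x < rk y" unfolding rk_def using finX by (intro psubset_card_mono) auto
  next
    assume L: "rk x < rk y"
    show "\<exists>S\<in>X. x \<in> S \<and> y \<notin> S"
    proof (rule ccontr)
      assume "\<not> (\<exists>S\<in>X. x \<in> S \<and> y \<notin> S)"
      then have "{S \<in> X. y \<notin> S} \<subseteq> {S \<in> X. x \<notin> S}" by blast
      then have "rk y \<le> rk x" unfolding rk_def using finX by (intro card_mono) auto
      then show False using L by simp
    qed
  qed
  have prec: "precedes (inversions n X) x y" if "x \<in> {1..n}" "y \<in> {1..n}" "rk x < rk y \<or> rk x = rk y \<and> x < y" for x y
  proof (cases "x < y")
    case True
    have "\<not> rk y < rk x" using that(3) by linarith
    then have "(x, y) \<notin> inversions n X" using sep[of y x] by (auto simp: inversions_def)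
    then show ?thesis using True by (simp add: precedes_def)
  next
    case False
    then have "rk x < rk y" using that(3) by linarith
    then have S: "\<exists>S\<in>X. x \<in> S \<and> y \<notin> S" using sep[of x y] by blast
    then have "x \<noteq> y" by blast
    then have "y < x" using False by simp
    moreover have "(y, x) \<in> inversions n X" unfolding inversions_def using S that(1,2) \<open>y < x\<close> by simp
    ultimately show ?thesis by (simp add: precedes_def)
  qed
  show ?thesis using c
  proof (induction c)
    case 0
    show ?case by (intro exI[of _ "{}"]) (simp add: initial_def)
  next
    case (Suc c)
    then obtain I where I: "initial n (inversions n X) I" "card I = c" by auto
    have Isub: "I \<subseteq> {1..n}" using I(1) by (simp add: initial_def)
    then have finI: "finite I" using finite_subset by blast
    have "{1..n} - I \<noteq> {}"
    proof
      assume "{1..n} - I = {}"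
      then have "card {1..n} \<le> card I" using finI by (intro card_mono) auto
      then show False using I(2) Suc.prems by simp
    qed
    define r where "r = Min (rk ` ({1..n} - I))"
    have r: "r \<in> rk ` ({1..n} - I)" "\<And>y. y \<in> {1..n} - I \<Longrightarrow> r \<le> rk y"
      unfolding r_def using \<open>{1..n} - I \<noteq> {}\<close> by (intro Min_in Min_le; simp)+
    define M where "M = {y \<in> {1..n} - I. rk y = r}"
    have M: "finite M" "M \<noteq> {}" using r(1) by (auto simp: M_def)
    define m where "m = Min M"
    have m: "m \<in> {1..n}" "m \<notin> I" "rk m = r" using Min_in[OF M] by (auto simp: m_def M_def)
    have least: "m \<le> y" if "y \<in> M" for y using Min_le[OF M(1) that] by (simp add: m_def)
    have "initial n (inversions n X) (insert m I)"
      unfolding initial_def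
    proof (intro conjI ballI)
      show "insert m I \<subseteq> {1..n}" using Isub m by blast
      fix x y assume xy: "x \<in> insert m I" "y \<in> {1..n} - insert m I"
      show "precedes (inversions n X) x y"
      proof (cases "x = m")
        case True
        have "y \<in> {1..n} - I" "y \<noteq> m" using xy(2) by auto
        then have "rk m < rk y \<or> rk m = rk y \<and> m < y"
          using r(2)[of y] m(3) least[of y] by (cases "rk y = r") (auto simp: M_def)
        then show ?thesis using prec[of m y] True m(1) xy(2) by blast
      next
        case False
        then show ?thesis using I(1) xy unfolding initial_def by blast
      qed
    qed
    moreover have "card (insert m I) = Suc c" using finI m(2) I(2) by simp
    ultimately show ?case by blast
  qed
qed

text \<open>Cuts that are not descents stay so when another of them is dropped: a letter between the
  two cuts would otherwise compare in the wrong order with one of its neighbours.\<close>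

lemma inversions_remove_two:
  assumes X: "flag {1..n} X"
    and S: "inversions n (X - {S}) = inversions n X" and T: "inversions n (X - {T}) = inversions n X"
  shows "inversions n (X - {S} - {T}) = inversions n X"
proof -
  have main: "inversions n X \<subseteq> inversions n (X - {S} - {T})"
    if ST: "S \<in> X" "T \<in> X" "S \<subset> T" and S: "inversions n (X - {S}) = inversions n X"
      and T: "inversions n (X - {T}) = inversions n X" for S T
  proof (rule subrelI)
    fix y x assume yx: "(y, x) \<in> inversions n X"
    then have xy: "x \<in> {1..n}" "y \<in> {1..n}" "y < x" by (auto simp: inversions_def)
    show "(y, x) \<in> inversions n (X - {S} - {T})"
    proof (rule ccontr)
      assume "(y, x) \<notin> inversions n (X - {S} - {T})"
      then have only: "U = S \<or> U = T" if "U \<in> X" "x \<in> U" "y \<notin> U" for U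
        using that xy by (auto simp: inversions_def)
      obtain U where "U \<in> X - {S}" "x \<in> U" "y \<notin> U" using yx unfolding S[symmetric] by (auto simp: inversions_def)
      then have yT: "y \<notin> T" using only by blast
      obtain U where "U \<in> X - {T}" "x \<in> U" "y \<notin> U" using yx unfolding T[symmetric] by (auto simp: inversions_def)
      then have xS: "x \<in> S" using only by blast
      obtain z where z: "z \<in> T" "z \<notin> S" using ST(3) by blast
      have zn: "z \<in> {1..n}" using flag_mem[OF X ST(2)] z by blast
      have "(z, x) \<notin> inversions n (X - {S})"
      proof
        assume "(z, x) \<in> inversions n (X - {S})"
        then obtain U where U: "U \<in> X" "U \<noteq> S" "x \<in> U" "z \<notin> U" by (auto simp: inversions_def)
        then have "y \<notin> U" using flag_chain[OF X ST(2) U(1)] z(1) yT by blast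
        then show False using only[OF U(1,3)] U z by blast
      qed
      then have "\<not> z < x" using xS z(2) ST(1) xy zn unfolding S by (auto simp: inversions_def)
      have "(y, z) \<notin> inversions n (X - {T})"
      proof
        assume "(y, z) \<in> inversions n (X - {T})"
        then obtain U where U: "U \<in> X" "U \<noteq> T" "z \<in> U" "y \<notin> U" by (auto simp: inversions_def)
        then have "x \<in> U" using flag_chain[OF X ST(1) U(1)] z(2) xS by blast
        then show False using only[OF U(1)] U z by blast
      qed
      then have "\<not> y < z" using yT z(1) ST(2) xy zn unfolding T by (auto simp: inversions_def)
      then show False using \<open>\<not> z < x\<close> xy(3) by simp
    qed
  qed
  have "inversions n X \<subseteq> inversions n (X - {S} - {T})"
  proof (cases "S \<in> X \<and> T \<in> X \<and> S \<noteq> T")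
    case True
    then consider "S \<subset> T" | "T \<subset> S" using flag_chain[OF X, of S T] by blast
    then show ?thesis
    proof cases
      case 1
      then show ?thesis using main[of S T] True S T by blast
    next
      case 2
      then have "inversions n X \<subseteq> inversions n (X - {T} - {S})" using main[of T S] True S T by blast
      moreover have "X - {T} - {S} = X - {S} - {T}" by blast
      ultimately show ?thesis by simp
    qed
  next
    case False
    then have "X - {S} - {T} = X - {S} \<or> X - {S} - {T} = X - {T}" by blast
    then show ?thesis using S T by auto
  qed
  moreover have "inversions n (X - {S} - {T}) \<subseteq> inversions n X" by (rule inversions_mono) blast
  ultimately show ?thesis by blast
qed

section \<open>The matching\<close>

text \<open>The cuts in \<open>F\<close> that are not descents, as initial segments: adding or dropping one of them
  does not change the permutation, and therefore not this set.\<close>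

definition nondescents :: "nat \<Rightarrow> nat set \<Rightarrow> nat set set \<Rightarrow> nat set set" where
  "nondescents n F X = {I. initial n (inversions n X) I \<and> card I \<in> F \<and> inversions n (X - {I}) = inversions n X}"

definition pivot :: "nat \<Rightarrow> nat set \<Rightarrow> nat set set \<Rightarrow> nat set" where
  "pivot n F X = (SOME I. I \<in> nondescents n F X)"

lemma pivot_mem: "nondescents n F X \<noteq> {} \<Longrightarrow> pivot n F X \<in> nondescents n F X"
  unfolding pivot_def by (rule someI_ex) blast

lemma nondescents_remove:
  assumes X: "flag {1..n} X" and S: "inversions n (X - {S}) = inversions n X"
  shows "nondescents n F (X - {S}) = nondescents n F X"
proof -
  have "inversions n (X - {S} - {I}) = inversions n X \<longleftrightarrow> inversions n (X - {I}) = inversions n X" for I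
  proof
    assume L: "inversions n (X - {S} - {I}) = inversions n X"
    have "inversions n (X - {S} - {I}) \<subseteq> inversions n (X - {I})" "inversions n (X - {I}) \<subseteq> inversions n X"
      by (rule inversions_mono, blast)+
    then show "inversions n (X - {I}) = inversions n X" using L by blast
  qed (rule inversions_remove_two[OF X S])
  then show ?thesis unfolding nondescents_def S by simp
qed

lemma nondescents_insert:
  assumes X: "flag {1..n} X" and F: "F \<subseteq> {0<..<n}" and I: "I \<in> nondescents n F X"
  shows "flag {1..n} (insert I X)" "inversions n (insert I X) = inversions n X"
    "nondescents n F (insert I X) = nondescents n F X"
proof -
  have init: "initial n (inversions n X) I" and cI: "card I \<in> F"
    and rem: "inversions n (X - {I}) = inversions n X" using I by (auto simp: nondescents_def)
  have "I \<noteq> {}" "I \<noteq> {1..n}" using cI F by auto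
  then show flag: "flag {1..n} (insert I X)" using flag_insert_initial[OF X init] by blast
  show inv: "inversions n (insert I X) = inversions n X" by (rule inversions_insert_initial[OF init])
  show "nondescents n F (insert I X) = nondescents n F X"
  proof (cases "I \<in> X")
    case True
    then show ?thesis by (simp add: insert_absorb)
  next
    case False
    then have "insert I X - {I} = X" by blast
    then show ?thesis using nondescents_remove[OF flag, of I F] inv by simp
  qed
qed

lemma nondescents_nonempty:
  assumes X: "flag {1..n} X" and F: "F \<subseteq> {0<..<n}" and c: "card ` X \<subset> F"
  shows "nondescents n F X \<noteq> {}"
proof -
  obtain c where c: "c \<in> F" "c \<notin> card ` X" using c by blast
  have "c \<le> n" using F c(1) by auto
  then obtain I where I: "initial n (inversions n X) I" "card I = c" using initial_exists[OF X] by blast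
  then have "I \<notin> X" using c(2) by blast
  then have "I \<in> nondescents n F X" using I c(1) by (simp add: nondescents_def)
  then show ?thesis by blast
qed

text \<open>Dropping a descent destroys inversions, also after the pivot has been added.\<close>

lemma inversions_descent:
  assumes X: "flag {1..n} X" and F: "F \<subseteq> {0<..<n}" and I: "I \<in> nondescents n F X" "I \<notin> X"
    and S: "S \<in> X" "inversions n (X - {S}) \<noteq> inversions n X"
  shows "inversions n (insert I X - {S}) \<subset> inversions n X"
proof -
  note ins = nondescents_insert[OF X F I(1)]
  have "inversions n (insert I X - {S}) \<subseteq> inversions n (insert I X)" by (rule inversions_mono) blast
  moreover have "inversions n (insert I X - {S}) \<noteq> inversions n (insert I X)"
  proof
    assume "inversions n (insert I X - {S}) = inversions n (insert I X)"
    moreover have "inversions n (insert I X - {I}) = inversions n (insert I X)"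
      using I(2) ins(2) by simp
    ultimately have "inversions n (insert I X - {S} - {I}) = inversions n (insert I X)"
      by (rule inversions_remove_two[OF ins(1)])
    moreover have "insert I X - {S} - {I} = X - {S}" using I(2) by blast
    ultimately show False using S(2) ins(2) by simp
  qed
  ultimately show ?thesis using ins(2) by blast
qed

section \<open>Basis elements as pairs of a decoration and a flag\<close>

definition union_upto :: "'b set list \<Rightarrow> nat \<Rightarrow> 'b set" where
  "union_upto Bs i = \<Union>(set (take i Bs))"

definition flag_of :: "'b set list \<Rightarrow> 'b set set" where
  "flag_of Bs = union_upto Bs ` {1..<length Bs}"

lemma union_upto_Suc: "i < length Bs \<Longrightarrow> union_upto Bs (Suc i) = union_upto Bs i \<union> Bs ! i"
  by (simp add: union_upto_def take_Suc_conv_app_nth Un_commute)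

lemma union_upto_length: "union_upto Bs (length Bs) = \<Union>(set Bs)"
  by (simp add: union_upto_def)

lemma union_upto_0 [simp]: "union_upto Bs 0 = {}"
  by (simp add: union_upto_def)

lemma union_upto_Cons [simp]: "union_upto (B # Bs) (Suc i) = B \<union> union_upto Bs i"
  by (simp add: union_upto_def)

lemma ordered_partitions_lengths: "Bs \<in> ordered_partitions A \<beta> \<Longrightarrow> length Bs = length \<beta>"
  by (auto simp: ordered_partitions_def)

lemma union_upto_card:
  "finite A \<Longrightarrow> Bs \<in> ordered_partitions A \<beta> \<Longrightarrow> i \<le> length \<beta> \<Longrightarrow>
    union_upto Bs i \<subseteq> A \<and> card (union_upto Bs i) = sum_list (take i \<beta>)"
proof (induction \<beta> arbitrary: A Bs i)
  case (Cons b \<beta>)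
  obtain B Cs where B: "Bs = B # Cs" "B \<subseteq> A" "card B = b" "Cs \<in> ordered_partitions (A - B) \<beta>"
    using Cons.prems(2) by (rule ordered_partitions_ConsE)
  show ?case
  proof (cases i)
    case (Suc j)
    have IH: "union_upto Cs j \<subseteq> A - B \<and> card (union_upto Cs j) = sum_list (take j \<beta>)"
      by (rule Cons.IH) (use Cons.prems B(4) Suc in auto)
    have fin: "finite B" "finite (union_upto Cs j)"
      using Cons.prems(1) B(2) IH finite_subset[of _ A] by blast+
    have "B \<inter> union_upto Cs j = {}" using IH by blast
    then have "card (B \<union> union_upto Cs j) = card B + card (union_upto Cs j)" using fin by (rule card_Un_disjoint[rotated 2])
    then show ?thesis using Suc B IH by auto
  qed simp
qed simp

lemma union_upto_mono: "i \<le> j \<Longrightarrow> union_upto Bs i \<subseteq> union_upto Bs j"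
  by (simp add: union_upto_def set_take_subset_set_take Union_mono)

lemma sum_take_strict:
  fixes \<beta> :: "nat list"
  assumes "0 \<notin> set \<beta>" "i < j" "j \<le> length \<beta>"
  shows "sum_list (take i \<beta>) < sum_list (take j \<beta>)"
proof -
  have "take j \<beta> = take i \<beta> @ drop i (take j \<beta>)" using assms(2) by (metis append_take_drop_id min.absorb1 min.commute less_imp_le take_take)
  moreover have "drop i (take j \<beta>) \<noteq> []" using assms by simp
  then have "0 < sum_list (drop i (take j \<beta>))"
  proof (cases "drop i (take j \<beta>)")
    case (Cons x xs)
    then have "x \<in> set \<beta>" by (metis in_set_dropD in_set_takeD list.set_intros(1))
    then have "0 < x" using assms(1) by (metis gr0I)
    then show ?thesis using Cons by simp
  qed simp
  ultimately show ?thesis by (metis add.right_neutral add_strict_left_mono sum_list_append)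
qed

locale partition =
  fixes A :: "'b set" and Bs :: "'b set list" and \<beta> :: "nat list"
  assumes fin: "finite A" and part: "Bs \<in> ordered_partitions A \<beta>" and pos: "0 \<notin> set \<beta>"
begin

lemma len: "length Bs = length \<beta>"
  using ordered_partitions_lengths[OF part] .

lemma upto_card: "i \<le> length Bs \<Longrightarrow> card (union_upto Bs i) = sum_list (take i \<beta>)"
  using union_upto_card[OF fin part] len by simp

lemma upto_sub: "i \<le> length Bs \<Longrightarrow> union_upto Bs i \<subseteq> A"
  using union_upto_card[OF fin part] len by simp

lemma upto_strict: "i < j \<Longrightarrow> j \<le> length Bs \<Longrightarrow> union_upto Bs i \<subset> union_upto Bs j"
proof -
  assume ij: "i < j" "j \<le> length Bs"
  have "card (union_upto Bs i) < card (union_upto Bs j)"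
    using sum_take_strict[OF pos ij(1)] ij len upto_card by simp
  then show ?thesis using union_upto_mono[of i j Bs] ij by (auto simp: psubset_eq)
qed

lemma upto_inj: "i \<le> length Bs \<Longrightarrow> j \<le> length Bs \<Longrightarrow> union_upto Bs i = union_upto Bs j \<longleftrightarrow> i = j"
  using upto_strict[of i j] upto_strict[of j i] by (metis linorder_neqE_nat psubset_eq)

lemma upto_less: "i \<le> length Bs \<Longrightarrow> j \<le> length Bs \<Longrightarrow> union_upto Bs i \<subset> union_upto Bs j \<longleftrightarrow> i < j"
  using upto_strict[of i j] upto_strict[of j i] upto_inj[of i j] by (metis linorder_neqE_nat psubset_eq psubset_trans)

lemma upto_all: "union_upto Bs (length Bs) = A"
  using part by (simp add: union_upto_length ordered_partitions_def)

lemma flag: "flag A (flag_of Bs)"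
  unfolding flag_def
proof (intro conjI ballI)
  fix S assume "S \<in> flag_of Bs"
  then obtain i where i: "S = union_upto Bs i" "1 \<le> i" "i < length Bs" by (auto simp: flag_of_def)
  have "union_upto Bs 0 \<subset> S" "S \<subset> union_upto Bs (length Bs)"
    unfolding i(1) by (rule upto_strict; use i in simp)+
  then show "S \<noteq> {}" "S \<subset> A" using upto_all by auto
  fix T assume "T \<in> flag_of Bs"
  then obtain j where j: "T = union_upto Bs j" by (auto simp: flag_of_def)
  show "S \<subseteq> T \<or> T \<subseteq> S" unfolding i(1) j using union_upto_mono by (metis nat_le_linear)
qed

lemma card_flag: "card (flag_of Bs) = length Bs - 1"
proof -
  have "inj_on (union_upto Bs) {1..<length Bs}" by (rule inj_onI) (simp add: upto_inj)
  then show ?thesis by (simp add: flag_of_def card_image)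
qed

lemma cards_flag: "card ` flag_of Bs = cuts \<beta>"
proof -
  have "card ` flag_of Bs = (\<lambda>i. sum_list (take i \<beta>)) ` {1..<length \<beta>}"
    unfolding flag_of_def image_image using len by (intro image_cong) (auto simp: upto_card)
  then show ?thesis by (auto simp: cuts_def)
qed

lemma sign:
  assumes "Suc i < length Bs"
  shows "flag_sign (flag_of Bs) (union_upto Bs (Suc i)) = ((- 1) ^ i :: 'k::comm_ring_1)"
proof -
  have "{T \<in> flag_of Bs. T \<subset> union_upto Bs (Suc i)} = union_upto Bs ` {1..i}"
  proof -
    have "union_upto Bs j \<subset> union_upto Bs (Suc i) \<longleftrightarrow> j \<le> i" if "j \<in> {1..<length Bs}" for j
      using upto_less[of j "Suc i"] that assms less_Suc_eq_le[of j i] by simp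
    then have "{j \<in> {1..<length Bs}. union_upto Bs j \<subset> union_upto Bs (Suc i)} = {j \<in> {1..<length Bs}. j \<le> i}" by blast
    also have "\<dots> = {1..i}" using assms by auto
    finally have "{j \<in> {1..<length Bs}. union_upto Bs j \<subset> union_upto Bs (Suc i)} = {1..i}" .
    moreover have "{T \<in> flag_of Bs. T \<subset> union_upto Bs (Suc i)}
        = union_upto Bs ` {j \<in> {1..<length Bs}. union_upto Bs j \<subset> union_upto Bs (Suc i)}"
      unfolding flag_of_def by blast
    ultimately show ?thesis by simp
  qed
  moreover have "inj_on (union_upto Bs) {1..i}" using assms by (intro inj_onI) (simp add: upto_inj)
  ultimately show ?thesis by (simp add: flag_sign_def card_image)
qed

end

lemma union_upto_merge:
  assumes "Suc i < length Bs"
  shows "union_upto (merge_at (\<union>) i Bs) j = union_upto Bs (if j \<le> i then j else Suc j)"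
proof (cases "j \<le> i")
  case True
  then show ?thesis using assms by (simp add: union_upto_def merge_at_def min_def)
next
  case False
  then obtain m where m: "j = i + Suc m" by (metis add_Suc_right less_imp_Suc_add not_le_imp_less)
  have "take j (merge_at (\<union>) i Bs) = take i Bs @ (Bs ! i \<union> Bs ! Suc i) # take m (drop (i + 2) Bs)"
    using assms m by (simp add: merge_at_def min_def)
  moreover have "take (Suc j) Bs = take i Bs @ Bs ! i # Bs ! Suc i # take m (drop (i + 2) Bs)"
  proof -
    have "Bs = take i Bs @ Bs ! i # Bs ! Suc i # drop (i + 2) Bs"
      using assms by (metis Cons_nth_drop_Suc Suc_lessD add_2_eq_Suc' append_take_drop_id)
    moreover have "length (take i Bs) = i" using assms by simp
    ultimately show ?thesis using m
      by (metis (no_types, lifting) add_Suc_right append_take_drop_id take_Suc_Cons take_add take_append append_eq_conv_conj diff_add_inverse le_add1 take_all_iff nat_le_linear)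
  qed
  ultimately show ?thesis using False by (simp add: union_upto_def Un_assoc)
qed

lemma length_merge_at: "Suc i < length xs \<Longrightarrow> length (merge_at f i xs) = length xs - 1"
  by (simp add: merge_at_def)

lemma merge_at_Cons [simp]: "merge_at f (Suc i) (x # xs) = x # merge_at f i xs"
  by (simp add: merge_at_def)

lemma merge_at_0 [simp]: "merge_at f 0 (x # y # xs) = f x y # xs"
  by (simp add: merge_at_def)

lemma merge_ordered_partitions:
  assumes "finite A" "Bs \<in> ordered_partitions A \<beta>" "Suc i < length \<beta>"
  shows "merge_at (\<union>) i Bs \<in> ordered_partitions A (merge_at (+) i \<beta>)"
  using assms
proof (induction i arbitrary: A Bs \<beta>)
  case 0
  then obtain b c \<gamma> where \<beta>: "\<beta> = b # c # \<gamma>" by (metis Suc_less_eq2 length_Suc_conv_rev length_Suc_conv less_nat_zero_code list.exhaust list.size(3) length_Cons)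
  obtain B Cs where B: "Bs = B # Cs" "B \<subseteq> A" "card B = b" "Cs \<in> ordered_partitions (A - B) (c # \<gamma>)"
    using 0 unfolding \<beta> by (blast elim: ordered_partitions_ConsE)
  obtain C Ds where C: "Cs = C # Ds" "C \<subseteq> A - B" "card C = c" "Ds \<in> ordered_partitions (A - B - C) \<gamma>"
    using B(4) by (rule ordered_partitions_ConsE)
  have "card (B \<union> C) = b + c" using B C 0(1) finite_subset[of _ A]
    by (subst card_Un_disjoint) blast+
  moreover have "A - B - C = A - (B \<union> C)" by blast
  moreover have "B \<union> C \<subseteq> A" using B C by blast
  ultimately show ?case using B(1) C(1,4) by (simp add: \<beta> ordered_partitions_Cons)
next
  case (Suc i)
  then obtain b \<gamma> where \<beta>: "\<beta> = b # \<gamma>" by (cases \<beta>) auto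
  obtain B Cs where B: "Bs = B # Cs" "B \<subseteq> A" "card B = b" "Cs \<in> ordered_partitions (A - B) \<gamma>"
    using Suc.prems unfolding \<beta> by (blast elim: ordered_partitions_ConsE)
  have "merge_at (\<union>) i Cs \<in> ordered_partitions (A - B) (merge_at (+) i \<gamma>)"
    by (rule Suc.IH) (use Suc.prems B \<beta> in auto)
  then show ?case using B by (simp add: \<beta> ordered_partitions_Cons)
qed

lemma flag_of_merge:
  assumes "finite A" "Bs \<in> ordered_partitions A \<beta>" "0 \<notin> set \<beta>" "Suc i < length Bs"
  shows "flag_of (merge_at (\<union>) i Bs) = flag_of Bs - {union_upto Bs (Suc i)}"
proof -
  interpret partition A Bs \<beta> using assms by unfold_locales
  let ?f = "\<lambda>j. if j \<le> i then j else Suc j"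
  have "flag_of (merge_at (\<union>) i Bs) = (\<lambda>j. union_upto Bs (?f j)) ` {1..<length Bs - 1}"
    using assms(4) by (simp add: flag_of_def length_merge_at union_upto_merge)
  also have "\<dots> = union_upto Bs ` ?f ` {1..<length Bs - 1}" by (simp only: image_image)
  also have "?f ` {1..<length Bs - 1} = {1..<length Bs} - {Suc i}"
  proof (intro subset_antisym subsetI)
    fix k assume k: "k \<in> {1..<length Bs} - {Suc i}"
    show "k \<in> ?f ` {1..<length Bs - 1}"
    proof (cases "k \<le> i")
      case True
      then show ?thesis using k assms(4) by (intro image_eqI[of _ _ k]) auto
    next
      case False
      then show ?thesis using k assms(4) by (intro image_eqI[of _ _ "k - 1"]) auto
    qed
  qed (use assms(4) in auto)
  also have "union_upto Bs ` ({1..<length Bs} - {Suc i}) = flag_of Bs - {union_upto Bs (Suc i)}"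
    using assms(4) upto_inj unfolding flag_of_def
    by (subst inj_on_image_set_diff[of "union_upto Bs" "{1..<length Bs}"]) (auto simp: inj_on_def)
  finally show ?thesis .
qed

lemma flag_of_Cons: "Bs \<noteq> [] \<Longrightarrow> flag_of (B # Bs) = insert B ((\<union>) B ` flag_of Bs)"
proof -
  assume "Bs \<noteq> []"
  then have "{1..<length (B # Bs)} = insert 1 (Suc ` {1..<length Bs})" by (cases Bs) auto
  then show ?thesis unfolding flag_of_def by (simp only: image_insert image_image union_upto_Cons One_nat_def) simp
qed

lemma flag_of_single [simp]: "flag_of [B] = {}"
  by (simp add: flag_of_def)

text \<open>A flag is the flag of partial unions of exactly one ordered set partition into nonempty
  blocks; its smallest member is the first block.\<close>

lemma flag_of_inject:
  assumes "finite A" "Bs \<in> ordered_partitions A \<beta>" "0 \<notin> set \<beta>" "Cs \<in> ordered_partitions A \<gamma>" "0 \<notin> set \<gamma>"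
    "A \<noteq> {}" "flag_of Bs = flag_of Cs"
  shows "Bs = Cs"
  using assms
proof (induction Bs arbitrary: A \<beta> Cs \<gamma>)
  case Nil
  then show ?case by (simp add: ordered_partitions_def)
next
  case (Cons B Bs)
  interpret P: partition A "B # Bs" \<beta> using Cons.prems by unfold_locales
  interpret Q: partition A Cs \<gamma> using Cons.prems by unfold_locales
  have len: "length Cs = length (B # Bs)"
  proof -
    have "Cs \<noteq> []" using Cons.prems(4,6) by (auto simp: ordered_partitions_def)
    then show ?thesis using P.card_flag Q.card_flag Cons.prems(7) by (cases Cs) auto
  qed
  then obtain C Ds where Cs: "Cs = C # Ds" by (cases Cs) auto
  show ?case
  proof (cases "Bs = []")
    case True
    then have "B = A" "C = A" "Ds = []" using P.upto_all Q.upto_all len Cs by (auto simp: union_upto_def)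
    then show ?thesis using True Cs by simp
  next
    case False
    then have Ds: "Ds \<noteq> []" using len Cs by auto
    obtain b \<beta>' where \<beta>: "\<beta> = b # \<beta>'" using P.len by (cases \<beta>) auto
    obtain c \<gamma>' where \<gamma>: "\<gamma> = c # \<gamma>'" using Q.len Cs by (cases \<gamma>) auto
    have B: "B \<subseteq> A" "card B = b" "Bs \<in> ordered_partitions (A - B) \<beta>'"
      and C: "C \<subseteq> A" "card C = c" "Ds \<in> ordered_partitions (A - C) \<gamma>'"
      using Cons.prems(2,4) unfolding \<beta> \<gamma> Cs by (simp_all add: ordered_partitions_Cons)
    have subA: "S \<subseteq> A - B" if "S \<in> flag_of Bs" for S
      using that partition.flag[of "A - B" Bs \<beta>'] B(3) Cons.prems(1,3) \<beta>
      by (auto simp: partition_def flag_def)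
    have subC: "S \<subseteq> A - C" if "S \<in> flag_of Ds" for S
      using that partition.flag[of "A - C" Ds \<gamma>'] C(3) Cons.prems(1,5) \<gamma>
      by (auto simp: partition_def flag_def)
    have nonB: "{} \<notin> flag_of Bs"
      using partition.flag[of "A - B" Bs \<beta>'] B(3) Cons.prems(1,3) \<beta> by (auto simp: partition_def flag_def)
    have nonC: "{} \<notin> flag_of Ds"
      using partition.flag[of "A - C" Ds \<gamma>'] C(3) Cons.prems(1,5) \<gamma> by (auto simp: partition_def flag_def)
    have fl: "insert B ((\<union>) B ` flag_of Bs) = insert C ((\<union>) C ` flag_of Ds)"
      using Cons.prems(7) False Ds by (simp add: flag_of_Cons Cs)
    have BC: "B = C"
    proof
      have "C \<in> insert B ((\<union>) B ` flag_of Bs)" unfolding fl by blast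
      then show "B \<subseteq> C" by blast
      have "B \<in> insert C ((\<union>) C ` flag_of Ds)" unfolding fl[symmetric] by blast
      then show "C \<subseteq> B" by blast
    qed
    have "(\<union>) B ` flag_of Bs = insert B ((\<union>) B ` flag_of Bs) - {B}"
    proof -
      have "B \<union> S \<noteq> B" if S: "S \<in> flag_of Bs" for S
      proof -
        have "S \<noteq> {}" using nonB S by metis
        then show ?thesis using subA[OF S] by blast
      qed
      then show ?thesis by auto
    qed
    also have "\<dots> = insert C ((\<union>) C ` flag_of Ds) - {C}" unfolding fl unfolding BC ..
    also have "\<dots> = (\<union>) C ` flag_of Ds"
    proof -
      have "C \<union> S \<noteq> C" if S: "S \<in> flag_of Ds" for S
      proof -
        have "S \<noteq> {}" using nonC S by metis
        then show ?thesis using subC[OF S] by blast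
      qed
      then show ?thesis by auto
    qed
    finally have im: "(\<union>) B ` flag_of Bs = (\<union>) B ` flag_of Ds" unfolding BC .
    have cancel: "(\<lambda>S. S - B) ` (\<union>) B ` Y = Y" if "\<And>S. S \<in> Y \<Longrightarrow> S \<subseteq> A - B" for Y
    proof -
      have "(\<lambda>S. (B \<union> S) - B) ` Y = (\<lambda>S. S) ` Y" using that by (intro image_cong refl) blast
      then show ?thesis by (simp add: image_image)
    qed
    have "flag_of Bs = flag_of Ds"
      using cancel[of "flag_of Bs"] cancel[of "flag_of Ds"] subA subC im BC by metis
    moreover have "A - B \<noteq> {}"
    proof
      assume "A - B = {}"
      then have "\<Union>(set Bs) = {}" using B(3) by (auto simp: ordered_partitions_def)
      then have "hd Bs = {}" using False by (metis Sup_bot_conv(1) hd_in_set)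
      then have "0 \<in> set \<beta>'" using B(3) False unfolding ordered_partitions_def
        by (metis (mono_tags, lifting) card.empty hd_in_set hd_map list.map_disc_iff mem_Collect_eq)
      then show False using Cons.prems(3) \<beta> by simp
    qed
    ultimately have "Bs = Ds"
      using Cons.IH[of "A - B" \<beta>' Ds \<gamma>'] B(3) C(3) BC Cons.prems(1,3,5) \<beta> \<gamma> by simp
    then show ?thesis using BC Cs by simp
  qed
qed

lemma flag_of_surj:
  assumes "finite A" "A \<noteq> {}" "flag A X"
  shows "\<exists>\<beta>. \<exists>Bs\<in>ordered_partitions A \<beta>. 0 \<notin> set \<beta> \<and> flag_of Bs = X"
  using assms
proof (induction "card X" arbitrary: A X)
  case 0
  then have "X = {}" using flag_finite[OF 0(2,4)] by simp
  moreover have "[A] \<in> ordered_partitions A [card A]" by (simp add: ordered_partitions_def)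
  moreover have "0 \<notin> set [card A]" using 0 by simp
  ultimately show ?case using flag_of_single by metis
next
  case (Suc k)
  have finX: "finite X" using flag_finite[OF Suc(3,5)] .
  have "X \<noteq> {}" using Suc(2) by auto
  then obtain B where B: "B \<in> X" "\<And>S. S \<in> X \<Longrightarrow> S \<subseteq> B \<Longrightarrow> S = B"
    using finite_has_minimal[OF finX] by metis
  then have min: "B \<subseteq> S" if "S \<in> X" for S using flag_chain[OF Suc(5) B(1) that] that by blast
  have BA: "B \<noteq> {}" "B \<subset> A" using flag_mem[OF Suc(5) B(1)] by auto
  define Y where "Y = (\<lambda>S. S - B) ` (X - {B})"
  have inj: "inj_on (\<lambda>S. S - B) (X - {B})" using min by (intro inj_onI) (metis Diff_iff Diff_partition)
  have "k = card Y" unfolding Y_def using Suc(2) B(1) finX by (simp add: card_image[OF inj])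
  moreover have "finite (A - B)" "A - B \<noteq> {}" using Suc(3) BA by auto
  moreover have "flag (A - B) Y" unfolding flag_def
  proof (intro conjI ballI)
    fix S assume "S \<in> Y"
    then obtain S' where S': "S = S' - B" "S' \<in> X" "S' \<noteq> B" by (auto simp: Y_def)
    then show "S \<noteq> {}" using B(2) by blast
    show "S \<subset> A - B" using S' flag_mem[OF Suc(5) S'(2)] BA(2) min[OF S'(2)] by blast
    fix T assume "T \<in> Y"
    then obtain T' where T': "T = T' - B" "T' \<in> X" by (auto simp: Y_def)
    then show "S \<subseteq> T \<or> T \<subseteq> S" using flag_chain[OF Suc(5) S'(2) T'(2)] S'(1) by blast
  qed
  ultimately obtain \<beta> Bs where Bs: "Bs \<in> ordered_partitions (A - B) \<beta>" "0 \<notin> set \<beta>" "flag_of Bs = Y"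
    using Suc(1)[of Y "A - B"] by blast
  have ne: "Bs \<noteq> []" using Bs(1) \<open>A - B \<noteq> {}\<close> by (auto simp: ordered_partitions_def)
  have "B # Bs \<in> ordered_partitions A (card B # \<beta>)" using Bs(1) BA by (simp add: ordered_partitions_Cons)
  moreover have "0 \<notin> set (card B # \<beta>)" using Bs(2) BA Suc(3) finite_subset[of B A] by auto
  moreover have "flag_of (B # Bs) = X"
  proof -
    have "(\<lambda>S. B \<union> (S - B)) ` (X - {B}) = (\<lambda>S. S) ` (X - {B})"
      using min by (intro image_cong refl) blast
    then have "(\<union>) B ` Y = X - {B}" unfolding Y_def by (simp add: image_image)
    then show ?thesis using flag_of_Cons[OF ne] Bs(3) B(1) by (simp add: insert_absorb)
  qed
  ultimately show ?case by blast
qed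

lemma mem_basis:
  "b \<in> basis (zigzag n) k \<longleftrightarrow> (\<exists>\<beta>\<in>coarsenings (zigzag n). length \<beta> = k \<and>
     fst b \<in> ordered_partitions {1..n} \<beta> \<and> list_all2 (\<lambda>\<xi> b. \<xi> \<in> decorations b) (snd b) \<beta>)"
  unfolding basis_def sum_zigzag osp_eq list_all2_conv_all_nth by (cases b) fastforce

lemma coarsenings_pos: "\<beta> \<in> coarsenings (zigzag n) \<Longrightarrow> 0 \<notin> set \<beta>"
  by (simp add: coarsenings_zigzag compositions_def)

lemma coarsenings_sum: "\<beta> \<in> coarsenings (zigzag n) \<Longrightarrow> sum_list \<beta> = n"
  by (simp add: coarsenings_zigzag compositions_def)

lemma basisE:
  assumes "b \<in> basis (zigzag n) k"
  obtains \<beta> where "\<beta> \<in> coarsenings (zigzag n)" "length \<beta> = k" "map card (fst b) = \<beta>"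
    "list_all2 (\<lambda>\<xi> b. \<xi> \<in> decorations b) (snd b) \<beta>" "partition {1..n} (fst b) \<beta>"
proof -
  obtain \<beta> where \<beta>: "\<beta> \<in> coarsenings (zigzag n)" "length \<beta> = k"
     "fst b \<in> ordered_partitions {1..n} \<beta>" "list_all2 (\<lambda>\<xi> b. \<xi> \<in> decorations b) (snd b) \<beta>"
    using assms unfolding mem_basis by blast
  moreover have "map card (fst b) = \<beta>" using \<beta>(3) by (simp add: ordered_partitions_def)
  moreover have "partition {1..n} (fst b) \<beta>" using \<beta>(3) coarsenings_pos[OF \<beta>(1)] by unfold_locales auto
  ultimately show ?thesis using that by blast
qed

definition flag_index :: "nat \<Rightarrow> (decoration \<times> nat set set) set" where
  "flag_index n = {(\<theta>, X). \<theta> \<in> decorations n \<and> flag {1..n} X \<and> card ` X \<subseteq> factorization_cuts n \<theta>}"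

lemma basis_flag_index:
  assumes n: "0 < n" and b: "b \<in> basis (zigzag n) k"
  shows "(total_decoration b, flag_of (fst b)) \<in> flag_index n" "k = Suc (card (flag_of (fst b)))"
proof -
  obtain \<beta> where \<beta>: "\<beta> \<in> coarsenings (zigzag n)" "length \<beta> = k" "map card (fst b) = \<beta>"
    "list_all2 (\<lambda>\<xi> b. \<xi> \<in> decorations b) (snd b) \<beta>" "partition {1..n} (fst b) \<beta>"
    using b by (rule basisE)
  interpret partition "{1..n}" "fst b" \<beta> by fact
  have "total_decoration b \<in> {\<theta> \<in> decorations n. cuts \<beta> \<subseteq> factorization_cuts n \<theta>}"
    using bij_betw_apply[OF total_decoration_bij[OF \<beta>(1) n], of "snd b"] \<beta>(3,4)
    by (simp add: total_decoration_def)
  then show "(total_decoration b, flag_of (fst b)) \<in> flag_index n"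
    using flag cards_flag by (simp add: flag_index_def)
  have "\<beta> \<noteq> []" using coarsenings_sum[OF \<beta>(1)] n by auto
  then show "k = Suc (card (flag_of (fst b)))" using card_flag len \<beta>(2) by (cases \<beta>) auto
qed

lemma basis_inject:
  assumes n: "0 < n" and b: "b \<in> basis (zigzag n) k" and c: "c \<in> basis (zigzag n) l"
    and eq: "total_decoration b = total_decoration c" "flag_of (fst b) = flag_of (fst c)"
  shows "b = c"
proof -
  obtain \<beta> where \<beta>: "\<beta> \<in> coarsenings (zigzag n)" "length \<beta> = k" "map card (fst b) = \<beta>"
    "list_all2 (\<lambda>\<xi> b. \<xi> \<in> decorations b) (snd b) \<beta>" "partition {1..n} (fst b) \<beta>"
    using b by (rule basisE)
  obtain \<gamma> where \<gamma>: "\<gamma> \<in> coarsenings (zigzag n)" "length \<gamma> = l" "map card (fst c) = \<gamma>"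
    "list_all2 (\<lambda>\<xi> b. \<xi> \<in> decorations b) (snd c) \<gamma>" "partition {1..n} (fst c) \<gamma>"
    using c by (rule basisE)
  have fst: "fst b = fst c"
    by (rule flag_of_inject[of "{1..n}" _ \<beta> _ \<gamma>]) (use \<beta>(5) \<gamma>(5) n eq in \<open>auto simp: partition_def\<close>)
  then have "\<beta> = \<gamma>" using \<beta>(3) \<gamma>(3) by simp
  moreover have "total_decoration_of \<beta> (snd b) = total_decoration_of \<beta> (snd c)"
    using eq(1) \<beta>(3) \<gamma>(3) \<open>\<beta> = \<gamma>\<close> by (simp add: total_decoration_def)
  ultimately have "snd b = snd c"
    using bij_betw_imp_inj_on[OF total_decoration_bij[OF \<beta>(1) n]] \<beta>(4) \<gamma>(4) by (simp add: inj_on_def)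
  then show ?thesis using fst by (simp add: prod_eq_iff)
qed

lemma basis_exists:
  assumes n: "0 < n" and i: "(\<theta>, X) \<in> flag_index n"
  shows "\<exists>b\<in>basis (zigzag n) (Suc (card X)). total_decoration b = \<theta> \<and> flag_of (fst b) = X"
proof -
  have X: "flag {1..n} X" "card ` X \<subseteq> factorization_cuts n \<theta>" and \<theta>: "\<theta> \<in> decorations n"
    using i by (auto simp: flag_index_def)
  obtain \<beta> Bs where Bs: "Bs \<in> ordered_partitions {1..n} \<beta>" "0 \<notin> set \<beta>" "flag_of Bs = X"
    using flag_of_surj[OF _ _ X(1)] n by auto
  interpret partition "{1..n}" Bs \<beta> using Bs by unfold_locales auto
  have cuts: "cuts \<beta> \<subseteq> factorization_cuts n \<theta>" using cards_flag Bs(3) X(2) by simp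
  have "sum_list \<beta> = n" using upto_card[of "length Bs"] upto_all len by simp
  then have \<beta>: "\<beta> \<in> coarsenings (zigzag n)"
    using Bs(2) cuts by (auto simp: coarsenings_def compositions_def factorization_cuts_def)
  obtain \<xi>s where \<xi>s: "list_all2 (\<lambda>\<xi> b. \<xi> \<in> decorations b) \<xi>s \<beta>" "total_decoration_of \<beta> \<xi>s = \<theta>"
    using bij_betw_imp_surj_on[OF total_decoration_bij[OF \<beta> n]] \<theta> cuts by (metis (mono_tags, lifting) imageE mem_Collect_eq)
  have "length \<beta> = Suc (card X)"
  proof -
    have "\<beta> \<noteq> []" using \<open>sum_list \<beta> = n\<close> n by auto
    then show ?thesis using card_flag Bs(3) len by (cases \<beta>) auto
  qed
  then have "(Bs, \<xi>s) \<in> basis (zigzag n) (Suc (card X))" using \<beta> Bs(1) \<xi>s(1) by (auto simp: mem_basis)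
  moreover have "map card Bs = \<beta>" using Bs(1) by (simp add: ordered_partitions_def)
  ultimately show ?thesis using \<xi>s(2) Bs(3) by (intro bexI[of _ "(Bs, \<xi>s)"]) (auto simp: total_decoration_def)
qed

definition elt :: "nat \<Rightarrow> decoration \<Rightarrow> nat set set \<Rightarrow> basis_elt" where
  "elt n \<theta> X = (THE b. b \<in> basis (zigzag n) (Suc (card X)) \<and> total_decoration b = \<theta> \<and> flag_of (fst b) = X)"

lemma elt:
  assumes "0 < n" "(\<theta>, X) \<in> flag_index n"
  shows "elt n \<theta> X \<in> basis (zigzag n) (Suc (card X))" "total_decoration (elt n \<theta> X) = \<theta>"
    "flag_of (fst (elt n \<theta> X)) = X"
proof -
  have "\<exists>!b. b \<in> basis (zigzag n) (Suc (card X)) \<and> total_decoration b = \<theta> \<and> flag_of (fst b) = X"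
    using basis_exists[OF assms] basis_inject[OF assms(1)] by metis
  from theI'[OF this] show "elt n \<theta> X \<in> basis (zigzag n) (Suc (card X))" "total_decoration (elt n \<theta> X) = \<theta>"
    "flag_of (fst (elt n \<theta> X)) = X" unfolding elt_def by auto
qed

lemma elt_eq:
  assumes "0 < n" "b \<in> basis (zigzag n) k" "total_decoration b = \<theta>" "flag_of (fst b) = X"
  shows "elt n \<theta> X = b"
proof -
  have i: "(\<theta>, X) \<in> flag_index n" using basis_flag_index[OF assms(1,2)] assms(3,4) by simp
  show ?thesis using basis_inject[OF assms(1) elt(1)[OF assms(1) i] assms(2)] elt(2,3)[OF assms(1) i] assms(3,4) by simp
qed

lemma merge_decorations:
  assumes "\<beta> \<in> coarsenings (zigzag n)" "Suc i < length \<beta>" "list_all2 (\<lambda>\<xi> b. \<xi> \<in> decorations b) \<xi>s \<beta>"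
  shows "even (\<beta> ! i) \<and> merge_at (+) i \<beta> \<in> coarsenings (zigzag n) \<and>
    list_all2 (\<lambda>\<xi> b. \<xi> \<in> decorations b) (merge_at (diamond (\<beta> ! i) (\<beta> ! Suc i)) i \<xi>s) (merge_at (+) i \<beta>) \<and>
    total_decoration_of (merge_at (+) i \<beta>) (merge_at (diamond (\<beta> ! i) (\<beta> ! Suc i)) i \<xi>s) = total_decoration_of \<beta> \<xi>s"
  using assms
proof (induction i arbitrary: n \<beta> \<xi>s)
  case 0
  then obtain b c \<gamma> where \<beta>: "\<beta> = b # c # \<gamma>"
    by (cases \<beta>; cases "tl \<beta>") auto
  obtain \<xi> \<eta> \<zeta>s where \<xi>s: "\<xi>s = \<xi> # \<eta> # \<zeta>s" "\<xi> \<in> decorations b" "\<eta> \<in> decorations c"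
    "list_all2 (\<lambda>\<xi> b. \<xi> \<in> decorations b) \<zeta>s \<gamma>"
    using 0(3) unfolding \<beta> by (auto simp: list_all2_Cons2)
  have b: "0 < b" "even b" "b \<le> n" and c\<gamma>: "c # \<gamma> \<in> coarsenings (zigzag (n - b))"
    using 0(1) unfolding \<beta> by (simp_all add: coarsenings_zigzag_Cons)
  have d: "diamond b c \<xi> \<eta> \<in> decorations (b + c)" using diamond_decorations[OF b(2) \<xi>s(2,3)] .
  show ?case
  proof (cases "\<gamma> = []")
    case True
    then have "n = b + c" using coarsenings_sum[OF 0(1)] \<beta> by simp
    then have "[b + c] \<in> coarsenings (zigzag n)" using b(1) by (simp add: coarsenings_zigzag Cons_compositions)
    then show ?thesis using True \<beta> \<xi>s b d by simp
  next
    case False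
    have c: "0 < c" "even c" "c \<le> n - b" and \<gamma>: "\<gamma> \<in> coarsenings (zigzag (n - b - c))"
      using c\<gamma> False by (simp_all add: coarsenings_zigzag_Cons)
    have sum: "sum_list \<gamma> = n - b - c" using coarsenings_sum[OF \<gamma>] .
    have pos: "0 < n - b - c"
    proof (rule ccontr)
      assume "\<not> 0 < n - b - c"
      then have "n - b - c = 0" by blast
      then have "\<gamma> \<in> compositions 0" using \<gamma> by (simp only: coarsenings_zigzag mem_Collect_eq)
      then show False using False by simp
    qed
    have T: "total_decoration_of \<gamma> \<zeta>s \<in> decorations (n - b - c)"
      using bij_betw_apply[OF total_decoration_bij[OF \<gamma> pos], of \<zeta>s] \<xi>s(4) by simp
    have "(b + c) # \<gamma> \<in> coarsenings (zigzag n)"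
      using b c \<gamma> False by (simp add: coarsenings_zigzag_Cons diff_diff_eq)
    moreover have "total_decoration_of ((b + c) # \<gamma>) (diamond b c \<xi> \<eta> # \<zeta>s) = total_decoration_of \<beta> \<xi>s"
      using diamond_assoc[OF b(2) c(2) \<xi>s(2,3) T] list_all2_lengthD[OF \<xi>s(4)] sum False
      by (simp add: \<beta> \<xi>s(1) total_decoration_of_Cons)
    ultimately show ?thesis using \<beta> \<xi>s b d by simp
  qed
next
  case (Suc i)
  then obtain b \<gamma> where \<beta>: "\<beta> = b # \<gamma>" by (cases \<beta>) auto
  obtain \<xi> \<zeta>s where \<xi>s: "\<xi>s = \<xi> # \<zeta>s" "\<xi> \<in> decorations b" "list_all2 (\<lambda>\<xi> b. \<xi> \<in> decorations b) \<zeta>s \<gamma>"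
    using Suc.prems(3) unfolding \<beta> by (auto simp: list_all2_Cons2)
  have \<gamma>ne: "\<gamma> \<noteq> []" using Suc.prems(2) \<beta> by auto
  have b: "0 < b" "even b" "b \<le> n" and \<gamma>: "\<gamma> \<in> coarsenings (zigzag (n - b))"
    using Suc.prems(1) \<gamma>ne unfolding \<beta> by (simp_all add: coarsenings_zigzag_Cons)
  let ?\<gamma> = "merge_at (+) i \<gamma>" and ?\<zeta>s = "merge_at (diamond (\<gamma> ! i) (\<gamma> ! Suc i)) i \<zeta>s"
  have IH: "even (\<gamma> ! i)" "?\<gamma> \<in> coarsenings (zigzag (n - b))" "list_all2 (\<lambda>\<xi> b. \<xi> \<in> decorations b) ?\<zeta>s ?\<gamma>"
    "total_decoration_of ?\<gamma> ?\<zeta>s = total_decoration_of \<gamma> \<zeta>s"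
    using Suc.IH[OF \<gamma> _ \<xi>s(3)] Suc.prems(2) \<beta> by auto
  have ne: "?\<gamma> \<noteq> []" by (simp add: merge_at_def)
  have "sum_list ?\<gamma> = sum_list \<gamma>" using coarsenings_sum[OF IH(2)] coarsenings_sum[OF \<gamma>] by simp
  then have "total_decoration_of (b # ?\<gamma>) (\<xi> # ?\<zeta>s) = total_decoration_of (b # \<gamma>) (\<xi> # \<zeta>s)"
    using total_decoration_of_Cons[OF ne] total_decoration_of_Cons[OF \<gamma>ne] IH(4)
      list_all2_lengthD[OF IH(3)] list_all2_lengthD[OF \<xi>s(3)] by simp
  moreover have "b # ?\<gamma> \<in> coarsenings (zigzag n)" using b IH(2) ne by (simp add: coarsenings_zigzag_Cons)
  ultimately show ?case using IH(1,3) \<xi>s(1,2) by (simp add: \<beta>)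
qed

text \<open>In terms of flags, merging two neighbouring blocks deletes a member of the flag and keeps
  the total decoration, by associativity.\<close>

lemma boundary_basis_flag:
  assumes n: "0 < n" and b: "b \<in> basis (zigzag n) k"
  shows "(boundary_basis b :: 'k::field chain) = (\<Sum>S\<in>flag_of (fst b). scale_fs (flag_sign (flag_of (fst b)) S)
    (Poly_Mapping.single (elt n (total_decoration b) (flag_of (fst b) - {S})) 1))"
proof -
  obtain \<beta> where \<beta>: "\<beta> \<in> coarsenings (zigzag n)" "length \<beta> = k" "map card (fst b) = \<beta>"
    "list_all2 (\<lambda>\<xi> b. \<xi> \<in> decorations b) (snd b) \<beta>" "partition {1..n} (fst b) \<beta>"
    using b by (rule basisE)
  interpret partition "{1..n}" "fst b" \<beta> by fact
  let ?X = "flag_of (fst b)" and ?\<theta> = "total_decoration b"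
  have face: "(face i b :: 'k chain) = Poly_Mapping.single (elt n ?\<theta> (?X - {union_upto (fst b) (Suc i)})) 1"
    if i: "Suc i < length (fst b)" for i
  proof -
    note M = merge_decorations[OF \<beta>(1) _ \<beta>(4), of i]
    have il: "Suc i < length \<beta>" using i len by simp
    have card: "card (fst b ! i) = \<beta> ! i" "card (fst b ! Suc i) = \<beta> ! Suc i"
      using i \<beta>(3) by (metis Suc_lessD nth_map, metis nth_map)
    let ?b = "(merge_at (\<union>) i (fst b), merge_at (diamond (\<beta> ! i) (\<beta> ! Suc i)) i (snd b))"
    have part': "merge_at (\<union>) i (fst b) \<in> ordered_partitions {1..n} (merge_at (+) i \<beta>)"
      using merge_ordered_partitions[OF fin part il] .
    then have "?b \<in> basis (zigzag n) (length (merge_at (+) i \<beta>))" using M il by (auto simp: mem_basis)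
    moreover have "total_decoration ?b = ?\<theta>"
      using part' M il \<beta>(3) by (simp add: total_decoration_def ordered_partitions_def)
    moreover have "flag_of (fst ?b) = ?X - {union_upto (fst b) (Suc i)}"
      using flag_of_merge[OF fin part pos i] by simp
    ultimately have "elt n ?\<theta> (?X - {union_upto (fst b) (Suc i)}) = ?b" by (rule elt_eq[OF n])
    moreover have "face i b = (Poly_Mapping.single ?b 1 :: 'k chain)"
      using M il by (simp add: face_def card Let_def)
    ultimately show ?thesis by simp
  qed
  have "(boundary_basis b :: 'k chain) = (\<Sum>i<length (fst b) - 1. scale_fs (flag_sign ?X (union_upto (fst b) (Suc i)))
      (Poly_Mapping.single (elt n ?\<theta> (?X - {union_upto (fst b) (Suc i)})) 1))"
    unfolding boundary_basis_def by (rule sum.cong[OF refl]) (simp add: face sign)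
  also have "\<dots> = (\<Sum>S\<in>(\<lambda>i. union_upto (fst b) (Suc i)) ` {..<length (fst b) - 1}. scale_fs (flag_sign ?X S)
      (Poly_Mapping.single (elt n ?\<theta> (?X - {S})) 1))"
    by (subst sum.reindex) (auto intro!: inj_onI simp: upto_inj)
  also have "(\<lambda>i. union_upto (fst b) (Suc i)) ` {..<length (fst b) - 1} = ?X"
  proof -
    have "Suc ` {..<length (fst b) - 1} = {1..<length (fst b)}"
      by (cases "length (fst b)") (simp_all only: lessThan_atLeast0 image_Suc_atLeastLessThan, auto)
    then show ?thesis unfolding flag_of_def by (metis image_image)
  qed
  finally show ?thesis .
qed

lemma act_basis_flag:
  assumes n: "0 < n" and b: "b \<in> basis (zigzag n) k" and w: "w permutes {1..n}"
  shows "(map ((`) w) (fst b), snd b) \<in> basis (zigzag n) k"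
    "total_decoration (map ((`) w) (fst b), snd b) = total_decoration b"
    "flag_of (map ((`) w) (fst b)) = (`) w ` flag_of (fst b)"
proof -
  have inj: "inj_on w S" for S using permutes_inj_on[OF w] .
  have card: "map card (map ((`) w) (fst b)) = map card (fst b)" by (simp add: card_image[OF inj])
  obtain \<beta> where \<beta>: "\<beta> \<in> coarsenings (zigzag n)" "length \<beta> = k" "map card (fst b) = \<beta>"
    "list_all2 (\<lambda>\<xi> b. \<xi> \<in> decorations b) (snd b) \<beta>" "partition {1..n} (fst b) \<beta>"
    using b by (rule basisE)
  interpret partition "{1..n}" "fst b" \<beta> by fact
  have un: "\<Union>(set (map ((`) w) Bs)) = w ` \<Union>(set Bs)" for Bs by auto
  have "map ((`) w) (fst b) \<in> ordered_partitions {1..n} \<beta>"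
    unfolding ordered_partitions_def mem_Collect_eq
  proof (intro conjI)
    show "map card (map ((`) w) (fst b)) = \<beta>" using card \<beta>(3) by simp
    show "\<Union>(set (map ((`) w) (fst b))) = {1..n}"
      unfolding un using part permutes_image[OF w] by (simp add: ordered_partitions_def)
    show "\<forall>i<length (map ((`) w) (fst b)). \<forall>j<length (map ((`) w) (fst b)). i \<noteq> j \<longrightarrow>
        map ((`) w) (fst b) ! i \<inter> map ((`) w) (fst b) ! j = {}"
      using part by (auto simp: ordered_partitions_def image_Int[OF permutes_inj[OF w], symmetric])
  qed
  then show "(map ((`) w) (fst b), snd b) \<in> basis (zigzag n) k" using \<beta> by (auto simp: mem_basis)
  show "total_decoration (map ((`) w) (fst b), snd b) = total_decoration b"
    by (simp only: total_decoration_def fst_conv snd_conv card)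
  have "union_upto (map ((`) w) (fst b)) i = w ` union_upto (fst b) i" for i
    by (simp add: union_upto_def take_map un image_Union)
  then show "flag_of (map ((`) w) (fst b)) = (`) w ` flag_of (fst b)"
    by (simp add: flag_of_def image_image)
qed

lemma bideg_total:
  assumes n: "0 < n" and b: "b \<in> basis (zigzag n) k"
  shows "bideg b = (deg_t n (total_decoration b), deg_q n (total_decoration b))"
proof -
  have main: "sum_list (map2 deg_t \<beta> \<xi>s) = deg_t n (total_decoration_of \<beta> \<xi>s) \<and>
      sum_list (map2 deg_q \<beta> \<xi>s) = deg_q n (total_decoration_of \<beta> \<xi>s)"
    if "\<beta> \<in> coarsenings (zigzag n)" "list_all2 (\<lambda>\<xi> b. \<xi> \<in> decorations b) \<xi>s \<beta>" "0 < n" for \<beta> \<xi>s n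
    using that
  proof (induction \<beta> arbitrary: \<xi>s n)
    case Nil
    then show ?case by (simp add: coarsenings_zigzag)
  next
    case (Cons b \<beta>)
    obtain \<xi> \<eta>s where \<xi>s: "\<xi>s = \<xi> # \<eta>s" "\<xi> \<in> decorations b" "list_all2 (\<lambda>\<xi> b. \<xi> \<in> decorations b) \<eta>s \<beta>"
      using Cons.prems(2) by (auto simp: list_all2_Cons2)
    show ?case
    proof (cases "\<beta> = []")
      case True
      then show ?thesis using \<xi>s coarsenings_sum[OF Cons.prems(1)] by simp
    next
      case False
      have b: "even b" "b \<le> n" and \<beta>: "\<beta> \<in> coarsenings (zigzag (n - b))"
        using Cons.prems(1) False by (simp_all add: coarsenings_zigzag_Cons)
      have pos: "0 < n - b"
      proof (rule ccontr)
        assume "\<not> 0 < n - b"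
        then have "n - b = 0" by blast
        then have "\<beta> \<in> compositions 0" using \<beta> by (simp only: coarsenings_zigzag mem_Collect_eq)
        then show False using False by simp
      qed
      have T: "total_decoration_of \<beta> \<eta>s \<in> decorations (n - b)"
        using bij_betw_apply[OF total_decoration_bij[OF \<beta> pos], of \<eta>s] \<xi>s(3) by simp
      show ?thesis using Cons.IH[OF \<beta> \<xi>s(3) pos] deg_q_diamond[OF b(1) \<xi>s(2) T] b(2)
        total_decoration_of_Cons[OF False list_all2_lengthD[OF \<xi>s(3)]] coarsenings_sum[OF \<beta>]
        by (simp add: \<xi>s(1))
    qed
  qed
  obtain \<beta> where \<beta>: "\<beta> \<in> coarsenings (zigzag n)" "map card (fst b) = \<beta>"
    "list_all2 (\<lambda>\<xi> b. \<xi> \<in> decorations b) (snd b) \<beta>"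
    using b by (rule basisE)
  show ?thesis using main[OF \<beta>(1,3) n] by (simp add: bideg_def total_decoration_def \<beta>(2))
qed

lemma finite_basis [simp]: "finite (basis (zigzag n) k)"
proof -
  let ?L = "{\<xi>s. set \<xi>s \<subseteq> (\<Union>m\<le>n. decorations m) \<and> length \<xi>s = k}"
  have "basis (zigzag n) k \<subseteq> (\<Union>\<beta>\<in>coarsenings (zigzag n). ordered_partitions {1..n} \<beta>) \<times> ?L"
  proof
    fix b assume "b \<in> basis (zigzag n) k"
    then obtain \<beta> where \<beta>: "\<beta> \<in> coarsenings (zigzag n)" "length \<beta> = k"
      "list_all2 (\<lambda>\<xi> b. \<xi> \<in> decorations b) (snd b) \<beta>" "partition {1..n} (fst b) \<beta>" by (rule basisE)
    have "set (snd b) \<subseteq> (\<Union>m\<le>n. decorations m)"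
    proof
      fix \<xi> assume "\<xi> \<in> set (snd b)"
      then obtain i where i: "i < length (snd b)" "\<xi> = snd b ! i" by (metis in_set_conv_nth)
      then have "\<xi> \<in> decorations (\<beta> ! i)" "i < length \<beta>" using \<beta>(3) by (auto simp: list_all2_conv_all_nth)
      moreover have "\<beta> ! i \<le> n" using member_le_sum_list[of "\<beta> ! i" \<beta>] coarsenings_sum[OF \<beta>(1)] \<open>i < length \<beta>\<close> by simp
      ultimately show "\<xi> \<in> (\<Union>m\<le>n. decorations m)" by blast
    qed
    then show "b \<in> (\<Union>\<beta>\<in>coarsenings (zigzag n). ordered_partitions {1..n} \<beta>) \<times> ?L"
      using \<beta> list_all2_lengthD[OF \<beta>(3)] by (cases b) (auto simp: partition_def)
  qed
  moreover have "finite ?L" by (rule finite_lists_length_eq) simp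
  ultimately show ?thesis using finite_ordered_partitions[of "{1..n}"]
    by (meson finite_SigmaI finite_UN_I finite_atLeastAtMost finite_coarsenings finite_subset)
qed

section \<open>Linear extensions\<close>

lemma lin_ext_sum:
  assumes "finite S" "Poly_Mapping.keys x \<subseteq> S"
  shows "lin_ext f x = (\<Sum>b\<in>S. scale_fs (Poly_Mapping.lookup x b) (f b))"
  unfolding lin_ext_def by (rule sum.mono_neutral_left) (use assms in \<open>auto simp: in_keys_iff\<close>)

lemma lin_ext_linear:
  fixes f :: "'b \<Rightarrow> ('c \<Rightarrow>\<^sub>0 'k::field)"
  shows "Vector_Spaces.linear scale_fs scale_fs (lin_ext f)"
proof (unfold_locales)
  fix x y :: "'b \<Rightarrow>\<^sub>0 'k"
  let ?S = "Poly_Mapping.keys x \<union> Poly_Mapping.keys y"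
  show "lin_ext f (x + y) = lin_ext f x + lin_ext f y"
    using Poly_Mapping.keys_add[of x y]
    by (simp add: lin_ext_sum[of ?S] lookup_add fs.scale_left_distrib sum.distrib)
next
  fix c and x :: "'b \<Rightarrow>\<^sub>0 'k"
  have "Poly_Mapping.keys (scale_fs c x) \<subseteq> Poly_Mapping.keys x" by (auto simp: in_keys_iff)
  then show "lin_ext f (scale_fs c x) = scale_fs c (lin_ext f x)"
    by (simp add: lin_ext_sum[of "Poly_Mapping.keys x"] fs.scale_sum_right)
qed

lemma lin_ext_single [simp]: "lin_ext f (Poly_Mapping.single b c) = scale_fs c (f b)"
  using lin_ext_sum[of "{b}" "Poly_Mapping.single b c" f] by simp

lemma chain_expansion: "(\<Sum>b\<in>Poly_Mapping.keys x. scale_fs (Poly_Mapping.lookup x b) (Poly_Mapping.single b 1)) = x"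
proof (rule poly_mapping_eqI)
  fix a
  have "Poly_Mapping.lookup (\<Sum>b\<in>Poly_Mapping.keys x. scale_fs (Poly_Mapping.lookup x b) (Poly_Mapping.single b 1)) a
      = (\<Sum>b\<in>Poly_Mapping.keys x. if b = a then Poly_Mapping.lookup x b else 0)"
    by (simp add: lookup_sum lookup_single when_def if_distrib cong: if_cong)
  also have "\<dots> = Poly_Mapping.lookup x a" by (auto simp: in_keys_iff)
  finally show "Poly_Mapping.lookup (\<Sum>b\<in>Poly_Mapping.keys x. scale_fs (Poly_Mapping.lookup x b) (Poly_Mapping.single b 1)) a
      = Poly_Mapping.lookup x a" .
qed

lemma linear_expansion:
  assumes "Vector_Spaces.linear scale_fs scale_fs f"
  shows "f x = (\<Sum>b\<in>Poly_Mapping.keys x. scale_fs (Poly_Mapping.lookup x b) (f (Poly_Mapping.single b 1)))"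
proof -
  interpret f: Vector_Spaces.linear scale_fs scale_fs f by fact
  have "f x = f (\<Sum>b\<in>Poly_Mapping.keys x. scale_fs (Poly_Mapping.lookup x b) (Poly_Mapping.single b 1))"
    by (simp only: chain_expansion)
  then show ?thesis by (simp only: f.sum f.scale)
qed

lemma linear_eq_on_keys:
  assumes "Vector_Spaces.linear scale_fs scale_fs f" "Vector_Spaces.linear scale_fs scale_fs g"
    "\<And>b. b \<in> Poly_Mapping.keys x \<Longrightarrow> f (Poly_Mapping.single b 1) = g (Poly_Mapping.single b 1)"
  shows "f x = g x"
  unfolding linear_expansion[OF assms(1), of x] linear_expansion[OF assms(2), of x]
  by (rule sum.cong[OF refl]) (simp add: assms(3))

lemma linear_compose:
  assumes "Vector_Spaces.linear scale_fs scale_fs f" "Vector_Spaces.linear scale_fs scale_fs g"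
  shows "Vector_Spaces.linear scale_fs scale_fs (\<lambda>x. g (f x))"
  using Vector_Spaces.linear_compose[OF assms] by (simp add: comp_def)

lemma keys_scale_fs: "Poly_Mapping.keys (scale_fs c x) \<subseteq> Poly_Mapping.keys x"
  by (auto simp: in_keys_iff)

lemma keys_sum_subset: "(\<And>i. i \<in> I \<Longrightarrow> Poly_Mapping.keys (f i) \<subseteq> K) \<Longrightarrow> Poly_Mapping.keys (sum f I) \<subseteq> K"
proof (induction I rule: infinite_finite_induct)
  case (insert i I)
  then show ?case using Poly_Mapping.keys_add[of "f i" "sum f I"] by fastforce
qed auto

lemma keys_linear:
  assumes "Vector_Spaces.linear scale_fs scale_fs f"
    "\<And>b. b \<in> Poly_Mapping.keys x \<Longrightarrow> Poly_Mapping.keys (f (Poly_Mapping.single b 1)) \<subseteq> K"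
  shows "Poly_Mapping.keys (f x) \<subseteq> K"
  unfolding linear_expansion[OF assms(1), of x]
  by (rule keys_sum_subset, rule order_trans[OF keys_scale_fs assms(2)])

lemma boundary_linear: "Vector_Spaces.linear scale_fs scale_fs boundary"
  unfolding boundary_def by (rule lin_ext_linear)

lemma act_linear: "Vector_Spaces.linear scale_fs scale_fs (act w)"
  unfolding act_def by (rule lin_ext_linear)

lemma component_linear: "Vector_Spaces.linear scale_fs scale_fs (component i j)"
  unfolding component_def by (rule lin_ext_linear)

global_interpretation boundary: Vector_Spaces.linear scale_fs scale_fs "boundary :: 'k::field chain \<Rightarrow> 'k chain"
  by (rule boundary_linear)
global_interpretation act: Vector_Spaces.linear scale_fs scale_fs "act w :: 'k::field chain \<Rightarrow> 'k chain" for w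
  by (rule act_linear)
global_interpretation component: Vector_Spaces.linear scale_fs scale_fs "component i j :: 'k::field chain \<Rightarrow> 'k chain" for i j
  by (rule component_linear)

lemma lookup_component: "Poly_Mapping.lookup (component i j x) b = (if bideg b = (i, j) then Poly_Mapping.lookup x b else 0)"
proof -
  have "Poly_Mapping.lookup (component i j x) b = (\<Sum>a\<in>Poly_Mapping.keys x. Poly_Mapping.lookup x a *
      Poly_Mapping.lookup (if bideg a = (i, j) then Poly_Mapping.single a 1 else 0) b)"
    by (simp add: component_def lin_ext_def lookup_sum)
  also have "\<dots> = (\<Sum>a\<in>Poly_Mapping.keys x. if a = b then (if bideg b = (i, j) then Poly_Mapping.lookup x b else 0) else 0)"
    by (rule sum.cong[OF refl]) (simp add: lookup_single when_def)
  also have "\<dots> = (if bideg b = (i, j) then Poly_Mapping.lookup x b else 0)"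
    by (auto simp: in_keys_iff)
  finally show ?thesis .
qed

lemma component_eq_self: "component i j x = x \<longleftrightarrow> (\<forall>b\<in>Poly_Mapping.keys x. bideg b = (i, j))"
proof
  assume L: "component i j x = x"
  show "\<forall>b\<in>Poly_Mapping.keys x. bideg b = (i, j)"
  proof
    fix b assume "b \<in> Poly_Mapping.keys x"
    then have "Poly_Mapping.lookup (component i j x) b \<noteq> 0" unfolding L by (simp add: in_keys_iff)
    then show "bideg b = (i, j)" unfolding lookup_component by (simp split: if_splits)
  qed
next
  assume R: "\<forall>b\<in>Poly_Mapping.keys x. bideg b = (i, j)"
  show "component i j x = x"
    by (rule poly_mapping_eqI) (use R in \<open>auto simp: lookup_component in_keys_iff\<close>)
qed

section \<open>The decorated complex in terms of flags\<close>

abbreviation elt_chain :: "nat \<Rightarrow> decoration \<Rightarrow> nat set set \<Rightarrow> 'k::field chain" where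
  "elt_chain n \<theta> X \<equiv> Poly_Mapping.single (elt n \<theta> X) 1"

text \<open>The chains all of whose total decorations satisfy \<open>Q\<close>.\<close>

abbreviation decorated_chains :: "nat \<Rightarrow> (decoration \<Rightarrow> bool) \<Rightarrow> nat \<Rightarrow> 'k::field chain set" where
  "decorated_chains n Q k \<equiv> chain_group (zigzag n) (\<lambda>b. Q (total_decoration b)) k"

lemma chain_keysE:
  assumes "x \<in> decorated_chains n Q k" "b \<in> Poly_Mapping.keys x" "0 < n"
  obtains \<theta> X where "b = elt n \<theta> X" "(\<theta>, X) \<in> flag_index n" "Q \<theta>" "k = Suc (card X)"
proof -
  have b: "b \<in> basis (zigzag n) k" "Q (total_decoration b)" using assms by (auto simp: chain_group_def)
  show ?thesis
    using that[of "total_decoration b" "flag_of (fst b)"] b elt_eq[OF assms(3) b(1) refl refl]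
      basis_flag_index[OF assms(3) b(1)] by simp
qed

lemma elt_chain_mem:
  assumes "0 < n" "(\<theta>, X) \<in> flag_index n" "Q \<theta>" "k = Suc (card X)"
  shows "elt_chain n \<theta> X \<in> decorated_chains n Q k"
  using elt[OF assms(1,2)] assms(3,4) by (simp add: chain_group_def)

lemma chain_subspace: "fs.subspace (chain_group \<alpha> P k :: 'k::field chain set)"
proof (rule fs.subspaceI)
  fix x y :: "'k chain" assume "x \<in> chain_group \<alpha> P k" "y \<in> chain_group \<alpha> P k"
  then show "x + y \<in> chain_group \<alpha> P k" using Poly_Mapping.keys_add[of x y] by (auto simp: chain_group_def)
next
  fix c and x :: "'k chain" assume "x \<in> chain_group \<alpha> P k"
  then show "scale_fs c x \<in> chain_group \<alpha> P k" using keys_scale_fs[of c x] by (auto simp: chain_group_def)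
qed (simp add: chain_group_def)

lemma flag_index_remove: "(\<theta>, X) \<in> flag_index n \<Longrightarrow> (\<theta>, X - Y) \<in> flag_index n"
  unfolding flag_index_def using flag_subset[of "{1..n}" X "X - Y"] by auto

lemma flag_index_finite: "(\<theta>, X) \<in> flag_index n \<Longrightarrow> finite X"
  using flag_finite[of "{1..n}" X] by (simp add: flag_index_def)

lemma boundary_elt:
  assumes "0 < n" "(\<theta>, X) \<in> flag_index n"
  shows "boundary (elt_chain n \<theta> X) = (\<Sum>S\<in>X. scale_fs (flag_sign X S) (elt_chain n \<theta> (X - {S})))"
  using boundary_basis_flag[OF assms(1) elt(1)[OF assms]] elt(2,3)[OF assms] by (simp add: boundary_def)

lemma boundary_mem:
  assumes n: "0 < n" and x: "x \<in> decorated_chains n Q (Suc k)"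
  shows "boundary x \<in> decorated_chains n Q k"
proof -
  have "Poly_Mapping.keys (boundary x) \<subseteq> {b \<in> basis (zigzag n) k. Q (total_decoration b)}"
  proof (rule keys_linear[OF boundary_linear])
    fix b assume "b \<in> Poly_Mapping.keys x"
    with x obtain \<theta> X where b: "b = elt n \<theta> X" "(\<theta>, X) \<in> flag_index n" "Q \<theta>" "Suc k = Suc (card X)"
      using n by (rule chain_keysE)
    have "elt n \<theta> (X - {S}) \<in> {b \<in> basis (zigzag n) k. Q (total_decoration b)}" if "S \<in> X" for S
      using elt(1,2)[OF n flag_index_remove[OF b(2), of "{S}"]] b(3,4) that flag_index_finite[OF b(2)]
        card_Suc_Diff1[of X S] by simp
    then show "Poly_Mapping.keys (boundary (Poly_Mapping.single b 1 :: 'a chain)) \<subseteq> {b \<in> basis (zigzag n) k. Q (total_decoration b)}"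
      unfolding b(1) boundary_elt[OF n b(2)]
      by (intro keys_sum_subset order_trans[OF keys_scale_fs]) auto
  qed
  then show ?thesis by (simp add: chain_group_def)
qed

lemma boundary_low:
  assumes n: "0 < n" and x: "x \<in> decorated_chains n Q 0 \<or> x \<in> decorated_chains n Q 1"
  shows "boundary x = 0"
proof -
  have "boundary (Poly_Mapping.single b 1 :: 'a chain) = 0" if "b \<in> Poly_Mapping.keys x" for b
  proof -
    obtain k where k: "x \<in> decorated_chains n Q k" "k \<le> 1" using x by auto
    obtain \<theta> X where b: "b = elt n \<theta> X" "(\<theta>, X) \<in> flag_index n" "card X = 0"
    proof (rule chain_keysE[OF k(1) \<open>b \<in> Poly_Mapping.keys x\<close> n])
      fix \<theta> X assume "b = elt n \<theta> X" "(\<theta>, X) \<in> flag_index n" "k = Suc (card X)"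
      then show ?thesis using that k(2) by simp
    qed
    then have "X = {}" using flag_index_finite[OF b(2)] by simp
    then show ?thesis unfolding b(1) boundary_elt[OF n b(2)] by simp
  qed
  then show ?thesis by (subst linear_expansion[OF boundary_linear]) simp
qed

lemma boundary_mem_pred:
  assumes n: "0 < n" and x: "x \<in> decorated_chains n Q k"
  shows "boundary x \<in> decorated_chains n Q (k - 1)"
proof (cases k)
  case 0
  then show ?thesis using boundary_low[OF n, of x Q] x fs.subspace_0[OF chain_subspace] by simp
qed (use boundary_mem[OF n] x in simp)

lemma boundary_boundary:
  fixes x :: "'k::field_char_0 chain"
  assumes n: "0 < n" and x: "x \<in> decorated_chains n Q k"
  shows "boundary (boundary x) = 0"
proof -
  have "boundary (boundary (elt_chain n \<theta> X :: 'k chain)) = 0" if i: "(\<theta>, X) \<in> flag_index n" for \<theta> X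
  proof -
    have fin: "finite X" using flag_index_finite[OF i] .
    let ?g = "\<lambda>S T. scale_fs (flag_sign X S * flag_sign (X - {S}) T) (elt_chain n \<theta> (X - {S} - {T}) :: 'k chain)"
    have "boundary (boundary (elt_chain n \<theta> X :: 'k chain)) = (\<Sum>S\<in>X. \<Sum>T\<in>X - {S}. ?g S T)"
      by (simp add: boundary_elt[OF n i] boundary.sum boundary.scale
          boundary_elt[OF n flag_index_remove[OF i]] fs.scale_sum_right)
    also have "\<dots> = (\<Sum>S\<in>X. \<Sum>T\<in>X. if S \<noteq> T then ?g S T else 0)"
    proof (rule sum.cong[OF refl])
      fix S assume "S \<in> X"
      show "(\<Sum>T\<in>X - {S}. ?g S T) = (\<Sum>T\<in>X. if S \<noteq> T then ?g S T else 0)"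
        by (rule sum.mono_neutral_cong_left) (use fin in auto)
    qed
    finally have eq: "boundary (boundary (elt_chain n \<theta> X :: 'k chain)) = (\<Sum>S\<in>X. \<Sum>T\<in>X. if S \<noteq> T then ?g S T else 0)" .
    also have "\<dots> = (\<Sum>T\<in>X. \<Sum>S\<in>X. if S \<noteq> T then ?g S T else 0)" by (rule sum.swap)
    also have "\<dots> = (\<Sum>T\<in>X. \<Sum>S\<in>X. - (if T \<noteq> S then ?g T S else 0))"
    proof (intro sum.cong[OF refl])
      fix T S assume ST: "T \<in> X" "S \<in> X"
      show "(if S \<noteq> T then ?g S T else 0) = - (if T \<noteq> S then ?g T S else 0)"
      proof (cases "S = T")
        case False
        have chain: "S \<subseteq> T \<or> T \<subseteq> S"
          using flag_chain[OF _ ST(2,1), of "{1..n}"] i by (simp add: flag_index_def)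
        have "X - {S} - {T} = X - {T} - {S}" by blast
        then show ?thesis using False flag_sign_swap[OF fin ST(2,1) False chain, where 'k = 'k] by simp
      qed simp
    qed
    also have "\<dots> = - (\<Sum>S\<in>X. \<Sum>T\<in>X. if S \<noteq> T then ?g S T else 0)" by (simp only: sum_negf)
    finally have neg: "boundary (boundary (elt_chain n \<theta> X :: 'k chain)) = - boundary (boundary (elt_chain n \<theta> X :: 'k chain))"
      using eq by simp
    show ?thesis
    proof (rule poly_mapping_eqI)
      fix a
      let ?l = "Poly_Mapping.lookup (boundary (boundary (elt_chain n \<theta> X :: 'k chain))) a"
      have "?l = - ?l" by (subst neg) simp
      then show "?l = Poly_Mapping.lookup 0 a" by simp
    qed
  qed
  then have "boundary (boundary (Poly_Mapping.single b 1 :: 'k chain)) = 0" if "b \<in> Poly_Mapping.keys x" for b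
    using chain_keysE[OF x that n] by metis
  then show ?thesis by (subst linear_expansion[OF linear_compose[OF boundary_linear boundary_linear]]) simp
qed

lemma act_elt:
  assumes n: "0 < n" and i: "(\<theta>, X) \<in> flag_index n" and w: "w permutes {1..n}"
  shows "act w (elt_chain n \<theta> X) = elt_chain n \<theta> ((`) w ` X)" "(\<theta>, (`) w ` X) \<in> flag_index n"
    "card ((`) w ` X) = card X"
proof -
  let ?b = "elt n \<theta> X"
  let ?wb = "(map ((`) w) (fst ?b), snd ?b)"
  note e = elt[OF n i]
  note a = act_basis_flag[OF n e(1) w]
  have "elt n \<theta> ((`) w ` X) = ?wb"
    by (rule elt_eq[OF n a(1)]) (use a(2,3) e(2,3) in auto)
  then show "act w (elt_chain n \<theta> X) = elt_chain n \<theta> ((`) w ` X)" by (simp add: act_def)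
  show "(\<theta>, (`) w ` X) \<in> flag_index n" using basis_flag_index(1)[OF n a(1)] a(2,3) e(2,3) by simp
  show "card ((`) w ` X) = card X"
    by (rule card_image) (use permutes_inj[OF w] in \<open>auto intro!: inj_onI simp: inj_image_eq_iff\<close>)
qed

lemma act_mem:
  assumes n: "0 < n" and x: "x \<in> decorated_chains n Q k" and w: "w permutes {1..n}"
  shows "act w x \<in> decorated_chains n Q k"
proof -
  have "Poly_Mapping.keys (act w x) \<subseteq> {b \<in> basis (zigzag n) k. Q (total_decoration b)}"
  proof (rule keys_linear[OF act_linear])
    fix b assume "b \<in> Poly_Mapping.keys x"
    with x obtain \<theta> X where b: "b = elt n \<theta> X" "(\<theta>, X) \<in> flag_index n" "Q \<theta>" "k = Suc (card X)"
      using n by (rule chain_keysE)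
    note a = act_elt[OF n b(2) w]
    show "Poly_Mapping.keys (act w (Poly_Mapping.single b 1 :: 'a chain)) \<subseteq> {b \<in> basis (zigzag n) k. Q (total_decoration b)}"
      unfolding b(1) a(1) using elt(1,2)[OF n a(2)] a(3) b(3,4) by simp
  qed
  then show ?thesis by (simp add: chain_group_def)
qed

lemma boundary_act:
  assumes n: "0 < n" and x: "x \<in> decorated_chains n Q k" and w: "w permutes {1..n}"
  shows "boundary (act w x) = act w (boundary x)"
proof (rule linear_eq_on_keys[OF linear_compose[OF act_linear boundary_linear] linear_compose[OF boundary_linear act_linear]])
  fix b assume "b \<in> Poly_Mapping.keys x"
  with x obtain \<theta> X where b: "b = elt n \<theta> X" "(\<theta>, X) \<in> flag_index n" using n by (rule chain_keysE)
  have inj: "inj ((`) w)" by (rule injI) (simp only: inj_image_eq_iff[OF permutes_inj[OF w]])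
  have sign: "flag_sign ((`) w ` X) (w ` S) = (flag_sign X S :: 'a)" for S
  proof -
    have "{T \<in> (`) w ` X. T \<subset> w ` S} = (`) w ` {T \<in> X. T \<subset> S}"
    proof -
      have "w ` T \<subset> w ` S \<longleftrightarrow> T \<subset> S" for T
        unfolding psubset_eq inj_image_subset_iff[OF permutes_inj[OF w]] inj_image_eq_iff[OF permutes_inj[OF w]] ..
      then show ?thesis by (simp only: Compr_image_eq)
    qed
    then show ?thesis using card_image[OF inj_on_subset[OF inj subset_UNIV]] by (simp add: flag_sign_def)
  qed
  have "boundary (act w (elt_chain n \<theta> X :: 'a chain)) = (\<Sum>S\<in>(`) w ` X. scale_fs (flag_sign ((`) w ` X) S) (elt_chain n \<theta> ((`) w ` X - {S})))"
    by (simp only: act_elt(1)[OF n b(2) w] boundary_elt[OF n act_elt(2)[OF n b(2) w]])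
  also have "\<dots> = (\<Sum>S\<in>X. scale_fs (flag_sign X S) (elt_chain n \<theta> ((`) w ` (X - {S}))))"
    by (subst sum.reindex[OF inj_on_subset[OF inj subset_UNIV]])
      (simp add: sign image_set_diff[OF inj])
  also have "\<dots> = act w (boundary (elt_chain n \<theta> X))"
    by (simp add: boundary_elt[OF n b(2)] act.sum act.scale act_elt(1)[OF n flag_index_remove[OF b(2)] w])
  finally show "boundary (act w (Poly_Mapping.single b 1 :: 'a chain)) = act w (boundary (Poly_Mapping.single b 1))"
    by (simp only: b(1))
qed

lemma component_elt:
  assumes n: "0 < n" and i: "(\<theta>, X) \<in> flag_index n"
  shows "component i j (elt_chain n \<theta> X) = (if (deg_t n \<theta>, deg_q n \<theta>) = (i, j) then elt_chain n \<theta> X else 0)"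
  using bideg_total[OF n elt(1)[OF n i]] elt(2)[OF n i] by (simp add: component_def)

lemma boundary_component:
  assumes n: "0 < n" and x: "x \<in> decorated_chains n Q k"
  shows "boundary (component i j x) = component i j (boundary x)"
proof (rule linear_eq_on_keys[OF linear_compose[OF component_linear boundary_linear] linear_compose[OF boundary_linear component_linear]])
  fix b assume "b \<in> Poly_Mapping.keys x"
  with x obtain \<theta> X where b: "b = elt n \<theta> X" "(\<theta>, X) \<in> flag_index n" using n by (rule chain_keysE)
  show "boundary (component i j (Poly_Mapping.single b 1 :: 'a chain)) = component i j (boundary (Poly_Mapping.single b 1))"
  proof (cases "(deg_t n \<theta>, deg_q n \<theta>) = (i, j)")
    case True
    then show ?thesis unfolding b(1) component_elt[OF n b(2)] boundary_elt[OF n b(2)]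
      by (simp add: boundary_elt[OF n b(2)] component.sum component.scale component_elt[OF n flag_index_remove[OF b(2)]])
  next
    case False
    then show ?thesis unfolding b(1) component_elt[OF n b(2)] boundary_elt[OF n b(2)]
      by (simp only: if_False component.sum component.scale component_elt[OF n flag_index_remove[OF b(2)]]) simp
  qed
qed

lemma act_component:
  assumes n: "0 < n" and x: "x \<in> decorated_chains n Q k" and w: "w permutes {1..n}"
  shows "component i j (act w x) = act w (component i j x)"
proof (rule linear_eq_on_keys[OF linear_compose[OF act_linear component_linear] linear_compose[OF component_linear act_linear]])
  fix b assume "b \<in> Poly_Mapping.keys x"
  with x obtain \<theta> X where b: "b = elt n \<theta> X" "(\<theta>, X) \<in> flag_index n" using n by (rule chain_keysE)
  show "component i j (act w (Poly_Mapping.single b 1 :: 'a chain)) = act w (component i j (Poly_Mapping.single b 1))"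
    unfolding b(1) component_elt[OF n b(2)] act_elt(1)[OF n b(2) w] component_elt[OF n act_elt(2)[OF n b(2) w]]
    by (simp add: act_elt(1)[OF n b(2) w])
qed

lemma component_mem: "x \<in> chain_group \<alpha> P k \<Longrightarrow> component i j x \<in> chain_group \<alpha> P k"
  by (auto simp: chain_group_def in_keys_iff lookup_component split: if_splits)

lemma decorated_complex:
  assumes n: "0 < n"
  shows "bigraded_Sn_complex n (decorated_chains n Q :: nat \<Rightarrow> 'k::field_char_0 chain set)"
  unfolding bigraded_Sn_complex_def
proof (intro allI conjI ballI impI)
  fix k i j show "fs.subspace (decorated_chains n Q k :: 'k chain set)" by (rule chain_subspace)
  fix x :: "'k chain" assume x: "x \<in> decorated_chains n Q k"
  show "boundary x \<in> decorated_chains n Q (k - 1)" by (rule boundary_mem_pred[OF n x])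
  show "boundary (boundary x) = 0" by (rule boundary_boundary[OF n x])
  show "component i j x \<in> decorated_chains n Q k" by (rule component_mem[OF x])
  show "boundary (component i j x) = component i j (boundary x)" by (rule boundary_component[OF n x])
  fix w assume w: "w permutes {1..n}"
  show "act w x \<in> decorated_chains n Q k" by (rule act_mem[OF n x w])
  show "boundary (act w x) = act w (boundary x)" by (rule boundary_act[OF n x w])
  show "component i j (act w x) = act w (component i j x)" by (rule act_component[OF n x w])
qed

section \<open>The homology is concentrated in one degree\<close>

definition homotopy :: "nat \<Rightarrow> 'k::field chain \<Rightarrow> 'k chain" where
  "homotopy n = lin_ext (\<lambda>b. let \<theta> = total_decoration b; X = flag_of (fst b);
       F = factorization_cuts n \<theta>; I = pivot n F X in
     if nondescents n F X = {} \<or> I \<in> X then 0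
     else scale_fs (flag_sign (insert I X) I) (elt_chain n \<theta> (insert I X)))"

global_interpretation homotopy: Vector_Spaces.linear scale_fs scale_fs "homotopy n :: 'k::field chain \<Rightarrow> 'k chain" for n
  unfolding homotopy_def by (rule lin_ext_linear)

lemma homotopy_linear: "Vector_Spaces.linear scale_fs scale_fs (homotopy n)"
  unfolding homotopy_def by (rule lin_ext_linear)

lemma homotopy_elt:
  assumes "0 < n" "(\<theta>, X) \<in> flag_index n" "F = factorization_cuts n \<theta>" "I = pivot n F X"
  shows "homotopy n (elt_chain n \<theta> X) = (if nondescents n F X = {} \<or> I \<in> X then 0
    else scale_fs (flag_sign (insert I X) I) (elt_chain n \<theta> (insert I X)))"
  using elt[OF assms(1,2)] assms(3,4) by (simp add: homotopy_def Let_def)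

lemma flag_index_insert:
  assumes i: "(\<theta>, X) \<in> flag_index n" and I: "I \<in> nondescents n (factorization_cuts n \<theta>) X"
  shows "(\<theta>, insert I X) \<in> flag_index n"
  using i nondescents_insert(1)[OF _ factorization_cuts_bounds I] I
  by (auto simp: flag_index_def nondescents_def)

text \<open>The homotopy pairs each flag with the one that differs by its pivot. On a flag that has a
  pivot, the terms of \<open>\<partial>H + H\<partial>\<close> that keep the permutation add up to the flag itself, as in a
  simplex; all other terms drop a descent and thus have fewer inversions.\<close>

lemma homotopy_lowers_inversions:
  assumes n: "0 < n" and i: "(\<theta>, X) \<in> flag_index n" and c: "card ` X \<subset> factorization_cuts n \<theta>"
  defines "V \<equiv> {x :: 'k::field chain. Poly_Mapping.keys x \<subseteq> {elt n \<theta> Y | Y. (\<theta>, Y) \<in> flag_index n \<and> card Y = card X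
      \<and> card (inversions n Y) < card (inversions n X)}}"
  shows "elt_chain n \<theta> X - boundary (homotopy n (elt_chain n \<theta> X)) - homotopy n (boundary (elt_chain n \<theta> X)) \<in> V"
proof -
  define F where "F = factorization_cuts n \<theta>"
  define I where "I = pivot n F X"
  have X: "flag {1..n} X" and finX: "finite X" using i flag_index_finite[OF i] by (auto simp: flag_index_def)
  have F: "F \<subseteq> {0<..<n}" unfolding F_def by (rule factorization_cuts_bounds)
  have nd: "nondescents n F X \<noteq> {}" using nondescents_nonempty[OF X F] c F_def by simp
  have I: "I \<in> nondescents n F X" unfolding I_def by (rule pivot_mem[OF nd])
  have V: "fs.subspace V"
  proof -
    have "V = chain_group_like" if "chain_group_like = V" for chain_group_like using that by simp
    show ?thesis unfolding V_def
    proof (rule fs.subspaceI)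
      fix x y :: "'k chain" and c and K :: "basis_elt set"
      show "0 \<in> {x :: 'k chain. Poly_Mapping.keys x \<subseteq> K}" by simp
      assume x: "x \<in> {x. Poly_Mapping.keys x \<subseteq> K}"
      then show "scale_fs c x \<in> {x. Poly_Mapping.keys x \<subseteq> K}" using keys_scale_fs[of c x] by auto
      assume "y \<in> {x. Poly_Mapping.keys x \<subseteq> K}"
      then show "x + y \<in> {x. Poly_Mapping.keys x \<subseteq> K}" using x Poly_Mapping.keys_add[of x y] by auto
    qed
  qed
  have memV: "elt_chain n \<theta> Y \<in> V" if "(\<theta>, Y) \<in> flag_index n" "card Y = card X" "inversions n Y \<subset> inversions n X" for Y
    using that psubset_card_mono[OF finite_inversions that(3)] unfolding V_def by auto
  let ?e = "\<lambda>Y. elt_chain n \<theta> Y :: 'k chain"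
  let ?H = "homotopy n :: 'k chain \<Rightarrow> 'k chain"
  have H: "?H (?e Y) = (if nondescents n F Y = {} \<or> pivot n F Y \<in> Y then 0
      else scale_fs (flag_sign (insert (pivot n F Y) Y) (pivot n F Y)) (?e (insert (pivot n F Y) Y)))"
    if "(\<theta>, Y) \<in> flag_index n" for Y
    using homotopy_elt[OF n that F_def refl] .
  have Hdesc: "?H (?e (X - {S})) \<in> V" if S: "S \<in> X" "inversions n (X - {S}) \<noteq> inversions n X" for S
  proof (cases "nondescents n F (X - {S}) = {} \<or> pivot n F (X - {S}) \<in> X - {S}")
    case True
    then show ?thesis using H[OF flag_index_remove[OF i, of "{S}"]] fs.subspace_0[OF V] by simp
  next
    case False
    let ?Y = "X - {S}" and ?J = "pivot n F (X - {S})"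
    have iY: "(\<theta>, ?Y) \<in> flag_index n" by (rule flag_index_remove[OF i])
    have J: "?J \<in> nondescents n F ?Y" "?J \<notin> ?Y" using False pivot_mem[of n F ?Y] by blast+
    have "(\<theta>, insert ?J ?Y) \<in> flag_index n" using flag_index_insert[OF iY] J(1) F_def by simp
    moreover have "card (insert ?J ?Y) = card X"
      unfolding card_insert_disjoint[OF finite_Diff[OF finX] J(2)] by (rule card_Suc_Diff1[OF finX S(1)])
    moreover have "inversions n (insert ?J ?Y) = inversions n ?Y"
      by (rule nondescents_insert(2)[OF flag_subset[OF X Diff_subset] F J(1)])
    then have "inversions n (insert ?J ?Y) \<subset> inversions n X" using S(2) inversions_mono[of ?Y X n] by blast
    ultimately have "?e (insert ?J ?Y) \<in> V" by (rule memV)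
    then show ?thesis unfolding H[OF iY] if_not_P[OF False] by (rule fs.subspace_scale[OF V])
  qed
  have bd: "boundary (?e Y) = (\<Sum>S\<in>Y. scale_fs (flag_sign Y S) (?e (Y - {S})))" if "(\<theta>, Y) \<in> flag_index n" for Y
    by (rule boundary_elt[OF n that])
  have Hb: "?H (boundary (?e X)) = (\<Sum>S\<in>X. scale_fs (flag_sign X S) (?H (?e (X - {S}))))"
    unfolding bd[OF i] by (simp only: homotopy.sum homotopy.scale)
  show ?thesis
  proof (cases "I \<in> X")
    case False
    let ?Z = "insert I X"
    have iZ: "(\<theta>, ?Z) \<in> flag_index n" using flag_index_insert[OF i] I F_def by simp
    have "boundary (?H (?e X)) = scale_fs (flag_sign ?Z I) (\<Sum>S\<in>?Z. scale_fs (flag_sign ?Z S) (?e (?Z - {S})))"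
      using False nd H[OF i] bd[OF iZ] by (simp add: boundary.scale flip: I_def)
    also have "(\<Sum>S\<in>?Z. scale_fs (flag_sign ?Z S) (?e (?Z - {S})))
        = scale_fs (flag_sign ?Z I) (?e X) + (\<Sum>S\<in>X. scale_fs (flag_sign ?Z S) (?e (?Z - {S})))"
      using False finX by simp
    finally have BH: "boundary (?H (?e X)) = ?e X + (\<Sum>S\<in>X. scale_fs (flag_sign ?Z I * flag_sign ?Z S) (?e (?Z - {S})))"
      by (simp add: fs.scale_right_distrib fs.scale_sum_right)
    have "?e X - boundary (?H (?e X)) - ?H (boundary (?e X)) = - (\<Sum>S\<in>X.
        scale_fs (flag_sign ?Z I * flag_sign ?Z S) (?e (?Z - {S})) + scale_fs (flag_sign X S) (?H (?e (X - {S}))))"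
      unfolding BH Hb by (simp add: sum.distrib)
    also have "\<dots> \<in> V"
    proof (intro fs.subspace_neg[OF V] fs.subspace_sum[OF V])
      fix S assume S: "S \<in> X"
      have SI: "S \<noteq> I" using S False by blast
      have ZS: "?Z - {S} = insert I (X - {S})" using SI by blast
      show "scale_fs (flag_sign ?Z I * flag_sign ?Z S) (?e (?Z - {S})) + scale_fs (flag_sign X S) (?H (?e (X - {S}))) \<in> V"
      proof (cases "inversions n (X - {S}) = inversions n X")
        case False
        have "inversions n (?Z - {S}) \<subset> inversions n X"
          by (rule inversions_descent[OF X F I \<open>I \<notin> X\<close> S False])
        moreover have "card (?Z - {S}) = card X"
          unfolding ZS using card_insert_disjoint[of "X - {S}" I] card_Suc_Diff1[OF finX S] finX \<open>I \<notin> X\<close> by simp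
        ultimately have "?e (?Z - {S}) \<in> V" using memV[OF flag_index_remove[OF iZ, of "{S}"]] by blast
        then show ?thesis using Hdesc[OF S False] by (intro fs.subspace_add[OF V] fs.subspace_scale[OF V])
      next
        case True
        have nds: "nondescents n F (X - {S}) = nondescents n F X" by (rule nondescents_remove[OF X True])
        then have piv: "pivot n F (X - {S}) = I" by (simp add: pivot_def I_def)
        have HS: "?H (?e (X - {S})) = scale_fs (flag_sign (?Z - {S}) I) (?e (?Z - {S}))"
          unfolding H[OF flag_index_remove[OF i]] nds piv ZS using nd \<open>I \<notin> X\<close> by simp
        have "S \<subseteq> I \<or> I \<subseteq> S" using flag_chain[of "{1..n}" ?Z S I] iZ S by (simp add: flag_index_def)
        then have "flag_sign ?Z S * flag_sign (?Z - {S}) I = - (flag_sign ?Z I * flag_sign (?Z - {I}) S :: 'k)"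
          using flag_sign_swap[of ?Z S I] finX S SI by simp
        moreover have "?Z - {I} = X" using \<open>I \<notin> X\<close> by blast
        ultimately have swap: "flag_sign ?Z S * flag_sign (?Z - {S}) I = - (flag_sign ?Z I * flag_sign X S :: 'k)" by simp
        have "flag_sign ?Z I * flag_sign ?Z S
            = flag_sign ?Z I * (flag_sign ?Z S * flag_sign (?Z - {S}) I) * (flag_sign (?Z - {S}) I :: 'k)"
          by (simp add: mult.assoc)
        also have "\<dots> = - (flag_sign ?Z I * flag_sign ?Z I) * flag_sign X S * (flag_sign (?Z - {S}) I :: 'k)"
          unfolding swap by (simp add: mult.assoc)
        finally have "flag_sign ?Z I * flag_sign ?Z S + flag_sign X S * flag_sign (?Z - {S}) I = (0 :: 'k)" by simp
        then have "scale_fs (flag_sign ?Z I * flag_sign ?Z S) (?e (?Z - {S})) + scale_fs (flag_sign X S) (?H (?e (X - {S}))) = 0"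
          unfolding HS fs.scale_scale fs.scale_left_distrib[symmetric] by simp
        then show ?thesis using fs.subspace_0[OF V] by simp
      qed
    qed
    finally show ?thesis .
  next
    case True
    have nds: "nondescents n F (X - {S}) = nondescents n F X" "pivot n F (X - {S}) = I"
      if "inversions n (X - {S}) = inversions n X" for S
      using nondescents_remove[OF X that] by (simp_all add: pivot_def I_def)
    have Iinv: "inversions n (X - {I}) = inversions n X" using I by (simp add: nondescents_def)
    have BH: "boundary (?H (?e X)) = 0"
      unfolding H[OF i] using True by (simp add: boundary.zero flip: I_def)
    have HI: "scale_fs (flag_sign X I) (?H (?e (X - {I}))) = ?e X"
      unfolding H[OF flag_index_remove[OF i]] nds[OF Iinv] using nd True by (simp add: insert_absorb)
    have "?H (boundary (?e X)) = ?e X + (\<Sum>S\<in>X - {I}. scale_fs (flag_sign X S) (?H (?e (X - {S}))))"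
      unfolding Hb sum.remove[OF finX True] HI ..
    then have "?e X - boundary (?H (?e X)) - ?H (boundary (?e X)) = - (\<Sum>S\<in>X - {I}. scale_fs (flag_sign X S) (?H (?e (X - {S}))))"
      unfolding BH by simp
    also have "\<dots> \<in> V"
    proof (intro fs.subspace_neg[OF V] fs.subspace_sum[OF V] fs.subspace_scale[OF V])
      fix S assume S: "S \<in> X - {I}"
      show "?H (?e (X - {S})) \<in> V"
      proof (cases "inversions n (X - {S}) = inversions n X")
        case False
        then show ?thesis using Hdesc S by blast
      next
        case inv: True
        have "I \<in> X - {S}" using True S by blast
        then have "?H (?e (X - {S})) = 0" unfolding H[OF flag_index_remove[OF i]] nds[OF inv] by simp
        then show ?thesis using fs.subspace_0[OF V] by simp
      qed
    qed
    finally show ?thesis .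
  qed
qed

lemma homotopy_mem:
  assumes n: "0 < n" and x: "x \<in> decorated_chains n Q k"
  shows "homotopy n x \<in> decorated_chains n Q (Suc k)"
proof -
  have "Poly_Mapping.keys (homotopy n x) \<subseteq> {b \<in> basis (zigzag n) (Suc k). Q (total_decoration b)}"
  proof (rule keys_linear[OF homotopy_linear])
    fix b assume "b \<in> Poly_Mapping.keys x"
    with x obtain \<theta> X where b: "b = elt n \<theta> X" "(\<theta>, X) \<in> flag_index n" "Q \<theta>" "k = Suc (card X)"
      using n by (rule chain_keysE)
    define F where "F = factorization_cuts n \<theta>"
    define I where "I = pivot n F X"
    show "Poly_Mapping.keys (homotopy n (Poly_Mapping.single b 1 :: 'a chain)) \<subseteq> {b \<in> basis (zigzag n) (Suc k). Q (total_decoration b)}"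
    proof (cases "nondescents n F X = {} \<or> I \<in> X")
      case True
      then show ?thesis unfolding b(1) homotopy_elt[OF n b(2) F_def I_def] by simp
    next
      case False
      then have "I \<in> nondescents n F X" using pivot_mem I_def by metis
      then have iZ: "(\<theta>, insert I X) \<in> flag_index n" using flag_index_insert[OF b(2)] F_def by simp
      have "card (insert I X) = Suc (card X)" using False flag_index_finite[OF b(2)] by simp
      then have "elt n \<theta> (insert I X) \<in> {b \<in> basis (zigzag n) (Suc k). Q (total_decoration b)}"
        using elt(1,2)[OF n iZ] b(3,4) by simp
      moreover have "homotopy n (Poly_Mapping.single b 1 :: 'a chain) = scale_fs (flag_sign (insert I X) I) (elt_chain n \<theta> (insert I X))"
        using homotopy_elt[OF n b(2) F_def I_def] False b(1) by simp
      ultimately show ?thesis using keys_scale_fs[of "flag_sign (insert I X) I" "elt_chain n \<theta> (insert I X) :: 'a chain"] by auto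
    qed
  qed
  then show ?thesis by (simp add: chain_group_def)
qed

lemma flag_card_inj:
  assumes "finite A" "flag A X"
  shows "inj_on card X"
proof (rule inj_onI)
  fix S T assume ST: "S \<in> X" "T \<in> X" "card S = card T"
  have "finite S" "finite T" using flag_mem[OF assms(2)] ST(1,2) assms(1) finite_subset by blast+
  then show "S = T" using flag_chain[OF assms(2) ST(1,2)] ST(3) card_subset_eq by metis
qed

text \<open>Subtracting the boundary of its image under the homotopy replaces a cycle below the top
  degree by a homologous one with fewer inversions.\<close>

lemma cycle_is_boundary:
  fixes x :: "'k::field_char_0 chain"
  assumes n: "0 < n" and off: "\<And>\<theta>. \<theta> \<in> decorations n \<Longrightarrow> Q \<theta> \<Longrightarrow> k \<noteq> Suc (card (factorization_cuts n \<theta>))"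
    and x: "x \<in> decorated_chains n Q k" "boundary x = 0"
  shows "x \<in> boundary ` decorated_chains n Q (Suc k)"
proof -
  let ?inv = "\<lambda>b :: basis_elt. card (inversions n (flag_of (fst b)))"
  have main: "x \<in> boundary ` decorated_chains n Q (Suc k)"
    if "x \<in> decorated_chains n Q k" "boundary x = 0" "\<forall>b\<in>Poly_Mapping.keys x. ?inv b < m" for x :: "'k chain" and m
    using that
  proof (induction m arbitrary: x)
    case 0
    then have "Poly_Mapping.keys x = {}" by blast
    then have "x = 0" by simp
    then show ?case using boundary.zero fs.subspace_0[OF chain_subspace] by (metis image_eqI)
  next
    case (Suc m)
    define x' where "x' = x - boundary (homotopy n x)"
    have Hx: "homotopy n x \<in> decorated_chains n Q (Suc k)" by (rule homotopy_mem[OF n Suc.prems(1)])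
    have mem: "x' \<in> decorated_chains n Q k"
      unfolding x'_def by (rule fs.subspace_diff[OF chain_subspace Suc.prems(1) boundary_mem[OF n Hx]])
    have cyc: "boundary x' = 0" unfolding x'_def boundary.diff Suc.prems(2) boundary_boundary[OF n Hx] by simp
    let ?A = "\<lambda>x :: 'k chain. x - boundary (homotopy n x) - homotopy n (boundary x)"
    have linA: "Vector_Spaces.linear scale_fs scale_fs ?A"
      by unfold_locales (simp_all add: boundary.add homotopy.add boundary.scale homotopy.scale fs.scale_right_diff_distrib)
    have "x' = ?A x" unfolding x'_def Suc.prems(2) by (simp add: homotopy.zero)
    moreover have "Poly_Mapping.keys (?A x) \<subseteq> {b. ?inv b < m}"
    proof (rule keys_linear[OF linA])
      fix b assume b: "b \<in> Poly_Mapping.keys x"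
      with Suc.prems(1) obtain \<theta> X where e: "b = elt n \<theta> X" "(\<theta>, X) \<in> flag_index n" "Q \<theta>" "k = Suc (card X)"
        using n by (rule chain_keysE)
      have X: "flag {1..n} X" "\<theta> \<in> decorations n" "card ` X \<subseteq> factorization_cuts n \<theta>"
        using e(2) by (auto simp: flag_index_def)
      have "card (card ` X) = card X" by (rule card_image[OF flag_card_inj[OF _ X(1)]]) simp
      then have "card ` X \<noteq> factorization_cuts n \<theta>" using off[OF X(2) e(3)] e(4) by auto
      then have "card ` X \<subset> factorization_cuts n \<theta>" using X(3) by blast
      note low = homotopy_lowers_inversions[OF n e(2) this, where 'k = 'k]
      have "Poly_Mapping.keys (?A (Poly_Mapping.single b 1)) \<subseteq> {elt n \<theta> Y | Y. (\<theta>, Y) \<in> flag_index n \<and> card Y = card X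
          \<and> card (inversions n Y) < card (inversions n X)}"
        using low unfolding e(1) mem_Collect_eq .
      also have "\<dots> \<subseteq> {b. ?inv b < m}"
      proof
        fix b' assume "b' \<in> {elt n \<theta> Y | Y. (\<theta>, Y) \<in> flag_index n \<and> card Y = card X \<and> card (inversions n Y) < card (inversions n X)}"
        then obtain Y where Y: "b' = elt n \<theta> Y" "(\<theta>, Y) \<in> flag_index n" "card (inversions n Y) < card (inversions n X)" by blast
        have "?inv b < Suc m" using Suc.prems(3) b by blast
        then show "b' \<in> {b. ?inv b < m}" using Y elt(3)[OF n e(2)] elt(3)[OF n Y(2)] e(1) by simp
      qed
      finally show "Poly_Mapping.keys (?A (Poly_Mapping.single b 1)) \<subseteq> {b. ?inv b < m}" .
    qed
    ultimately have "\<forall>b\<in>Poly_Mapping.keys x'. ?inv b < m" by auto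
    then obtain y where y: "y \<in> decorated_chains n Q (Suc k)" "x' = boundary y" using Suc.IH[OF mem cyc] by blast
    have "x = boundary (y + homotopy n x)" using y(2) unfolding boundary.add x'_def by (metis diff_add_cancel)
    moreover have "y + homotopy n x \<in> decorated_chains n Q (Suc k)" by (rule fs.subspace_add[OF chain_subspace y(1) Hx])
    ultimately show ?case by blast
  qed
  show ?thesis
    by (rule main[OF x, of "Suc (Max (?inv ` Poly_Mapping.keys x))"]) (simp add: less_Suc_eq_le)
qed

abbreviation in_bidegree :: "nat \<Rightarrow> (decoration \<Rightarrow> bool) \<Rightarrow> nat \<Rightarrow> nat \<Rightarrow> decoration \<Rightarrow> bool" where
  "in_bidegree n Q i j \<theta> \<equiv> Q \<theta> \<and> deg_t n \<theta> = i \<and> deg_q n \<theta> = j"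

lemma chain_bidegree:
  assumes n: "0 < n"
  shows "x \<in> decorated_chains n (in_bidegree n Q i j) k \<longleftrightarrow> x \<in> decorated_chains n Q k \<and> component i j x = x"
proof -
  have "b \<in> basis (zigzag n) k \<and> in_bidegree n Q i j (total_decoration b) \<longleftrightarrow>
      (b \<in> basis (zigzag n) k \<and> Q (total_decoration b)) \<and> bideg b = (i, j)" for b
    using bideg_total[OF n, of b k] by auto
  then have K: "{b \<in> basis (zigzag n) k. in_bidegree n Q i j (total_decoration b)}
      = {b \<in> basis (zigzag n) k. Q (total_decoration b)} \<inter> {b. bideg b = (i, j)}" by blast
  show ?thesis unfolding chain_group_def mem_Collect_eq K component_eq_self Int_subset_iff
    by (simp only: subset_eq mem_Collect_eq)
qed

lemma cycles_eq:
  assumes n: "0 < n"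
  shows "cycles (zigzag n) (\<lambda>b. Q (total_decoration b)) k i j
    = {x \<in> decorated_chains n (in_bidegree n Q i j) k. boundary x = 0}"
  unfolding cycles_def using chain_bidegree[OF n] by blast

lemma boundaries_eq:
  assumes n: "0 < n"
  shows "boundaries (zigzag n) (\<lambda>b. Q (total_decoration b)) k i j
    = boundary ` decorated_chains n (in_bidegree n Q i j) (Suc k)"
proof (intro subset_antisym subsetI)
  fix x :: "'a chain" assume "x \<in> boundaries (zigzag n) (\<lambda>b. Q (total_decoration b)) k i j"
  then obtain y where y: "y \<in> decorated_chains n Q (Suc k)" "x = boundary y" "component i j x = x"
    by (auto simp: boundaries_def)
  have "component i j (component i j y) = component i j y"
    by (rule poly_mapping_eqI) (simp add: lookup_component)
  then have "component i j y \<in> decorated_chains n (in_bidegree n Q i j) (Suc k)"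
    using chain_bidegree[OF n] component_mem[OF y(1)] by blast
  moreover have "x = boundary (component i j y)" using boundary_component[OF n y(1)] y(2,3) by simp
  ultimately show "x \<in> boundary ` decorated_chains n (in_bidegree n Q i j) (Suc k)" by blast
next
  fix x :: "'a chain" assume "x \<in> boundary ` decorated_chains n (in_bidegree n Q i j) (Suc k)"
  then obtain y where y: "y \<in> decorated_chains n (in_bidegree n Q i j) (Suc k)" "x = boundary y" by blast
  then have "component i j x = x" using boundary_mem[OF n y(1)] chain_bidegree[OF n] by blast
  then show "x \<in> boundaries (zigzag n) (\<lambda>b. Q (total_decoration b)) k i j"
    using y chain_bidegree[OF n] unfolding boundaries_def by blast
qed

lemma homology_zero_off_top:
  assumes n: "0 < n"
    and off: "\<And>\<theta>. \<theta> \<in> decorations n \<Longrightarrow> in_bidegree n Q i j \<theta> \<Longrightarrow> k \<noteq> Suc (card (factorization_cuts n \<theta>))"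
  shows "homology_zero TYPE('k::field_char_0) (zigzag n) (\<lambda>b. Q (total_decoration b)) k i j"
  unfolding homology_zero_def cycles_eq[OF n] boundaries_eq[OF n]
proof (intro subset_antisym subsetI)
  fix x :: "'k chain" assume "x \<in> {x \<in> decorated_chains n (in_bidegree n Q i j) k. boundary x = 0}"
  then show "x \<in> boundary ` decorated_chains n (in_bidegree n Q i j) (Suc k)"
    by (intro cycle_is_boundary[OF n]) (use off in simp_all)
next
  fix x :: "'k chain" assume "x \<in> boundary ` decorated_chains n (in_bidegree n Q i j) (Suc k)"
  then obtain y :: "'k chain" where y: "y \<in> decorated_chains n (in_bidegree n Q i j) (Suc k)" "x = boundary y" by blast
  then show "x \<in> {x \<in> decorated_chains n (in_bidegree n Q i j) k. boundary x = 0}"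
    using boundary_mem[OF n y(1)] boundary_boundary[OF n y(1)] by simp
qed

section \<open>Splitting the complex by total decoration\<close>

definition part :: "(basis_elt \<Rightarrow> bool) \<Rightarrow> 'k::field chain \<Rightarrow> 'k chain" where
  "part P = lin_ext (\<lambda>b. if P b then Poly_Mapping.single b 1 else 0)"

lemma part_linear: "Vector_Spaces.linear scale_fs scale_fs (part P)"
  unfolding part_def by (rule lin_ext_linear)

global_interpretation part: Vector_Spaces.linear scale_fs scale_fs "part P :: 'k::field chain \<Rightarrow> 'k chain" for P
  by (rule part_linear)

lemma lookup_part: "Poly_Mapping.lookup (part P x) b = (if P b then Poly_Mapping.lookup x b else 0)"
proof -
  have "Poly_Mapping.lookup (part P x) b = (\<Sum>a\<in>Poly_Mapping.keys x. Poly_Mapping.lookup x a *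
      Poly_Mapping.lookup (if P a then Poly_Mapping.single a 1 else 0) b)"
    by (simp add: part_def lin_ext_def lookup_sum)
  also have "\<dots> = (\<Sum>a\<in>Poly_Mapping.keys x. if a = b then (if P b then Poly_Mapping.lookup x b else 0) else 0)"
    by (rule sum.cong[OF refl]) (simp add: lookup_single when_def)
  also have "\<dots> = (if P b then Poly_Mapping.lookup x b else 0)"
    by (auto simp: in_keys_iff)
  finally show ?thesis .
qed

lemma part_mem: "x \<in> chain_group \<alpha> R k \<Longrightarrow> part P x \<in> chain_group \<alpha> (\<lambda>b. R b \<and> P b) k"
  by (auto simp: chain_group_def in_keys_iff lookup_part split: if_splits)

lemma part_complement: "part P x + part (\<lambda>b. \<not> P b) x = x"
  by (rule poly_mapping_eqI) (simp add: lookup_add lookup_part)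

lemma boundary_part:
  assumes n: "0 < n" and x: "x \<in> decorated_chains n Q k"
  shows "boundary (part (\<lambda>b. P (total_decoration b)) x) = part (\<lambda>b. P (total_decoration b)) (boundary x)"
proof (rule linear_eq_on_keys[OF linear_compose[OF part_linear boundary_linear] linear_compose[OF boundary_linear part_linear]])
  fix b assume "b \<in> Poly_Mapping.keys x"
  with x obtain \<theta> X where b: "b = elt n \<theta> X" "(\<theta>, X) \<in> flag_index n" using n by (rule chain_keysE)
  let ?p = "part (\<lambda>b. P (total_decoration b)) :: 'a chain \<Rightarrow> 'a chain"
  have pe: "?p (elt_chain n \<theta> Y) = (if P \<theta> then elt_chain n \<theta> Y else 0)" if "(\<theta>, Y) \<in> flag_index n" for Y
    using elt(2)[OF n that] by (simp add: part_def)
  show "boundary (?p (Poly_Mapping.single b 1)) = ?p (boundary (Poly_Mapping.single b 1))"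
    unfolding b(1) pe[OF b(2)] boundary_elt[OF n b(2)] part.sum part.scale pe[OF flag_index_remove[OF b(2)]]
    by (simp add: boundary_elt[OF n b(2)])
qed

lemma fd_bounds_decomposition:
  fixes x :: "'k::field chain"
  assumes x: "x \<in> decorated_chains n (\<lambda>_. True) k" and p: "\<And>b. b \<in> basis (zigzag n) k \<Longrightarrow> \<exists>d<m. p b d"
    and uniq: "\<And>b d d'. p b d \<Longrightarrow> p b d' \<Longrightarrow> d = (d' :: nat)"
  shows "\<exists>!y. (\<forall>d<m. y d \<in> chain_group (zigzag n) (\<lambda>b. p b d) k) \<and> (\<forall>d\<ge>m. y d = 0) \<and> x = (\<Sum>d<m. y d)"
proof (rule ex1I)
  let ?y = "\<lambda>d. if d < m then part (\<lambda>b. p b d) x else 0"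
  have "x = (\<Sum>d<m. ?y d)"
  proof (rule poly_mapping_eqI)
    fix b
    have "Poly_Mapping.lookup (\<Sum>d<m. ?y d) b = (\<Sum>d<m. if p b d then Poly_Mapping.lookup x b else 0)"
      by (simp add: lookup_sum lookup_part)
    also have "\<dots> = Poly_Mapping.lookup x b"
    proof (cases "b \<in> Poly_Mapping.keys x")
      case True
      then have "b \<in> basis (zigzag n) k" using x by (auto simp: chain_group_def)
      then obtain d where d: "d < m" "p b d" using p by blast
      have "(\<Sum>d'<m. if p b d' then Poly_Mapping.lookup x b else 0) = (\<Sum>d'<m. if d' = d then Poly_Mapping.lookup x b else 0)"
        using d(2) uniq by (intro sum.cong) auto
      then show ?thesis using d(1) by simp
    qed (auto simp: in_keys_iff intro!: sum.neutral)
    finally show "Poly_Mapping.lookup x b = Poly_Mapping.lookup (\<Sum>d<m. ?y d) b" ..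
  qed
  moreover have "\<forall>d<m. ?y d \<in> chain_group (zigzag n) (\<lambda>b. p b d) k"
    using part_mem[OF x] by simp
  ultimately show "(\<forall>d<m. ?y d \<in> chain_group (zigzag n) (\<lambda>b. p b d) k) \<and> (\<forall>d\<ge>m. ?y d = 0) \<and> x = (\<Sum>d<m. ?y d)"
    by simp
  fix y :: "nat \<Rightarrow> 'k chain"
  assume y: "(\<forall>d<m. y d \<in> chain_group (zigzag n) (\<lambda>b. p b d) k) \<and> (\<forall>d\<ge>m. y d = 0) \<and> x = (\<Sum>d<m. y d)"
  show "y = ?y"
  proof
    fix d show "y d = ?y d"
    proof (cases "d < m")
      case True
      have supp: "Poly_Mapping.lookup (y e) b = 0" if "e < m" "\<not> p b e" for e b
      proof (rule ccontr)
        assume "Poly_Mapping.lookup (y e) b \<noteq> 0"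
        then have "b \<in> Poly_Mapping.keys (y e)" by (simp add: in_keys_iff)
        moreover have "y e \<in> chain_group (zigzag n) (\<lambda>b. p b e) k" using y that(1) by blast
        ultimately show False using that(2) by (auto simp: chain_group_def)
      qed
      show ?thesis
      proof (rule poly_mapping_eqI)
        fix b
        show "Poly_Mapping.lookup (y d) b = Poly_Mapping.lookup (?y d) b"
        proof (cases "p b d")
          case pd: True
          have "Poly_Mapping.lookup x b = (\<Sum>e<m. Poly_Mapping.lookup (y e) b)" using y by (simp add: lookup_sum)
          also have "\<dots> = (\<Sum>e<m. if e = d then Poly_Mapping.lookup (y d) b else 0)"
          proof (rule sum.cong[OF refl])
            fix e assume "e \<in> {..<m}"
            then show "Poly_Mapping.lookup (y e) b = (if e = d then Poly_Mapping.lookup (y d) b else 0)"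
              using supp[of e b] uniq[OF pd, of e] by (cases "e = d") auto
          qed
          finally show ?thesis using True pd by (simp add: lookup_part)
        qed (use True supp in \<open>simp add: lookup_part\<close>)
      qed
    qed (use y in simp)
  qed
qed

section \<open>Traces on the decorated complex\<close>

lemma chain_group_span:
  "fs.independent ((\<lambda>b. Poly_Mapping.single b (1 :: 'k::field)) ` B)"
  "finite B \<Longrightarrow> fs.span ((\<lambda>b. Poly_Mapping.single b (1 :: 'k::field)) ` B) = {x. Poly_Mapping.keys x \<subseteq> B}"
proof -
  let ?s = "\<lambda>b. Poly_Mapping.single b (1 :: 'k)"
  have inj: "inj_on ?s A" for A by (rule inj_onI) (metis lookup_single_eq lookup_single_not_eq zero_neq_one)
  show "fs.independent (?s ` B)"
    unfolding fs.independent_explicit_module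
  proof (intro allI impI)
    fix t u v assume t: "finite t" "t \<subseteq> ?s ` B" "(\<Sum>v\<in>t. scale_fs (u v) v) = 0" "v \<in> t"
    then obtain b where b: "v = ?s b" by blast
    have "Poly_Mapping.lookup (\<Sum>v\<in>t. scale_fs (u v) v) b = (\<Sum>v'\<in>t. if v' = v then u v else 0)"
      unfolding lookup_sum
    proof (rule sum.cong[OF refl])
      fix v' assume "v' \<in> t"
      then obtain b' where b': "v' = ?s b'" using t(2) by blast
      then have "v' = v \<longleftrightarrow> b' = b" using inj_eq[OF inj] b by metis
      then show "Poly_Mapping.lookup (scale_fs (u v') v') b = (if v' = v then u v else 0)"
        by (simp add: b' lookup_single when_def b)
    qed
    then show "u v = 0" using t by simp
  qed
  show "fs.span (?s ` B) = {x. Poly_Mapping.keys x \<subseteq> B}" if "finite B"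
  proof
    have "fs.subspace {x :: 'a \<Rightarrow>\<^sub>0 'k. Poly_Mapping.keys x \<subseteq> B}"
    proof (rule fs.subspaceI)
      fix x y :: "'a \<Rightarrow>\<^sub>0 'k" and c
      assume x: "x \<in> {x. Poly_Mapping.keys x \<subseteq> B}"
      then show "scale_fs c x \<in> {x. Poly_Mapping.keys x \<subseteq> B}" using keys_scale_fs[of c x] by auto
      assume "y \<in> {x. Poly_Mapping.keys x \<subseteq> B}"
      then show "x + y \<in> {x. Poly_Mapping.keys x \<subseteq> B}" using x Poly_Mapping.keys_add[of x y] by auto
    qed simp
    then show "fs.span (?s ` B) \<subseteq> {x. Poly_Mapping.keys x \<subseteq> B}"
      by (intro fs.span_minimal) auto
    show "{x. Poly_Mapping.keys x \<subseteq> B} \<subseteq> fs.span (?s ` B)"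
    proof
      fix x :: "'a \<Rightarrow>\<^sub>0 'k" assume "x \<in> {x. Poly_Mapping.keys x \<subseteq> B}"
      then have "(\<Sum>b\<in>Poly_Mapping.keys x. scale_fs (Poly_Mapping.lookup x b) (?s b)) \<in> fs.span (?s ` B)"
        by (intro fs.span_sum fs.span_scale fs.span_base) auto
      then show "x \<in> fs.span (?s ` B)" by (simp only: chain_expansion)
    qed
  qed
qed

lemma fin_dim_chain: "fs.fin_dim (chain_group (zigzag n) P k :: 'k::field chain set)"
proof -
  have "fs.span ((\<lambda>b. Poly_Mapping.single b (1 :: 'k)) ` {b \<in> basis (zigzag n) k. P b}) = chain_group (zigzag n) P k"
    unfolding chain_group_def by (rule chain_group_span(2)) simp
  moreover have "finite ((\<lambda>b. Poly_Mapping.single b (1 :: 'k)) ` {b \<in> basis (zigzag n) k. P b})" by simp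
  ultimately show ?thesis unfolding fs.fin_dim_def by blast
qed

definition fixed_partitions :: "nat \<Rightarrow> nat list \<Rightarrow> (nat \<Rightarrow> nat) \<Rightarrow> nat set list set" where
  "fixed_partitions n \<beta> w = {Bs \<in> ordered_partitions {1..n} \<beta>. map ((`) w) Bs = Bs}"

lemma trace_chain_group:
  assumes n: "0 < n" and w: "w permutes {1..n}"
  shows "fs.trace_on (act w) (decorated_chains n Q k :: 'k::field chain set)
    = of_nat (card {b \<in> basis (zigzag n) k. Q (total_decoration b) \<and> map ((`) w) (fst b) = fst b})"
proof -
  let ?s = "\<lambda>b. Poly_Mapping.single b (1 :: 'k)"
  define B where "B = {b \<in> basis (zigzag n) k. Q (total_decoration b)}"
  have B: "finite B" by (simp add: B_def)
  have inj: "inj_on ?s B" by (rule inj_onI) (metis lookup_single_eq lookup_single_not_eq zero_neq_one)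
  have ind: "fs.independent (?s ` B)" by (rule chain_group_span(1))
  let ?w = "\<lambda>b :: basis_elt. (map ((`) w) (fst b), snd b)"
  have wB: "?w b \<in> B" if "b \<in> B" for b
    using act_basis_flag[OF n _ w, of b k] that by (simp add: B_def)
  have "fs.trace_on (act w) (decorated_chains n Q k :: 'k chain set)
      = (\<Sum>v\<in>?s ` B. fs.representation (?s ` B) (act w v) v)"
  proof (rule fs.trace_on_basis[OF _ ind _ act_linear])
    show "fs.span (?s ` B) = decorated_chains n Q k"
      using chain_group_span(2)[OF B] by (simp add: B_def chain_group_def)
    show "act w ` decorated_chains n Q k \<subseteq> (decorated_chains n Q k :: 'k chain set)"
      by (rule image_subsetI, rule act_mem[OF n _ w])
  qed (use B in simp)
  also have "\<dots> = (\<Sum>b\<in>B. fs.representation (?s ` B) (act w (?s b)) (?s b))"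
    by (simp add: sum.reindex[OF inj])
  also have "\<dots> = (\<Sum>b\<in>B. if map ((`) w) (fst b) = fst b then 1 else 0)"
  proof (rule sum.cong[OF refl])
    fix b assume b: "b \<in> B"
    have "act w (?s b) = ?s (?w b)" by (simp add: act_def)
    then have "fs.representation (?s ` B) (act w (?s b)) (?s b) = (if ?s b = ?s (?w b) then 1 else 0)"
      using fs.representation_basis[OF ind, of "?s (?w b)"] wB[OF b] by simp
    also have "?s b = ?s (?w b) \<longleftrightarrow> b = ?w b" using inj_on_eq_iff[OF inj b wB[OF b]] .
    also have "b = ?w b \<longleftrightarrow> map ((`) w) (fst b) = fst b" by (cases b) auto
    finally show "fs.representation (?s ` B) (act w (?s b)) (?s b) = (if map ((`) w) (fst b) = fst b then 1 else 0)" .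
  qed
  also have "\<dots> = of_nat (card {b \<in> B. map ((`) w) (fst b) = fst b})"
    by (simp add: sum.If_cases[OF B] Int_def)
  also have "{b \<in> B. map ((`) w) (fst b) = fst b} = {b \<in> basis (zigzag n) k. Q (total_decoration b) \<and> map ((`) w) (fst b) = fst b}"
    by (auto simp: B_def)
  finally show ?thesis .
qed

text \<open>The coarsenings allowed for \<open>\<theta>\<close> are those of its factorization composition.\<close>

lemma factorization_composition:
  assumes "0 < n"
  shows "factorization_composition n \<theta> \<in> compositions n"
    "coarsenings (factorization_composition n \<theta>) = {\<beta> \<in> compositions n. cuts \<beta> \<subseteq> factorization_cuts n \<theta>}"
    "length (factorization_composition n \<theta>) = Suc (card (factorization_cuts n \<theta>))"
  using comp_of_cuts[OF factorization_cuts_bounds assms] coarsenings_comp_of_cuts[OF factorization_cuts_bounds assms]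
  by (simp_all add: factorization_composition_def)

lemma card_fixed_basis:
  assumes n: "0 < n"
  shows "card {b \<in> basis (zigzag n) k. Q (total_decoration b) \<and> map ((`) w) (fst b) = fst b}
    = (\<Sum>\<theta> | \<theta> \<in> decorations n \<and> Q \<theta>. \<Sum>\<beta> | \<beta> \<in> coarsenings (factorization_composition n \<theta>) \<and> length \<beta> = k.
        card (fixed_partitions n \<beta> w))"
proof -
  let ?\<Theta> = "{\<theta> \<in> decorations n. Q \<theta>}"
  let ?C = "\<lambda>\<theta>. {\<beta> \<in> coarsenings (factorization_composition n \<theta>). length \<beta> = k}"
  let ?S = "Sigma ?\<Theta> (\<lambda>\<theta>. Sigma (?C \<theta>) (\<lambda>\<beta>. fixed_partitions n \<beta> w))"
  let ?B = "{b \<in> basis (zigzag n) k. Q (total_decoration b) \<and> map ((`) w) (fst b) = fst b}"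
  let ?f = "\<lambda>b :: basis_elt. (total_decoration b, map card (fst b), fst b)"
  have fin: "finite (fixed_partitions n \<beta> w)" for \<beta>
    using finite_ordered_partitions[of "{1..n}" \<beta>] by (simp add: fixed_partitions_def)
  have "bij_betw ?f ?B ?S"
  proof (rule bij_betw_imageI)
    show "inj_on ?f ?B"
      by (rule inj_onI) (use basis_inject[OF n] in auto)
    show "?f ` ?B = ?S"
    proof (intro subset_antisym subsetI)
      fix p assume "p \<in> ?f ` ?B"
      then obtain b where b: "p = ?f b" "b \<in> basis (zigzag n) k" "Q (total_decoration b)" "map ((`) w) (fst b) = fst b" by blast
      obtain \<beta> where \<beta>: "\<beta> \<in> coarsenings (zigzag n)" "length \<beta> = k" "map card (fst b) = \<beta>"
        "list_all2 (\<lambda>\<xi> b. \<xi> \<in> decorations b) (snd b) \<beta>" "partition {1..n} (fst b) \<beta>"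
        using b(2) by (rule basisE)
      interpret partition "{1..n}" "fst b" \<beta> by fact
      have "(total_decoration b, flag_of (fst b)) \<in> flag_index n" by (rule basis_flag_index(1)[OF n b(2)])
      then have "total_decoration b \<in> decorations n" "cuts \<beta> \<subseteq> factorization_cuts n (total_decoration b)"
        using cards_flag by (auto simp: flag_index_def)
      then show "p \<in> ?S" using b \<beta> part
        by (simp add: factorization_composition[OF n] fixed_partitions_def coarsenings_zigzag)
    next
      fix p assume "p \<in> ?S"
      then obtain \<theta> \<beta> Bs where p: "p = (\<theta>, \<beta>, Bs)" "\<theta> \<in> decorations n" "Q \<theta>" "\<beta> \<in> compositions n"
        "cuts \<beta> \<subseteq> factorization_cuts n \<theta>" "length \<beta> = k" "Bs \<in> ordered_partitions {1..n} \<beta>" "map ((`) w) Bs = Bs"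
        by (auto simp: factorization_composition[OF n] fixed_partitions_def)
      have \<beta>: "\<beta> \<in> coarsenings (zigzag n)"
        using p(4,5) by (auto simp: coarsenings_def compositions_def factorization_cuts_def)
      have "\<theta> \<in> total_decoration_of \<beta> ` {\<xi>s. list_all2 (\<lambda>\<xi> b. \<xi> \<in> decorations b) \<xi>s \<beta>}"
        unfolding bij_betw_imp_surj_on[OF total_decoration_bij[OF \<beta> n]] using p(2,5) by blast
      then obtain \<xi>s where \<xi>s: "\<theta> = total_decoration_of \<beta> \<xi>s" "list_all2 (\<lambda>\<xi> b. \<xi> \<in> decorations b) \<xi>s \<beta>" by blast
      have mc: "map card Bs = \<beta>" using p(7) by (simp add: ordered_partitions_def)
      then have "p = ?f (Bs, \<xi>s)" using p(1) \<xi>s(1) by (simp add: total_decoration_def)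
      moreover have "(Bs, \<xi>s) \<in> ?B" using p \<beta> \<xi>s mc by (auto simp: mem_basis total_decoration_def)
      ultimately show "p \<in> ?f ` ?B" by blast
    qed
  qed
  then have "card ?B = card ?S" by (rule bij_betw_same_card)
  also have "\<dots> = (\<Sum>\<theta>\<in>?\<Theta>. \<Sum>\<beta>\<in>?C \<theta>. card (fixed_partitions n \<beta> w))"
    using fin by (subst card_SigmaI) (auto intro!: sum.cong card_SigmaI)
  finally show ?thesis .
qed

section \<open>Frobenius characteristics of the homology\<close>

lemma frobenius_eq:
  "frobenius n f Z W = smult_ms (1 / of_nat (fact n)) (\<Sum>w | w permutes {1..n}. smult_ms (quotient_trace (f w) Z W) (cycle_psum {1..n} w))"
  by (simp add: frobenius_def cycle_psum_def)

lemma cycle_boundary_spaces: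
  fixes Q :: "decoration \<Rightarrow> bool"
  assumes n: "0 < n" and w: "w permutes {1..n}"
  defines "C \<equiv> \<lambda>k. decorated_chains n Q k :: 'k::field_char_0 chain set"
  shows "fs.fin_dim {x \<in> C k. boundary x = 0}" "fs.subspace (boundary ` C (Suc k))"
    "boundary ` C (Suc k) \<subseteq> {x \<in> C k. boundary x = 0}"
    "act w ` {x \<in> C k. boundary x = 0} \<subseteq> {x \<in> C k. boundary x = 0}"
    "act w ` boundary ` C (Suc k) \<subseteq> boundary ` C (Suc k)"
proof -
  have sub: "fs.subspace {x \<in> C k. boundary x = 0}"
    using fs.subspace_inter[OF chain_subspace boundary.subspace_kernel] unfolding C_def by (simp add: Int_def)
  show "fs.fin_dim {x \<in> C k. boundary x = 0}"
    by (rule fs.fin_dim_subset[OF fin_dim_chain sub]) (auto simp: C_def)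
  show "fs.subspace (boundary ` C (Suc k))" unfolding C_def by (rule boundary.subspace_image[OF chain_subspace])
  show "boundary ` C (Suc k) \<subseteq> {x \<in> C k. boundary x = 0}"
    unfolding C_def
  proof (rule image_subsetI)
    fix x :: "'k chain" assume x: "x \<in> decorated_chains n Q (Suc k)"
    show "boundary x \<in> {x \<in> decorated_chains n Q k. boundary x = 0}"
      using boundary_mem[OF n x] boundary_boundary[OF n x] by simp
  qed
  show "act w ` {x \<in> C k. boundary x = 0} \<subseteq> {x \<in> C k. boundary x = 0}"
  proof (rule image_subsetI)
    fix x assume x: "x \<in> {x \<in> C k. boundary x = 0}"
    then have xm: "x \<in> decorated_chains n Q k" "boundary x = 0" by (simp_all add: C_def)
    have "boundary (act w x) = 0" unfolding boundary_act[OF n xm(1) w] xm(2) by (rule act.zero)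
    then show "act w x \<in> {x \<in> C k. boundary x = 0}" using act_mem[OF n xm(1) w] by (simp add: C_def)
  qed
  show "act w ` boundary ` C (Suc k) \<subseteq> boundary ` C (Suc k)"
  proof clarify
    fix x assume x: "x \<in> C (Suc k)"
    then have xm: "x \<in> decorated_chains n Q (Suc k)" by (simp add: C_def)
    show "act w (boundary x) \<in> boundary ` C (Suc k)"
      unfolding C_def boundary_act[OF n xm w, symmetric] using act_mem[OF n xm w] by (rule imageI)
  qed
qed

lemma frobenius_homology_zero:
  assumes n: "0 < n" and z: "homology_zero TYPE('k::field_char_0) (zigzag n) (\<lambda>b. Q (total_decoration b)) k i j"
  shows "frobenius n act (cycles (zigzag n) (\<lambda>b. Q (total_decoration b)) k i j)
    (boundaries (zigzag n) (\<lambda>b. Q (total_decoration b)) k i j :: 'k chain set) = 0"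
proof -
  let ?Q = "in_bidegree n Q i j"
  have "quotient_trace (act w) (cycles (zigzag n) (\<lambda>b. Q (total_decoration b)) k i j)
      (boundaries (zigzag n) (\<lambda>b. Q (total_decoration b)) k i j :: 'k chain set) = 0" if w: "w permutes {1..n}" for w
  proof -
    note sp = cycle_boundary_spaces[OF n w, where Q = ?Q and k = k and 'k = 'k]
    have "{x \<in> decorated_chains n ?Q k. boundary x = 0} = (boundary ` decorated_chains n ?Q (Suc k) :: 'k chain set)"
      using z unfolding homology_zero_def cycles_eq[OF n] boundaries_eq[OF n] .
    moreover have "quotient_trace (act w) {x \<in> decorated_chains n ?Q k. boundary x = 0} (boundary ` decorated_chains n ?Q (Suc k))
        = fs.trace_on (act w) {x \<in> decorated_chains n ?Q k. boundary x = 0} - fs.trace_on (act w) (boundary ` decorated_chains n ?Q (Suc k) :: 'k chain set)"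
      by (rule quotient_trace_eq[OF sp(1,2,3) act_linear sp(4,5)])
    ultimately show ?thesis unfolding cycles_eq[OF n] boundaries_eq[OF n] by simp
  qed
  then show ?thesis by (simp add: frobenius_eq)
qed

text \<open>In its only nonzero degree the homology has, by the Hopf trace formula, the alternating
  sum of the Frobenius characteristics of the chain groups; for each total decoration the chain
  groups contribute exactly the terms of the ribbon function of its factorization composition.\<close>

lemma frobenius_homology_top:
  assumes n: "0 < n"
    and top: "\<And>\<theta>. \<theta> \<in> decorations n \<Longrightarrow> in_bidegree n Q i j \<theta> \<Longrightarrow> Suc (card (factorization_cuts n \<theta>)) = K"
  shows "frobenius n act (cycles (zigzag n) (\<lambda>b. Q (total_decoration b)) K i j)
      (boundaries (zigzag n) (\<lambda>b. Q (total_decoration b)) K i j :: 'k::field_char_0 chain set)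
    = (\<Sum>\<theta> | \<theta> \<in> decorations n \<and> in_bidegree n Q i j \<theta>. ribbon (factorization_composition n \<theta>))"
proof -
  let ?Q = "in_bidegree n Q i j"
  let ?C = "\<lambda>k. decorated_chains n ?Q k :: 'k chain set"
  let ?\<Theta> = "{\<theta> \<in> decorations n. ?Q \<theta>}"
  let ?\<gamma> = "factorization_composition n"
  let ?fix = "\<lambda>\<beta> w. of_nat (card (fixed_partitions n \<beta> w)) :: 'k"
  have trace: "quotient_trace (act w) {x \<in> ?C K. boundary x = 0} (boundary ` ?C (Suc K))
      = (\<Sum>\<theta>\<in>?\<Theta>. \<Sum>\<beta>\<in>coarsenings (?\<gamma> \<theta>). (- 1) ^ (length (?\<gamma> \<theta>) - length \<beta>) * ?fix \<beta> w)"
    if w: "w permutes {1..n}" for w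
  proof -
    note sp = cycle_boundary_spaces[OF n w, where Q = ?Q and 'k = 'k]
    define q where "q k = quotient_trace (act w) {x \<in> ?C k. boundary x = 0} (boundary ` ?C (Suc k))" for k
    have q: "q k = fs.trace_on (act w) {x \<in> ?C k. boundary x = 0} - fs.trace_on (act w) (boundary ` ?C (Suc k))" for k
      unfolding q_def by (rule quotient_trace_eq[OF sp(1,2,3) act_linear sp(4,5)])
    have q0: "q k = 0" if "k \<noteq> K" for k
    proof -
      have "homology_zero TYPE('k) (zigzag n) (\<lambda>b. Q (total_decoration b)) k i j"
        by (rule homology_zero_off_top[OF n]) (use top that in auto)
      then have "{x \<in> ?C k. boundary x = 0} = boundary ` ?C (Suc k)"
        unfolding homology_zero_def cycles_eq[OF n] boundaries_eq[OF n] .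
      then show ?thesis using q by simp
    qed
    define m where "m = n + K"
    have empty: "?C k = {0}" if "k = 0 \<or> n < k" for k
    proof -
      have "basis (zigzag n) k = {}"
      proof (rule ccontr)
        assume "basis (zigzag n) k \<noteq> {}"
        then obtain b where b: "b \<in> basis (zigzag n) k" by blast
        have k: "k = Suc (card (flag_of (fst b)))" by (rule basis_flag_index(2)[OF n b])
        obtain \<beta> where \<beta>: "\<beta> \<in> coarsenings (zigzag n)" "length \<beta> = k" using b by (rule basisE)
        have "card (cuts \<beta>) \<le> card {0<..<n}" using cuts_bounds[of \<beta> n] \<beta>(1) by (intro card_mono) (auto simp: coarsenings_zigzag)
        moreover have "length \<beta> = Suc (card (cuts \<beta>))"
        proof (rule card_cuts)
          show "\<beta> \<in> compositions n" using \<beta>(1) by (simp add: coarsenings_zigzag)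
          show "\<beta> \<noteq> []" using \<beta>(2) k by auto
        qed
        ultimately show False using that k \<beta>(2) n by simp
      qed
      then show ?thesis by (auto simp: chain_group_def)
    qed
    have "(\<Sum>k\<le>m. (- 1) ^ k * q k) = (\<Sum>k\<le>m. (- 1) ^ k * fs.trace_on (act w) (?C k))"
      unfolding q
    proof (rule fs.hopf_trace[OF fin_dim_chain act_linear _ boundary_linear])
      show "act w ` ?C k \<subseteq> ?C k" for k by (rule image_subsetI, rule act_mem[OF n _ w])
      show "boundary ` ?C (Suc k) \<subseteq> ?C k" for k by (rule image_subsetI, rule boundary_mem[OF n])
      show "boundary (act w x) = act w (boundary x)" if "x \<in> ?C k" for k x by (rule boundary_act[OF n that w])
    qed (use empty in \<open>simp_all add: m_def\<close>)
    also have "(\<Sum>k\<le>m. (- 1) ^ k * q k) = (\<Sum>k\<le>m. if k = K then (- 1) ^ K * q K else 0)"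
      using q0 by (intro sum.cong) auto
    also have "\<dots> = (- 1) ^ K * q K" by (simp add: m_def)
    finally have "(- 1) ^ K * q K = (\<Sum>k\<le>m. (- 1) ^ k * fs.trace_on (act w) (?C k))" .
    also have "\<dots> = (\<Sum>k\<le>m. \<Sum>\<theta>\<in>?\<Theta>. \<Sum>\<beta>\<in>{\<beta> \<in> coarsenings (?\<gamma> \<theta>). length \<beta> = k}. (- 1) ^ length \<beta> * ?fix \<beta> w)"
    proof (rule sum.cong[OF refl])
      fix k
      show "(- 1) ^ k * fs.trace_on (act w) (?C k)
          = (\<Sum>\<theta>\<in>?\<Theta>. \<Sum>\<beta>\<in>{\<beta> \<in> coarsenings (?\<gamma> \<theta>). length \<beta> = k}. (- 1) ^ length \<beta> * ?fix \<beta> w)"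
        unfolding trace_chain_group[OF n w, of ?Q k] card_fixed_basis[OF n, of k ?Q w] of_nat_sum sum_distrib_left
        by (intro sum.cong[OF refl]) simp
    qed
    also have "\<dots> = (\<Sum>\<theta>\<in>?\<Theta>. \<Sum>k\<le>m. \<Sum>\<beta>\<in>{\<beta> \<in> coarsenings (?\<gamma> \<theta>). length \<beta> = k}. (- 1) ^ length \<beta> * ?fix \<beta> w)"
      by (rule sum.swap)
    also have "\<dots> = (\<Sum>\<theta>\<in>?\<Theta>. \<Sum>\<beta>\<in>coarsenings (?\<gamma> \<theta>). (- 1) ^ length \<beta> * ?fix \<beta> w)"
    proof (rule sum.cong[OF refl])
      fix \<theta> assume \<theta>: "\<theta> \<in> ?\<Theta>"
      have "length ` coarsenings (?\<gamma> \<theta>) \<subseteq> {..m}"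
      proof (rule image_subsetI)
        fix \<beta> assume \<beta>: "\<beta> \<in> coarsenings (?\<gamma> \<theta>)"
        then have "\<beta> \<noteq> []" using n by (auto simp: factorization_composition[OF n])
        then have "length \<beta> = Suc (card (cuts \<beta>))" "card (cuts \<beta>) \<le> card (factorization_cuts n \<theta>)"
          using \<beta> card_cuts[of \<beta> n] by (auto simp: factorization_composition[OF n] intro: card_mono)
        then show "length \<beta> \<in> {..m}" using top[of \<theta>] \<theta> by (simp add: m_def)
      qed
      then show "(\<Sum>k\<le>m. \<Sum>\<beta>\<in>{\<beta> \<in> coarsenings (?\<gamma> \<theta>). length \<beta> = k}. (- 1) ^ length \<beta> * ?fix \<beta> w)
          = (\<Sum>\<beta>\<in>coarsenings (?\<gamma> \<theta>). (- 1) ^ length \<beta> * ?fix \<beta> w)"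
        by (intro sum.group) auto
    qed
    finally have qK: "(- 1) ^ K * q K = (\<Sum>\<theta>\<in>?\<Theta>. \<Sum>\<beta>\<in>coarsenings (?\<gamma> \<theta>). (- 1) ^ length \<beta> * ?fix \<beta> w)" .
    have "q K = (- 1) ^ K * ((- 1) ^ K * q K)" by (simp add: mult.assoc[symmetric] power_mult_distrib[symmetric])
    also have "\<dots> = (\<Sum>\<theta>\<in>?\<Theta>. \<Sum>\<beta>\<in>coarsenings (?\<gamma> \<theta>). (- 1) ^ (length (?\<gamma> \<theta>) - length \<beta>) * ?fix \<beta> w)"
      unfolding qK sum_distrib_left
    proof (intro sum.cong[OF refl])
      fix \<theta> \<beta> assume \<theta>: "\<theta> \<in> ?\<Theta>" and \<beta>: "\<beta> \<in> coarsenings (?\<gamma> \<theta>)"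
      have K: "length (?\<gamma> \<theta>) = K" using top[of \<theta>] \<theta> by (simp add: factorization_composition[OF n])
      have "\<beta> \<noteq> []" using \<beta> n by (auto simp: factorization_composition[OF n])
      then have "length \<beta> = Suc (card (cuts \<beta>))" "card (cuts \<beta>) \<le> card (factorization_cuts n \<theta>)"
        using \<beta> card_cuts[of \<beta> n] by (auto simp: factorization_composition[OF n] intro: card_mono)
      then have "length \<beta> \<le> K" using K by (simp add: factorization_composition[OF n])
      then have "K = length \<beta> + (K - length \<beta>)" by simp
      then have "(- 1) ^ K * (- 1) ^ length \<beta> = ((- 1) ^ (K - length \<beta>) :: 'k)"
        by (metis (no_types, lifting) mult.assoc mult.commute mult.left_neutral left_minus_one_mult_self power_add)
      then show "(- 1) ^ K * ((- 1) ^ length \<beta> * ?fix \<beta> w) = (- 1) ^ (length (?\<gamma> \<theta>) - length \<beta>) * ?fix \<beta> w"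
        unfolding K by (simp add: mult.assoc[symmetric])
    qed
    finally show ?thesis by (simp add: q_def)
  qed
  let ?p = "cycle_psum {1..n} :: _ \<Rightarrow> 'k mseries"
  have "frobenius n act (cycles (zigzag n) (\<lambda>b. Q (total_decoration b)) K i j)
      (boundaries (zigzag n) (\<lambda>b. Q (total_decoration b)) K i j :: 'k chain set)
    = smult_ms (1 / of_nat (fact n)) (\<Sum>w | w permutes {1..n}.
        smult_ms (\<Sum>\<theta>\<in>?\<Theta>. \<Sum>\<beta>\<in>coarsenings (?\<gamma> \<theta>). (- 1) ^ (length (?\<gamma> \<theta>) - length \<beta>) * ?fix \<beta> w) (?p w))"
    unfolding frobenius_eq cycles_eq[OF n] boundaries_eq[OF n]
    by (intro arg_cong[where f = "smult_ms (1 / of_nat (fact n))"] sum.cong[OF refl]) (simp add: trace)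
  also have "\<dots> = smult_ms (1 / of_nat (fact n)) (\<Sum>w | w permutes {1..n}. \<Sum>\<theta>\<in>?\<Theta>. \<Sum>\<beta>\<in>coarsenings (?\<gamma> \<theta>).
        smult_ms ((- 1) ^ (length (?\<gamma> \<theta>) - length \<beta>)) (smult_ms (?fix \<beta> w) (?p w)))"
    by (simp add: smult_ms_sum_left)
  also have "(\<Sum>w | w permutes {1..n}. \<Sum>\<theta>\<in>?\<Theta>. \<Sum>\<beta>\<in>coarsenings (?\<gamma> \<theta>).
        smult_ms ((- 1) ^ (length (?\<gamma> \<theta>) - length \<beta>)) (smult_ms (?fix \<beta> w) (?p w)))
      = (\<Sum>\<theta>\<in>?\<Theta>. \<Sum>\<beta>\<in>coarsenings (?\<gamma> \<theta>). \<Sum>w | w permutes {1..n}.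
        smult_ms ((- 1) ^ (length (?\<gamma> \<theta>) - length \<beta>)) (smult_ms (?fix \<beta> w) (?p w)))"
    by (subst sum.swap) (intro sum.cong[OF refl] sum.swap)
  also have "smult_ms (1 / of_nat (fact n)) \<dots> = (\<Sum>\<theta>\<in>?\<Theta>. \<Sum>\<beta>\<in>coarsenings (?\<gamma> \<theta>).
      smult_ms ((- 1) ^ (length (?\<gamma> \<theta>) - length \<beta>)) (smult_ms (1 / of_nat (fact n)) (\<Sum>w | w permutes {1..n}. smult_ms (?fix \<beta> w) (?p w))))"
    by (simp only: smult_ms_sum smult_smult_ms) (simp only: mult.commute mult.left_commute mult.assoc)
  also have "\<dots> = (\<Sum>\<theta>\<in>?\<Theta>. \<Sum>\<beta>\<in>coarsenings (?\<gamma> \<theta>). smult_ms ((- 1) ^ (length (?\<gamma> \<theta>) - length \<beta>)) (prod_list (map hsym \<beta>)))"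
  proof (intro sum.cong[OF refl])
    fix \<theta> \<beta> assume "\<beta> \<in> coarsenings (?\<gamma> \<theta>)"
    then have "sum_list \<beta> = card {1..n}" by (simp add: factorization_composition[OF n] compositions_sum)
    then have "(\<Sum>w | w permutes {1..n}. smult_ms (?fix \<beta> w) (?p w)) = smult_ms (of_nat (fact n)) (prod_list (map hsym \<beta>))"
      using sum_fixed_ordered_partitions[of "{1..n}" \<beta>, where 'a = 'k] by (simp add: fixed_partitions_def)
    then show "smult_ms ((- 1) ^ (length (?\<gamma> \<theta>) - length \<beta>)) (smult_ms (1 / of_nat (fact n)) (\<Sum>w | w permutes {1..n}. smult_ms (?fix \<beta> w) (?p w)))
        = smult_ms ((- 1) ^ (length (?\<gamma> \<theta>) - length \<beta>)) (prod_list (map hsym \<beta>))" by simp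
  qed
  finally show ?thesis by (simp add: ribbon_def power_neg_one_ms)
qed

section \<open>The factorization defect\<close>

lemma fd_formula:
  assumes \<theta>: "\<theta> \<in> decorations n"
  shows "fd n \<theta> = int (ell n) - int (Suc (card (factorization_cuts n \<theta>))) - int (deg_q n \<theta>)"
  using cycle_count_le[of "{1..up_half n}" "fst \<theta>"] by (simp add: fd_def deg_q_def ell_up_half)

text \<open>The intervals \<open>{1..a}\<close> that end at a factorization cut, together with the whole interval,
  are invariant under \<open>\<sigma>\<close>; so their largest elements lie on different cycles.\<close>

lemma fd_nonneg:
  assumes n: "0 < n" and \<theta>: "\<theta> \<in> decorations n"
  shows "0 \<le> fd n \<theta>"
proof -
  let ?\<sigma> = "fst \<theta>" and ?F = "factorization_cuts n \<theta>" and ?p = "up_half n"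
  have \<sigma>: "?\<sigma> permutes {1..?p}" using \<theta> by (simp add: mem_decorations)
  let ?A = "insert ?p (up_half ` ?F)"
  have half: "up_half c < ?p" "1 \<le> up_half c" "2 * up_half c = c" if "c \<in> ?F" for c
  proof -
    have "even c" "0 < c" "c < n" using that by (auto simp: factorization_cuts_def cuts_zigzag)
    then show "up_half c < ?p" "1 \<le> up_half c" "2 * up_half c = c" by (auto simp: up_half_def elim!: evenE)
  qed
  have card: "card ?A = Suc (card ?F)"
  proof -
    have "inj_on up_half ?F"
    proof (rule inj_onI)
      fix c c' assume "c \<in> ?F" "c' \<in> ?F" "up_half c = up_half c'"
      then show "c = c'" by (metis half(3))
    qed
    then have "card (up_half ` ?F) = card ?F" by (rule card_image)
    moreover have "?p \<notin> up_half ` ?F"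
    proof
      assume "?p \<in> up_half ` ?F"
      then obtain c where "c \<in> ?F" "?p = up_half c" by (rule imageE)
      then show False using half(1)[of c] by simp
    qed
    moreover have "finite (up_half ` ?F)" by simp
    ultimately show ?thesis using card_insert_disjoint by metis
  qed
  have inv: "?\<sigma> ` {1..a} = {1..a}" "1 \<le> a" "a \<le> ?p" if "a \<in> ?A" for a
  proof -
    have p1: "1 \<le> ?p" using n by (simp add: up_half_def)
    show "?\<sigma> ` {1..a} = {1..a}" using that permutes_image[OF \<sigma>] by (auto simp: factorization_cuts_def)
    show "1 \<le> a" "a \<le> ?p" using that half(1,2) p1 less_imp_le by blast+
  qed
  have orb: "orbit ?\<sigma> a \<subseteq> {1..a}" if "a \<in> ?A" for a
  proof
    fix y assume "y \<in> orbit ?\<sigma> a"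
    then show "y \<in> {1..a}" by induct (use inv[OF that] in auto)
  qed
  have self: "a \<in> orbit ?\<sigma> a" for a
    by (rule permutation_self_in_orbit[OF permutes_imp_permutation[OF finite_atLeastAtMost \<sigma>]])
  have inj: "inj_on (orbit ?\<sigma>) ?A"
  proof (rule inj_onI)
    fix a b assume ab: "a \<in> ?A" "b \<in> ?A" "orbit ?\<sigma> a = orbit ?\<sigma> b"
    have "b \<in> {1..a}" "a \<in> {1..b}" using self[of a] self[of b] orb[OF ab(1)] orb[OF ab(2)] ab(3) by blast+
    then show "a = b" by simp
  qed
  have "orbit ?\<sigma> ` ?A \<subseteq> orbit ?\<sigma> ` {1..?p}" using inv(2,3) by fastforce
  then have "card (orbit ?\<sigma> ` ?A) \<le> card (orbit ?\<sigma> ` {1..?p})" by (rule card_mono[rotated]) simp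
  then have "Suc (card ?F) \<le> cycle_count {1..?p} ?\<sigma>"
    unfolding card_image[OF inj] card by (simp add: cycle_count_def)
  then show ?thesis by (simp add: fd_def)
qed

lemma ell_le_degrees:
  assumes \<theta>: "\<theta> \<in> decorations n"
  shows "ell n \<le> deg_t n \<theta> + deg_q n \<theta>"
  using cycle_count_le[of "{1..up_half n}" "fst \<theta>"] cycle_count_pos[of "{0..dn_half n}" "snd \<theta>"]
  by (simp add: deg_t_def deg_q_def ell_up_half)

section \<open>Homology of the pieces of given defect\<close>

definition defect_ribbons :: "nat \<Rightarrow> nat \<Rightarrow> nat \<Rightarrow> nat \<Rightarrow> 'a::comm_ring_1 mseries" where
  "defect_ribbons n d i j = (\<Sum>\<theta> | \<theta> \<in> decorations n \<and> in_bidegree n (\<lambda>\<theta>. fd n \<theta> = int d) i j \<theta>.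
     ribbon (factorization_composition n \<theta>))"

abbreviation frobenius_homology :: "nat \<Rightarrow> (decoration \<Rightarrow> bool) \<Rightarrow> nat \<Rightarrow> nat \<Rightarrow> nat \<Rightarrow> 'k::field_char_0 mseries" where
  "frobenius_homology n Q k i j \<equiv> frobenius n act (cycles (zigzag n) (\<lambda>b. Q (total_decoration b)) k i j)
     (boundaries (zigzag n) (\<lambda>b. Q (total_decoration b)) k i j :: 'k chain set)"

lemma frobenius_defect:
  assumes n: "0 < n"
  shows "(frobenius_homology n (\<lambda>\<theta>. fd n \<theta> = int d) k i j :: 'k::field_char_0 mseries)
    = (if k + j + d = ell n then defect_ribbons n d i j else 0)"
proof -
  have top: "int (Suc (card (factorization_cuts n \<theta>))) + int j + int d = int (ell n)"
    if "\<theta> \<in> decorations n" "in_bidegree n (\<lambda>\<theta>. fd n \<theta> = int d) i j \<theta>" for \<theta>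
    using fd_formula[OF that(1)] that(2) by simp
  show ?thesis
  proof (cases "k + j + d = ell n")
    case True
    have "(frobenius_homology n (\<lambda>\<theta>. fd n \<theta> = int d) k i j :: 'k mseries) = defect_ribbons n d i j"
      unfolding defect_ribbons_def
    proof (rule frobenius_homology_top[OF n])
      fix \<theta> assume "\<theta> \<in> decorations n" "in_bidegree n (\<lambda>\<theta>. fd n \<theta> = int d) i j \<theta>"
      from top[OF this] show "Suc (card (factorization_cuts n \<theta>)) = k" using True by linarith
    qed
    then show ?thesis using True by simp
  next
    case False
    have "(frobenius_homology n (\<lambda>\<theta>. fd n \<theta> = int d) k i j :: 'k mseries) = 0"
    proof (rule frobenius_homology_zero[OF n], rule homology_zero_off_top[OF n])
      fix \<theta> assume "\<theta> \<in> decorations n" "in_bidegree n (\<lambda>\<theta>. fd n \<theta> = int d) i j \<theta>"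
      from top[OF this] show "k \<noteq> Suc (card (factorization_cuts n \<theta>))" using False by linarith
    qed
    then show ?thesis using False by simp
  qed
qed

lemma chain_bidegree_split:
  assumes n: "0 < n"
  shows "x \<in> decorated_chains n (in_bidegree n (\<lambda>_. True) i j) k \<Longrightarrow>
      part (\<lambda>b. P (total_decoration b)) x \<in> decorated_chains n (in_bidegree n P i j) k"
    and "x \<in> decorated_chains n (in_bidegree n P i j) k \<Longrightarrow>
      x \<in> decorated_chains n (in_bidegree n (\<lambda>_. True) i j) k"
  by (auto simp: chain_group_def in_keys_iff lookup_part split: if_splits)

text \<open>Homology is additive over a splitting by total decoration; a part without homology in the
  degree at hand can be dropped.\<close>

lemma frobenius_part:
  assumes n: "0 < n"
    and z: "homology_zero TYPE('k::field_char_0) (zigzag n) (\<lambda>b. \<not> P (total_decoration b)) k i j"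
  shows "(frobenius_homology n (\<lambda>_. True) k i j :: 'k mseries) = frobenius_homology n P k i j"
proof -
  let ?C = "\<lambda>P k. decorated_chains n (in_bidegree n P i j) k :: 'k chain set"
  let ?Z = "\<lambda>P. {x \<in> ?C P k. boundary x = 0}" and ?W = "\<lambda>P. boundary ` ?C P (Suc k)"
  let ?N = "\<lambda>\<theta>. \<not> P \<theta>" and ?T = "\<lambda>_ :: decoration. True"
  have ZW: "?Z ?N = ?W ?N" using z unfolding homology_zero_def cycles_eq[OF n, of ?N] boundaries_eq[OF n, of ?N] .
  have int: "?C P m \<inter> ?C ?N m = {0}" for m
  proof -
    have "x = 0" if "x \<in> ?C P m \<inter> ?C ?N m" for x
    proof -
      have "False" if b: "b \<in> Poly_Mapping.keys x" for b
      proof -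
        have "P (total_decoration b)" "\<not> P (total_decoration b)"
          using \<open>x \<in> ?C P m \<inter> ?C ?N m\<close> b unfolding chain_group_def by blast+
        then show False by blast
      qed
      then have "Poly_Mapping.keys x = {}" by blast
      then show ?thesis by simp
    qed
    then show ?thesis using fs.subspace_0[OF chain_subspace] by blast
  qed
  have Z: "?Z ?T = {a + b | a b. a \<in> ?Z P \<and> b \<in> ?Z ?N}"
  proof (intro subset_antisym subsetI)
    fix x assume x: "x \<in> ?Z ?T"
    then have xC: "x \<in> ?C ?T k" by blast
    let ?a = "part (\<lambda>b. P (total_decoration b)) x" and ?b = "part (\<lambda>b. \<not> P (total_decoration b)) x"
    have "?a \<in> ?Z P" using chain_bidegree_split(1)[OF n xC] boundary_part[OF n xC] x by (simp add: part.zero)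
    moreover have "?b \<in> ?Z ?N"
      using chain_bidegree_split(1)[OF n xC, of ?N] boundary_part[OF n xC, of ?N] x by (simp add: part.zero)
    moreover have "x = ?a + ?b" by (rule part_complement[symmetric])
    ultimately show "x \<in> {a + b | a b. a \<in> ?Z P \<and> b \<in> ?Z ?N}" by blast
  next
    fix x assume "x \<in> {a + b | a b. a \<in> ?Z P \<and> b \<in> ?Z ?N}"
    then obtain a b where ab: "x = a + b" "a \<in> ?C P k" "boundary a = 0" "b \<in> ?C ?N k" "boundary b = 0" by blast
    then show "x \<in> ?Z ?T"
      using fs.subspace_add[OF chain_subspace chain_bidegree_split(2)[OF n ab(2)] chain_bidegree_split(2)[OF n ab(4)]]
      by (simp add: boundary.add)
  qed
  have W: "?W ?T = {a + b | a b. a \<in> ?W P \<and> b \<in> ?W ?N}"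
  proof (intro subset_antisym subsetI)
    fix x assume "x \<in> ?W ?T"
    then obtain y where y: "y \<in> ?C ?T (Suc k)" "x = boundary y" by blast
    let ?a = "part (\<lambda>b. P (total_decoration b)) y" and ?b = "part (\<lambda>b. \<not> P (total_decoration b)) y"
    have "boundary ?a \<in> ?W P" using chain_bidegree_split(1)[OF n y(1)] by blast
    moreover have "boundary ?b \<in> ?W ?N" using chain_bidegree_split(1)[OF n y(1), of ?N] by blast
    moreover have "x = boundary ?a + boundary ?b"
      unfolding y(2) boundary.add[symmetric] part_complement[of "\<lambda>b. P (total_decoration b)" y] ..
    ultimately show "x \<in> {a + b | a b. a \<in> ?W P \<and> b \<in> ?W ?N}" by blast
  next
    fix x assume "x \<in> {a + b | a b. a \<in> ?W P \<and> b \<in> ?W ?N}"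
    then obtain a b where ab: "x = boundary a + boundary b" "a \<in> ?C P (Suc k)" "b \<in> ?C ?N (Suc k)" by blast
    have "a + b \<in> ?C ?T (Suc k)"
      by (rule fs.subspace_add[OF chain_subspace chain_bidegree_split(2)[OF n ab(2)] chain_bidegree_split(2)[OF n ab(3)]])
    then show "x \<in> ?W ?T" unfolding ab(1) boundary.add[symmetric] by (rule imageI)
  qed
  have "quotient_trace (act w) (?Z ?T) (?W ?T) = quotient_trace (act w) (?Z P) (?W P)" if w: "w permutes {1..n}" for w
  proof -
    note sT = cycle_boundary_spaces[OF n w, of "in_bidegree n ?T i j" k, where 'k = 'k]
    note sP = cycle_boundary_spaces[OF n w, of "in_bidegree n P i j" k, where 'k = 'k]
    note sN = cycle_boundary_spaces[OF n w, of "in_bidegree n ?N i j" k, where 'k = 'k]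
    have fW: "fs.fin_dim (?W P)" "fs.fin_dim (?W ?N)"
      by (rule fs.fin_dim_subset[OF sP(1,2,3)], rule fs.fin_dim_subset[OF sN(1,2,3)])
    have zero: "0 \<in> ?Z P" "0 \<in> ?Z ?N" "0 \<in> ?W P" "0 \<in> ?W ?N"
      using fs.subspace_0[OF fs.fin_dim_subspace[OF sP(1)]] fs.subspace_0[OF fs.fin_dim_subspace[OF sN(1)]]
        fs.subspace_0[OF sP(2)] fs.subspace_0[OF sN(2)] by blast+
    have i1: "?Z P \<inter> ?Z ?N = {0}" using int[of k] zero by blast
    have i2: "?W P \<inter> ?W ?N = {0}" using i1 sP(3) sN(3) zero by blast
    have "quotient_trace (act w) (?Z ?T) (?W ?T) = fs.trace_on (act w) (?Z ?T) - fs.trace_on (act w) (?W ?T)"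
      by (rule quotient_trace_eq[OF sT(1,2,3) act_linear sT(4,5)])
    also have "\<dots> = fs.trace_on (act w) (?Z P) + fs.trace_on (act w) (?Z ?N)
        - (fs.trace_on (act w) (?W P) + fs.trace_on (act w) (?W ?N))"
      unfolding Z W fs.trace_direct_sum[OF sP(1) sN(1) i1 act_linear sP(4) sN(4)]
        fs.trace_direct_sum[OF fW i2 act_linear sP(5) sN(5)] ..
    also have "\<dots> = fs.trace_on (act w) (?Z P) - fs.trace_on (act w) (?W P)" unfolding ZW by simp
    also have "\<dots> = quotient_trace (act w) (?Z P) (?W P)"
      by (rule quotient_trace_eq[OF sP(1,2,3) act_linear sP(4,5), symmetric])
    finally show ?thesis .
  qed
  then show ?thesis unfolding frobenius_eq cycles_eq[OF n, of ?T] boundaries_eq[OF n, of ?T] cycles_eq[OF n, of P] boundaries_eq[OF n, of P]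
    by (intro arg_cong[where f = "smult_ms (1 / of_nat (fact n))"] sum.cong[OF refl]) simp
qed

lemma homology_zero_full:
  assumes n: "0 < n" and v: "\<not> (k + j \<le> ell n \<and> ell n \<le> i + j)"
  shows "homology_zero TYPE('k::field_char_0) (zigzag n) (\<lambda>b. (\<lambda>_. True) (total_decoration b)) k i j"
proof (rule homology_zero_off_top[OF n])
  fix \<theta> assume \<theta>: "\<theta> \<in> decorations n" "in_bidegree n (\<lambda>_. True) i j \<theta>"
  show "k \<noteq> Suc (card (factorization_cuts n \<theta>))"
    using fd_formula[OF \<theta>(1)] fd_nonneg[OF n \<theta>(1)] ell_le_degrees[OF \<theta>(1)] \<theta>(2) v by linarith
qed

lemma frobenius_full:
  assumes n: "0 < n"
  shows "(frobenius_homology n (\<lambda>_. True) k i j :: 'k::field_char_0 mseries)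
    = (if k + j \<le> ell n then defect_ribbons n (ell n - k - j) i j else 0)"
proof (cases "k + j \<le> ell n")
  case False
  then show ?thesis using frobenius_homology_zero[OF n homology_zero_full[OF n], of k j i, where 'k = 'k] by simp
next
  case True
  define d where "d = ell n - k - j"
  have "homology_zero TYPE('k) (zigzag n) (\<lambda>b. \<not> fd n (total_decoration b) = int d) k i j"
  proof (rule homology_zero_off_top[OF n])
    fix \<theta> assume \<theta>: "\<theta> \<in> decorations n" "in_bidegree n (\<lambda>\<theta>. \<not> fd n \<theta> = int d) i j \<theta>"
    show "k \<noteq> Suc (card (factorization_cuts n \<theta>))"
    proof
      assume "k = Suc (card (factorization_cuts n \<theta>))"
      then have "fd n \<theta> = int (ell n) - int k - int j" using fd_formula[OF \<theta>(1)] \<theta>(2) by simp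
      then have "fd n \<theta> = int d" using True by (simp add: d_def)
      then show False using \<theta>(2) by blast
    qed
  qed
  then have "(frobenius_homology n (\<lambda>_. True) k i j :: 'k mseries) = frobenius_homology n (\<lambda>\<theta>. fd n \<theta> = int d) k i j"
    by (rule frobenius_part[OF n])
  then show ?thesis using frobenius_defect[OF n, of d k i j, where 'k = 'k] True by (simp add: d_def)
qed

section \<open>Graded characteristics\<close>

lemma bimonom_add: "bimonom (x + y) i j = bimonom x i j + bimonom y i j"
  by (simp add: bimonom_def add_monom)

lemma bimonom_0 [simp]: "bimonom 0 i j = 0"
  by (simp add: bimonom_def)

lemma bimonom_const: "bimonom c i j = bimonom 1 i j * [:[:c:]:]"
  by (simp add: bimonom_def smult_monom mult.commute)

lemma bimonom_mult: "bimonom a i j * bimonom b i' j' = bimonom (a * b) (i + i') (j + j')"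
  by (simp add: bimonom_def mult_monom)

lemma negate_bimonom: "negate_q (bimonom c i j) = (- 1) ^ j * bimonom c i j"
proof -
  have "negate_q (bimonom c i j) = smult (monom c i) ((- var_q) ^ j)"
  proof -
    have "pcompose (monom a j) q = smult a (q ^ j)" for a and q :: "'a poly poly"
      by (induction j) (simp_all add: monom_0 monom_Suc pcompose_pCons)
    then show ?thesis by (simp add: negate_q_def bimonom_def)
  qed
  also have "(- var_q :: 'a poly poly) ^ j = (- 1) ^ j * monom 1 j"
    unfolding power_minus[of var_q] by (simp add: var_q_def monom_altdef)
  finally show ?thesis by (simp add: bimonom_def smult_monom flip: mult_smult_right)
qed

lemma negate_add: "negate_q (P + Q) = negate_q P + negate_q Q"
  by (simp add: negate_q_def pcompose_add)

lemma map_bimonom_sum: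
  "map_ms (\<lambda>c. bimonom c i j) (\<Sum>x\<in>I. F x) = (\<Sum>x\<in>I. map_ms (\<lambda>c. bimonom c i j) (F x))"
  by (rule map_ms_sum) (rule bimonom_add)

lemma map_bimonom_ribbon:
  "map_ms (\<lambda>c :: 'k::field. bimonom c i j) (ribbon \<alpha>) = smult_ms (bimonom 1 i j) (ribbon \<alpha>)"
proof -
  have "map_ms (\<lambda>c. [:[:c:]:] :: 'k poly poly) (ribbon \<alpha>) = ribbon \<alpha>"
    by (rule map_ms_ribbon) (simp_all add: one_pCons)
  then have "smult_ms (bimonom 1 i j) (ribbon \<alpha>) = smult_ms (bimonom 1 i j) (map_ms (\<lambda>c. [:[:c:]:]) (ribbon \<alpha> :: 'k mseries))"
    by simp
  also have "\<dots> = map_ms (\<lambda>c. bimonom c i j) (ribbon \<alpha>)"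
    by (rule mseries_eqI) (simp only: mcoeff_simps bimonom_const[symmetric])
  finally show ?thesis ..
qed

text \<open>The part of a defect class in bidegree \<open>(i, j)\<close>.\<close>

definition defect_part :: "nat \<Rightarrow> nat \<Rightarrow> nat \<Rightarrow> nat \<Rightarrow> 'k::field_char_0 poly poly mseries" where
  "defect_part n d i j = map_ms (\<lambda>c :: 'k. bimonom c i j) (defect_ribbons n d i j)"

definition bidegrees :: "nat \<Rightarrow> (nat \<times> nat) set" where
  "bidegrees n = (\<lambda>\<theta>. (deg_t n \<theta>, deg_q n \<theta>)) ` decorations n"

lemma finite_bidegrees [simp]: "finite (bidegrees n)"
  by (simp add: bidegrees_def)

lemma defect_class_parts: "(defect_class n d :: 'k::field_char_0 poly poly mseries) = (\<Sum>(i, j)\<in>bidegrees n. defect_part n d i j)"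
proof -
  let ?\<Theta> = "{\<theta> \<in> decorations n. fd n \<theta> = int d}"
  let ?t = "\<lambda>\<theta>. smult_ms (bimonom 1 (deg_t n \<theta>) (deg_q n \<theta>)) (ribbon (factorization_composition n \<theta>)) :: 'k poly poly mseries"
  have "(\<Sum>(i, j)\<in>bidegrees n. defect_part n d i j :: 'k poly poly mseries)
      = (\<Sum>p\<in>bidegrees n. \<Sum>\<theta>\<in>{\<theta> \<in> ?\<Theta>. (deg_t n \<theta>, deg_q n \<theta>) = p}. ?t \<theta>)"
  proof (rule sum.cong[OF refl])
    fix p assume "p \<in> bidegrees n"
    obtain i j where p: "p = (i, j)" by (cases p)
    have "(defect_part n d i j :: 'k poly poly mseries)
        = (\<Sum>\<theta> | \<theta> \<in> decorations n \<and> in_bidegree n (\<lambda>\<theta>. fd n \<theta> = int d) i j \<theta>. ?t \<theta>)"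
      unfolding defect_part_def defect_ribbons_def map_bimonom_sum map_bimonom_ribbon
      by (intro sum.cong[OF refl]) auto
    also have "\<dots> = (\<Sum>\<theta>\<in>{\<theta> \<in> ?\<Theta>. (deg_t n \<theta>, deg_q n \<theta>) = p}. ?t \<theta>)"
      by (rule sum.cong) (auto simp: p)
    finally show "(case p of (i, j) \<Rightarrow> defect_part n d i j) = (\<Sum>\<theta>\<in>{\<theta> \<in> ?\<Theta>. (deg_t n \<theta>, deg_q n \<theta>) = p}. ?t \<theta>)"
      by (simp add: p)
  qed
  also have "\<dots> = (\<Sum>\<theta>\<in>?\<Theta>. ?t \<theta>)" by (rule sum.group) (auto simp: bidegrees_def)
  finally show ?thesis by (simp add: defect_class_def)
qed

lemma defect_part_zero:
  assumes n: "0 < n" and z: "ell n \<le> j + d"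
  shows "(defect_part n d i j :: 'k::field_char_0 poly poly mseries) = 0"
proof -
  have no: "{\<theta> \<in> decorations n. in_bidegree n (\<lambda>\<theta>. fd n \<theta> = int d) i j \<theta>} = {}"
  proof (rule equals0I)
    fix \<theta> assume "\<theta> \<in> {\<theta> \<in> decorations n. in_bidegree n (\<lambda>\<theta>. fd n \<theta> = int d) i j \<theta>}"
    then have "\<theta> \<in> decorations n" "fd n \<theta> = int d" "deg_q n \<theta> = j" by auto
    then show False using fd_formula[of \<theta> n] z by simp
  qed
  have "(defect_ribbons n d i j :: 'k mseries) = 0" unfolding defect_ribbons_def no by simp
  then show ?thesis unfolding defect_part_def by (intro mseries_eqI) simp
qed

text \<open>The sum over the bidegrees of basis elements can be taken over all bidegrees of
  decorations.\<close>

lemma ch_homology_bidegrees: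
  assumes n: "0 < n"
  shows "ch_homology (zigzag n) (\<lambda>b. Q (total_decoration b)) k
    = (\<Sum>(i, j)\<in>bidegrees n. map_ms (\<lambda>c :: 'k::field_char_0. bimonom c i j) (frobenius_homology n Q k i j))"
proof -
  have "(frobenius_homology n Q k i j :: 'k mseries) = 0" if "(i, j) \<notin> bideg ` basis (zigzag n) k" for i j
  proof (rule frobenius_homology_zero[OF n])
    have nil: "x = 0" if "x \<in> chain_group (zigzag n) P k" "component i j x = x" for x :: "'k chain" and P
    proof -
      have "Poly_Mapping.keys x = {}"
      proof (rule equals0I)
        fix b assume b: "b \<in> Poly_Mapping.keys x"
        then have "b \<in> basis (zigzag n) k" "bideg b = (i, j)"
          using that unfolding component_eq_self chain_group_def by blast+
        then show False using \<open>(i, j) \<notin> bideg ` basis (zigzag n) k\<close> by (metis imageI)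
      qed
      then show ?thesis by simp
    qed
    have "x = 0" if "x \<in> cycles (zigzag n) (\<lambda>b. Q (total_decoration b)) k i j" for x :: "'k chain"
      using that nil unfolding cycles_def by blast
    moreover have "x = 0" if "x \<in> boundaries (zigzag n) (\<lambda>b. Q (total_decoration b)) k i j" for x :: "'k chain"
    proof -
      from that obtain y where "y \<in> decorated_chains n Q (Suc k)" "x = boundary y" "component i j x = x"
        unfolding boundaries_def by blast
      then show ?thesis using nil boundary_mem[OF n] by blast
    qed
    moreover have "0 \<in> cycles (zigzag n) (\<lambda>b. Q (total_decoration b)) k i j" "0 \<in> boundaries (zigzag n) (\<lambda>b. Q (total_decoration b)) k i j"
      unfolding cycles_def boundaries_def using fs.subspace_0[OF chain_subspace] boundary.zero component.zero
      by (auto intro!: image_eqI[of _ _ 0])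
    ultimately show "homology_zero TYPE('k) (zigzag n) (\<lambda>b. Q (total_decoration b)) k i j"
      unfolding homology_zero_def by blast
  qed
  then have "(\<Sum>(i, j)\<in>bideg ` basis (zigzag n) k. map_ms (\<lambda>c :: 'k. bimonom c i j) (frobenius_homology n Q k i j))
      = (\<Sum>(i, j)\<in>bidegrees n. map_ms (\<lambda>c :: 'k. bimonom c i j) (frobenius_homology n Q k i j))"
  proof (intro sum.mono_neutral_left)
    show "bideg ` basis (zigzag n) k \<subseteq> bidegrees n"
    proof (rule image_subsetI)
      fix b assume b: "b \<in> basis (zigzag n) k"
      then have "total_decoration b \<in> decorations n" using basis_flag_index(1)[OF n b] by (simp add: flag_index_def)
      then show "bideg b \<in> bidegrees n" unfolding bideg_total[OF n b] bidegrees_def by (rule imageI)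
    qed
  qed (auto intro!: mseries_eqI)
  then show ?thesis by (simp add: ch_homology_def)
qed

lemma ch_homology_defect:
  assumes n: "0 < n"
  shows "(ch_homology (zigzag n) (has_defect n d) k :: 'k::field_char_0 poly poly mseries)
    = (\<Sum>(i, j)\<in>bidegrees n. if k + j + d = ell n then defect_part n d i j else 0)"
proof -
  have "(ch_homology (zigzag n) (has_defect n d) k :: 'k poly poly mseries)
      = ch_homology (zigzag n) (\<lambda>b. (\<lambda>\<theta>. fd n \<theta> = int d) (total_decoration b)) k"
    by (simp add: has_defect_def[abs_def])
  also have "\<dots> = (\<Sum>(i, j)\<in>bidegrees n. if k + j + d = ell n then defect_part n d i j else 0)"
    unfolding ch_homology_bidegrees[OF n, of "\<lambda>\<theta>. fd n \<theta> = int d"] frobenius_defect[OF n]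
    by (rule sum.cong[OF refl]) (auto simp: defect_part_def intro!: mseries_eqI)
  finally show ?thesis .
qed

lemma ch_homology_full:
  assumes n: "0 < n"
  shows "(ch_homology (zigzag n) full k :: 'k::field_char_0 poly poly mseries)
    = (\<Sum>(i, j)\<in>bidegrees n. if k + j \<le> ell n then defect_part n (ell n - k - j) i j else 0)"
  unfolding ch_homology_bidegrees[OF n, of "\<lambda>_. True"] frobenius_full[OF n]
  by (rule sum.cong[OF refl]) (auto simp: defect_part_def intro!: mseries_eqI)

lemma negate_defect_part: "map_ms negate_q (defect_part n d i j) = (- 1) ^ j * defect_part n d i j"
  unfolding power_neg_one_ms by (rule mseries_eqI) (simp add: defect_part_def negate_bimonom)

lemma negate_ms_sum: "map_ms negate_q (\<Sum>x\<in>I. F x) = (\<Sum>x\<in>I. map_ms negate_q (F x))"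
  by (rule map_ms_sum) (rule negate_add)

lemma negate_ms_0: "map_ms negate_q 0 = 0"
  by (rule mseries_eqI) (simp add: negate_q_def)

lemma defect_degree_range:
  assumes n: "0 < n"
  shows "(\<Sum>k\<le>ell n. if k + j + d = ell n then defect_part n d i j else 0) = (defect_part n d i j :: 'k::field_char_0 poly poly mseries)"
proof (cases "j + d \<le> ell n")
  case True
  then have "(\<Sum>k\<le>ell n. if k + j + d = ell n then defect_part n d i j else 0)
      = (\<Sum>k\<le>ell n. if k = ell n - (j + d) then defect_part n d i j else (0 :: 'k poly poly mseries))"
    by (intro sum.cong) auto
  then show ?thesis by simp
next
  case False
  then show ?thesis using defect_part_zero[OF n, of j d i, where 'k = 'k] by simp
qed

section \<open>The polynomial Z and decorations\<close>

lemma bimonom_powers: "bimonom (1 :: 'a::field) i j = var_t ^ i * var_q ^ j"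
proof -
  have "(var_t :: 'a poly poly) ^ i = bimonom 1 i 0" for i
    by (induction i) (simp_all add: bimonom_def var_t_def monom_0 monom_Suc one_pCons)
  moreover have "(var_q :: 'a poly poly) ^ j = bimonom 1 0 j"
    by (induction j) (simp_all add: bimonom_def var_q_def monom_0 monom_Suc flip: one_pCons)
  ultimately show ?thesis by (simp add: bimonom_mult)
qed

text \<open>Cycle counts are distributed on the permutations of a set of size \<open>p\<close> as the coefficients of
  \<open>t (t + q) \<dots> (t + (p - 1) q)\<close>.  For the rooted permutation, where only the nonroot cycles
  count, this leaves the factor \<open>(t + 1) \<dots> (t + s)\<close>.\<close>

lemma sum_decorations_h_tq:
  "(\<Sum>\<xi>\<in>decorations m. bimonom 1 (deg_t m \<xi>) (deg_q m \<xi>)) = of_nat (fact m) * (h_tq m :: 'k::field_char_0 poly poly)"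
proof -
  let ?A = "{1..up_half m}" and ?B = "{0..dn_half m}"
  let ?c = "cycle_count ?A" and ?r = "cycle_count ?B"
  have weight: "var_t * bimonom 1 (deg_t m (\<sigma>, \<tau>)) (deg_q m (\<sigma>, \<tau>))
      = (var_t ^ ?c \<sigma> * var_q ^ (card ?A - ?c \<sigma>)) * (var_t ^ ?r \<tau> * 1 ^ (card ?B - ?r \<tau>) :: 'k poly poly)" for \<sigma> \<tau>
  proof -
    have "Suc (deg_t m (\<sigma>, \<tau>)) = ?c \<sigma> + ?r \<tau>"
      using cycle_count_pos[of ?B \<tau>] by (simp add: deg_t_def)
    then have "var_t * (var_t ^ deg_t m (\<sigma>, \<tau>)) = (var_t :: 'k poly poly) ^ (?c \<sigma> + ?r \<tau>)"
      unfolding power_Suc[symmetric] by simp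
    then show ?thesis unfolding bimonom_powers mult.assoc[symmetric]
      by (simp add: deg_q_def power_add mult_ac)
  qed
  have "var_t * (\<Sum>\<xi>\<in>decorations m. bimonom 1 (deg_t m \<xi>) (deg_q m \<xi>))
      = (\<Sum>\<sigma> | \<sigma> permutes ?A. var_t ^ ?c \<sigma> * var_q ^ (card ?A - ?c \<sigma>))
        * (\<Sum>\<tau> | \<tau> permutes ?B. var_t ^ ?r \<tau> * 1 ^ (card ?B - ?r \<tau>) :: 'k poly poly)"
    unfolding sum_distrib_left[of var_t] sum_product decorations_def sum.cartesian_product
    by (rule sum.cong[OF refl]) (use weight in auto)
  also have "\<dots> = (\<Prod>j<up_half m. var_t + of_nat j * var_q) * (\<Prod>j<Suc (dn_half m). var_t + of_nat j * 1)"
    unfolding sum_permutations_cycle_count[OF finite_atLeastAtMost] by simp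
  also have "(\<Prod>j<Suc (dn_half m). var_t + of_nat j * 1) = (var_t :: 'k poly poly) * (\<Prod>i=1..dn_half m. var_t + of_nat i)"
    unfolding prod.lessThan_Suc_shift by (simp add: prod.atLeast1_atMost_eq)
  finally have "var_t * (\<Sum>\<xi>\<in>decorations m. bimonom 1 (deg_t m \<xi>) (deg_q m \<xi>))
      = var_t * ((\<Prod>i=1..dn_half m. var_t + of_nat i) * (\<Prod>j<up_half m. var_t + of_nat j * var_q) :: 'k poly poly)"
    by (simp add: mult_ac)
  moreover have "(var_t :: 'k poly poly) \<noteq> 0" by (simp add: var_t_def)
  ultimately have "(\<Sum>\<xi>\<in>decorations m. bimonom 1 (deg_t m \<xi>) (deg_q m \<xi>))
      = ((\<Prod>i=1..dn_half m. var_t + of_nat i) * (\<Prod>j<up_half m. var_t + of_nat j * var_q) :: 'k poly poly)"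
    by simp
  moreover have "of_nat (fact m) * [:[:1 / of_nat (fact m):]:] = (1 :: 'k poly poly)"
    by (simp add: of_nat_poly one_pCons)
  ultimately show ?thesis unfolding h_tq_def mult.assoc[symmetric] by simp
qed

lemma sum_decorations_factorizing:
  assumes "\<beta> \<in> coarsenings (zigzag n)" "0 < n"
  shows "(\<Sum>\<theta> | \<theta> \<in> decorations n \<and> cuts \<beta> \<subseteq> factorization_cuts n \<theta>. bimonom 1 (deg_t n \<theta>) (deg_q n \<theta>))
    = prod_list (map (\<lambda>m. of_nat (fact m) * (h_tq m :: 'k::field_char_0 poly poly)) \<beta>)"
  using assms
proof (induction \<beta> arbitrary: n)
  case Nil
  then show ?case by (simp add: coarsenings_zigzag compositions_def)
next
  case (Cons b \<beta>)
  show ?case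
  proof (cases "\<beta> = []")
    case True
    then have "b = n" using Cons.prems by (simp add: coarsenings_zigzag compositions_def)
    then show ?thesis using True sum_decorations_h_tq[of n, where 'k = 'k] by simp
  next
    case False
    have b: "0 < b" "even b" "b \<le> n" "\<beta> \<in> coarsenings (zigzag (n - b))"
      using Cons.prems(1) unfolding coarsenings_zigzag_Cons[OF False] by auto
    have "n - b \<noteq> 0"
    proof
      assume "n - b = 0"
      then show False using b(4) False by (simp add: coarsenings_zigzag)
    qed
    then obtain m where m: "n = b + m" "0 < m" "n - b = m" using b(3) by (metis le_add_diff_inverse neq0_conv)
    have \<beta>: "\<beta> \<in> coarsenings (zigzag m)" using b(4) unfolding m(3) .
    let ?w = "\<lambda>n \<theta>. bimonom 1 (deg_t n \<theta>) (deg_q n \<theta>) :: 'k poly poly"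
    have "(\<Sum>\<theta> | \<theta> \<in> decorations n \<and> cuts (b # \<beta>) \<subseteq> factorization_cuts n \<theta>. ?w n \<theta>)
        = (\<Sum>p\<in>decorations b \<times> {\<theta> \<in> decorations m. cuts \<beta> \<subseteq> factorization_cuts m \<theta>}. ?w n (case p of (\<xi>, \<eta>) \<Rightarrow> diamond b m \<xi> \<eta>))"
      unfolding m(1) by (rule sum.reindex_bij_betw[OF diamond_bij_cuts[OF b(1,2) m(2) \<beta> False], symmetric])
    also have "\<dots> = (\<Sum>(\<xi>, \<eta>)\<in>decorations b \<times> {\<theta> \<in> decorations m. cuts \<beta> \<subseteq> factorization_cuts m \<theta>}. ?w b \<xi> * ?w m \<eta>)"
    proof (rule sum.cong[OF refl])
      fix p assume p: "p \<in> decorations b \<times> {\<theta> \<in> decorations m. cuts \<beta> \<subseteq> factorization_cuts m \<theta>}"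
      obtain \<xi> \<eta> where [simp]: "p = (\<xi>, \<eta>)" by (cases p)
      have "\<xi> \<in> decorations b" "\<eta> \<in> decorations m" using p by auto
      then show "?w n (case p of (\<xi>, \<eta>) \<Rightarrow> diamond b m \<xi> \<eta>) = (case p of (\<xi>, \<eta>) \<Rightarrow> ?w b \<xi> * ?w m \<eta>)"
        by (simp add: m(1) deg_q_diamond[OF b(2)] bimonom_mult)
    qed
    also have "\<dots> = (\<Sum>\<xi>\<in>decorations b. ?w b \<xi>) * (\<Sum>\<eta> | \<eta> \<in> decorations m \<and> cuts \<beta> \<subseteq> factorization_cuts m \<eta>. ?w m \<eta>)"
      unfolding sum_product sum.cartesian_product ..
    finally show ?thesis using Cons.IH[OF \<beta> m(2)] by (simp add: sum_decorations_h_tq)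
  qed
qed

lemma multinomial_prod:
  "of_nat (fact (sum_list \<beta>)) * prod_list (map f \<beta>)
    = of_nat (multinomial \<beta>) * prod_list (map (\<lambda>m. of_nat (fact m) * f m) \<beta>)"
  for f :: "nat \<Rightarrow> 'a::comm_semiring_1"
proof -
  have "prod_list (map (\<lambda>m. of_nat (fact m) * f m) \<beta>) = of_nat (prod_list (map fact \<beta>)) * prod_list (map f \<beta>)"
    by (induction \<beta>) (simp_all add: mult_ac)
  then show ?thesis unfolding multinomial_fact[symmetric, of \<beta>] of_nat_mult by (simp add: mult.assoc)
qed

text \<open>The number of permutations whose descent set is the set of factorization cuts: the
  dimension of the ribbon module of the decoration.\<close>

definition ribbon_number :: "nat \<Rightarrow> decoration \<Rightarrow> int" where
  "ribbon_number n \<theta> = (\<Sum>\<beta>\<in>coarsenings (factorization_composition n \<theta>).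
     (- 1) ^ (length (factorization_composition n \<theta>) - length \<beta>) * int (multinomial \<beta>))"

lemma mcoeff_ribbon_squarefree:
  assumes n: "0 < n"
  shows "mcoeff (ribbon (factorization_composition n \<theta>) :: 'a::comm_ring_1 mseries) (mset_set {..<n}) = of_int (ribbon_number n \<theta>)"
proof -
  have "mcoeff ((- 1) ^ k * prod_list (map hsym \<beta>) :: 'a mseries) (mset_set {..<n}) = of_int ((- 1) ^ k * int (multinomial \<beta>))"
    if "\<beta> \<in> coarsenings (factorization_composition n \<theta>)" for k \<beta>
  proof -
    have "sum_list \<beta> = n" using that compositions_sum[of \<beta> n] unfolding factorization_composition(2)[OF n] by simp
    then show ?thesis unfolding power_neg_one_ms by (simp add: mcoeff_hsym_prod_squarefree)
  qed
  then show ?thesis unfolding ribbon_def ribbon_number_def mcoeff_sum of_int_sum by (intro sum.cong[OF refl])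
qed

lemma Z_poly_decorations:
  assumes n: "0 < n"
  shows "of_nat (fact n) * negate_q (Z_poly (zigzag n) :: 'k::field_char_0 poly poly)
    = (\<Sum>\<theta>\<in>decorations n. bimonom (of_int ((- 1) ^ nat (fd n \<theta>) * ribbon_number n \<theta>)) (deg_t n \<theta>) (deg_q n \<theta>))"
proof -
  let ?F = "factorization_cuts n" and ?g = "factorization_composition n"
  let ?w = "\<lambda>\<theta>. bimonom 1 (deg_t n \<theta>) (deg_q n \<theta>) :: 'k poly poly"
  let ?s = "\<lambda>\<beta>. (- 1) ^ (ell n - length \<beta>) * of_nat (multinomial \<beta>) :: 'k poly poly"
  have sub: "{\<beta> \<in> coarsenings (zigzag n). cuts \<beta> \<subseteq> ?F \<theta>} = coarsenings (?g \<theta>)" for \<theta>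
  proof -
    have "?F \<theta> \<subseteq> cuts (zigzag n)" by (auto simp: factorization_cuts_def)
    then show ?thesis unfolding factorization_composition(2)[OF n] by (auto simp: coarsenings_def)
  qed
  have "of_nat (fact n) * (Z_poly (zigzag n) :: 'k poly poly)
      = (\<Sum>\<beta>\<in>coarsenings (zigzag n). ?s \<beta> * (\<Sum>\<theta> | \<theta> \<in> decorations n \<and> cuts \<beta> \<subseteq> ?F \<theta>. ?w \<theta>))"
    unfolding Z_poly_def sum_distrib_left[of "of_nat (fact n)"]
  proof (rule sum.cong[OF refl])
    fix \<beta> assume \<beta>: "\<beta> \<in> coarsenings (zigzag n)"
    have "sum_list \<beta> = n" using \<beta> compositions_sum by (simp add: coarsenings_def)
    from multinomial_prod[of \<beta> "h_tq :: nat \<Rightarrow> 'k poly poly", unfolded this]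
    have "of_nat (fact n) * prod_list (map h_tq \<beta>) = of_nat (multinomial \<beta>) * (\<Sum>\<theta> | \<theta> \<in> decorations n \<and> cuts \<beta> \<subseteq> ?F \<theta>. ?w \<theta>)"
      unfolding sum_decorations_factorizing[OF \<beta> n] .
    then show "of_nat (fact n) * ((- 1) ^ (length (zigzag n) - length \<beta>) * prod_list (map h_tq \<beta>))
        = ?s \<beta> * (\<Sum>\<theta> | \<theta> \<in> decorations n \<and> cuts \<beta> \<subseteq> ?F \<theta>. ?w \<theta>)"
      unfolding ell_def mult.assoc mult.left_commute[of "of_nat (fact n)"] by simp
  qed
  also have "\<dots> = (\<Sum>\<beta>\<in>coarsenings (zigzag n). \<Sum>\<theta> | \<theta> \<in> decorations n \<and> cuts \<beta> \<subseteq> ?F \<theta>. ?s \<beta> * ?w \<theta>)"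
    by (simp only: sum_distrib_left)
  also have "\<dots> = (\<Sum>\<theta>\<in>decorations n. \<Sum>\<beta> | \<beta> \<in> coarsenings (zigzag n) \<and> cuts \<beta> \<subseteq> ?F \<theta>. ?s \<beta> * ?w \<theta>)"
    by (rule sum.swap_restrict) simp_all
  also have "\<dots> = (\<Sum>\<theta>\<in>decorations n. \<Sum>\<beta>\<in>coarsenings (?g \<theta>). ?s \<beta> * ?w \<theta>)"
    by (simp only: sub)
  also have "\<dots> = (\<Sum>\<theta>\<in>decorations n. \<Sum>\<beta>\<in>coarsenings (?g \<theta>).
      bimonom ((- 1) ^ (ell n - length \<beta>) * of_nat (multinomial \<beta>)) (deg_t n \<theta>) (deg_q n \<theta>))"
  proof (intro sum.cong[OF refl])
    fix \<theta> \<beta>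
    have "(- 1) ^ a * of_nat m = [:[:(- 1) ^ a * of_nat m :: 'k:]:]" for a m
    proof (induction a)
      case (Suc a)
      have "(- 1) ^ Suc a * of_nat m = - ((- 1) ^ a * of_nat m :: 'k poly poly)" by simp
      then show ?case unfolding Suc.IH by simp
    qed (simp add: of_nat_poly)
    then show "?s \<beta> * ?w \<theta> = bimonom ((- 1) ^ (ell n - length \<beta>) * of_nat (multinomial \<beta>)) (deg_t n \<theta>) (deg_q n \<theta>)"
      unfolding bimonom_const[of "_ * _"] by (simp only: mult.commute)
  qed
  finally have Z: "of_nat (fact n) * (Z_poly (zigzag n) :: 'k poly poly) = \<dots>" .
  have "of_nat (fact n) * negate_q (Z_poly (zigzag n) :: 'k poly poly) = negate_q (of_nat (fact n) * Z_poly (zigzag n))"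
  proof -
    have "pcompose (of_nat k) q = of_nat k" for k and q :: "'k poly poly" by (simp add: of_nat_poly)
    then show ?thesis unfolding negate_q_def pcompose_mult by (simp only:)
  qed
  also have "\<dots> = (\<Sum>\<theta>\<in>decorations n. \<Sum>\<beta>\<in>coarsenings (?g \<theta>).
      bimonom ((- 1) ^ (deg_q n \<theta> + (ell n - length \<beta>)) * of_nat (multinomial \<beta>)) (deg_t n \<theta>) (deg_q n \<theta>))"
  proof -
    have sum: "negate_q (\<Sum>x\<in>I. f x) = (\<Sum>x\<in>I. negate_q (f x))" for f :: "'x \<Rightarrow> 'k poly poly" and I
      by (induction I rule: infinite_finite_induct) (simp_all add: negate_add, simp_all add: negate_q_def)
    have "(- 1) ^ a * bimonom c i j = bimonom ((- 1) ^ a * c) i j" for a i j and c :: 'k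
      by (induction a) (simp_all add: bimonom_def minus_monom)
    then show ?thesis unfolding Z sum negate_bimonom by (simp add: power_add mult.assoc)
  qed
  also have "\<dots> = (\<Sum>\<theta>\<in>decorations n. bimonom (of_int ((- 1) ^ nat (fd n \<theta>) * ribbon_number n \<theta>)) (deg_t n \<theta>) (deg_q n \<theta>))"
  proof (rule sum.cong[OF refl])
    fix \<theta> assume \<theta>: "\<theta> \<in> decorations n"
    have sign: "(- 1) ^ (deg_q n \<theta> + (ell n - length \<beta>)) = (- 1) ^ nat (fd n \<theta>) * (- 1 :: 'k) ^ (length (?g \<theta>) - length \<beta>)"
      if "\<beta> \<in> coarsenings (?g \<theta>)" for \<beta>
    proof -
      have \<beta>: "\<beta> \<in> compositions n" "cuts \<beta> \<subseteq> ?F \<theta>" using that unfolding factorization_composition(2)[OF n] by auto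
      have "length \<beta> = Suc (card (cuts \<beta>))" using n \<beta>(1) by (intro card_cuts) auto
      moreover have "card (cuts \<beta>) \<le> card (?F \<theta>)" by (rule card_mono[OF finite_factorization_cuts \<beta>(2)])
      ultimately have le: "length \<beta> \<le> length (?g \<theta>)" unfolding factorization_composition(3)[OF n] by simp
      have "int (ell n) = fd n \<theta> + int (length (?g \<theta>)) + int (deg_q n \<theta>)"
        unfolding fd_formula[OF \<theta>] factorization_composition(3)[OF n] by simp
      then have "ell n = nat (fd n \<theta>) + length (?g \<theta>) + deg_q n \<theta>" using fd_nonneg[OF n \<theta>] by linarith
      then have "deg_q n \<theta> + (ell n - length \<beta>) = 2 * deg_q n \<theta> + (nat (fd n \<theta>) + (length (?g \<theta>) - length \<beta>))"
        using le by linarith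
      then show ?thesis by (simp add: power_add power_mult)
    qed
    have sum: "bimonom (\<Sum>x\<in>I. f x) i j = (\<Sum>x\<in>I. bimonom (f x) i j)" for f :: "nat list \<Rightarrow> 'k" and I i j
      by (induction I rule: infinite_finite_induct) (simp_all add: bimonom_add)
    show "(\<Sum>\<beta>\<in>coarsenings (?g \<theta>). bimonom ((- 1) ^ (deg_q n \<theta> + (ell n - length \<beta>)) * of_nat (multinomial \<beta>)) (deg_t n \<theta>) (deg_q n \<theta>))
        = bimonom (of_int ((- 1) ^ nat (fd n \<theta>) * ribbon_number n \<theta>) :: 'k) (deg_t n \<theta>) (deg_q n \<theta>)"
      unfolding ribbon_number_def sum_distrib_left of_int_sum sum
      by (intro sum.cong[OF refl]) (simp add: sign mult.assoc)
  qed
  finally show ?thesis .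
qed

lemma hsym_psum_span: "(hsym m :: 'k::field_char_0 poly poly mseries) \<in> psum_span"
  by (rule hsym_in_psum_span[of "[:[:1 / of_nat (fact m):]:]"]) (simp add: of_nat_poly one_pCons)

lemma ribbon_psum_span: "(ribbon \<alpha> :: 'k::field_char_0 poly poly mseries) \<in> psum_span"
proof -
  have "(prod_list (map hsym \<beta>) :: 'k poly poly mseries) \<in> psum_span" for \<beta>
    by (induction \<beta>) (auto intro: psum_span_1 psum_span_mult hsym_psum_span)
  then show ?thesis unfolding ribbon_def power_neg_one_ms by (intro psum_span_sum psum_span_smult)
qed

lemma fd_less:
  assumes "0 < n" "\<theta> \<in> decorations n"
  shows "fd n \<theta> < int (ell n)"
  using cycle_count_le[of "{1..up_half n}" "fst \<theta>"] by (simp add: fd_def ell_up_half)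

lemma dim_defect_classes:
  assumes n: "0 < n"
  shows "dim_sf n (\<Sum>d<ell n. (- 1) ^ d * defect_class n d :: 'k::field_char_0 poly poly mseries)
    = (\<Sum>\<theta>\<in>decorations n. bimonom (of_int ((- 1) ^ nat (fd n \<theta>) * ribbon_number n \<theta>)) (deg_t n \<theta>) (deg_q n \<theta>))"
proof -
  let ?g = "factorization_composition n"
  let ?w = "\<lambda>c \<theta>. bimonom (of_int (c * ribbon_number n \<theta>)) (deg_t n \<theta>) (deg_q n \<theta>) :: 'k poly poly"
  let ?f = "\<Sum>d<ell n. (- 1) ^ d * defect_class n d :: 'k poly poly mseries"
  have "?f \<in> psum_span" unfolding power_neg_one_ms defect_class_def
    by (intro psum_span_sum psum_span_smult ribbon_psum_span)
  then have "dim_sf n ?f = mcoeff ?f (mset_set {..<n})" by (rule dim_sf_squarefree)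
  also have "\<dots> = (\<Sum>d<ell n. \<Sum>\<theta> | \<theta> \<in> decorations n \<and> fd n \<theta> = int d. ?w ((- 1) ^ d) \<theta>)"
  proof -
    have "(- 1) ^ d * (bimonom 1 i j * of_int z) = (bimonom (of_int ((- 1) ^ d * z)) i j :: 'k poly poly)" for d i j z
    proof -
      have "(- 1) ^ d * bimonom c i j = bimonom ((- 1) ^ d * c) i j" for c :: 'k
        by (induction d) (simp_all add: bimonom_def minus_monom)
      moreover have "bimonom 1 i j * of_int z = (bimonom (of_int z) i j :: 'k poly poly)"
        unfolding bimonom_const[of "of_int z"] by (simp add: of_int_poly)
      ultimately show ?thesis by simp
    qed
    then show ?thesis
      unfolding power_neg_one_ms defect_class_def by (simp add: mcoeff_sum sum_distrib_left mcoeff_ribbon_squarefree[OF n])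
  qed
  also have "\<dots> = (\<Sum>d<ell n. \<Sum>\<theta>\<in>{\<theta> \<in> decorations n. nat (fd n \<theta>) = d}. ?w ((- 1) ^ nat (fd n \<theta>)) \<theta>)"
  proof (rule sum.cong[OF refl])
    fix d
    have "fd n \<theta> = int d \<longleftrightarrow> nat (fd n \<theta>) = d" if "\<theta> \<in> decorations n" for \<theta>
      using fd_nonneg[OF n that] by linarith
    then show "(\<Sum>\<theta> | \<theta> \<in> decorations n \<and> fd n \<theta> = int d. ?w ((- 1) ^ d) \<theta>)
        = (\<Sum>\<theta>\<in>{\<theta> \<in> decorations n. nat (fd n \<theta>) = d}. ?w ((- 1) ^ nat (fd n \<theta>)) \<theta>)"
      by (intro sum.cong) auto
  qed
  also have "\<dots> = (\<Sum>\<theta>\<in>decorations n. ?w ((- 1) ^ nat (fd n \<theta>)) \<theta>)"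
  proof (rule sum.group)
    show "(\<lambda>\<theta>. nat (fd n \<theta>)) ` decorations n \<subseteq> {..<ell n}"
    proof (rule image_subsetI)
      fix \<theta> assume "\<theta> \<in> decorations n"
      then show "nat (fd n \<theta>) \<in> {..<ell n}" using fd_less[OF n, of \<theta>] fd_nonneg[OF n, of \<theta>] by simp
    qed
  qed simp_all
  finally show ?thesis .
qed

lemma of_int_Nats: "(of_int z :: 'a::ring_char_0) \<in> \<nat> \<longleftrightarrow> 0 \<le> z"
proof
  assume "(of_int z :: 'a) \<in> \<nat>"
  then obtain k where "(of_int z :: 'a) = of_nat k" by (rule Nats_cases)
  then have "(of_int z :: 'a) = of_int (int k)" by simp
  then show "0 \<le> z" unfolding of_int_eq_iff by simp
next
  assume "0 \<le> z"
  then show "(of_int z :: 'a) \<in> \<nat>" by (metis of_int_of_nat_eq of_nat_in_Nats zero_le_imp_eq_int)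
qed

lemma integral_bimonom_sum:
  fixes z :: "'a \<Rightarrow> int" and a b :: "'a \<Rightarrow> nat" and I :: "'a set"
  defines "P \<equiv> (\<Sum>x\<in>I. bimonom (of_int (z x)) (a x) (b x)) :: 'k::field_char_0 poly poly"
  shows "\<exists>D :: int poly poly. P = map_poly (map_poly of_int) D \<and> (nat_coeffs P \<longleftrightarrow> (\<forall>i j. 0 \<le> coeff (coeff D j) i))"
proof -
  let ?D = "\<Sum>x\<in>I. monom (monom (z x) (a x)) (b x)"
  have P: "coeff (coeff P j) i = of_int (coeff (coeff ?D j) i)" for i j
    unfolding P_def bimonom_def coeff_sum of_int_sum by (intro sum.cong[OF refl]) simp
  have "P = map_poly (map_poly of_int) ?D"
  proof (intro poly_eqI)
    fix i j
    have "coeff (map_poly (map_poly of_int) ?D) j = (map_poly of_int (coeff ?D j) :: 'k poly)"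
      by (rule coeff_map_poly) simp
    moreover have "coeff (map_poly of_int (coeff ?D j)) i = (of_int (coeff (coeff ?D j) i) :: 'k)"
      by (rule coeff_map_poly) simp
    ultimately show "coeff (coeff P j) i = coeff (coeff (map_poly (map_poly of_int) ?D) j) i"
      unfolding P by (simp only:)
  qed
  then show ?thesis unfolding nat_coeffs_def P of_int_Nats by blast
qed

section \<open>The defect classes as graded characteristics\<close>

lemma boundary_total_decoration:
  assumes n: "0 < n" and b: "b \<in> basis (zigzag n) k"
    and b': "b' \<in> Poly_Mapping.keys (boundary_basis b :: 'k::field chain)"
  shows "total_decoration b' = total_decoration b"
proof -
  let ?X = "flag_of (fst b)"
  have "b' \<in> (\<Union>S\<in>?X. Poly_Mapping.keys (scale_fs (flag_sign ?X S)
      (Poly_Mapping.single (elt n (total_decoration b) (?X - {S})) 1 :: 'k chain)))"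
    by (rule subsetD[OF Poly_Mapping.keys_sum b'[unfolded boundary_basis_flag[OF n b]]])
  then obtain S where "b' = elt n (total_decoration b) (?X - {S})"
  proof (rule UN_E)
    fix S assume S: "b' \<in> Poly_Mapping.keys (scale_fs (flag_sign ?X S)
      (Poly_Mapping.single (elt n (total_decoration b) (?X - {S})) 1 :: 'k chain))"
    have "b' = elt n (total_decoration b) (?X - {S})"
    proof (rule ccontr)
      assume "b' \<noteq> elt n (total_decoration b) (?X - {S})"
      then show False using S by (simp add: in_keys_iff lookup_single_not_eq)
    qed
    then show ?thesis by (rule that)
  qed
  then show ?thesis using elt(2)[OF n flag_index_remove[OF basis_flag_index(1)[OF n b]]] by simp
qed

lemma Sum_any_ch_homology:
  assumes n: "0 < n"
  shows "finite {k. (ch_homology (zigzag n) (has_defect n d) k :: 'k::field_char_0 poly poly mseries) \<noteq> 0}"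
    and "Sum_any (ch_homology (zigzag n) (has_defect n d)) = (defect_class n d :: 'k poly poly mseries)"
proof -
  let ?c = "ch_homology (zigzag n) (has_defect n d) :: nat \<Rightarrow> 'k poly poly mseries"
  have sub: "{k. ?c k \<noteq> 0} \<subseteq> {..ell n}"
  proof
    fix k assume k: "k \<in> {k. ?c k \<noteq> 0}"
    show "k \<in> {..ell n}"
    proof (rule ccontr)
      assume "k \<notin> {..ell n}"
      then have "?c k = 0" unfolding ch_homology_defect[OF n] by (intro sum.neutral) auto
      then show False using k by simp
    qed
  qed
  then show "finite {k. ?c k \<noteq> 0}" by (rule finite_subset) simp
  have "Sum_any ?c = (\<Sum>k\<le>ell n. ?c k)" by (rule Sum_any.expand_superset) (use sub in auto)
  also have "\<dots> = (\<Sum>p\<in>bidegrees n. \<Sum>k\<le>ell n. case p of (i, j) \<Rightarrow> if k + j + d = ell n then defect_part n d i j else 0)"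
    unfolding ch_homology_defect[OF n] by (rule sum.swap)
  also have "\<dots> = (\<Sum>(i, j)\<in>bidegrees n. defect_part n d i j)"
    by (rule sum.cong[OF refl]) (auto simp: defect_degree_range[OF n])
  finally show "Sum_any ?c = defect_class n d" unfolding defect_class_parts .
qed

lemma ch_homology_sign:
  assumes n: "0 < n"
  shows "(- 1) ^ (ell n - k) * map_ms negate_q (ch_homology (zigzag n) (has_defect n d) k :: 'k::field_char_0 poly poly mseries)
    = (- 1) ^ d * ch_homology (zigzag n) (has_defect n d) k"
  unfolding ch_homology_defect[OF n] negate_ms_sum sum_distrib_left
proof (rule sum.cong[OF refl])
  fix p :: "nat \<times> nat"
  obtain i j :: nat where [simp]: "p = (i, j)" by (cases p)
  let ?R = "defect_part n d i j :: 'k poly poly mseries"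
  have key: "(- 1) ^ (ell n - k) * ((- 1) ^ j * ?R) = (- 1) ^ d * ?R" if "k + j + d = ell n"
  proof -
    have e: "ell n - k + j = 2 * j + d" using that by simp
    have "(- 1 :: 'k poly poly mseries) ^ (ell n - k + j) = (- 1) ^ d"
      unfolding e power_add power_mult by simp
    then show ?thesis unfolding mult.assoc[symmetric] power_add[symmetric] by (simp only:)
  qed
  show "(- 1) ^ (ell n - k) * map_ms negate_q (case p of (i, j) \<Rightarrow> if k + j + d = ell n then defect_part n d i j else 0)
      = (- 1) ^ d * (case p of (i, j) \<Rightarrow> if k + j + d = ell n then defect_part n d i j else (0 :: 'k poly poly mseries))"
  proof (cases "k + j + d = ell n")
    case True
    then show ?thesis using key[OF True] unfolding \<open>p = (i, j)\<close> prod.case negate_defect_part if_P[OF True] by (simp only:)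
  qed (simp add: negate_ms_0)
qed

lemma defect_class_from_full:
  assumes n: "0 < n"
  shows "(\<Sum>(k, j) | 1 \<le> k \<and> k + j + d = ell n.
      map_ms (\<lambda>P :: 'k::field_char_0 poly poly. monom (coeff P j) j) (ch_homology (zigzag n) full k))
    = defect_class n d"
proof -
  let ?S = "{(k, j). 1 \<le> k \<and> k + j + d = ell n}"
  let ?R = "\<lambda>i j. defect_part n d i j :: 'k poly poly mseries"
  let ?q = "\<lambda>j. map_ms (\<lambda>P :: 'k poly poly. monom (coeff P j) j)"
  have fin: "finite ?S" by (rule finite_subset[of _ "{..ell n} \<times> {..ell n}"]) auto
  have "(\<Sum>(k, j)\<in>?S. ?q j (ch_homology (zigzag n) full k))
      = (\<Sum>(k, j)\<in>?S. \<Sum>(i, j')\<in>bidegrees n. if j' = j then ?R i j' else 0)"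
  proof (rule sum.cong[OF refl])
    fix p assume "p \<in> ?S"
    then obtain k j where p [simp]: "p = (k, j)" and kj: "k + j + d = ell n" by auto
    have "?q j (ch_homology (zigzag n) full k)
        = (\<Sum>(i, j')\<in>bidegrees n. ?q j (if k + j' \<le> ell n then defect_part n (ell n - k - j') i j' else 0))"
      unfolding ch_homology_full[OF n] by (subst map_ms_sum) (simp_all add: add_monom case_prod_unfold)
    also have "\<dots> = (\<Sum>(i, j')\<in>bidegrees n. if j' = j then ?R i j' else 0)"
    proof (rule sum.cong[OF refl])
      fix r :: "nat \<times> nat"
      obtain i j' :: nat where [simp]: "r = (i, j')" by (cases r)
      have "?q j (if k + j' \<le> ell n then defect_part n (ell n - k - j') i j' else 0) = (if j' = j then ?R i j' else 0)"
      proof (cases "j' = j")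
        case True
        have "ell n - k - j = d" "k + j \<le> ell n" using kj by auto
        then show ?thesis using True by (intro mseries_eqI) (simp add: defect_part_def bimonom_def)
      next
        case False
        then show ?thesis by (intro mseries_eqI) (simp add: defect_part_def bimonom_def)
      qed
      then show "(case r of (i, j') \<Rightarrow> ?q j (if k + j' \<le> ell n then defect_part n (ell n - k - j') i j' else 0))
          = (case r of (i, j') \<Rightarrow> if j' = j then ?R i j' else 0)" by simp
    qed
    finally show "(case p of (k, j) \<Rightarrow> ?q j (ch_homology (zigzag n) full k))
        = (case p of (k, j) \<Rightarrow> \<Sum>(i, j')\<in>bidegrees n. if j' = j then ?R i j' else 0)" by simp
  qed
  also have "\<dots> = (\<Sum>r\<in>bidegrees n. \<Sum>p\<in>?S. if snd r = snd p then ?R (fst r) (snd r) else 0)"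
    unfolding case_prod_unfold by (rule sum.swap)
  also have "\<dots> = (\<Sum>r\<in>bidegrees n. ?R (fst r) (snd r))"
  proof (rule sum.cong[OF refl])
    fix r :: "nat \<times> nat"
    let ?r = "?R (fst r) (snd r)" and ?p = "(ell n - d - snd r, snd r)"
    have "(\<Sum>p\<in>?S. if snd r = snd p then ?r else 0) = (\<Sum>p\<in>?S. if p = ?p then ?r else 0)"
      by (rule sum.cong[OF refl]) auto
    also have "\<dots> = (if ?p \<in> ?S then ?r else 0)" using fin by simp
    also have "\<dots> = ?r"
    proof (cases "snd r + d < ell n")
      case False
      then show ?thesis using defect_part_zero[OF n, of "snd r" d "fst r", where 'k = 'k] by simp
    qed auto
    finally show "(\<Sum>p\<in>?S. if snd r = snd p then ?r else 0) = ?r" .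
  qed
  finally show ?thesis unfolding defect_class_parts by (simp add: case_prod_unfold)
qed

lemma ch_homology_full_alternating:
  assumes n: "0 < n"
  shows "(\<Sum>k=1..ell n. (- 1) ^ (ell n - k) * map_ms negate_q (ch_homology (zigzag n) full k :: 'k::field_char_0 poly poly mseries))
    = (\<Sum>d<ell n. (- 1) ^ d * defect_class n d)"
proof -
  let ?g = "\<lambda>i j d. (- 1) ^ d * defect_part n d i j :: 'k poly poly mseries"
  have "(- 1) ^ (ell n - k) * map_ms negate_q (ch_homology (zigzag n) full k)
      = (\<Sum>r\<in>bidegrees n. if k + snd r \<le> ell n then ?g (fst r) (snd r) (ell n - k - snd r) else 0)" for k
    unfolding ch_homology_full[OF n] negate_ms_sum sum_distrib_left
  proof (rule sum.cong[OF refl])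
    fix r :: "nat \<times> nat"
    obtain i j :: nat where [simp]: "r = (i, j)" by (cases r)
    let ?d = "ell n - k - j"
    have "(- 1) ^ (ell n - k) * ((- 1) ^ j * defect_part n ?d i j) = ?g i j ?d" if "k + j \<le> ell n"
    proof -
      have "ell n - k + j = 2 * j + ?d" using that by simp
      then have "(- 1 :: 'k poly poly mseries) ^ (ell n - k + j) = (- 1) ^ ?d" by (simp only: power_add power_mult) simp
      then show ?thesis by (simp add: power_add flip: mult.assoc)
    qed
    then show "(- 1) ^ (ell n - k) * map_ms negate_q (case r of (i, j) \<Rightarrow> if k + j \<le> ell n then defect_part n (ell n - k - j) i j else 0)
        = (if k + snd r \<le> ell n then ?g (fst r) (snd r) (ell n - k - snd r) else 0)"
      by (simp add: negate_defect_part negate_ms_0)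
  qed
  then have "(\<Sum>k=1..ell n. (- 1) ^ (ell n - k) * map_ms negate_q (ch_homology (zigzag n) full k :: 'k poly poly mseries))
      = (\<Sum>k=1..ell n. \<Sum>r\<in>bidegrees n. if k + snd r \<le> ell n then ?g (fst r) (snd r) (ell n - k - snd r) else 0)"
    by simp
  also have "\<dots> = (\<Sum>r\<in>bidegrees n. \<Sum>k=1..ell n. if k + snd r \<le> ell n then ?g (fst r) (snd r) (ell n - k - snd r) else 0)"
    by (rule sum.swap)
  also have "\<dots> = (\<Sum>r\<in>bidegrees n. \<Sum>d<ell n. ?g (fst r) (snd r) d)"
  proof (rule sum.cong[OF refl])
    fix r :: "nat \<times> nat"
    let ?j = "snd r"
    have "(\<Sum>k=1..ell n. if k + ?j \<le> ell n then ?g (fst r) ?j (ell n - k - ?j) else 0)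
        = (\<Sum>k=1..ell n - ?j. ?g (fst r) ?j (ell n - k - ?j))"
      by (rule sum.mono_neutral_cong_right) auto
    also have "\<dots> = (\<Sum>d<ell n - ?j. ?g (fst r) ?j d)"
      by (rule sum.reindex_bij_witness[where i = "\<lambda>d. ell n - d - ?j" and j = "\<lambda>k. ell n - k - ?j"]) auto
    also have "\<dots> = (\<Sum>d<ell n. ?g (fst r) ?j d)"
      by (rule sum.mono_neutral_left) (auto simp: defect_part_zero[OF n])
    finally show "(\<Sum>k=1..ell n. if k + ?j \<le> ell n then ?g (fst r) ?j (ell n - k - ?j) else 0)
        = (\<Sum>d<ell n. ?g (fst r) ?j d)" .
  qed
  also have "\<dots> = (\<Sum>d<ell n. \<Sum>r\<in>bidegrees n. ?g (fst r) (snd r) d)" by (rule sum.swap)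
  finally show ?thesis by (simp add: defect_class_parts sum_distrib_left case_prod_unfold)
qed

lemma defect_class_ribbon_expansion:
  assumes n: "0 < n"
  shows "\<exists>c. (\<forall>\<alpha>. nat_coeffs (c \<alpha>)) \<and> (defect_class n d :: 'k::field_char_0 poly poly mseries)
    = (\<Sum>\<alpha>\<in>compositions n. smult_ms (c \<alpha>) (ribbon \<alpha>))"
proof (intro exI conjI allI)
  let ?\<Theta> = "{\<theta> \<in> decorations n. fd n \<theta> = int d}" and ?g = "factorization_composition n"
  let ?w = "\<lambda>\<theta>. bimonom 1 (deg_t n \<theta>) (deg_q n \<theta>) :: 'k poly poly"
  let ?c = "\<lambda>\<alpha>. \<Sum>\<theta>\<in>{\<theta> \<in> ?\<Theta>. ?g \<theta> = \<alpha>}. ?w \<theta>"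
  show "nat_coeffs (?c \<alpha>)" for \<alpha>
  proof -
    have "coeff (coeff (?c \<alpha>) j) i
        = of_nat (\<Sum>\<theta>\<in>{\<theta> \<in> ?\<Theta>. ?g \<theta> = \<alpha>}. if deg_q n \<theta> = j \<and> deg_t n \<theta> = i then 1 else 0)" for i j
      unfolding coeff_sum of_nat_sum by (intro sum.cong[OF refl]) (simp add: bimonom_def)
    then show ?thesis unfolding nat_coeffs_def by (simp only: of_nat_in_Nats)  simp
  qed
  have "(defect_class n d :: 'k poly poly mseries) = (\<Sum>\<theta>\<in>?\<Theta>. smult_ms (?w \<theta>) (ribbon (?g \<theta>)))"
    by (simp add: defect_class_def)
  also have "\<dots> = (\<Sum>\<alpha>\<in>compositions n. \<Sum>\<theta>\<in>{\<theta> \<in> ?\<Theta>. ?g \<theta> = \<alpha>}. smult_ms (?w \<theta>) (ribbon (?g \<theta>)))"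
    by (rule sum.group[symmetric]) (use factorization_composition(1)[OF n] in auto)
  also have "\<dots> = (\<Sum>\<alpha>\<in>compositions n. smult_ms (?c \<alpha>) (ribbon \<alpha>))"
    unfolding smult_ms_sum_left by (intro sum.cong[OF refl]) auto
  finally show "(defect_class n d :: 'k poly poly mseries) = \<dots>" .
qed

theorem theorem4p5:
  fixes n :: nat
  assumes n: "1 \<le> n"
  shows
    "(\<forall>\<theta>\<in>decorations n. 0 \<le> fd n \<theta> \<and> fd n \<theta> \<le> int (ell n) - 1)
   \<and> (\<forall>k. \<forall>b\<in>basis (zigzag n) k. \<forall>b'\<in>Poly_Mapping.keys (boundary_basis b :: 'k::field_char_0 chain).
        total_decoration b' = total_decoration b)
   \<and> bigraded_Sn_complex n (chain_group (zigzag n) full :: nat \<Rightarrow> 'k chain set)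
   \<and> (\<forall>d. bigraded_Sn_complex n (chain_group (zigzag n) (has_defect n d) :: nat \<Rightarrow> 'k chain set))
   \<and> (\<forall>d k. (chain_group (zigzag n) (has_defect n d) k :: 'k chain set) \<subseteq> chain_group (zigzag n) full k)
   \<and> (\<forall>k. \<forall>x\<in>chain_group (zigzag n) full k :: 'k chain set.
        \<exists>!y. (\<forall>d<ell n. y d \<in> chain_group (zigzag n) (has_defect n d) k) \<and> (\<forall>d\<ge>ell n. y d = 0) \<and>
             x = (\<Sum>d<ell n. y d))
   \<and> (\<forall>\<theta>\<in>decorations n. \<forall>k i j. contributes TYPE('k) n \<theta> k i j \<longrightarrow>
        fd n \<theta> = int (ell n) - int k - int j)
   \<and> (\<forall>k i j. \<not> (k + j \<le> ell n \<and> ell n \<le> i + j) \<longrightarrow>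
        homology_zero TYPE('k) (zigzag n) full k i j)
   \<and> (\<forall>d.
        (defect_class n d :: 'k poly poly mseries) =
          Sum_any (\<lambda>k. ch_homology (zigzag n) (has_defect n d) k)
      \<and> Sum_any (\<lambda>k. ch_homology (zigzag n) (has_defect n d) k) =
          (\<Sum>(k, j) | 1 \<le> k \<and> k + j + d = ell n.
             map_ms (\<lambda>P :: 'k poly poly. monom (coeff P j) j) (ch_homology (zigzag n) full k))
      \<and> Sum_any (\<lambda>k. (-1) ^ (ell n - k) *
            map_ms negate_q (ch_homology (zigzag n) (has_defect n d) k :: 'k poly poly mseries)) =
          (-1) ^ d * defect_class n d)
   \<and> (\<Sum>k=1..ell n. (-1) ^ (ell n - k) *
          map_ms negate_q (ch_homology (zigzag n) full k :: 'k poly poly mseries)) =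
        (\<Sum>d<ell n. (-1) ^ d * defect_class n d)
   \<and> of_nat (fact n) * negate_q (Z_poly (zigzag n) :: 'k poly poly) =
        dim_sf n (\<Sum>d<ell n. (-1) ^ d * defect_class n d)
   \<and> (\<forall>d. \<exists>c. (\<forall>\<alpha>. nat_coeffs (c \<alpha>)) \<and>
        (defect_class n d :: 'k poly poly mseries) =
          (\<Sum>\<alpha>\<in>compositions n. smult_ms (c \<alpha>) (ribbon \<alpha>)))
   \<and> (\<exists>D :: int poly poly.
        dim_sf n (\<Sum>d<ell n. (-1) ^ d * defect_class n d :: 'k poly poly mseries) =
          map_poly (map_poly of_int) D
      \<and> (nat_coeffs (of_nat (fact n) * negate_q (Z_poly (zigzag n) :: 'k poly poly)) \<longleftrightarrow>
          (\<forall>i j. 0 \<le> coeff (coeff D j) i)))"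
proof -
  have n0: "0 < n" using n by simp
  have p1: "\<forall>\<theta>\<in>decorations n. 0 \<le> fd n \<theta> \<and> fd n \<theta> \<le> int (ell n) - 1"
  proof
    fix \<theta> assume "\<theta> \<in> decorations n"
    then show "0 \<le> fd n \<theta> \<and> fd n \<theta> \<le> int (ell n) - 1"
      using fd_nonneg[OF n0, of \<theta>] fd_less[OF n0, of \<theta>] by simp
  qed
  have p2: "\<forall>k. \<forall>b\<in>basis (zigzag n) k. \<forall>b'\<in>Poly_Mapping.keys (boundary_basis b :: 'k chain).
      total_decoration b' = total_decoration b"
    by (intro allI ballI) (rule boundary_total_decoration[OF n0])
  have p3: "bigraded_Sn_complex n (chain_group (zigzag n) full :: nat \<Rightarrow> 'k chain set)"
    using decorated_complex[OF n0, of "\<lambda>_. True", where 'k = 'k] by simp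
  have p4: "\<forall>d. bigraded_Sn_complex n (chain_group (zigzag n) (has_defect n d) :: nat \<Rightarrow> 'k chain set)"
  proof
    fix d
    show "bigraded_Sn_complex n (chain_group (zigzag n) (has_defect n d) :: nat \<Rightarrow> 'k chain set)"
      using decorated_complex[OF n0, of "\<lambda>\<theta>. fd n \<theta> = int d", where 'k = 'k] by (simp add: has_defect_def[abs_def])
  qed
  have p5: "\<forall>d k. (chain_group (zigzag n) (has_defect n d) k :: 'k chain set) \<subseteq> chain_group (zigzag n) full k"
    by (auto simp: chain_group_def)
  have p6: "\<forall>k. \<forall>x\<in>chain_group (zigzag n) full k :: 'k chain set.
      \<exists>!y. (\<forall>d<ell n. y d \<in> chain_group (zigzag n) (has_defect n d) k) \<and> (\<forall>d\<ge>ell n. y d = 0) \<and>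
           x = (\<Sum>d<ell n. y d)"
  proof (intro allI ballI)
    fix k and x :: "'k chain" assume x: "x \<in> chain_group (zigzag n) full k"
    have "\<exists>d<ell n. has_defect n d b" if "b \<in> basis (zigzag n) k" for b
    proof -
      have \<theta>: "total_decoration b \<in> decorations n"
        using basis_flag_index(1)[OF n0 that] by (simp add: flag_index_def)
      then have "has_defect n (nat (fd n (total_decoration b))) b" "nat (fd n (total_decoration b)) < ell n"
        using fd_nonneg[OF n0 \<theta>] fd_less[OF n0 \<theta>] by (simp_all add: has_defect_def)
      then show ?thesis by blast
    qed
    moreover have "d = d'" if "has_defect n d b" "has_defect n d' b" for d d' b
      using that by (simp add: has_defect_def)
    ultimately show "\<exists>!y. (\<forall>d<ell n. y d \<in> chain_group (zigzag n) (has_defect n d) k) \<and> (\<forall>d\<ge>ell n. y d = 0) \<and>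
        x = (\<Sum>d<ell n. y d)"
      using fd_bounds_decomposition[OF x, of "ell n" "\<lambda>b d. has_defect n d b"] by simp
  qed
  have p7: "\<forall>\<theta>\<in>decorations n. \<forall>k i j. contributes TYPE('k) n \<theta> k i j \<longrightarrow>
      fd n \<theta> = int (ell n) - int k - int j"
  proof (intro ballI allI impI)
    fix \<theta> k i j assume \<theta>: "\<theta> \<in> decorations n" and c: "contributes TYPE('k) n \<theta> k i j"
    have "k = Suc (card (factorization_cuts n \<theta>)) \<and> deg_q n \<theta> = j"
    proof (rule ccontr)
      assume no: "\<not> (k = Suc (card (factorization_cuts n \<theta>)) \<and> deg_q n \<theta> = j)"
      have "homology_zero TYPE('k) (zigzag n) (\<lambda>b. (\<lambda>x. x = \<theta>) (total_decoration b)) k i j"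
      proof (rule homology_zero_off_top[OF n0])
        fix \<theta>' assume "in_bidegree n (\<lambda>x. x = \<theta>) i j \<theta>'"
        then show "k \<noteq> Suc (card (factorization_cuts n \<theta>'))" using no by auto
      qed
      then show False using c by (simp add: contributes_def)
    qed
    then show "fd n \<theta> = int (ell n) - int k - int j" using fd_formula[OF \<theta>] by simp
  qed
  have p8: "\<forall>k i j. \<not> (k + j \<le> ell n \<and> ell n \<le> i + j) \<longrightarrow> homology_zero TYPE('k) (zigzag n) full k i j"
    by (intro allI impI) (rule homology_zero_full[OF n0])
  have p9: "\<forall>d. (defect_class n d :: 'k poly poly mseries) =
        Sum_any (\<lambda>k. ch_homology (zigzag n) (has_defect n d) k)
      \<and> Sum_any (\<lambda>k. ch_homology (zigzag n) (has_defect n d) k) =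
        (\<Sum>(k, j) | 1 \<le> k \<and> k + j + d = ell n.
           map_ms (\<lambda>P :: 'k poly poly. monom (coeff P j) j) (ch_homology (zigzag n) full k))
      \<and> Sum_any (\<lambda>k. (-1) ^ (ell n - k) *
          map_ms negate_q (ch_homology (zigzag n) (has_defect n d) k :: 'k poly poly mseries)) =
        (-1) ^ d * defect_class n d"
  proof (intro allI conjI)
    fix d
    note s = Sum_any_ch_homology[OF n0, of d, where 'k = 'k]
    show "(defect_class n d :: 'k poly poly mseries) = Sum_any (\<lambda>k. ch_homology (zigzag n) (has_defect n d) k)"
      by (rule s(2)[symmetric])
    show "Sum_any (\<lambda>k. ch_homology (zigzag n) (has_defect n d) k) = (\<Sum>(k, j) | 1 \<le> k \<and> k + j + d = ell n.
        map_ms (\<lambda>P :: 'k poly poly. monom (coeff P j) j) (ch_homology (zigzag n) full k))"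
      unfolding defect_class_from_full[OF n0] by (rule s(2))
    show "Sum_any (\<lambda>k. (-1) ^ (ell n - k) *
        map_ms negate_q (ch_homology (zigzag n) (has_defect n d) k :: 'k poly poly mseries)) = (-1) ^ d * defect_class n d"
      unfolding ch_homology_sign[OF n0] Sum_any_right_distrib[OF s(1), symmetric] s(2) ..
  qed
  note Z = Z_poly_decorations[OF n0, where 'k = 'k] and dim = dim_defect_classes[OF n0, where 'k = 'k]
  have p11: "of_nat (fact n) * negate_q (Z_poly (zigzag n) :: 'k poly poly) =
      dim_sf n (\<Sum>d<ell n. (-1) ^ d * defect_class n d)"
    by (rule trans[OF Z dim[symmetric]])
  have p13: "\<exists>D :: int poly poly.
      dim_sf n (\<Sum>d<ell n. (-1) ^ d * defect_class n d :: 'k poly poly mseries) = map_poly (map_poly of_int) D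
    \<and> (nat_coeffs (of_nat (fact n) * negate_q (Z_poly (zigzag n) :: 'k poly poly)) \<longleftrightarrow>
        (\<forall>i j. 0 \<le> coeff (coeff D j) i))"
    unfolding Z dim by (rule integral_bimonom_sum)
  show ?thesis
    by (intro conjI p1 p2 p3 p4 p5 p6 p7 p8 p9 p11 p13 ch_homology_full_alternating[OF n0] allI
        defect_class_ribbon_expansion[OF n0])
qed

end
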